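(* Let $n\ge 1$ be an integer and let $q\in\mathbb{C}^*$ with $|q|<1$. Suppose that $a_1,\ldots,a_6,t\in\mathbb{C}$ satisfy $|a_i|<1$ $(i=1,\ldots,6)$ and $|t|<1$, together with the balancing condition $q=a_1a_2a_3a_4a_5a_6t^{2n-2}$. Then for every $v\in\mathbb{C}^*$, $$ \begin{aligned} &\frac{1}{n!}\int_{\mathbb{T}^{n}} \prod_{i=1}^{n} \bigg[ \frac{(z_{i}^{2};q)_{\infty}}{(qz_{i}^{2};q)_{\infty}} \frac{\theta(t^{n-1}a_{1}a_{2}vz_{i}^{-1}, vz_{i};q)}{\prod_{j=1}^{2}(a_jz_{i},a_jz_{i}^{-1};q)_{\infty}} \prod_{k=3}^{6}\frac{(qa_{k}^{-1}z_{i};q)_{\infty}}{(a_{k}z_{i};q)_{\infty}} \bigg]\\ &\qquad\times\prod_{1\le j< k\le n} \frac{(z_{j}z_{k};q)_{\infty}}{(qz_{j}z_{k};q)_{\infty}} \frac{(z_{j}/z_{k},z_{k}/z_{j};q)_{\infty}}{(tz_{j}/z_{k},tz_{k}/z_{j};q)_{\infty}} \frac{(qt^{-1}z_{j}z_{k};q)_{\infty}}{(tz_{j}z_{k};q)_{\infty}} \,\varpi(z)\\ &\quad = \prod_{i=1}^{n}\frac{(t;q)_{\infty}\prod_{l=1}^{2}\theta(t^{i-1}a_{l}v;q)\prod_{3\le j<k\le 6}\theta(t^{i-1}a_{j}a_{k};q)} {(q,t^{i};q)_{\infty}\prod_{1\le j<k\le 6}(t^{i-1}a_{j}a_{k};q)_{\infty}}.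 \end{aligned} $$
   Context: Notation: $(u;q)_\infty=\prod_{i=0}^\infty(1-q^iu)$, $(u_1,\ldots,u_m;q)_\infty=(u_1;q)_\infty\cdots(u_m;q)_\infty$, $\theta(u;q)=(u,q/u;q)_\infty$ for $u\in\mathbb{C}^*$, $\theta(u_1,\ldots,u_m;q)=\theta(u_1;q)\cdots\theta(u_m;q)$. The quotients $(z_i^2;q)_\infty/(qz_i^2;q)_\infty$ and $(z_jz_k;q)_\infty/(qz_jz_k;q)_\infty$ are simply $1-z_i^2$ and $1-z_jz_k$. The measure is $\varpi(z)=\frac{1}{(2\pi\sqrt{-1})^n}\frac{dz_1}{z_1}\cdots\frac{dz_n}{z_n}$, and $\mathbb{T}^n=\{(z_1,\ldots,z_n)\in\mathbb{C}^n : |z_i|=1\ (i=1,\ldots,n)\}$ is the $n$-fold product of the unit circle, each traversed in the positive direction. *)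

theory Defs
  imports "HOL-Complex_Analysis.Complex_Analysis"
begin

definition qpoch_inf :: "complex \<Rightarrow> complex \<Rightarrow> complex" where
  "qpoch_inf u q = (\<Prod>i. 1 - q ^ i * u)"

definition qpochs_inf :: "complex list \<Rightarrow> complex \<Rightarrow> complex" where
  "qpochs_inf us q = (\<Prod>u\<leftarrow>us. qpoch_inf u q)"

definition theta :: "complex \<Rightarrow> complex \<Rightarrow> complex" where
  "theta u q = qpochs_inf [u, q / u] q"

definition thetas :: "complex list \<Rightarrow> complex \<Rightarrow> complex" where
  "thetas us q = (\<Prod>u\<leftarrow>us. theta u q)"

(* The integral of F(z) dz_1 ... dz_n over the n-fold product of positively oriented unit
   circles.  Points of the torus are functions on {1..n}; each circle is parametrized by
   the path circlepath 0 1 on [0, 1], and the integrand carries the same derivative factors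
   as in contour_integral, but the integral is a Lebesgue integral over the cube. *)
definition torus_contour_integral :: "nat \<Rightarrow> ((nat \<Rightarrow> complex) \<Rightarrow> complex) \<Rightarrow> complex" where
  "torus_contour_integral n F =
     (LINT x:(\<Pi>\<^sub>E i\<in>{1..n}. {0..1})|(\<Pi>\<^sub>M i\<in>{1..n}. lborel).
        F (\<lambda>i\<in>{1..n}. circlepath 0 1 (x i)) *
        (\<Prod>i=1..n. vector_derivative (circlepath 0 1) (at (x i))))"

definition varpi_integral :: "nat \<Rightarrow> ((nat \<Rightarrow> complex) \<Rightarrow> complex) \<Rightarrow> complex" where
  "varpi_integral n F =
     torus_contour_integral n (\<lambda>z. F z * (1 / (2 * of_real pi * \<i>) ^ n * (\<Prod>i=1..n. 1 / z i)))"

lemma convergent_prod_qpoch_inf: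
  assumes "norm q < 1"
  shows "convergent_prod (\<lambda>i. 1 - q ^ i * (u :: complex))"
proof -
  have "summable (\<lambda>i. norm (q ^ i * u))"
    using assms by (auto simp: norm_mult norm_power intro!: summable_mult2 summable_geometric)
  hence "summable (\<lambda>i. norm ((1 - q ^ i * u) - 1))"
    by (simp add: norm_minus_commute)
  thus ?thesis
    by (intro abs_convergent_prod_imp_convergent_prod summable_imp_abs_convergent_prod)
qed

lemma varpi_integral_altdef:
  "varpi_integral n F =
     (LINT x:(\<Pi>\<^sub>E i\<in>{1..n}. {0..1})|(\<Pi>\<^sub>M i\<in>{1..n}. lborel). F (\<lambda>i\<in>{1..n}. cis (2 * pi * x i)))"
proof -
  have circle: "circlepath 0 1 s = cis (2 * pi * s)" for s
    by (simp add: circlepath cis_conv_exp mult_ac)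
  have deriv: "vector_derivative (circlepath 0 1) (at s) = 2 * of_real pi * \<i> * cis (2 * pi * s)" for s
    by (simp add: vector_derivative_circlepath cis_conv_exp mult_ac)
  have "1 / (2 * of_real pi * \<i>) ^ n * (\<Prod>i=1..n. 1 / (\<lambda>i\<in>{1..n}. circlepath 0 1 (x i)) i) *
          (\<Prod>i=1..n. vector_derivative (circlepath 0 1) (at (x i))) = 1" for x :: "nat \<Rightarrow> real"
  proof -
    have "(\<Prod>i=1..n. 1 / (\<lambda>i\<in>{1..n}. circlepath 0 1 (x i)) i) = (\<Prod>i=1..n. 1 / cis (2 * pi * x i))"
      by (intro prod.cong) (auto simp: circle)
    moreover have "(\<Prod>i=1..n. vector_derivative (circlepath 0 1) (at (x i))) =
        (2 * of_real pi * \<i>) ^ n * (\<Prod>i=1..n. cis (2 * pi * x i))"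
      by (simp add: deriv prod.distrib power_mult_distrib)
    moreover have "(\<Prod>i=1..n. 1 / cis (2 * pi * x i)) * (\<Prod>i=1..n. cis (2 * pi * x i)) = 1"
      by (simp flip: prod.distrib)
    ultimately show ?thesis
      by (simp add: power_mult_distrib)
  qed
  thus ?thesis
    unfolding varpi_integral_def torus_contour_integral_def
    by (simp only: mult.assoc mult_1_right circle)
qed

end

theory Submission
  imports Defs "HOL-Probability.Probability"
begin

text \<open>
  As a function of \<open>v\<close> the integral is \<open>v ^ n\<close> times the value at \<open>\<alpha> = 1 / v\<close> of the mean \<open>U \<alpha>\<close> of a fixed
  function times \<open>\<Prod>k. z k * g \<alpha> (z k)\<close>, where \<open>g \<alpha> w = w * theta (\<alpha> / w) q * theta (c / (\<alpha> * w)) q\<close> and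
  \<open>c = t ^ (n - 1) * a1 * a2\<close>. Partial fractions of theta functions and Cauchy's theorem give a first-order
  recursion for \<open>U\<close> along the points \<open>t ^ r * a1\<close>; hence \<open>U\<close> vanishes at the first \<open>n\<close> of them and is
  proportional to \<open>\<Prod>r<n. g \<alpha> (t ^ r * a1)\<close>. It remains to know one value, and at \<open>\<alpha> = 1 / a3\<close> summing
  over the reflections \<open>z k \<mapsto> 1 / z k\<close> turns the integral into the symmetric type BC integral \<open>J\<close> with the five
  parameters other than \<open>a3\<close>.

  The same argument with nome 0 in place of \<open>q\<close> compares the values at two points and shows that a certain
  product formula for \<open>J\<close> is stable under multiplying a parameter by \<open>q\<close>; iterating, the ratio of \<open>J\<close> to that
  formula is independent of all parameters. This constant is found by induction on \<open>n\<close>: for a balanced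
  choice the sum of a non-symmetric kernel over the hyperoctahedral group, combined with Cauchy's theorem
  in the last variable, expresses \<open>J\<close> through the same integral in one variable less. Both group sums are
  evaluated by the fact that the theta functions antisymmetric under the hyperoctahedral group, of the
  right degree, form a line.

  All of this needs \<open>t\<close> and the parameters to be generic, which is removed by deforming them along a curve
  that meets the exceptional set in a countable set.
\<close>

subsection \<open>Infinite products and theta functions\<close>

text \<open>The integrand is not invariant under z -> 1 / z, so no symmetric evaluation applies to
  it directly. What helps is the dependence on v: for fixed c the functions g \<alpha> span only a
  plane, by the three-term relation of theta functions. In coordinates of this plane U is a
  homogeneous polynomial of degree n, so n zeros fix it up to a factor. Cauchy's theorem enters in
  two ways. At nome q all poles of the last variable inside the unit disc cancel and a factor u
  remains, so the mean is a value 0 at the centre. At nome 0 only the first pole of each q-sequence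
  is cancelled; what remains is odd under u -> q / u. The density of J contains the Weyl
  denominators of nome 0 and of nome q. Each argument symmetrizes a kernel of one nome against the
  denominator of the other, and balancing conditions are what give the kernels the multiplier for
  which the antisymmetric theta functions form a line.\<close>

lemma qpoch_inf_rec:
  assumes "norm p < 1"
  shows "qpoch_inf u p = (1 - u) * qpoch_inf (p * u) p"
\<comment> \<open>Splitting off the head of an infinite product requires a nonzero head, so the
  vanishing case is separate.\<close>
proof (cases "u = 1")
  case True
  have "(\<lambda>i. 1 - p ^ i * u) has_prod qpoch_inf u p"
    unfolding qpoch_inf_def using convergent_prod_qpoch_inf[OF assms] by (rule convergent_prod_has_prod)
  then have "qpoch_inf u p = 0"
    using has_prod_eq_0_iff True by (force simp: image_iff intro!: exI[of _ 0])
  then show ?thesis by (simp add: True)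
next
  case False
  show ?thesis
    unfolding qpoch_inf_def
    using prodinf_split_head[OF convergent_prod_qpoch_inf[OF assms, of u]] False
    by (simp add: mult_ac)
qed

lemma qpoch_inf_eq_0_iff:
  assumes "norm p < 1"
  shows "qpoch_inf u p = 0 \<longleftrightarrow> (\<exists>i. p ^ i * u = 1)"
proof -
  have "(\<lambda>i. 1 - p ^ i * u) has_prod qpoch_inf u p"
    unfolding qpoch_inf_def using convergent_prod_qpoch_inf[OF assms] by (rule convergent_prod_has_prod)
  from has_prod_eq_0_iff[OF this] show ?thesis by (simp add: image_iff eq_diff_eq)
qed

lemma qpoch_inf_nonzero:
  assumes "norm p < 1" "norm u < 1"
  shows "qpoch_inf u p \<noteq> 0"
proof
  assume "qpoch_inf u p = 0"
  then obtain i where "p ^ i * u = 1" using qpoch_inf_eq_0_iff[OF assms(1)] by blast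
  then have "norm p ^ i * norm u = 1" by (metis norm_mult norm_one norm_power)
  moreover have "norm p ^ i * norm u \<le> 1 * norm u"
    using assms by (intro mult_right_mono power_le_one) auto
  ultimately show False using assms by simp
qed

lemma qpoch_inf_0_left [simp]: "qpoch_inf 0 p = 1"
  by (simp add: qpoch_inf_def)

lemma qpoch_inf_0_right [simp]: "qpoch_inf u 0 = 1 - u"
  using qpoch_inf_rec[of 0 u] by simp

lemma qpoch_inf_tendsto_prod:
  assumes "norm p < 1"
  shows "(\<lambda>N. \<Prod>i<N. 1 - p ^ i * u) \<longlonglongrightarrow> qpoch_inf u p"
  unfolding qpoch_inf_def
  using convergent_prod_LIMSEQ[OF convergent_prod_qpoch_inf[OF assms, of u]]
  by (simp add: LIMSEQ_lessThan_iff_atMost)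

text \<open>The M-test with majorant r ^ n * R works in the argument and the nome together.
  Continuity in the nome is what later carries a symmetrization identity from nonzero nome to nome
  0.\<close>

lemma uniform_limit_qpoch_inf:
  assumes "r < 1"
  shows "uniform_limit (cball 0 R \<times> cball 0 r) (\<lambda>N (u, p). \<Prod>i<N. 1 - p ^ i * u)
           (\<lambda>(u, p). qpoch_inf u p) sequentially"
proof (cases "r \<ge> 0 \<and> R \<ge> 0")
  case True
  let ?A = "cball 0 R \<times> cball (0::complex) r :: (complex \<times> complex) set"
  have "uniformly_convergent_on ?A (\<lambda>N x. \<Prod>n<N. (\<lambda>n x. 1 - snd x ^ n * fst x) n x)"
  proof (rule uniformly_convergent_on_prod')
    show "continuous_on ?A (\<lambda>x. 1 - snd x ^ n * fst x)" for n
      by (intro continuous_intros)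
    show "compact ?A" by (intro compact_Times compact_cball)
    show "uniformly_convergent_on ?A (\<lambda>N x. \<Sum>n<N. norm (1 - snd x ^ n * fst x - 1))"
    proof (rule Weierstrass_m_test'[where M = "\<lambda>n. r ^ n * R"])
      show "norm (norm (1 - snd x ^ n * fst x - 1)) \<le> r ^ n * R" if "x \<in> ?A" for x n
        using True that by (auto simp: norm_mult norm_power intro!: mult_mono power_mono)
      show "summable (\<lambda>n. r ^ n * R)"
        using assms True by (intro summable_mult2 summable_geometric) auto
    qed
  qed
  then have "uniform_limit ?A (\<lambda>N x. \<Prod>n<N. 1 - snd x ^ n * fst x)
      (\<lambda>x. lim (\<lambda>N. \<Prod>n<N. 1 - snd x ^ n * fst x)) sequentially"
    using uniformly_convergent_uniform_limit_iff by blast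
  moreover have "lim (\<lambda>N. \<Prod>n<N. 1 - snd x ^ n * fst x) = qpoch_inf (fst x) (snd x)" if "x \<in> ?A" for x
    using qpoch_inf_tendsto_prod[of "snd x" "fst x"] that assms by (intro limI) auto
  ultimately have "uniform_limit ?A (\<lambda>N x. \<Prod>n<N. 1 - snd x ^ n * fst x)
      (\<lambda>x. qpoch_inf (fst x) (snd x)) sequentially"
    by (subst (asm) uniform_limit_cong'[where g = "\<lambda>N x. \<Prod>n<N. 1 - snd x ^ n * fst x"
          and i = "\<lambda>x. qpoch_inf (fst x) (snd x)"]) auto
  then show ?thesis by (simp only: case_prod_unfold)
next
  case False
  then have "cball 0 R \<times> cball (0::complex) r = ({}:: (complex \<times> complex) set)" by auto
  then show ?thesis by (simp only: uniform_limit_iff) simp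
qed

lemma continuous_on_qpoch_inf_joint:
  "continuous_on (UNIV \<times> ball 0 1) (\<lambda>(u, p). qpoch_inf u p)"
proof -
  have "isCont (\<lambda>(u, p). qpoch_inf u p) (u, p)" if p: "norm p < 1" for u p :: complex
  proof -
    define r where "r = (norm p + 1) / 2"
    have r: "norm p < r" "r < 1" using p by (auto simp: r_def field_simps)
    have "continuous_on (cball 0 (norm u + 1) \<times> cball 0 r) (\<lambda>(u, p). qpoch_inf u p)"
    proof (rule uniform_limit_theorem[OF _ uniform_limit_qpoch_inf[OF r(2)]])
      show "\<forall>\<^sub>F N in sequentially. continuous_on (cball 0 (norm u + 1) \<times> cball 0 r)
          (\<lambda>(u, p). \<Prod>i<N. 1 - p ^ i * u :: complex)"
        by (auto intro!: always_eventually continuous_intros simp: case_prod_beta)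
    qed auto
    then have "continuous_on (ball 0 (norm u + 1) \<times> ball 0 r) (\<lambda>(u, p). qpoch_inf u p)"
      by (rule continuous_on_subset) auto
    then show ?thesis
      using r by (subst (asm) continuous_on_eq_continuous_at) (auto simp: open_Times)
  qed
  then show ?thesis by (auto intro!: continuous_at_imp_continuous_on)
qed

lemma continuous_on_qpoch_inf [continuous_intros]:
  assumes "continuous_on A f" "continuous_on A g" "\<And>x. x \<in> A \<Longrightarrow> norm (g x) < 1"
  shows "continuous_on A (\<lambda>x. qpoch_inf (f x) (g x))"
proof -
  have "continuous_on A (\<lambda>x. (f x, g x))" using assms by (intro continuous_intros)
  moreover have "(\<lambda>x. (f x, g x)) ` A \<subseteq> UNIV \<times> ball 0 1" using assms by auto
  ultimately show ?thesis
    using continuous_on_compose2[OF continuous_on_qpoch_inf_joint, of A "\<lambda>x. (f x, g x)"] by simp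
qed

lemma holomorphic_on_qpoch_inf_UNIV:
  assumes "norm p < 1"
  shows "(\<lambda>u. qpoch_inf u p) holomorphic_on UNIV"
proof (rule holomorphic_uniform_sequence)
  show "(\<lambda>u. \<Prod>i<N. 1 - p ^ i * u) holomorphic_on UNIV" for N
    by (intro holomorphic_intros)
  fix u :: complex
  have "uniform_limit (cball 0 (norm u + 1) \<times> cball 0 (norm p)) (\<lambda>N (u, p). \<Prod>i<N. 1 - p ^ i * u)
           (\<lambda>(u, p). qpoch_inf u p) sequentially"
    by (rule uniform_limit_qpoch_inf[OF assms])
  then have "uniform_limit (cball u 1) (\<lambda>N u. \<Prod>i<N. 1 - p ^ i * u) (\<lambda>u. qpoch_inf u p) sequentially"
    unfolding uniform_limit_iff
  proof safe
    fix e :: real assume e: "e > 0"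
      and *: "\<forall>e>0. \<forall>\<^sub>F n in sequentially. \<forall>x\<in>cball 0 (norm u + 1) \<times> cball 0 (norm p).
           dist (case x of (u, p) \<Rightarrow> \<Prod>i<n. 1 - p ^ i * u) (case x of (u, p) \<Rightarrow> qpoch_inf u p) < e"
    from *[rule_format, OF e] show "\<forall>\<^sub>F n in sequentially. \<forall>x\<in>cball u 1.
           dist (\<Prod>i<n. 1 - p ^ i * x) (qpoch_inf x p) < e"
    proof eventually_elim
      case (elim n)
      show ?case
      proof
        fix x assume "x \<in> cball u 1"
        then have "norm (x - u) \<le> 1" by (simp add: dist_norm norm_minus_commute)
        then have "norm x \<le> norm u + 1" by norm
        then show "dist (\<Prod>i<n. 1 - p ^ i * x) (qpoch_inf x p) < e"
          using elim[rule_format, of "(x, p)"] by simp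
      qed
    qed
  qed
  then show "\<exists>d>0. cball u d \<subseteq> UNIV \<and> uniform_limit (cball u d) (\<lambda>N u. \<Prod>i<N. 1 - p ^ i * u)
      (\<lambda>u. qpoch_inf u p) sequentially"
    by (intro exI[of _ 1]) auto
qed auto

lemma holomorphic_on_qpoch_inf [holomorphic_intros]:
  assumes "f holomorphic_on A" "norm p < 1"
  shows "(\<lambda>x. qpoch_inf (f x) p) holomorphic_on A"
  using holomorphic_on_compose_gen[OF assms(1) holomorphic_on_qpoch_inf_UNIV[OF assms(2)]]
  by (simp add: o_def)

lemma theta_def': "theta u p = qpoch_inf u p * qpoch_inf (p / u) p"
  by (simp add: theta_def qpochs_inf_def)

lemma theta_0_right [simp]: "theta u 0 = 1 - u"
  by (simp add: theta_def')

lemma theta_1 [simp]: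
  assumes "norm p < 1"
  shows "theta 1 p = 0"
  using qpoch_inf_eq_0_iff[OF assms, of 1] by (auto simp: theta_def' intro: exI[of _ 0])

lemma theta_mult_nome:
  assumes "norm p < 1" "p \<noteq> 0" "u \<noteq> 0"
  shows "theta (p * u) p = - theta u p / u"
proof -
  have "qpoch_inf (1 / u) p = (1 - 1 / u) * qpoch_inf (p / u) p"
    using qpoch_inf_rec[OF assms(1), of "1 / u"] by simp
  moreover have "qpoch_inf u p = (1 - u) * qpoch_inf (p * u) p"
    by (rule qpoch_inf_rec[OF assms(1)])
  moreover have "p / (p * u) = 1 / u" using assms by simp
  ultimately have "theta (p * u) p = qpoch_inf (p * u) p * ((1 - 1 / u) * qpoch_inf (p / u) p)"
    and "theta u p = (1 - u) * qpoch_inf (p * u) p * qpoch_inf (p / u) p"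
    unfolding theta_def' by simp_all
  then show ?thesis using assms(3) by (simp add: divide_simps) (simp add: algebra_simps)
qed

lemma theta_div_nome:
  assumes "norm p < 1" "p \<noteq> 0" "u \<noteq> 0"
  shows "theta (u / p) p = - (u / p) * theta u p"
  using theta_mult_nome[OF assms(1,2), of "u / p"] assms by (simp add: field_simps)

lemma theta_nome_div:
  assumes "u \<noteq> 0" "p \<noteq> 0"
  shows "theta (p / u) p = theta u p"
  using assms by (simp add: theta_def')

lemma theta_inverse:
  assumes "norm p < 1" "u \<noteq> 0"
  shows "theta (1 / u) p = - theta u p / u"
proof -
  have "qpoch_inf (1 / u) p = (1 - 1 / u) * qpoch_inf (p / u) p"
    using qpoch_inf_rec[OF assms(1), of "1 / u"] by simp
  moreover have "qpoch_inf u p = (1 - u) * qpoch_inf (p * u) p"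
    by (rule qpoch_inf_rec[OF assms(1)])
  moreover have "theta (1 / u) p = qpoch_inf (1 / u) p * qpoch_inf (p * u) p"
    by (simp add: theta_def')
  moreover have "theta u p = qpoch_inf u p * qpoch_inf (p / u) p"
    by (simp add: theta_def')
  ultimately show ?thesis using assms(2)
    by (simp only:) (simp add: divide_simps, simp add: algebra_simps)
qed

lemma theta_divide_swap:
  assumes "norm p < 1" "u \<noteq> 0" "v \<noteq> 0"
  shows "theta (u / v) p = - (u / v) * theta (v / u) p"
  using theta_inverse[OF assms(1), of "v / u"] assms by (simp add: field_simps)

lemma theta_eq_0_iff:
  assumes "norm p < 1" "p \<noteq> 0" "u \<noteq> 0"
  shows "theta u p = 0 \<longleftrightarrow> (\<exists>k::int. u = p powi k)"
proof
  assume "theta u p = 0"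
  then consider i where "p ^ i * u = 1" | i where "p ^ i * (p / u) = 1"
    by (auto simp: theta_def' qpoch_inf_eq_0_iff[OF assms(1)])
  then show "\<exists>k::int. u = p powi k"
  proof cases
    case 1
    then have "u = p powi (- int i)"
      using assms by (simp add: power_int_minus field_simps)
    then show ?thesis by blast
  next
    case 2
    then have "u = p powi (int (Suc i))"
      using assms by (simp add: field_simps del: of_nat_Suc)
    then show ?thesis by blast
  qed
next
  assume "\<exists>k::int. u = p powi k"
  then obtain k :: int where k: "u = p powi k" by blast
  show "theta u p = 0"
  proof (cases "k > 0")
    case True
    then have "p ^ nat (k - 1) * (p / u) = 1"
      using assms k by (simp add: power_int_def nat_diff_distrib power_eq_if divide_simps)
    then show ?thesis by (auto simp: theta_def' qpoch_inf_eq_0_iff[OF assms(1)])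
  next
    case False
    then have "p ^ nat (- k) * u = 1"
      using assms k by (simp add: power_int_def field_simps)
    then show ?thesis by (auto simp: theta_def' qpoch_inf_eq_0_iff[OF assms(1)])
  qed
qed

text \<open>The zeros are the integer powers of p, a multiplicative group; at nome 0 they form the
  trivial group.\<close>

lemma theta_eq_0_divide:
  assumes "norm p < 1" "u \<noteq> 0" "v \<noteq> 0" "theta u p = 0" "theta v p = 0"
  shows "theta (u / v) p = 0"
proof (cases "p = 0")
  case False
  then show ?thesis using assms theta_eq_0_iff[OF assms(1) False]
    by (metis power_int_diff divide_eq_0_iff)
qed (use assms in auto)

lemma continuous_on_theta [continuous_intros]:
  assumes "continuous_on A f" "continuous_on A g" "\<And>x. x \<in> A \<Longrightarrow> norm (g x) < 1" "\<And>x. x \<in> A \<Longrightarrow> f x \<noteq> 0"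
  shows "continuous_on A (\<lambda>x. theta (f x) (g x))"
  unfolding theta_def' using assms by (intro continuous_intros) auto

lemma holomorphic_on_theta [holomorphic_intros]:
  assumes "f holomorphic_on A" "norm p < 1" "\<And>x. x \<in> A \<Longrightarrow> f x \<noteq> 0"
  shows "(\<lambda>x. theta (f x) p) holomorphic_on A"
  unfolding theta_def' using assms by (intro holomorphic_intros) auto

lemma exists_theta_nonzero:
  assumes "norm p < 1"
  shows "\<exists>u. u \<noteq> 0 \<and> theta u p \<noteq> 0"
proof -
  \<comment> \<open>Apart from the power 0, no integer power of p has modulus 1, so -1 is not a
    zero.\<close>
  have "theta (-1) p \<noteq> 0"
  proof (cases "p = 0")
    case False
    have False if "-1 = p powi k" for k :: int
    proof -
      have "norm p powi k = 1" using that by (metis norm_minus_cancel norm_one norm_power_int)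
      then have "k = 0"
        using False assms power_int_strict_decreasing[of 0 k "norm p"] power_int_strict_decreasing[of k 0 "norm p"]
          \<open>norm p powi k = 1\<close>
        by (cases "k = 0"; cases "k > 0") auto
      then show False using that by simp
    qed
    then show ?thesis using theta_eq_0_iff[OF assms False, of "-1"] by auto
  qed auto
  then show ?thesis by (intro exI[of _ "-1"]) auto
qed

text \<open>Source of genericity: the factor exp (d * s) moves any point off the zero set for all
  small nonzero s. The function of s is entire and nonzero at s = Ln (u / c) / d, so its zeros are
  isolated.\<close>

lemma eventually_theta_exp_nonzero:
  assumes "norm p < 1" "c \<noteq> 0" "d \<noteq> 0"
  shows "\<forall>\<^sub>F s in at 0. theta (c * exp (d * s)) p \<noteq> 0"
proof -
  obtain u where u: "u \<noteq> 0" "theta u p \<noteq> 0" using exists_theta_nonzero[OF assms(1)] by blast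
  let ?f = "\<lambda>s. theta (c * exp (d * s)) p"
  have hol: "?f holomorphic_on UNIV" using assms by (intro holomorphic_intros) auto
  have "c * exp (d * (Ln (u / c) / d)) = u" using u assms by simp
  then have "?f (Ln (u / c) / d) \<noteq> 0" using u by metis
  then show ?thesis
    using non_zero_neighbour_alt[OF hol, of 0 "Ln (u / c) / d"]
    by (auto elim: eventually_mono)
qed

text \<open>Carries an identity known at generic points to a special point lying on a curve of
  generic ones.\<close>

lemma eq_zero_by_curve:
  fixes F :: "complex \<Rightarrow> complex"
  assumes "\<forall>\<^sub>F s in at 0. F s = 0" "isCont F 0"
  shows "F 0 = 0"
proof -
  have "(F \<longlongrightarrow> 0) (at 0)" using assms(1) by (rule tendsto_eventually)
  then show ?thesis using assms(2) by (metis LIM_unique isCont_def)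
qed

section \<open>Zeros and factorization of theta functions on the punctured plane\<close>

lemma holomorphic_quotient_simple_zeros:
  fixes f D :: "complex \<Rightarrow> complex"
  assumes S: "open S" and f: "f holomorphic_on S" and D: "D holomorphic_on S"
    and zeros: "\<And>z. z \<in> S \<Longrightarrow> D z = 0 \<Longrightarrow> f z = 0 \<and> deriv D z \<noteq> 0"
  obtains h where "h holomorphic_on S" "\<And>z. z \<in> S \<Longrightarrow> f z = D z * h z"
proof
  define h where "h = (\<lambda>z. if D z = 0 then deriv f z / deriv D z else f z / D z)"
  show "f z = D z * h z" if "z \<in> S" for z
    using zeros[OF that] by (auto simp: h_def)
  have "h field_differentiable at z" if z: "z \<in> S" for z
  proof (cases "D z = 0")
    case False
    define U where "U = S \<inter> D -` (- {0})"
    have U: "open U" unfolding U_def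
      using D S holomorphic_on_imp_continuous_on continuous_open_preimage by blast
    have "(\<lambda>z. f z / D z) holomorphic_on U"
      by (intro holomorphic_intros holomorphic_on_subset[OF f] holomorphic_on_subset[OF D]) (auto simp: U_def)
    then have "h holomorphic_on U" by (rule holomorphic_transform) (auto simp: U_def h_def)
    then show ?thesis using U z False by (auto simp: U_def holomorphic_on_open field_differentiable_def)
  next
    case True
    \<comment> \<open>Difference quotients of f and D at the zero z. Both are holomorphic, and D1 z
      = deriv D z is nonzero, so h equals F1 / D1 near z and also at z itself.\<close>
    define F1 where "F1 = (\<lambda>w. if w = z then deriv f z else (f w - f z) / (w - z))"
    define D1 where "D1 = (\<lambda>w. if w = z then deriv D z else (D w - D z) / (w - z))"
    have F1: "F1 holomorphic_on S" unfolding F1_def by (rule pole_lemma_open[OF f S])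
    have D1: "D1 holomorphic_on S" unfolding D1_def by (rule pole_lemma_open[OF D S])
    define U where "U = S \<inter> D1 -` (- {0})"
    have U: "open U" unfolding U_def
      using D1 S holomorphic_on_imp_continuous_on continuous_open_preimage by blast
    have zU: "z \<in> U" using z zeros[OF z True] by (auto simp: U_def D1_def)
    have "(\<lambda>z. F1 z / D1 z) holomorphic_on U"
      by (intro holomorphic_intros holomorphic_on_subset[OF F1] holomorphic_on_subset[OF D1]) (auto simp: U_def)
    then have "h holomorphic_on U"
    proof (rule holomorphic_transform)
      fix w assume w: "w \<in> U"
      show "F1 w / D1 w = h w"
        using w zeros[OF z True] True by (auto simp: U_def h_def F1_def D1_def)
    qed
    then show ?thesis using U zU by (auto simp: holomorphic_on_open field_differentiable_def)
  qed
  then show "h holomorphic_on S"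
    by (auto simp: holomorphic_on_def intro: field_differentiable_at_within)
qed

text \<open>At u = 1 the factor 1 - u splits off and leaves a nonzero product; the functional
  equation transports the simple zero from 1 to all integer powers of p.\<close>

lemma deriv_theta_nonzero:
  assumes p: "norm p < 1" "p \<noteq> 0" and u: "u \<noteq> 0" "theta u p = 0"
  shows "deriv (\<lambda>u. theta u p) u \<noteq> 0"
proof -
  let ?T = "\<lambda>u. theta u p"
  have diff: "(?T has_field_derivative deriv ?T x) (at x)" if "x \<noteq> 0" for x
  proof -
    have "?T holomorphic_on - {0}" using p by (intro holomorphic_intros) auto
    then show ?thesis using that by (intro holomorphic_derivI[of _ "- {0}"]) auto
  qed
  have one: "deriv ?T 1 \<noteq> 0"
  proof -
    let ?G = "\<lambda>u. qpoch_inf (p * u) p * qpoch_inf (p / u) p"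
    have "?G holomorphic_on - {0}" using p by (intro holomorphic_intros) auto
    then have G: "(?G has_field_derivative deriv ?G 1) (at 1)"
      by (intro holomorphic_derivI[of _ "- {0}"]) auto
    have "((\<lambda>u. (1 - u) * ?G u) has_field_derivative - ?G 1) (at 1)"
      by (rule derivative_eq_intros G | simp)+
    moreover have "(1 - u) * ?G u = ?T u" for u
      using qpoch_inf_rec[OF p(1), of u] by (simp add: theta_def')
    ultimately have "(?T has_field_derivative - ?G 1) (at 1)" by simp
    then have "deriv ?T 1 = - ?G 1" by (rule DERIV_imp_deriv)
    then show ?thesis using qpoch_inf_nonzero[OF p(1), of p] p by simp
  qed
  have step: "deriv ?T (p * x) \<noteq> 0 \<longleftrightarrow> deriv ?T x \<noteq> 0" if x: "x \<noteq> 0" "?T x = 0" for x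
  proof -
    have "((\<lambda>x. ?T (p * x)) has_field_derivative deriv ?T (p * x) * p) (at x)"
      using DERIV_chain[OF diff[of "p * x"] DERIV_cmult_Id[of p x UNIV]] p x by (simp add: o_def)
    moreover have "((\<lambda>x. - ?T x / x) has_field_derivative - deriv ?T x / x) (at x)"
      using x by (auto intro!: derivative_eq_intros diff simp: field_simps)
    then have "((\<lambda>x. ?T (p * x)) has_field_derivative - deriv ?T x / x) (at x)"
    proof (rule DERIV_cong_ev[THEN iffD1, rotated 3])
      show "\<forall>\<^sub>F y in nhds x. - ?T y / y = ?T (p * y)"
        using t1_space_nhds[OF x(1)] by (rule eventually_mono) (use theta_mult_nome[OF p] in auto)
    qed auto
    ultimately have "deriv ?T (p * x) * p = - deriv ?T x / x" by (rule DERIV_unique)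
    then show ?thesis using p x by (auto simp: field_simps)
  qed
  obtain k :: int where k: "u = p powi k" using u theta_eq_0_iff[OF p] by blast
  have "deriv ?T (p powi k) \<noteq> 0"
  proof (induction k rule: int_induct[where k = 0])
    case base
    then show ?case using one by simp
  next
    case (step1 i)
    have "?T (p powi i) = 0" using theta_eq_0_iff[OF p, of "p powi i"] p by auto
    from step[OF _ this] show ?case using step1 p by (simp add: power_int_add_1')
  next
    case (step2 i)
    have "?T (p powi (i - 1)) = 0" using theta_eq_0_iff[OF p, of "p powi (i - 1)"] p by auto
    moreover have "p * p powi (i - 1) = p powi i" using p by (simp add: power_int_diff)
    ultimately show ?case using step[of "p powi (i - 1)"] step2 p by simp
  qed
  then show ?thesis using k by simp
qed

text \<open>The multiplier m never vanishes, so the zero c propagates to its whole orbit under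
  multiplication by p. These points are exactly the zeros of theta (z / c), and they are simple
  there.\<close>

lemma theta_factor:
  assumes p: "norm p < 1" "p \<noteq> 0" and c: "c \<noteq> 0" "f c = 0"
    and f: "f holomorphic_on - {0}"
    and m: "\<And>z. z \<noteq> 0 \<Longrightarrow> f (p * z) = m z * f z" "\<And>z. z \<noteq> 0 \<Longrightarrow> m z \<noteq> 0"
  obtains h where "h holomorphic_on - {0}" "\<And>z. z \<noteq> 0 \<Longrightarrow> f z = theta (z / c) p * h z"
proof (rule holomorphic_quotient_simple_zeros[of "- {0}" f "\<lambda>z. theta (z / c) p"])
  show "(\<lambda>z. theta (z / c) p) holomorphic_on - {0}" using p c by (intro holomorphic_intros) auto
  have zero: "f (p powi k * c) = 0" for k :: int
  proof (induction k rule: int_induct[where k = 0])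
    case base
    then show ?case using c by simp
  next
    case (step1 i)
    then show ?case using m(1)[of "p powi i * c"] p c by (simp add: power_int_add_1' mult_ac)
  next
    case (step2 i)
    have "p * (p powi (i - 1) * c) = p powi i * c" using p by (simp add: power_int_diff)
    then have "f (p powi i * c) = m (p powi (i - 1) * c) * f (p powi (i - 1) * c)"
      using m(1)[of "p powi (i - 1) * c"] p c by (metis mult_eq_0_iff power_int_eq_0_iff)
    then show ?case using m(2)[of "p powi (i - 1) * c"] p c step2 by auto
  qed
  fix z assume z: "z \<in> - {0}" "theta (z / c) p = 0"
  then obtain k :: int where "z / c = p powi k" using theta_eq_0_iff[OF p, of "z / c"] c by auto
  then have "z = p powi k * c" using c by (simp add: field_simps)
  moreover have "deriv (\<lambda>z. theta (z / c) p) z \<noteq> 0"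
  proof -
    have "(\<lambda>u. theta u p) holomorphic_on - {0}" using p by (intro holomorphic_intros) auto
    then have "((\<lambda>u. theta u p) has_field_derivative deriv (\<lambda>u. theta u p) (z / c)) (at (z / c))"
      using z c by (intro holomorphic_derivI[of _ "- {0}"]) auto
    from DERIV_chain2[where f = "\<lambda>u. theta u p" and g = "\<lambda>z. z / c" and x = z and s = UNIV, OF this
        DERIV_cdivide[OF DERIV_ident]]
    have "((\<lambda>z. theta (z / c) p) has_field_derivative deriv (\<lambda>u. theta u p) (z / c) * (1 / c)) (at z)"
      by simp
    then have "deriv (\<lambda>z. theta (z / c) p) z = deriv (\<lambda>u. theta u p) (z / c) * (1 / c)"
      by (rule DERIV_imp_deriv)
    then show ?thesis using deriv_theta_nonzero[OF p, of "z / c"] z c by auto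
  qed
  ultimately show "f z = 0 \<and> deriv (\<lambda>z. theta (z / c) p) z \<noteq> 0" using zero by simp
qed (use f that in auto)

text \<open>The exponent is ln r / - ln P rounded up. The annulus serves as a compact fundamental
  domain for multiplication by p.\<close>

lemma exists_power_int_in_annulus:
  fixes P r :: real
  assumes "0 < P" "P < 1" "r > 0"
  shows "\<exists>k::int. P \<le> P powi k * r \<and> P powi k * r \<le> 1"
proof -
  define x where "x = ln r / - ln P"
  define k where "k = \<lceil>x\<rceil>"
  have L: "ln P < 0" using assms by simp
  have k: "x \<le> real_of_int k" "real_of_int k - 1 \<le> x" unfolding k_def by linarith+
  have eq: "P powi k * r = exp (real_of_int k * ln P + ln r)"
    using assms powr_real_of_int'[of P k] by (simp add: exp_add powr_def)
  have xr: "ln r = - x * ln P" using L by (simp add: x_def)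
  have "real_of_int k * ln P + ln r = (real_of_int k - x) * ln P" by (simp add: xr algebra_simps)
  moreover have "(real_of_int k - x) * ln P \<le> 0" using k L by (intro mult_nonneg_nonpos) auto
  moreover have "(real_of_int k - x) * ln P \<ge> 1 * ln P" using k L by (intro mult_right_mono_neg) auto
  ultimately have "exp (ln P) \<le> exp (real_of_int k * ln P + ln r)" "real_of_int k * ln P + ln r \<le> 0" by auto
  then show ?thesis unfolding eq using assms by (intro exI[of _ k]) (simp add: eq)
qed

text \<open>A power of norm z compensates the constant K, which makes a multiple of norm (e z)
  invariant under z -> p * z and hence bounded by its maximum on an annulus. Pulled back by exp this
  gives a bounded entire function, constant by Liouville and zero over c.\<close>

lemma constant_multiplier_zero:
  assumes p: "norm p < 1" "p \<noteq> 0" and c: "c \<noteq> 0" "e c = 0"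
    and e: "e holomorphic_on - {0}" and K: "\<And>z. z \<noteq> 0 \<Longrightarrow> e (p * z) = K * e z"
    and z: "z \<noteq> 0"
  shows "e z = 0"
proof (cases "K = 0")
  case True
  then show ?thesis using K[of "z / p"] p z by simp
next
  case False
  define l where "l = - ln (norm K) / ln (norm p)"
  have lp: "norm p powr l * norm K = 1"
    using p False by (simp add: powr_def l_def exp_minus)
  define \<phi> where "\<phi> = (\<lambda>z. norm z powr l * norm (e z))"
  have \<phi>p: "\<phi> (p * z) = \<phi> z" if "z \<noteq> 0" for z
    using lp K[OF that] p that by (simp add: \<phi>_def norm_mult powr_mult mult_ac)
  have \<phi>k: "\<phi> (p powi k * z) = \<phi> z" if "z \<noteq> 0" for z and k :: int
  proof (induction k rule: int_induct[where k = 0])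
    case (step1 i)
    then show ?case using \<phi>p[of "p powi i * z"] p that by (simp add: power_int_add_1' mult_ac)
  next
    case (step2 i)
    have "p * (p powi (i - 1) * z) = p powi i * z" using p by (simp add: power_int_diff)
    then have "\<phi> (p powi i * z) = \<phi> (p powi (i - 1) * z)"
      using \<phi>p[of "p powi (i - 1) * z"] p that by (metis mult_eq_0_iff power_int_eq_0_iff)
    then show ?case using step2 by simp
  qed simp
  define A where "A = cball (0::complex) 1 - ball 0 (norm p)"
  have A: "compact A" unfolding A_def by (intro compact_diff) auto
  have A0: "z \<noteq> 0" if "z \<in> A" for z using that p by (auto simp: A_def)
  have "continuous_on A \<phi>"
    unfolding \<phi>_def using A0
    by (intro continuous_intros holomorphic_on_imp_continuous_on[OF holomorphic_on_subset[OF e]]) auto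
  then have "bounded (\<phi> ` A)" using A compact_continuous_image compact_imp_bounded by blast
  then obtain M where M: "\<And>z. z \<in> A \<Longrightarrow> norm (\<phi> z) \<le> M" unfolding bounded_iff by auto
  have bd: "\<phi> z \<le> M" if z: "z \<noteq> 0" for z
  proof -
    obtain k :: int where k: "norm p \<le> norm p powi k * norm z" "norm p powi k * norm z \<le> 1"
      using exists_power_int_in_annulus[of "norm p" "norm z"] p z by auto
    then have "p powi k * z \<in> A" by (auto simp: A_def norm_mult norm_power_int)
    from M[OF this] show ?thesis using \<phi>k[OF z, of k] by simp
  qed
  define E where "E = (\<lambda>w. exp (of_real l * w) * e (exp w))"
  have "E holomorphic_on UNIV" unfolding E_def
  proof -
    have "range (exp :: complex \<Rightarrow> complex) \<subseteq> - {0}" by auto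
    from holomorphic_on_compose_gen[OF holomorphic_on_exp e this]
    show "(\<lambda>w. exp (of_real l * w) * e (exp w)) holomorphic_on UNIV"
      by (intro holomorphic_intros) (simp only: o_def)
  qed
  moreover have "norm (E w) \<le> M" for w
  proof -
    have "norm (E w) = \<phi> (exp w)"
      by (simp add: E_def \<phi>_def norm_mult powr_def)
    then show ?thesis using bd[of "exp w"] by simp
  qed
  then have "bounded (range E)" by (auto simp: bounded_iff)
  ultimately have "E constant_on UNIV" by (rule Liouville_theorem)
  then have "E (Ln z) = E (Ln c)" by (auto simp: constant_on_def)
  then show ?thesis using c z by (simp add: E_def)
qed

text \<open>Dividing by theta (z / c) at a zero c lowers N by one and replaces K by - K / c; at N =
  0 Liouville's theorem applies. So N bounds the number of zeros modulo powers of p.\<close>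

lemma theta_function_eq_0:
  assumes p: "norm p < 1" "p \<noteq> 0" and f: "f holomorphic_on - {0}"
    and K: "\<And>z. z \<noteq> 0 \<Longrightarrow> f (p * z) = K * f z / z ^ N"
    and Z: "card Z = Suc N" "0 \<notin> Z" "\<And>x. x \<in> Z \<Longrightarrow> f x = 0"
      "\<And>x y. x \<in> Z \<Longrightarrow> y \<in> Z \<Longrightarrow> x \<noteq> y \<Longrightarrow> theta (x / y) p \<noteq> 0"
    and z: "z \<noteq> 0"
  shows "f z = 0"
  using f K Z z
proof (induction N arbitrary: f K Z z)
  case 0
  obtain c where "Z = {c}" using 0 by (auto simp: card_1_singleton_iff)
  then show ?case using constant_multiplier_zero[OF p, of c f K z] 0 by auto
next
  case (Suc N)
  show ?case
  proof (cases "K = 0")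
    case True
    then show ?thesis using Suc.prems(2)[of "z / p"] p Suc.prems by simp
  next
    case False
    obtain c where c: "c \<in> Z" using Suc.prems by fastforce
    have c0: "c \<noteq> 0" using c Suc.prems by auto
    obtain h where h: "h holomorphic_on - {0}" "\<And>z. z \<noteq> 0 \<Longrightarrow> f z = theta (z / c) p * h z"
      using theta_factor[OF p c0 Suc.prems(5)[OF c] Suc.prems(1), of "\<lambda>z. K / z ^ Suc N"] Suc.prems(2) False
      by (auto simp: field_simps)
    have hK: "h (p * z) = (- K / c) * h z / z ^ N" if z: "z \<noteq> 0" for z
    proof -
      \<comment> \<open>The multiplier of h can be read off only where theta (z / c) is nonzero;
        continuity along z * exp s covers the remaining points.\<close>
      define G where "G = (\<lambda>z. h (p * z) - (- K / c) * h z / z ^ N)"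
      have hp: "(\<lambda>z. h (p * z)) holomorphic_on - {0}"
      proof -
        have "(\<lambda>z. p * z) holomorphic_on - {0}" by (intro holomorphic_intros)
        moreover have "(\<lambda>z. p * z) ` (- {0}) \<subseteq> - {0}" using p by auto
        ultimately show ?thesis
          using holomorphic_on_compose_gen[of "\<lambda>z. p * z" "- {0}" h "- {0}"] h(1) by (simp add: o_def)
      qed
      have "G holomorphic_on - {0}"
        unfolding G_def using h hp c0 by (intro holomorphic_intros) auto
      then have Gc: "continuous_on (- {0}) G" by (rule holomorphic_on_imp_continuous_on)
      have "(\<lambda>s. G (z * exp s)) 0 = 0"
      proof (rule eq_zero_by_curve)
        show "\<forall>\<^sub>F s in at 0. G (z * exp s) = 0"
          using eventually_theta_exp_nonzero[OF p(1), of "z / c" 1] z c0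
        proof (simp, elim eventually_mono)
          fix s assume s: "theta (z * exp s / c) p \<noteq> 0"
          let ?z = "z * exp s"
          have z0: "?z \<noteq> 0" using z by simp
          have "theta (p * ?z / c) p * h (p * ?z) = K * (theta (?z / c) p * h ?z) / ?z ^ Suc N"
            using Suc.prems(2)[OF z0] h(2)[OF z0] h(2)[of "p * ?z"] z0 p by simp
          moreover have "theta (p * ?z / c) p = - (c / ?z) * theta (?z / c) p"
            using theta_mult_nome[OF p, of "?z / c"] z0 c0 by (simp add: field_simps)
          ultimately have "theta (?z / c) p * (- (c / ?z) * h (p * ?z) - K * h ?z / ?z ^ Suc N) = 0"
            by (simp add: algebra_simps)
          then have "- (c / ?z) * h (p * ?z) - K * h ?z / ?z ^ Suc N = 0" using s by simp
          then have "c * h (p * ?z) * ?z ^ N = - K * h ?z"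
            using z0 by (simp add: field_simps) (metis minus_minus)
          then show "G ?z = 0"
            unfolding G_def using z0 c0 by (simp add: divide_simps) (simp add: algebra_simps eq_neg_iff_add_eq_0)
        qed
        have "isCont G z" using continuous_on_interior[OF Gc, of z] z by (simp add: interior_open open_Compl)
        then show "isCont (\<lambda>s. G (z * exp s)) 0"
          by (intro continuous_at_compose[of 0 "\<lambda>s. z * exp s" G, unfolded o_def] continuous_intros) simp
      qed
      then show ?thesis by (simp add: G_def add_eq_0_iff)
    qed
    have "h z = 0"
    proof (rule Suc.IH[OF h(1) hK, of "Z - {c}"])
      have fin: "finite Z" using Suc.prems(3) by (metis card.infinite Zero_not_Suc)
      show "card (Z - {c}) = Suc N" using Suc.prems(3) c fin by simp
      fix x assume x: "x \<in> Z - {c}"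
      then have "x \<noteq> 0" "f x = 0" "theta (x / c) p \<noteq> 0" using Suc.prems c by auto
      then show "h x = 0" using h(2)[of x] by simp
    qed (use Suc.prems in auto)
    then show ?thesis using h(2) Suc.prems by simp
  qed
qed

section \<open>The three-term relation and partial fractions\<close>

definition theta_pair :: "complex \<Rightarrow> complex \<Rightarrow> complex \<Rightarrow> complex \<Rightarrow> complex" where
  "theta_pair p c a w = w * theta (a / w) p * theta (c / (a * w)) p"

lemma theta_pair_0: "c \<noteq> 0 \<Longrightarrow> a \<noteq> 0 \<Longrightarrow> w \<noteq> 0 \<Longrightarrow> theta_pair 0 c a w = (w + c / w) - (a + c / a)"
  by (simp add: theta_pair_def field_simps)

lemma theta_pair_swap:
  assumes "norm p < 1" "a \<noteq> 0" "w \<noteq> 0"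
  shows "theta_pair p c w a = - theta_pair p c a w"
  using theta_divide_swap[OF assms] assms by (simp add: theta_pair_def mult_ac)

lemma theta_pair_same [simp]:
  assumes "norm p < 1" "a \<noteq> 0"
  shows "theta_pair p c a a = 0"
  using assms by (simp add: theta_pair_def)

lemma continuous_on_theta_pair [continuous_intros]:
  assumes "continuous_on A f" "continuous_on A g" "continuous_on A h" "norm p < 1"
     "\<And>x. x \<in> A \<Longrightarrow> f x \<noteq> 0" "\<And>x. x \<in> A \<Longrightarrow> g x \<noteq> 0" "\<And>x. x \<in> A \<Longrightarrow> h x \<noteq> 0"
  shows "continuous_on A (\<lambda>x. theta_pair p (f x) (g x) (h x))"
  unfolding theta_pair_def using assms by (intro continuous_intros) auto

text \<open>Weierstrass's addition formula in multiplicative form. As a function of w the sum has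
  multiplier (c / p) / w ^ 2 and vanishes at a, b and d, one zero too many.
  \<open>theta_pair\<close> is the theta analogue of the difference of w + c / w and a + c / a, and
  the relation says that for fixed c these functions span a plane.\<close>

lemma theta_pair_three_term:
  assumes p: "norm p < 1" and nz: "c \<noteq> 0" "w \<noteq> 0" "a \<noteq> 0" "b \<noteq> 0" "d \<noteq> 0"
  shows "theta_pair p c w a * theta_pair p c b d + theta_pair p c w b * theta_pair p c d a
    + theta_pair p c w d * theta_pair p c a b = 0"
proof (cases "p = 0")
  case True
  then show ?thesis using nz by (simp add: theta_pair_0 algebra_simps)
next
  case False
  let ?F = "\<lambda>w a b d. theta_pair p c w a * theta_pair p c b d + theta_pair p c w b * theta_pair p c d a
    + theta_pair p c w d * theta_pair p c a b"
  have generic: "?F w a b d = 0"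
    if nz: "a \<noteq> 0" "b \<noteq> 0" "d \<noteq> 0" 
      and g: "theta (a / b) p \<noteq> 0" "theta (b / d) p \<noteq> 0" "theta (a / d) p \<noteq> 0" for a b d
  proof (rule theta_function_eq_0[OF p False, of "\<lambda>w. ?F w a b d" "c / p" 2 "{a, b, d}" w])
    show "(\<lambda>w. ?F w a b d) holomorphic_on - {0}"
      unfolding theta_pair_def using p nz \<open>c \<noteq> 0\<close> by (intro holomorphic_intros) auto
    have mult: "theta_pair p c (p * z) x = (c / p) * theta_pair p c z x / z ^ 2"
      if "z \<noteq> 0" "x \<noteq> 0" for z x
    proof -
      have "theta (p * z / x) p = - theta (z / x) p / (z / x)"
        using theta_mult_nome[OF p False, of "z / x"] that by simp
      moreover have "theta (c / (p * z * x)) p = - (c / (z * x) / p) * theta (c / (z * x)) p"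
        using theta_div_nome[OF p False, of "c / (z * x)"] that \<open>c \<noteq> 0\<close> by (simp add: mult_ac)
      ultimately show ?thesis using that False
        unfolding theta_pair_def by (simp only:) (simp add: field_simps power2_eq_square)
    qed
    show "?F (p * z) a b d = c / p * ?F z a b d / z\<^sup>2" if "z \<noteq> 0" for z
      using mult[OF that] nz by (simp add: add_divide_distrib algebra_simps)
    have ne: "a \<noteq> b" "b \<noteq> d" "a \<noteq> d" using g nz p by auto
    then show "card {a, b, d} = Suc 2" by simp
    have sw: "theta (y / x) p \<noteq> 0" if "theta (x / y) p \<noteq> 0" "x \<noteq> 0" "y \<noteq> 0" for x y
      using theta_divide_swap[OF p, of x y] that by auto
    show "theta (x / y) p \<noteq> 0" if "x \<in> {a, b, d}" "y \<in> {a, b, d}" "x \<noteq> y" for x y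
      using that g sw[OF g(1)] sw[OF g(2)] sw[OF g(3)] nz by auto
    show "?F x a b d = 0" if "x \<in> {a, b, d}" for x
      using that p nz theta_pair_swap[OF p, of a b c] theta_pair_swap[OF p, of a d c]
        theta_pair_swap[OF p, of b d c] by auto
  qed (use nz \<open>w \<noteq> 0\<close> in auto)
  \<comment> \<open>The rates 1, 2, 3 are distinct, so all quotients of the three points move off
    the zeros of theta.\<close>
  have "(\<lambda>s. ?F w (a * exp s) (b * exp (2 * s)) (d * exp (3 * s))) 0 = 0"
  proof (rule eq_zero_by_curve)
    have "\<forall>\<^sub>F s in at 0. theta (a / b * exp (-1 * s)) p \<noteq> 0"
      "\<forall>\<^sub>F s in at 0. theta (b / d * exp (-1 * s)) p \<noteq> 0"
      "\<forall>\<^sub>F s in at 0. theta (a / d * exp (-2 * s)) p \<noteq> 0"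
      using nz by (intro eventually_theta_exp_nonzero[OF p]; simp)+
    then show "\<forall>\<^sub>F s in at 0. ?F w (a * exp s) (b * exp (2 * s)) (d * exp (3 * s)) = 0"
    proof eventually_elim
      case (elim s)
      have "a * exp s / (b * exp (2 * s)) = a / b * exp (-1 * s)"
        "b * exp (2 * s) / (d * exp (3 * s)) = b / d * exp (-1 * s)"
        "a * exp s / (d * exp (3 * s)) = a / d * exp (-2 * s)"
        using nz by (simp_all add: field_simps flip: exp_add)
      then show ?case using elim nz by (intro generic) auto
    qed
    have "continuous_on UNIV (\<lambda>s. ?F w (a * exp s) (b * exp (2 * s)) (d * exp (3 * s)))"
      using p nz by (intro continuous_intros) auto
    then show "isCont (\<lambda>s. ?F w (a * exp s) (b * exp (2 * s)) (d * exp (3 * s))) 0"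
      by (simp add: continuous_on_eq_continuous_at)
  qed
  then show ?thesis by simp
qed

text \<open>Equality of the products of the zeros ys and the poles X plays the part of the residue
  theorem's periodicity condition. In the induction the factors of the first two ys are expanded, by
  the three-term relation, in the pairs belonging to two poles x1 and x2; in each of the two
  resulting sums one pole cancels.\<close>

lemma theta_partial_fractions:
  fixes X :: "complex set"
  assumes p: "norm p < 1"
    and X: "finite X" "0 \<notin> X" "X \<noteq> {}" "\<And>x y. x \<in> X \<Longrightarrow> y \<in> X \<Longrightarrow> x \<noteq> y \<Longrightarrow> theta (x / y) p \<noteq> 0"
    and ys: "length ys = card X" "prod_list ys = \<Prod>X"
  shows "(\<Sum>x\<in>X. (\<Prod>y\<leftarrow>ys. theta (y / x) p) / (\<Prod>x'\<in>X-{x}. theta (x' / x) p)) = 0"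
  using X ys
proof (induction "card X" arbitrary: X ys)
  case 0
  then show ?case by simp
next
  case (Suc n)
  note IH = Suc.hyps(1) and X = Suc.prems
  \<comment> \<open>The reduction needs three poles to choose from, so one and two poles are checked
    directly.\<close>
  consider "card X = 1" | "card X = 2" | "card X \<ge> 3" using Suc.hyps(2) by linarith
  then show ?case
  proof cases
    case 1
    then obtain x where x: "X = {x}" by (auto simp: card_1_singleton_iff)
    then obtain y where y: "ys = [y]" using X(5) by (auto simp: length_Suc_conv)
    have "x \<noteq> 0" "y = x" using x y X by auto
    then show ?thesis using p x y by simp
  next
    case 2
    then obtain x1 x2 where x: "X = {x1, x2}" "x1 \<noteq> x2" by (auto simp: card_2_iff)
    then obtain y1 y2 where y: "ys = [y1, y2]" using X(5) 2
      by (auto simp: length_Suc_conv numeral_2_eq_2)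
    have nz: "x1 \<noteq> 0" "x2 \<noteq> 0" and prod: "y1 * y2 = x1 * x2" using X x y by auto
    then have ynz: "y1 \<noteq> 0" "y2 \<noteq> 0" by auto
    have d: "theta (x2 / x1) p \<noteq> 0" "theta (x1 / x2) p \<noteq> 0" using X(4)[of x2 x1] X(4)[of x1 x2] x by auto
    have "y1 / x1 = x2 / y2" "y2 / x1 = x2 / y1" using prod nz ynz by (auto simp: field_simps)
    then have e: "theta (y1 / x1) p = - (x2 / y2) * theta (y2 / x2) p"
       "theta (y2 / x1) p = - (x2 / y1) * theta (y1 / x2) p"
      using theta_divide_swap[OF p nz(2), of y2] theta_divide_swap[OF p nz(2), of y1] ynz by auto
    have e3: "theta (x1 / x2) p = - (x1 / x2) * theta (x2 / x1) p"
      using theta_divide_swap[OF p, of x1 x2] nz by simp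
    have XX: "X - {x1} = {x2}" "X - {x2} = {x1}" using x by auto
    have "theta (y1 / x1) p * theta (y2 / x1) p / theta (x2 / x1) p
       + theta (y1 / x2) p * theta (y2 / x2) p / theta (x1 / x2) p
       = theta (y1 / x2) p * theta (y2 / x2) p * (x2 * x2 / (y1 * y2) / theta (x2 / x1) p - x2 / x1 / theta (x2 / x1) p)"
      using nz ynz d unfolding e e3 by (simp add: field_simps)
    also have "\<dots> = 0" using nz ynz unfolding prod by simp
    finally show ?thesis using x y XX by simp
  next
    case 3
    have "length ys \<ge> 2" using 3 X(5) by simp
    then obtain y1 y2 zs where y: "ys = y1 # y2 # zs"
      by (metis One_nat_def Suc_le_length_iff numeral_2_eq_2)
    have prodnz: "\<Prod>X \<noteq> 0" using X by (simp add: prod_zero_iff)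
    then have ynz: "y1 \<noteq> 0" "y2 \<noteq> 0" using X(6) y by auto
    define c where "c = y1 * y2"
    have c0: "c \<noteq> 0" using ynz by (simp add: c_def)
    \<comment> \<open>Of the products u * v and u * w at most one can be bad: if c were congruent to
      both modulo powers of p, then theta (w / v) would vanish.\<close>
    have "\<exists>x1 x2. x1 \<in> X \<and> x2 \<in> X \<and> x1 \<noteq> x2 \<and> theta (c / (x1 * x2)) p \<noteq> 0"
    proof -
      obtain S where "S \<subseteq> X" "card S = 3" using 3 obtain_subset_with_card_n by metis
      then obtain u v w where uvw: "u \<in> X" "v \<in> X" "w \<in> X" "u \<noteq> v" "u \<noteq> w" "v \<noteq> w"
        by (auto simp: card_3_iff)
      then have nz: "u \<noteq> 0" "v \<noteq> 0" "w \<noteq> 0" using X by auto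
      have "theta (c / (u * v)) p \<noteq> 0 \<or> theta (c / (u * w)) p \<noteq> 0"
      proof (rule ccontr)
        assume "\<not> ?thesis"
        then have a: "theta (c / (u * v)) p = 0" "theta (c / (u * w)) p = 0" by auto
        have "theta (c / (u * v) / (c / (u * w))) p = 0"
          using nz c0 by (intro theta_eq_0_divide[OF p _ _ a]) auto
        moreover have "c / (u * v) / (c / (u * w)) = w / v" using nz c0 by (simp add: field_simps)
        ultimately show False using X(4)[of w v] uvw by auto
      qed
      then show ?thesis using uvw by blast
    qed
    then obtain x1 x2 where x: "x1 \<in> X" "x2 \<in> X" "x1 \<noteq> x2" and xc: "theta (c / (x1 * x2)) p \<noteq> 0" by blast
    have nz: "x1 \<noteq> 0" "x2 \<noteq> 0" using X x by auto
    let ?g = "theta_pair p c"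
    have g12: "?g x1 x2 \<noteq> 0" using xc X(4)[OF x(1,2,3)] nz by (simp add: theta_pair_def)
    \<comment> \<open>Coordinates of the pair of y1 with respect to the pairs of x1 and x2, read off
      from the three-term relation.\<close>
    define \<alpha> where "\<alpha> = ?g y1 x2 / ?g x1 x2"
    define \<beta> where "\<beta> = - ?g y1 x1 / ?g x1 x2"
    have lin: "theta (y1 / w) p * theta (y2 / w) p
        = \<alpha> * (theta (x1 / w) p * theta (c / x1 / w) p) + \<beta> * (theta (x2 / w) p * theta (c / x2 / w) p)"
      if w: "w \<noteq> 0" for w
    proof -
      have "?g y1 w = \<alpha> * ?g x1 w + \<beta> * ?g x2 w"
      proof -
        have "?g y1 w * ?g x1 x2 + ?g y1 x1 * ?g x2 w + ?g y1 x2 * ?g w x1 = 0"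
          by (rule theta_pair_three_term[OF p c0 ynz(1) w nz])
        then have "?g y1 w * ?g x1 x2 = ?g y1 x2 * ?g x1 w - ?g y1 x1 * ?g x2 w"
          using theta_pair_swap[OF p nz(1) w, of c] by (simp add: algebra_simps add_eq_0_iff)
        then show ?thesis using g12 by (simp add: \<alpha>_def \<beta>_def field_simps)
      qed
      moreover have "y2 / w = c / (y1 * w)" using ynz by (simp add: c_def)
      moreover have "c / x1 / w = c / (x1 * w)" "c / x2 / w = c / (x2 * w)" by simp_all
      ultimately have "w * (theta (y1 / w) p * theta (y2 / w) p)
        = w * (\<alpha> * (theta (x1 / w) p * theta (c / x1 / w) p) + \<beta> * (theta (x2 / w) p * theta (c / x2 / w) p))"
        by (simp add: theta_pair_def algebra_simps)
      then show ?thesis using w by simp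
    qed
    \<comment> \<open>The term at u is zero, and in every other term theta (u / x) cancels. What
      remains is the claim for X - {u}, with the single zero c / u in place of y1 and y2.\<close>
    have vanish: "(\<Sum>x\<in>X. (theta (u / x) p * theta (c / u / x) p * (\<Prod>y\<leftarrow>zs. theta (y / x) p)) /
        (\<Prod>x'\<in>X-{x}. theta (x' / x) p)) = 0" if u: "u \<in> X" for u
    proof -
      have u0: "u \<noteq> 0" using u X by auto
      have "(\<Sum>x\<in>X. (theta (u / x) p * theta (c / u / x) p * (\<Prod>y\<leftarrow>zs. theta (y / x) p)) /
          (\<Prod>x'\<in>X-{x}. theta (x' / x) p))
        = (\<Sum>x\<in>X-{u}. (theta (u / x) p * theta (c / u / x) p * (\<Prod>y\<leftarrow>zs. theta (y / x) p)) /
          (\<Prod>x'\<in>X-{x}. theta (x' / x) p))"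
        using X(1) u u0 p by (subst sum.remove[of _ u]) auto
      also have "\<dots> = (\<Sum>x\<in>X-{u}. (\<Prod>y\<leftarrow>(c / u) # zs. theta (y / x) p) / (\<Prod>x'\<in>(X-{u})-{x}. theta (x' / x) p))"
      proof (rule sum.cong[OF refl])
        fix x assume xx: "x \<in> X - {u}"
        have "X - {x} = insert u (X - {u} - {x})" using xx u by auto
        then have *: "(\<Prod>x'\<in>X-{x}. theta (x' / x) p) = theta (u / x) p * (\<Prod>x'\<in>X-{u}-{x}. theta (x' / x) p)"
          using X(1) by simp
        then show "(theta (u / x) p * theta (c / u / x) p * (\<Prod>y\<leftarrow>zs. theta (y / x) p)) / (\<Prod>x'\<in>X-{x}. theta (x' / x) p)
          = (\<Prod>y\<leftarrow>(c / u) # zs. theta (y / x) p) / (\<Prod>x'\<in>(X-{u})-{x}. theta (x' / x) p)"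
        proof -
          have "theta (u / x) p \<noteq> 0" using X(4)[of u x] xx u by blast
          then show ?thesis using *  by simp
        qed
      qed
      also have "\<dots> = 0"
      proof (rule IH)
        show "n = card (X - {u})" using Suc.hyps(2) u X(1) by simp
        have "card (X - {u}) \<ge> 2" using 3 u X(1) by simp
        then show "X - {u} \<noteq> {}" by fastforce
        show "length ((c / u) # zs) = card (X - {u})" using X(1,5) y u by simp
        have "\<Prod>X = u * \<Prod>(X - {u})" using X(1) u by (rule prod.remove)
        moreover have "\<Prod>X = c * prod_list zs" using X(6) y by (simp add: c_def mult.assoc)
        ultimately show "prod_list ((c / u) # zs) = \<Prod>(X - {u})" using u0 by (simp add: field_simps)
      qed (use X in auto)
      finally show ?thesis .
    qed
    have "(\<Sum>x\<in>X. (\<Prod>y\<leftarrow>ys. theta (y / x) p) / (\<Prod>x'\<in>X-{x}. theta (x' / x) p))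
      = (\<Sum>x\<in>X. \<alpha> * ((theta (x1 / x) p * theta (c / x1 / x) p * (\<Prod>y\<leftarrow>zs. theta (y / x) p)) /
        (\<Prod>x'\<in>X-{x}. theta (x' / x) p)) + \<beta> * ((theta (x2 / x) p * theta (c / x2 / x) p * (\<Prod>y\<leftarrow>zs. theta (y / x) p)) /
        (\<Prod>x'\<in>X-{x}. theta (x' / x) p)))"
    proof (rule sum.cong[OF refl])
      fix x assume "x \<in> X"
      then have "x \<noteq> 0" using X by auto
      have "(\<Prod>y\<leftarrow>ys. theta (y / x) p) = (theta (y1 / x) p * theta (y2 / x) p) * (\<Prod>y\<leftarrow>zs. theta (y / x) p)"
        by (simp add: y)
      also note lin[OF \<open>x \<noteq> 0\<close>]
      finally show "(\<Prod>y\<leftarrow>ys. theta (y / x) p) / (\<Prod>x'\<in>X-{x}. theta (x' / x) p) =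
        \<alpha> * ((theta (x1 / x) p * theta (c / x1 / x) p * (\<Prod>y\<leftarrow>zs. theta (y / x) p)) /
        (\<Prod>x'\<in>X-{x}. theta (x' / x) p)) + \<beta> * ((theta (x2 / x) p * theta (c / x2 / x) p * (\<Prod>y\<leftarrow>zs. theta (y / x) p)) /
        (\<Prod>x'\<in>X-{x}. theta (x' / x) p))"
        by (simp add: algebra_simps add_divide_distrib)
    qed
    also have "\<dots> = 0"
      unfolding sum.distrib sum_distrib_left[symmetric] vanish[OF x(1)] vanish[OF x(2)] by simp
    finally show ?thesis .
  qed
qed

subsection \<open>Means over the torus\<close>

definition unit_interval_measure :: "real measure" where
  "unit_interval_measure = density lborel (\<lambda>x. ennreal (indicator {0..1} x))"

definition circle_mean :: "(complex \<Rightarrow> complex) \<Rightarrow> complex" where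
  "circle_mean f = (\<integral>x. f (cis (2 * pi * x)) \<partial>unit_interval_measure)"

text \<open>Points carry all natural indices, so the same functions serve in every dimension.
  Coordinates from n on are frozen at one number of modulus 1, because x i is
  \<open>undefined\<close> there.\<close>

definition torus_mean :: "nat \<Rightarrow> ((nat \<Rightarrow> complex) \<Rightarrow> complex) \<Rightarrow> complex" where
  "torus_mean n F = (\<integral>x. F (\<lambda>i. cis (2 * pi * x i)) \<partial>(\<Pi>\<^sub>M i\<in>{..<n}. unit_interval_measure))"

text \<open>All coordinates are constrained, not just the first n: the set is then compact in the
  product topology, and continuous functions on it are bounded.\<close>

definition torus :: "(nat \<Rightarrow> complex) set" where
  "torus = {z. \<forall>i. norm (z i) = 1}"

lemma sets_unit_interval_measure [simp, measurable_cong]: "sets unit_interval_measure = sets borel"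
  by (simp add: unit_interval_measure_def)

lemma space_unit_interval_measure [simp]: "space unit_interval_measure = UNIV"
  by (simp add: unit_interval_measure_def)

lemma emeasure_unit_interval_measure:
  "A \<in> sets borel \<Longrightarrow> emeasure unit_interval_measure A = emeasure lborel ({0..1} \<inter> A)"
proof -
  assume A: "A \<in> sets borel"
  have "emeasure unit_interval_measure A = (\<integral>\<^sup>+x. indicator {0..1} x * indicator A x \<partial>lborel)"
    using A by (simp add: unit_interval_measure_def emeasure_density ennreal_indicator)
  also have "\<dots> = (\<integral>\<^sup>+x. indicator ({0..1} \<inter> A) x \<partial>lborel)"
    by (intro nn_integral_cong) (simp add: indicator_def)
  finally show ?thesis using A by (simp add: nn_integral_indicator)
qed

lemma prob_space_unit_interval_measure: "prob_space unit_interval_measure"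
  by (rule prob_spaceI) (simp add: emeasure_unit_interval_measure)

interpretation unit_interval: prob_space unit_interval_measure
  by (rule prob_space_unit_interval_measure)

interpretation unit_cube: product_sigma_finite "\<lambda>_::nat. unit_interval_measure"
  by standard

lemma integral_unit_interval_measure:
  fixes f :: "real \<Rightarrow> complex"
  assumes "f \<in> borel_measurable borel"
  shows "(\<integral>x. f x \<partial>unit_interval_measure) = (\<integral>x. indicator {0..1} x *\<^sub>R f x \<partial>lborel)"
  unfolding unit_interval_measure_def using assms by (subst integral_density) (simp_all add: measurable_lborel1)

lemma torus_eq_PiE: "torus = Pi\<^sub>E UNIV (\<lambda>_. sphere 0 1)"
  by (auto simp: torus_def PiE_def)

lemma compact_torus: "compact torus"
proof -
  have "compactin (product_topology (\<lambda>_::nat. euclidean) UNIV) (Pi\<^sub>E UNIV (\<lambda>_. sphere (0::complex) 1))"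
    by (auto simp: compactin_PiE)
  then show ?thesis by (simp add: torus_eq_PiE euclidean_product_topology)
qed

lemma torusD: "z \<in> torus \<Longrightarrow> norm (z i) = 1" "z \<in> torus \<Longrightarrow> z i \<noteq> 0"
  by (auto simp: torus_def) (metis norm_zero zero_neq_one)

lemma cis_in_torus [simp]: "(\<lambda>i. cis (x i)) \<in> torus"
  by (simp add: torus_def)

lemma continuous_on_torus_component [continuous_intros]: "continuous_on torus (\<lambda>z. z i)"
  by (rule continuous_on_subset[OF continuous_on_product_coordinates]) simp

lemma continuous_on_fun_upd:
  assumes "continuous_on A f" "continuous_on A g"
  shows "continuous_on A (\<lambda>x. (f x)(i := g x) :: 'i \<Rightarrow> 'b::topological_space)"
proof (rule continuous_on_coordinatewise_then_product)
  fix j show "continuous_on A (\<lambda>x. ((f x)(i := g x)) j)"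
    using assms continuous_on_product_then_coordinatewise[OF assms(1), of j] by (cases "j = i") auto
qed

lemma continuous_on_comp_index [continuous_intros]:
  "continuous_on A f \<Longrightarrow> continuous_on A (\<lambda>x. f x \<circ> (\<tau> :: 'i \<Rightarrow> 'j) :: 'i \<Rightarrow> 'b::topological_space)"
  using continuous_on_product_then_coordinatewise
  by (intro continuous_on_coordinatewise_then_product) (auto simp: o_def)

lemma torus_comp: "z \<in> torus \<Longrightarrow> z \<circ> \<tau> \<in> torus"
  by (auto simp: torus_def)

lemma bounded_on_torus:
  assumes "continuous_on torus (F :: _ \<Rightarrow> complex)"
  obtains B where "\<And>z. z \<in> torus \<Longrightarrow> norm (F z) \<le> B"
proof -
  have "bounded (F ` torus)"
    using assms compact_torus compact_continuous_image compact_imp_bounded by blast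
  then show ?thesis using that unfolding bounded_iff by auto
qed

lemma torus_param_measurable:
  assumes "continuous_on torus (F :: _ \<Rightarrow> complex)"
  shows "(\<lambda>x. F (\<lambda>i. cis (2 * pi * x i))) \<in> borel_measurable (\<Pi>\<^sub>M i\<in>{..<n}. unit_interval_measure)"
proof -
  let ?M = "\<Pi>\<^sub>M i\<in>{..<n}. unit_interval_measure"
  have closed: "torus \<in> sets borel"
    using compact_torus compact_imp_closed by (intro borel_closed) blast
  have F: "(\<lambda>z. indicator torus z *\<^sub>R F z) \<in> borel_measurable borel"
    using assms closed by (rule borel_measurable_continuous_on_indicator[rotated])
  have "(\<lambda>x i. cis (2 * pi * x i)) \<in> borel_measurable ?M"
  proof (rule measurable_coordinatewise_then_product)
    fix i
    show "(\<lambda>x. cis (2 * pi * x i)) \<in> borel_measurable ?M"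
    proof (cases "i < n")
      case True
      then have "(\<lambda>x. x i) \<in> borel_measurable ?M"
        by (subst measurable_cong_sets[OF refl sets_unit_interval_measure[symmetric]])
          (rule measurable_component_singleton, simp)
      then have "(\<lambda>x. exp (\<i> * complex_of_real (2 * pi * x i))) \<in> borel_measurable ?M"
        by measurable
      then show ?thesis by (simp only: cis_conv_exp)
    next
      \<comment> \<open>Points of the product space are extensional, so a coordinate outside {..<n}
        is constant.\<close>
      case False
      have "(\<lambda>x. cis (2 * pi * x i)) \<in> borel_measurable ?M \<longleftrightarrow> (\<lambda>x. cis (2 * pi * undefined)) \<in> borel_measurable ?M"
        using False by (intro measurable_cong) (auto simp: space_PiM PiE_def extensional_def)
      then show ?thesis by simp
    qed
  qed
  from measurable_compose[OF this F] show ?thesis by simp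
qed

lemma torus_param_integrable:
  assumes "continuous_on torus (F :: _ \<Rightarrow> complex)"
  shows "integrable (\<Pi>\<^sub>M i\<in>{..<n}. unit_interval_measure) (\<lambda>x. F (\<lambda>i. cis (2 * pi * x i)))"
proof -
  obtain B where B: "\<And>z. z \<in> torus \<Longrightarrow> norm (F z) \<le> B" using bounded_on_torus[OF assms] by blast
  interpret P: prob_space "\<Pi>\<^sub>M i\<in>{..<n}. unit_interval_measure"
    by (rule prob_space_PiM) (rule prob_space_unit_interval_measure)
  show ?thesis
    by (rule P.integrable_const_bound[of _ B]) (auto intro!: AE_I2 B torus_param_measurable[OF assms])
qed

lemma torus_mean_cong:
  assumes "\<And>z. z \<in> torus \<Longrightarrow> F z = G z"
  shows "torus_mean n F = torus_mean n G"
  unfolding torus_mean_def by (intro Bochner_Integration.integral_cong) (auto intro: assms)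

lemma torus_mean_add:
  assumes "continuous_on torus F" "continuous_on torus G"
  shows "torus_mean n (\<lambda>z. F z + G z) = torus_mean n F + torus_mean n G"
  unfolding torus_mean_def
  by (intro Bochner_Integration.integral_add torus_param_integrable assms)

lemma torus_mean_sum:
  assumes "\<And>i. i \<in> A \<Longrightarrow> continuous_on torus (F i)"
  shows "torus_mean n (\<lambda>z. \<Sum>i\<in>A. F i z) = (\<Sum>i\<in>A. torus_mean n (F i))"
  unfolding torus_mean_def
  by (intro Bochner_Integration.integral_sum torus_param_integrable assms)

lemma torus_mean_mult [simp]: "torus_mean n (\<lambda>z. c * F z) = c * torus_mean n F"
  unfolding torus_mean_def by (rule integral_mult_right_zero)

lemma torus_mean_uminus [simp]: "torus_mean n (\<lambda>z. - F z) = - torus_mean n F"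
  unfolding torus_mean_def by (rule Bochner_Integration.integral_minus)

lemma torus_mean_0_right [simp]: "torus_mean n (\<lambda>z. 0) = 0"
  by (simp add: torus_mean_def)

lemma torus_mean_const [simp]: "torus_mean n (\<lambda>z. c) = c"
proof -
  interpret P: prob_space "\<Pi>\<^sub>M i\<in>{..<n}. unit_interval_measure"
    by (rule prob_space_PiM) (rule prob_space_unit_interval_measure)
  show ?thesis by (simp add: torus_mean_def P.prob_space)
qed

text \<open>Fubini with the last variable singled out; the one-variable Cauchy arguments are applied
  to the inner mean.\<close>

lemma torus_mean_Suc:
  assumes "continuous_on torus F"
  shows "torus_mean (Suc n) F = torus_mean n (\<lambda>z. circle_mean (\<lambda>u. F (z(n := u))))"
proof -
  have "torus_mean (Suc n) F = (\<integral>x. F (\<lambda>i. cis (2 * pi * x i)) \<partial>(\<Pi>\<^sub>M i\<in>insert n {..<n}. unit_interval_measure))"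
    by (simp add: torus_mean_def lessThan_Suc)
  also have "\<dots> = (\<integral>x. (\<integral>y. F (\<lambda>i. cis (2 * pi * (x(n := y)) i)) \<partial>unit_interval_measure)
      \<partial>(\<Pi>\<^sub>M i\<in>{..<n}. unit_interval_measure))"
    using torus_param_integrable[OF assms, of "Suc n"]
    by (intro unit_cube.product_integral_insert) (auto simp: lessThan_Suc)
  also have "(\<lambda>x y. F (\<lambda>i. cis (2 * pi * (x(n := y)) i))) =
      (\<lambda>x y. F ((\<lambda>i. cis (2 * pi * x i))(n := cis (2 * pi * y))))"
    by (intro ext arg_cong[where f = F]) auto
  finally show ?thesis by (simp add: torus_mean_def circle_mean_def)
qed

lemma torus_mean_transpose:
  assumes F: "continuous_on torus F" and ij: "i < n" "j < n"
  shows "torus_mean n (\<lambda>z. F (z \<circ> Transposition.transpose i j)) = torus_mean n F"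
proof -
  let ?\<tau> = "Transposition.transpose i j" and ?M = "\<Pi>\<^sub>M i\<in>{..<n}. unit_interval_measure"
  let ?t = "\<lambda>\<omega>. \<lambda>k\<in>{..<n}. \<omega> (?\<tau> k) :: real"
  have d: "distr ?M ?M ?t = ?M"
    by (rule distr_PiM_reindex) (use ij in \<open>auto simp: Transposition.transpose_def prob_space_unit_interval_measure inj_on_def\<close>)
  have t: "?t \<in> measurable ?M ?M"
    by (intro measurable_restrict measurable_component_singleton) (use ij in \<open>auto simp: Transposition.transpose_def\<close>)
  have "torus_mean n F = (\<integral>x. F (\<lambda>i. cis (2 * pi * x i)) \<partial>distr ?M ?M ?t)"
    by (simp add: d torus_mean_def)
  also have "\<dots> = (\<integral>x. F (\<lambda>i. cis (2 * pi * ?t x i)) \<partial>?M)"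
    by (rule integral_distr[OF t torus_param_measurable[OF F]])
  also have "\<dots> = (\<integral>x. F ((\<lambda>i. cis (2 * pi * x i)) \<circ> ?\<tau>) \<partial>?M)"
  proof (rule Bochner_Integration.integral_cong[OF refl], rule arg_cong[where f = F], rule ext)
    fix x k assume "x \<in> space ?M"
    then show "cis (2 * pi * ?t x k) = ((\<lambda>i. cis (2 * pi * x i)) \<circ> ?\<tau>) k"
      using ij by (auto simp: space_PiM PiE_def extensional_def Transposition.transpose_def)
  qed
  finally show ?thesis by (simp add: torus_mean_def)
qed

text \<open>The reflection x -> 1 - x of the parameter interval inverts cis (2 * pi * x).\<close>

lemma circle_mean_inverse:
  assumes "continuous_on (sphere 0 1) f"
  shows "circle_mean (\<lambda>u. f (1 / u)) = circle_mean f"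
proof -
  have c: "continuous_on UNIV (\<lambda>x. f (cis (2 * pi * x)))"
    by (rule continuous_on_compose2[OF assms]) (auto intro!: continuous_intros)
  have c': "continuous_on UNIV (\<lambda>x. f (1 / cis (2 * pi * x)))"
    by (rule continuous_on_compose2[OF assms]) (auto intro!: continuous_intros simp: norm_divide)
  have "circle_mean f = (\<integral>x. indicator {0..1} x *\<^sub>R f (cis (2 * pi * x)) \<partial>lborel)"
    unfolding circle_mean_def using c by (intro integral_unit_interval_measure borel_measurable_continuous_onI)
  also have "\<dots> = (\<integral>x. indicator {0..1} (1 + -1 * x) *\<^sub>R f (cis (2 * pi * (1 + -1 * x))) \<partial>lborel)"
    by (subst lborel_integral_real_affine[where c = "-1" and t = 1]) auto
  also have "\<dots> = (\<integral>x. indicator {0..1} x *\<^sub>R f (1 / cis (2 * pi * x)) \<partial>lborel)"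
  proof (rule Bochner_Integration.integral_cong[OF refl])
    fix x :: real
    have "cis (2 * pi * (1 + -1 * x)) = cis (2 * pi) / cis (2 * pi * x)"
      by (simp add: cis_divide algebra_simps)
    then have "cis (2 * pi * (1 + -1 * x)) = 1 / cis (2 * pi * x)" by simp
    then show "indicator {0..1} (1 + -1 * x) *\<^sub>R f (cis (2 * pi * (1 + -1 * x))) =
        indicator {0..1} x *\<^sub>R f (1 / cis (2 * pi * x))"
      by (auto simp: indicator_def)
  qed
  also have "\<dots> = circle_mean (\<lambda>u. f (1 / u))"
    unfolding circle_mean_def using c'
    by (intro integral_unit_interval_measure[symmetric] borel_measurable_continuous_onI)
  finally show ?thesis by simp
qed

lemma continuous_on_torus_section:
  assumes "continuous_on torus F" "z \<in> torus"
  shows "continuous_on (sphere 0 1) (\<lambda>u. F (z(i := u)))"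
  by (rule continuous_on_compose2[OF assms(1)])
    (use assms(2) in \<open>auto intro!: continuous_on_fun_upd continuous_on_const continuous_on_id simp: torus_def\<close>)

text \<open>A transposition moves coordinate i to the last place, where Fubini isolates it in a
  single circle mean.\<close>

lemma torus_mean_flip:
  assumes F: "continuous_on torus F" and i: "i < n"
  shows "torus_mean n (\<lambda>z. F (z(i := 1 / z i))) = torus_mean n F"
proof -
  obtain m where m: "n = Suc m" using i by (cases n) auto
  let ?\<tau> = "Transposition.transpose i m"
  define G where "G = (\<lambda>z. F (z \<circ> ?\<tau>))"
  have G: "continuous_on torus G" unfolding G_def
    by (rule continuous_on_compose2[OF F]) (auto intro!: continuous_intros torus_comp)
  have flip_in: "z(k := 1 / z k) \<in> torus" if "z \<in> torus" for z k
    using that by (auto simp: torus_def norm_divide)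
  have cflip: "continuous_on torus (\<lambda>z. H (z(k := 1 / z k)))" if "continuous_on torus H" for H :: "_ \<Rightarrow> complex" and k
    by (rule continuous_on_compose2[OF that]) (auto intro!: continuous_on_fun_upd continuous_on_id continuous_on_divide continuous_on_const
          continuous_on_torus_component flip_in simp: torusD)
  have "torus_mean n (\<lambda>z. F (z(i := 1 / z i))) = torus_mean n (\<lambda>z. (\<lambda>z. F (z(i := 1 / z i))) (z \<circ> ?\<tau>))"
    by (rule torus_mean_transpose[symmetric]) (use m i in \<open>auto intro!: cflip F\<close>)
  also have "\<dots> = torus_mean n (\<lambda>z. G (z(m := 1 / z m)))"
  proof (rule torus_mean_cong)
    fix z :: "nat \<Rightarrow> complex"
    have "(z \<circ> ?\<tau>)(i := 1 / (z \<circ> ?\<tau>) i) = z(m := 1 / z m) \<circ> ?\<tau>"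
      by (auto simp: Transposition.transpose_def)
    then show "F ((z \<circ> ?\<tau>)(i := 1 / (z \<circ> ?\<tau>) i)) = G (z(m := 1 / z m))"
      by (simp add: G_def)
  qed
  also have "\<dots> = torus_mean m (\<lambda>z. circle_mean (\<lambda>u. (\<lambda>u. G (z(m := u))) (1 / u)))"
    unfolding m by (subst torus_mean_Suc) (auto intro: cflip G)
  also have "\<dots> = torus_mean m (\<lambda>z. circle_mean (\<lambda>u. G (z(m := u))))"
    by (intro torus_mean_cong circle_mean_inverse continuous_on_torus_section G)
  also have "\<dots> = torus_mean n G" unfolding m using torus_mean_Suc[OF G] by simp
  also have "\<dots> = torus_mean n F" unfolding G_def by (rule torus_mean_transpose[OF F]) (use m i in auto)
  finally show ?thesis .
qed

text \<open>Dominated convergence with a constant bound, which exists because K \<times> torus is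
  compact.\<close>

lemma continuous_on_torus_mean:
  fixes F :: "complex \<Rightarrow> (nat \<Rightarrow> complex) \<Rightarrow> complex"
  assumes K: "compact K" and F: "continuous_on (K \<times> torus) (\<lambda>(s, z). F s z)"
  shows "continuous_on K (\<lambda>s. torus_mean n (F s))"
  unfolding continuous_on_sequentially o_def
proof (intro allI ballI impI, elim conjE)
  fix x a assume a: "a \<in> K" and x: "\<forall>k. x k \<in> K" "x \<longlonglongrightarrow> a"
  interpret P: prob_space "\<Pi>\<^sub>M i\<in>{..<n}. unit_interval_measure"
    by (rule prob_space_PiM) (rule prob_space_unit_interval_measure)
  have cz: "continuous_on torus (F s)" if "s \<in> K" for s
  proof -
    have "continuous_on torus (\<lambda>z. (s, z))"
      by (intro continuous_on_Pair continuous_on_const continuous_on_id)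
    from continuous_on_compose2[OF F this] that show ?thesis by auto
  qed
  have cs: "continuous_on K (\<lambda>s. F s z)" if "z \<in> torus" for z
  proof -
    have "continuous_on K (\<lambda>s. (s, z))"
      by (intro continuous_on_Pair continuous_on_const continuous_on_id)
    from continuous_on_compose2[OF F this] that show ?thesis by auto
  qed
  have "compact (K \<times> torus)" using K compact_torus by (rule compact_Times)
  then have "bounded ((\<lambda>(s, z). F s z) ` (K \<times> torus))"
    using F compact_continuous_image compact_imp_bounded by blast
  then obtain B where "\<And>s z. s \<in> K \<Longrightarrow> z \<in> torus \<Longrightarrow> norm (F s z) \<le> B"
    unfolding bounded_iff by fastforce
  then show "(\<lambda>k. torus_mean n (F (x k))) \<longlonglongrightarrow> torus_mean n (F a)"
    unfolding torus_mean_def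
  proof (intro integral_dominated_convergence[where w = "\<lambda>_. B"])
    show "AE y in \<Pi>\<^sub>M i\<in>{..<n}. unit_interval_measure.
        (\<lambda>k. F (x k) (\<lambda>i. cis (2 * pi * y i))) \<longlonglongrightarrow> F a (\<lambda>i. cis (2 * pi * y i))"
      using cs a x unfolding continuous_on_sequentially o_def by (auto intro!: AE_I2)
  qed (use a x in \<open>auto intro!: torus_param_measurable cz\<close>)
qed

section \<open>Means over one circle and Cauchy's theorem\<close>

lemma circle_mean_eq_integral:
  assumes "continuous_on (sphere 0 1) f"
  shows "((\<lambda>x. f (cis (2 * pi * x))) has_integral circle_mean f) {0..1}"
proof -
  have c: "continuous_on UNIV (\<lambda>x. f (cis (2 * pi * x)))"
    by (rule continuous_on_compose2[OF assms]) (auto intro!: continuous_intros)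
  have si: "set_integrable lborel {0..1} (\<lambda>x. f (cis (2 * pi * x)))"
    by (rule borel_integrable_atLeastAtMost') (rule continuous_on_subset[OF c], simp)
  have "circle_mean f = (LINT x:{0..1}|lborel. f (cis (2 * pi * x)))"
    unfolding circle_mean_def set_lebesgue_integral_def
    using c by (intro integral_unit_interval_measure borel_measurable_continuous_onI)
  also have "\<dots> = integral {0..1} (\<lambda>x. f (cis (2 * pi * x)))"
    by (rule set_borel_integral_eq_integral(2)[OF si])
  finally show ?thesis using set_borel_integral_eq_integral(1)[OF si] by (simp add: has_integral_iff)
qed

lemma circle_mean_cong:
  assumes "\<And>u. norm u = 1 \<Longrightarrow> f u = g u"
  shows "circle_mean f = circle_mean g"
  unfolding circle_mean_def by (intro Bochner_Integration.integral_cong) (auto intro: assms)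

lemma circle_mean_mult [simp]: "circle_mean (\<lambda>u. c * f u) = c * circle_mean f"
  unfolding circle_mean_def by (rule integral_mult_right_zero)

lemma circle_mean_holomorphic:
  assumes "f holomorphic_on cball 0 1"
  shows "circle_mean f = f 0"
proof -
  have "((\<lambda>u. f u / (u - 0)) has_contour_integral (2 * of_real pi * \<i> * f 0)) (circlepath 0 1)"
    using assms by (intro Cauchy_integral_circlepath_simple) auto
  then have "((\<lambda>x. f (circlepath 0 1 x) / circlepath 0 1 x * vector_derivative (circlepath 0 1) (at x))
      has_integral (2 * of_real pi * \<i> * f 0)) {0..1}"
    by (simp add: has_contour_integral)
  moreover have "f (circlepath 0 1 x) / circlepath 0 1 x * vector_derivative (circlepath 0 1) (at x)
      = (2 * pi * \<i>) * f (cis (2 * pi * x))" for x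
  proof -
    have "circlepath 0 1 x = cis (2 * pi * x)"
      by (simp add: circlepath cis_conv_exp mult_ac)
    moreover have "vector_derivative (circlepath 0 1) (at x) = 2 * of_real pi * \<i> * cis (2 * pi * x)"
      by (simp add: vector_derivative_circlepath cis_conv_exp mult_ac)
    ultimately show ?thesis by simp
  qed
  ultimately have "((\<lambda>x. (2 * pi * \<i>) * f (cis (2 * pi * x))) has_integral (2 * pi * \<i> * f 0)) {0..1}"
    by simp
  from has_integral_mult_right[OF this, of "1 / (2 * pi * \<i>)"]
  have "((\<lambda>x. f (cis (2 * pi * x))) has_integral f 0) {0..1}" by simp
  moreover have "continuous_on (sphere 0 1) f"
    using holomorphic_on_imp_continuous_on[OF assms] by (rule continuous_on_subset) auto
  ultimately show ?thesis using circle_mean_eq_integral has_integral_unique by blast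
qed

text \<open>In the variable w with u = exp w the annulus becomes a convex strip, where a primitive P
  exists. The increment Q of P over one period has derivative 0, so the mean is the same on every
  circle of the annulus.\<close>

lemma circle_mean_dilate:
  assumes f: "f holomorphic_on {z. r1 < norm z \<and> norm z < r2}" and r: "0 < r1" "r1 < norm p" "norm p < 1" "1 < r2"
  shows "circle_mean (\<lambda>u. f (p * u)) = circle_mean f"
proof -
  define S where "S = {w. ln r1 < Re w \<and> Re w < ln r2}"
  have S: "open S" "convex S"
  proof -
    have "S = {w. ln r1 < Re w} \<inter> {w. Re w < ln r2}" by (auto simp: S_def)
    then show "open S" "convex S"
      by (auto intro!: open_Int convex_Int open_halfspace_Re_gt open_halfspace_Re_lt convex_halfspace_Re_gt convex_halfspace_Re_lt)
  qed
  have "exp ` S \<subseteq> {z. r1 < norm z \<and> norm z < r2}"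
  proof safe
    fix w assume "w \<in> S"
    then have "ln r1 < Re w" "Re w < ln r2" by (auto simp: S_def)
    then have "exp (ln r1) < exp (Re w)" "exp (Re w) < exp (ln r2)" by simp_all
    then show "r1 < norm (exp w)" "norm (exp w) < r2" using r by auto
  qed
  from holomorphic_on_compose_gen[OF holomorphic_on_exp f this]
  have F: "(\<lambda>w. f (exp w)) holomorphic_on S" by (simp add: o_def)
  then obtain P where P: "\<And>w. w \<in> S \<Longrightarrow> (P has_field_derivative f (exp w)) (at w)"
    using holomorphic_convex_primitive'[OF S(2) S(1) F] at_within_open[OF _ S(1)] by metis
  have per: "w + 2 * pi * \<i> \<in> S \<longleftrightarrow> w \<in> S" for w by (simp add: S_def)
  define Q where "Q = (\<lambda>w. P (w + 2 * pi * \<i>) - P w)"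
  have "(Q has_field_derivative 0) (at w within S)" if w: "w \<in> S" for w
  proof -
    have "((\<lambda>w. P (w + 2 * pi * \<i>)) has_field_derivative f (exp (w + 2 * pi * \<i>))) (at w)"
      using DERIV_shift[of P "f (exp (w + 2 * pi * \<i>))" w "2 * pi * \<i>"] P[of "w + 2 * pi * \<i>"] w per by auto
    then have "(Q has_field_derivative f (exp (w + 2 * pi * \<i>)) - f (exp w)) (at w)"
      unfolding Q_def using P[OF w] by (rule DERIV_diff)
    moreover have "exp (w + 2 * pi * \<i>) = exp w" by (simp add: exp_add)
    ultimately show ?thesis by (simp add: has_field_derivative_at_within)
  qed
  then have Qc: "Q w1 = Q w2" if "w1 \<in> S" "w2 \<in> S" for w1 w2
    using has_field_derivative_zero_constant[OF S(2), of Q] that by metis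
  have int: "((\<lambda>x. f (exp (w + 2 * pi * \<i> * of_real x))) has_integral Q w / (2 * pi * \<i>)) {0..1}" if w: "w \<in> S" for w
  proof -
    have "((\<lambda>x. f (exp (w + 2 * pi * \<i> * of_real x)) * (2 * pi * \<i>)) has_integral
        (P (w + 2 * pi * \<i> * of_real 1) - P (w + 2 * pi * \<i> * of_real 0))) {0..1}"
    proof (rule fundamental_theorem_of_calculus)
      fix x :: real
      have "w + 2 * pi * \<i> * of_real x \<in> S" using w by (simp add: S_def)
      from P[OF this]
      show "((\<lambda>x. P (w + 2 * pi * \<i> * of_real x)) has_vector_derivative
          f (exp (w + 2 * pi * \<i> * of_real x)) * (2 * pi * \<i>)) (at x within {0..1})"
        by (intro has_vector_derivative_real_field[THEN has_vector_derivative_at_within]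
              DERIV_chain2[where f = P] ) (auto intro!: derivative_eq_intros)
    qed auto
    from has_integral_mult_left[OF this, of "1 / (2 * pi * \<i>)"] show ?thesis by (simp add: Q_def)
  qed
  have cf: "continuous_on (sphere 0 1) f"
    using holomorphic_on_imp_continuous_on[OF f] by (rule continuous_on_subset) (use r in auto)
  have cp: "continuous_on (sphere 0 1) (\<lambda>u. f (p * u))"
    by (rule continuous_on_compose2[OF holomorphic_on_imp_continuous_on[OF f]])
      (use r in \<open>auto intro!: continuous_intros simp: norm_mult\<close>)
  have p0: "p \<noteq> 0" using r by auto
  have S0: "0 \<in> S" "Ln p \<in> S" using r p0 by (auto simp: S_def ln_less_zero_iff)
  have c: "cis (2 * pi * x) = exp (0 + 2 * pi * \<i> * of_real x)"
     "p * cis (2 * pi * x) = exp (Ln p + 2 * pi * \<i> * of_real x)" for x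
    using p0 by (simp_all add: cis_conv_exp exp_add mult_ac)
  have "((\<lambda>x. f (cis (2 * pi * x))) has_integral Q 0 / (2 * pi * \<i>)) {0..1}"
    unfolding c(1) by (rule int[OF S0(1)])
  then have "circle_mean f = Q 0 / (2 * pi * \<i>)"
    using circle_mean_eq_integral[OF cf] has_integral_unique by blast
  moreover have "((\<lambda>x. f (p * cis (2 * pi * x))) has_integral Q (Ln p) / (2 * pi * \<i>)) {0..1}"
    unfolding c(2) by (rule int[OF S0(2)])
  then have "circle_mean (\<lambda>u. f (p * u)) = Q (Ln p) / (2 * pi * \<i>)"
    using circle_mean_eq_integral[OF cp] has_integral_unique by blast
  ultimately show ?thesis using Qc[OF S0] by simp
qed

text \<open>Inversion identifies the means of f (p * u) and f (p / u). The first equals the mean of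
  f by dilation, the second its negative by antisymmetry.\<close>

lemma circle_mean_antisym:
  assumes f: "f holomorphic_on {z. r1 < norm z \<and> norm z < r2}" and r: "0 < r1" "r1 < norm p" "norm p < 1" "1 < r2"
    and anti: "\<And>z. norm z = 1 \<Longrightarrow> f (p / z) = - f z"
  shows "circle_mean f = 0"
proof -
  have "continuous_on (sphere 0 1) (\<lambda>u. f (p * u))"
    by (rule continuous_on_compose2[OF holomorphic_on_imp_continuous_on[OF f]])
      (use r in \<open>auto intro!: continuous_intros simp: norm_mult\<close>)
  from circle_mean_inverse[OF this]
  have "circle_mean (\<lambda>u. f (p / u)) = circle_mean (\<lambda>u. f (p * u))" by simp
  also have "\<dots> = circle_mean f" by (rule circle_mean_dilate[OF f r])
  finally have "circle_mean (\<lambda>u. f (p / u)) = circle_mean f" .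
  moreover have "circle_mean (\<lambda>u. f (p / u)) = circle_mean (\<lambda>u. (-1) * f u)"
    by (rule circle_mean_cong) (simp add: anti)
  ultimately have "circle_mean f = - circle_mean f" unfolding circle_mean_mult by simp
  then show ?thesis by simp
qed

text \<open>Bridges two conventions: indices {1..n} against {..<n}, and Lebesgue measure restricted
  to a cube against a product of probability measures.\<close>

lemma varpi_integral_eq_torus_mean:
  assumes F: "continuous_on torus (\<lambda>z. F (\<lambda>i\<in>{1..n}. z (i - 1)))"
  shows "varpi_integral n F = torus_mean n (\<lambda>z. F (\<lambda>i\<in>{1..n}. z (i - 1)))"
proof -
  let ?U = "unit_interval_measure"
  let ?L = "\<Pi>\<^sub>M i\<in>{1..n}. (lborel :: real measure)" and ?M = "\<Pi>\<^sub>M i\<in>{1..n}. ?U"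
  let ?C = "\<Pi>\<^sub>E i\<in>{1..n}. {0..1::real}"
  interpret L: product_sigma_finite "\<lambda>_::nat. lborel :: real measure" by standard
  have C: "?C \<in> sets ?L" by (intro sets_PiM_I_finite) auto
  \<comment> \<open>A product measure is determined by its values on boxes; on a box both sides are
    the product of the Lebesgue measures of A i within the unit interval.\<close>
  have dens: "density ?L (\<lambda>x. ennreal (indicator ?C x)) = ?M"
  proof (rule unit_cube.PiM_eqI)
    show "sets (density ?L (\<lambda>x. ennreal (indicator ?C x))) = sets ?M"
      by (auto intro!: sets_PiM_cong)
    fix A assume A: "\<And>i. i \<in> {1..n} \<Longrightarrow> A i \<in> sets ?U"
    then have PA: "Pi\<^sub>E {1..n} A \<in> sets ?L" by (intro sets_PiM_I_finite) auto
    have "emeasure (density ?L (\<lambda>x. ennreal (indicator ?C x))) (Pi\<^sub>E {1..n} A)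
        = emeasure ?L (?C \<inter> Pi\<^sub>E {1..n} A)"
    proof -
      have "emeasure (density ?L (\<lambda>x. ennreal (indicator ?C x))) (Pi\<^sub>E {1..n} A)
          = (\<integral>\<^sup>+x. indicator ?C x * indicator (Pi\<^sub>E {1..n} A) x \<partial>?L)"
        using C PA by (subst emeasure_density) (auto simp: ennreal_indicator)
      also have "\<dots> = (\<integral>\<^sup>+x. indicator (?C \<inter> Pi\<^sub>E {1..n} A) x \<partial>?L)"
        by (intro nn_integral_cong) (simp add: indicator_def)
      finally show ?thesis using C PA by (simp add: nn_integral_indicator)
    qed
    also have "?C \<inter> Pi\<^sub>E {1..n} A = (\<Pi>\<^sub>E i\<in>{1..n}. {0..1} \<inter> A i)" by (rule PiE_Int)
    also have "emeasure ?L \<dots> = (\<Prod>i\<in>{1..n}. emeasure lborel ({0..1} \<inter> A i))"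
      using A by (intro L.emeasure_PiM) auto
    also have "\<dots> = (\<Prod>i\<in>{1..n}. emeasure ?U (A i))"
      using A by (intro prod.cong) (auto simp: emeasure_unit_interval_measure)
    finally show "emeasure (density ?L (\<lambda>x. ennreal (indicator ?C x))) (Pi\<^sub>E {1..n} A) = (\<Prod>i\<in>{1..n}. emeasure ?U (A i))" .
  qed auto
  define G where "G = (\<lambda>z. F (\<lambda>i\<in>{1..n}. z (i - 1)))"
  let ?N = "\<Pi>\<^sub>M i\<in>{..<n}. ?U"
  let ?t = "\<lambda>\<omega>. \<lambda>k\<in>{1..n}. \<omega> (k - 1) :: real"
  have d: "distr ?N ?M ?t = ?M"
    by (rule distr_PiM_reindex[where f = "\<lambda>k. k - 1"])
      (auto simp: prob_space_unit_interval_measure inj_on_def)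
  have t: "?t \<in> measurable ?N ?M"
    by (intro measurable_restrict measurable_component_singleton) auto
  \<comment> \<open>Undoes the reindexing \<open>?t\<close>. It expresses H through G, whose
    measurability follows from continuity on the torus.\<close>
  let ?s = "\<lambda>\<omega>. \<lambda>k\<in>{..<n}. \<omega> (Suc k) :: real"
  have s: "?s \<in> measurable ?M ?N"
    by (intro measurable_restrict measurable_component_singleton) auto
  define H where "H = (\<lambda>x. F (\<lambda>i\<in>{1..n}. cis (2 * pi * x i)))"
  have HG: "H x = G (\<lambda>i. cis (2 * pi * ?s x i))" for x
  proof -
    have "(\<lambda>i\<in>{1..n}. cis (2 * pi * x i)) = (\<lambda>i\<in>{1..n}. cis (2 * pi * ?s x (i - 1)))"
      by (rule restrict_ext) auto
    then show ?thesis by (simp only: H_def G_def)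
  qed
  have Hm: "H \<in> borel_measurable ?M"
    unfolding HG using measurable_compose[OF s torus_param_measurable] F unfolding G_def by auto
  then have HmL: "H \<in> borel_measurable ?L"
    by (subst measurable_cong_sets[OF sets_PiM_cong[OF refl] refl]) auto
  have "varpi_integral n F = (\<integral>x. indicator ?C x *\<^sub>R H x \<partial>?L)"
    by (simp add: varpi_integral_altdef set_lebesgue_integral_def H_def)
  also have "\<dots> = (\<integral>x. H x \<partial>density ?L (\<lambda>x. ennreal (indicator ?C x)))"
    using C HmL by (intro integral_density[symmetric]) auto
  also have "\<dots> = (\<integral>x. H x \<partial>distr ?N ?M ?t)" by (simp only: dens d)
  also have "\<dots> = (\<integral>x. H (?t x) \<partial>?N)" by (rule integral_distr[OF t Hm])
  also have "\<dots> = (\<integral>x. G (\<lambda>i. cis (2 * pi * x i)) \<partial>?N)"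
    unfolding H_def G_def by (intro Bochner_Integration.integral_cong arg_cong[where f = F]) (auto simp: restrict_def)
  finally show ?thesis by (simp add: torus_mean_def G_def)
qed

subsection \<open>Products over pairs and hyperoctahedral antisymmetry\<close>

definition pair_prod :: "('a \<Rightarrow> 'a \<Rightarrow> complex) \<Rightarrow> nat \<Rightarrow> (nat \<Rightarrow> 'a) \<Rightarrow> complex" where
  "pair_prod h n z = (\<Prod>k<n. \<Prod>j<k. h (z j) (z k))"

lemma pair_prod_0 [simp]: "pair_prod h 0 z = 1"
  by (simp add: pair_prod_def)

lemma pair_prod_Suc: "pair_prod h (Suc n) z = pair_prod h n z * (\<Prod>j<n. h (z j) (z n))"
  by (simp add: pair_prod_def)

lemma pair_prod_cong:
  assumes "\<And>j k. j < k \<Longrightarrow> k < n \<Longrightarrow> h (z j) (z k) = h' (z' j) (z' k)"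
  shows "pair_prod h n z = pair_prod h' n z'"
  unfolding pair_prod_def using assms by (intro prod.cong refl) auto

lemma pair_prod_mult: "pair_prod (\<lambda>x y. f x y * g x y) n z = pair_prod f n z * pair_prod g n z"
  by (simp add: pair_prod_def prod.distrib)

lemma pair_prod_divide: "pair_prod (\<lambda>x y. f x y / g x y) n z = pair_prod f n z / pair_prod g n z"
  by (simp add: pair_prod_def prod_dividef)

lemma pair_prod_nonzero:
  assumes "\<And>j k. j < k \<Longrightarrow> k < n \<Longrightarrow> h (z j) (z k) \<noteq> 0"
  shows "pair_prod h n z \<noteq> 0"
  unfolding pair_prod_def using assms by (simp add: prod_zero_iff)

lemma continuous_on_pair_prod:
  assumes "\<And>j k. j < k \<Longrightarrow> k < n \<Longrightarrow> continuous_on A (\<lambda>x. h x (z x j) (z x k))"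
  shows "continuous_on A (\<lambda>x. pair_prod (h x) n (z x))"
  unfolding pair_prod_def using assms by (intro continuous_intros) auto

lemma holomorphic_on_pair_prod:
  assumes "\<And>j. j \<noteq> i \<Longrightarrow> (\<lambda>u. h (z j) u) holomorphic_on A" "\<And>j. j \<noteq> i \<Longrightarrow> (\<lambda>u. h u (z j)) holomorphic_on A"
  shows "(\<lambda>u. pair_prod h n (z(i := u))) holomorphic_on A"
proof -
  have "(\<lambda>u. h ((z(i := u)) j) ((z(i := u)) k)) holomorphic_on A" if "j < k" for j k
    using that assms by (cases "j = i"; cases "k = i") auto
  then show ?thesis unfolding pair_prod_def by (intro holomorphic_intros) auto
qed

text \<open>Reduces a distant transposition to an adjacent one.\<close>

lemma transpose_conj:
  fixes z :: "nat \<Rightarrow> 'a"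
  assumes "a \<noteq> b" "a \<noteq> c" "b \<noteq> c"
  shows "z \<circ> Transposition.transpose a c =
    ((z \<circ> Transposition.transpose a b) \<circ> Transposition.transpose b c) \<circ> Transposition.transpose a b"
  using assms by (auto simp: Transposition.transpose_def fun_eq_iff)

text \<open>Symmetric and antisymmetric factors, e = 1 and e = -1, are treated together. Exchanging
  the last two indices permutes the factors, except that one factor is reversed. A transposition
  reaching further is a conjugate of this one by a transposition inside {..<n}, so e is contributed
  three times.\<close>

lemma pair_prod_transpose:
  assumes e: "e * e = 1" and h: "\<And>a b. h (z b) (z a) = e * h (z a) (z b)" and ij: "i < n" "j < n" "i \<noteq> j"
  shows "pair_prod h n (z \<circ> Transposition.transpose i j) = e * pair_prod h n z"
  using ij h
proof (induction n arbitrary: i j z)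
  case 0
  then show ?case by simp
next
  case (Suc n)
  have inner: "pair_prod h (Suc n) (z \<circ> Transposition.transpose i j) = e * pair_prod h (Suc n) z"
    if ij: "i < n" "j < n" "i \<noteq> j" and h: "\<And>a b. h (z b) (z a) = e * h (z a) (z b)" for i j z
  proof -
    have "(\<Prod>k<n. h ((z \<circ> Transposition.transpose i j) k) (z n)) = (\<Prod>k<n. h (z k) (z n))"
      by (rule prod.reindex_bij_witness[where i = "Transposition.transpose i j" and j = "Transposition.transpose i j"])
        (use ij in \<open>auto simp: Transposition.transpose_def\<close>)
    moreover have "(z \<circ> Transposition.transpose i j) n = z n" using ij by (simp add: Transposition.transpose_def)
    moreover have "pair_prod h n (z \<circ> Transposition.transpose i j) = e * pair_prod h n z"
      by (rule Suc.IH[OF ij]) (rule h)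
    ultimately show ?thesis unfolding pair_prod_Suc by (simp only: mult.assoc)
  qed
  have adj: "pair_prod h (Suc n) (z \<circ> Transposition.transpose (n - 1) n) = e * pair_prod h (Suc n) z"
    if n: "n \<ge> 1" and h: "\<And>a b. h (z b) (z a) = e * h (z a) (z b)" for z
  proof -
    obtain m where m: "n = Suc m" using n by (cases n) auto
    let ?z = "z \<circ> Transposition.transpose (n - 1) n"
    have 1: "?z k = z k" if "k < m" for k using that m by (simp add: Transposition.transpose_def)
    have 2: "?z m = z n" "?z n = z m" using m by (simp_all add: Transposition.transpose_def)
    have "pair_prod h m ?z = pair_prod h m z"
    proof (rule pair_prod_cong)
      fix j k assume "j < k" "k < m"
      then show "h (?z j) (?z k) = h (z j) (z k)" using 1[of j] 1[of k] by (simp only: order.strict_trans)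
    qed
    moreover have "(\<Prod>j<m. h (?z j) c) = (\<Prod>j<m. h (z j) c)" for c
    proof (rule prod.cong[OF refl])
      fix j assume "j \<in> {..<m}"
      then show "h (?z j) c = h (z j) c" using 1[of j] by (simp only: lessThan_iff)
    qed
    moreover have "pair_prod h (Suc n) y = pair_prod h m y * (\<Prod>j<m. h (y j) (y m)) *
        ((\<Prod>j<m. h (y j) (y n)) * h (y m) (y n))" for y
      by (simp add: m pair_prod_Suc)
    moreover have "h (z n) (z m) = e * h (z m) (z n)" by (rule h)
    ultimately show ?thesis by (simp only: 2 mult_ac)
  qed
  show ?case
  proof (cases "i < n \<and> j < n")
    case True
    then show ?thesis using inner Suc.prems by blast
  next
    case False
    have comm: "Transposition.transpose i j = Transposition.transpose j i" by (rule transpose_commute)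
    obtain i' where i': "i' < n" "Transposition.transpose i j = Transposition.transpose i' n"
      using False Suc.prems(1-3) comm by (metis less_SucE)
    show ?thesis
    proof (cases "i' = n - 1")
      case True
      have "n \<ge> 1" using i' by simp
      from adj[OF this Suc.prems(4)] show ?thesis unfolding i'(2) True .
    next
      case False
      let ?\<tau> = "Transposition.transpose i' (n - 1)"
      have *: "z \<circ> Transposition.transpose i' n = ((z \<circ> ?\<tau>) \<circ> Transposition.transpose (n - 1) n) \<circ> ?\<tau>"
        using False i' by (intro transpose_conj) auto
      have n: "i' < n" "n - 1 < n" "i' \<noteq> n - 1" "n \<ge> 1" using False i' by auto
      have h: "h ((z \<circ> \<sigma>) b) ((z \<circ> \<sigma>) a) = e * h ((z \<circ> \<sigma>) a) ((z \<circ> \<sigma>) b)" for a b \<sigma>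
        unfolding o_apply by (rule Suc.prems(4))
      have "pair_prod h (Suc n) (z \<circ> Transposition.transpose i' n) =
          e * pair_prod h (Suc n) ((z \<circ> ?\<tau>) \<circ> Transposition.transpose (n - 1) n)"
        unfolding * by (rule inner[OF n(1-3)]) (unfold o_apply, rule Suc.prems(4))
      also have "pair_prod h (Suc n) ((z \<circ> ?\<tau>) \<circ> Transposition.transpose (n - 1) n)
          = e * pair_prod h (Suc n) (z \<circ> ?\<tau>)"
        by (rule adj[OF n(4) h])
      also have "pair_prod h (Suc n) (z \<circ> ?\<tau>) = e * pair_prod h (Suc n) z"
        by (rule inner[OF n(1-3) Suc.prems(4)])
      also have "e * (e * (e * pair_prod h (Suc n) z)) = (e * e) * (e * pair_prod h (Suc n) z)"
        by (simp only: mult.assoc)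
      finally show ?thesis using i' e by simp
    qed
  qed
qed

lemma prod_upd:
  assumes "i < (n::nat)"
  shows "(\<Prod>k<n. g ((z(i := u)) k)) = g u * (\<Prod>k\<in>{..<n}-{i}. g (z k) :: 'a :: comm_monoid_mult)"
proof -
  have "(\<Prod>k<n. g ((z(i := u)) k)) = g ((z(i := u)) i) * (\<Prod>k\<in>{..<n}-{i}. g ((z(i := u)) k))"
    using assms by (intro prod.remove) auto
  also have "(\<Prod>k\<in>{..<n}-{i}. g ((z(i := u)) k)) = (\<Prod>k\<in>{..<n}-{i}. g (z k))"
    by (intro prod.cong) auto
  finally show ?thesis by simp
qed

lemma prod_transpose:
  assumes "i < (n::nat)" "j < n"
  shows "(\<Prod>k<n. g ((z \<circ> Transposition.transpose i j) k)) = (\<Prod>k<n. g (z k))"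
  by (rule prod.reindex_bij_witness[where i = "Transposition.transpose i j" and j = "Transposition.transpose i j"])
    (use assms in \<open>auto simp: Transposition.transpose_def\<close>)

text \<open>The factor r j is required to be the same whether i is the smaller or the larger index
  of the pair, so the ordering inside \<open>pair_prod\<close> has no influence on the total
  change.\<close>

lemma pair_prod_upd:
  assumes i: "i < n" and r: "\<And>j. j \<noteq> i \<Longrightarrow> h (z j) u = r j * h (z j) (z i)" "\<And>j. j \<noteq> i \<Longrightarrow> h u (z j) = r j * h (z i) (z j)"
  shows "pair_prod h n (z(i := u)) = (\<Prod>j\<in>{..<n}-{i}. r j) * pair_prod h n z"
proof -
  let ?e = "\<lambda>j k. if j = i then r k else if k = i then r j else 1"
  have "pair_prod h n (z(i := u)) = (\<Prod>k<n. \<Prod>j<k. ?e j k * h (z j) (z k))"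
    unfolding pair_prod_def using r by (intro prod.cong refl) auto
  also have "\<dots> = (\<Prod>k<n. \<Prod>j<k. ?e j k) * pair_prod h n z"
    by (simp add: pair_prod_def prod.distrib)
  also have "(\<Prod>k<n. \<Prod>j<k. ?e j k) = (\<Prod>j\<in>{..<n}-{i}. r j)"
    using i
  proof (induction n)
    case (Suc n)
    show ?case
    proof (cases "i = n")
      case True
      have "(\<Prod>k<n. \<Prod>j<k. ?e j k) = 1" using True by (intro prod.neutral ballI) auto
      moreover have "(\<Prod>j<n. ?e j n) = (\<Prod>j<n. r j)" using True by (intro prod.cong) auto
      moreover have "{..<Suc n} - {i} = {..<n}" using True by auto
      ultimately show ?thesis by simp
    next
      case False
      then have "i < n" using Suc by simp
      moreover have "(\<Prod>j<n. ?e j n) = r n"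
        using False \<open>i < n\<close> by (subst prod.remove[of _ i]) auto
      moreover have "{..<Suc n} - {i} = insert n ({..<n} - {i})" using False by auto
      ultimately show ?thesis using Suc.IH by simp
    qed
  qed simp
  finally show ?thesis .
qed

text \<open>Theta-function Weyl denominator for the roots 2 e_i and e_i + e_j, e_i - e_j. At nome 0
  its factors become z k - 1 / z k and the differences of y + 1 / y and x + 1 / x. The monomials are
  there to make the signs under transposition and inversion exact.\<close>

definition BC_vandermonde :: "complex \<Rightarrow> nat \<Rightarrow> (nat \<Rightarrow> complex) \<Rightarrow> complex" where
  "BC_vandermonde p n z = (\<Prod>k<n. z k * theta (1 / z k ^ 2) p) *
     pair_prod (\<lambda>x y. theta (x * y) p * theta (y / x) p / y) n z"

text \<open>The sign character of the hyperoctahedral group together with degree 2 n + 2 in each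
  variable, a degree that the zeros forced by the signs exhaust. Holomorphy is asked in each
  variable separately because uniqueness moves one coordinate at a time; joint continuity serves the
  passage to non-generic points.\<close>

definition BC_antisym :: "complex \<Rightarrow> nat \<Rightarrow> ((nat \<Rightarrow> complex) \<Rightarrow> complex) \<Rightarrow> bool" where
  "BC_antisym p n f \<longleftrightarrow> continuous_on {z. \<forall>i. z i \<noteq> 0} f \<and> (\<forall>z. (\<forall>i. z i \<noteq> 0) \<longrightarrow>
     (\<forall>i<n. \<forall>j<n. i \<noteq> j \<longrightarrow> f (z \<circ> Transposition.transpose i j) = - f z) \<and>
     (\<forall>i<n. f (z(i := 1 / z i)) = - f z \<and>
        f (z(i := p * z i)) = f z / (p ^ (n + 1) * z i ^ (2 * n + 2)) \<and>
        (\<lambda>u. f (z(i := u))) holomorphic_on - {0}))"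

lemma continuous_on_nonzero_component [continuous_intros]:
  "continuous_on {z :: nat \<Rightarrow> complex. \<forall>i. z i \<noteq> 0} (\<lambda>z. z i)"
  by (rule continuous_on_subset[OF continuous_on_product_coordinates]) simp

lemma theta_mult_swap:
  assumes "norm p < 1" "x \<noteq> 0" "y \<noteq> 0"
  shows "theta (y * x) p * theta (x / y) p / x = - (theta (x * y) p * theta (y / x) p / y)"
  using theta_divide_swap[OF assms] assms by (simp add: mult.commute)

lemma theta_square_inverse:
  assumes "norm p < 1" "x \<noteq> 0"
  shows "(1 / x) * theta (1 / (1 / x) ^ 2) p = - (x * theta (1 / x ^ 2) p)"
  using theta_inverse[OF assms(1), of "x ^ 2"] assms by (simp add: power2_eq_square field_simps)

lemma BC_vandermonde_transpose:
  assumes "norm p < 1" "\<forall>i. z i \<noteq> 0" "i < n" "j < n" "i \<noteq> j"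
  shows "BC_vandermonde p n (z \<circ> Transposition.transpose i j) = - BC_vandermonde p n z"
proof -
  have "pair_prod (\<lambda>x y. theta (x * y) p * theta (y / x) p / y) n (z \<circ> Transposition.transpose i j)
     = (-1) * pair_prod (\<lambda>x y. theta (x * y) p * theta (y / x) p / y) n z"
  proof (rule pair_prod_transpose)
    show "theta (z b * z a) p * theta (z a / z b) p / z a = - 1 * (theta (z a * z b) p * theta (z b / z a) p / z b)" for a b
      using theta_mult_swap[OF assms(1), of "z a" "z b"] assms(2) by simp
  qed (use assms in auto)
  then show ?thesis
    unfolding BC_vandermonde_def prod_transpose[OF assms(3,4), of "\<lambda>x. x * theta (1 / x ^ 2) p" z]
    by simp
qed

lemma BC_vandermonde_flip:
  assumes p: "norm p < 1" and z: "\<forall>i. z i \<noteq> 0" and i: "i < n"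
  shows "BC_vandermonde p n (z(i := 1 / z i)) = - BC_vandermonde p n z"
proof -
  have "pair_prod (\<lambda>x y. theta (x * y) p * theta (y / x) p / y) n (z(i := 1 / z i))
     = (\<Prod>j\<in>{..<n}-{i}. 1) * pair_prod (\<lambda>x y. theta (x * y) p * theta (y / x) p / y) n z"
  proof (rule pair_prod_upd[OF i])
    fix j assume "j \<noteq> i"
    have 1: "theta (z j * (1 / z i)) p = - (z j / z i) * theta (z i / z j) p"
      using theta_divide_swap[OF p, of "z j" "z i"] z by simp
    have 2: "theta ((1 / z i) / z j) p = - theta (z j * z i) p / (z j * z i)"
      using theta_inverse[OF p, of "z j * z i"] z by (simp add: mult.commute)
    show "theta (z j * (1 / z i)) p * theta ((1 / z i) / z j) p / (1 / z i) =
      1 * (theta (z j * z i) p * theta (z i / z j) p / z i)"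
      unfolding 1 2 using z by simp
    show "theta ((1 / z i) * z j) p * theta (z j / (1 / z i)) p / z j
       = 1 * (theta (z i * z j) p * theta (z j / z i) p / z j)"
      by (simp add: mult_ac)
  qed
  then show ?thesis
    using theta_square_inverse[OF p, of "z i"] z i
    unfolding BC_vandermonde_def prod_upd[OF i, of "\<lambda>x. x * theta (1 / x ^ 2) p" z]
    by (subst (2) prod.remove[of _ i]) auto
qed

lemma BC_vandermonde_shift:
  assumes p: "norm p < 1" "p \<noteq> 0" and z: "\<forall>i. z i \<noteq> 0" and i: "i < n"
  shows "BC_vandermonde p n (z(i := p * z i)) = BC_vandermonde p n z / (p ^ (n + 1) * z i ^ (2 * n + 2))"
proof -
  have "pair_prod (\<lambda>x y. theta (x * y) p * theta (y / x) p / y) n (z(i := p * z i))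
     = (\<Prod>j\<in>{..<n}-{i}. 1 / (p * z i ^ 2)) * pair_prod (\<lambda>x y. theta (x * y) p * theta (y / x) p / y) n z"
  proof (rule pair_prod_upd[OF i])
    fix j assume "j \<noteq> i"
    have 1: "theta (z j * (p * z i)) p = - theta (z j * z i) p / (z j * z i)"
      using theta_mult_nome[OF p, of "z j * z i"] z by (simp add: mult_ac)
    have 2: "theta (p * z i / z j) p = - theta (z i / z j) p / (z i / z j)"
      using theta_mult_nome[OF p, of "z i / z j"] z by (simp add: mult_ac)
    show "theta (z j * (p * z i)) p * theta ((p * z i) / z j) p / (p * z i) =
      1 / (p * z i ^ 2) * (theta (z j * z i) p * theta (z i / z j) p / z i)"
      unfolding 1 2 using z p by (simp add: field_simps power2_eq_square)
    have 3: "theta (z j / (p * z i)) p = - (z j / z i / p) * theta (z j / z i) p"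
      using theta_div_nome[OF p, of "z j / z i"] z by (simp add: mult_ac)
    have 4: "theta (p * z i * z j) p = - theta (z i * z j) p / (z i * z j)"
      using theta_mult_nome[OF p, of "z i * z j"] z by (simp add: mult_ac)
    show "theta ((p * z i) * z j) p * theta (z j / (p * z i)) p / z j
       = 1 / (p * z i ^ 2) * (theta (z i * z j) p * theta (z j / z i) p / z j)"
      unfolding 3 4 using z p by (simp add: field_simps power2_eq_square)
  qed
  moreover have "p * z i * theta (1 / (p * z i) ^ 2) p = 1 / (p ^ 2 * z i ^ 4) * (z i * theta (1 / z i ^ 2) p)"
  proof -
    have "theta (1 / (p * z i) ^ 2) p = - (1 / z i ^ 2 / p / p) * theta (1 / z i ^ 2 / p) p"
      using theta_div_nome[OF p, of "1 / z i ^ 2 / p"] z p by (simp add: power2_eq_square mult_ac)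
    also have "theta (1 / z i ^ 2 / p) p = - (1 / z i ^ 2 / p) * theta (1 / z i ^ 2) p"
      using theta_div_nome[OF p, of "1 / z i ^ 2"] z by simp
    finally show ?thesis using z p by (simp add: field_simps power2_eq_square power4_eq_xxxx)
  qed
  moreover have "1 / (p ^ 2 * z i ^ 4) * (\<Prod>j\<in>{..<n}-{i}. 1 / (p * z i ^ 2)) = 1 / (p ^ (n + 1) * z i ^ (2 * n + 2))"
  proof -
    obtain m where m: "n = Suc m" using i by (cases n) auto
    have "(z i ^ 2) ^ m = z i ^ (2 * m)" by (simp add: power_mult)
    then show ?thesis using i z p
      by (simp add: m power_divide power_mult_distrib field_simps power_add power2_eq_square power4_eq_xxxx)
  qed
  ultimately show ?thesis
    using i unfolding BC_vandermonde_def prod_upd[OF i, of "\<lambda>x. x * theta (1 / x ^ 2) p" z]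
    by (subst (2) prod.remove[of _ i]) (auto simp: field_simps)
qed

lemma continuous_on_BC_vandermonde:
  assumes p: "norm p < 1"
  shows "continuous_on {z. \<forall>i. z i \<noteq> 0} (BC_vandermonde p n)"
  unfolding BC_vandermonde_def using p by (intro continuous_intros continuous_on_pair_prod) auto

lemma BC_antisym_vandermonde:
  assumes p: "norm p < 1" "p \<noteq> 0"
  shows "BC_antisym p n (BC_vandermonde p n)"
proof -
  have hol: "(\<lambda>u. BC_vandermonde p n (z(i := u))) holomorphic_on - {0}"
    if z: "\<forall>i. z i \<noteq> 0" and i: "i < n" for z i
    unfolding BC_vandermonde_def prod_upd[OF i, of "\<lambda>x. x * theta (1 / x ^ 2) p" z]
    using z p by (intro holomorphic_intros holomorphic_on_pair_prod) auto
  show ?thesis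
    unfolding BC_antisym_def
    using continuous_on_BC_vandermonde BC_vandermonde_transpose BC_vandermonde_flip
       BC_vandermonde_shift hol p by auto
qed

section \<open>Uniqueness of antisymmetric theta functions\<close>

lemma power_int_inj:
  assumes "norm p < 1" "p \<noteq> (0 :: complex)" "p powi k = p powi l"
  shows "k = l"
proof (rule ccontr)
  assume "k \<noteq> l"
  then have "norm p powi k \<noteq> norm p powi l"
    using assms power_int_strict_decreasing[of k l "norm p"] power_int_strict_decreasing[of l k "norm p"]
    by (cases "k < l") auto
  then show False using assms(3) by (metis norm_power_int)
qed

lemma theta_divide_eq_0_commute:
  assumes "norm p < 1" "x \<noteq> 0" "y \<noteq> 0"
  shows "theta (x / y) p = 0 \<longleftrightarrow> theta (y / x) p = 0"
  using theta_divide_swap[OF assms] theta_divide_swap[OF assms(1,3,2)] assms by auto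

text \<open>If x / c were a power of p, then x ^ 2 would be one too, since c ^ 2 is.\<close>

lemma theta_divide_nonzero_of_square:
  assumes p: "norm p < 1" "p \<noteq> 0" and c: "c \<noteq> 0" "c ^ 2 = p powi m" and x: "x \<noteq> 0" "theta (x ^ 2) p \<noteq> 0"
  shows "theta (x / c) p \<noteq> 0" "theta (c / x) p \<noteq> 0"
proof -
  show *: "theta (x / c) p \<noteq> 0"
  proof
    assume "theta (x / c) p = 0"
    then obtain k :: int where "x / c = p powi k" using theta_eq_0_iff[OF p] x c by auto
    then have "x = p powi k * c" using c by (simp add: field_simps)
    then have "x ^ 2 = p powi k * p powi k * p powi m"
      using c by (simp add: power_mult_distrib power2_eq_square mult_ac)
    also have "\<dots> = p powi (k + k + m)"
      using p by (metis power_int_add)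
    finally have "\<exists>k::int. x ^ 2 = p powi k" ..
    then show False using x theta_eq_0_iff[OF p, of "x ^ 2"] by auto
  qed
  show "theta (c / x) p \<noteq> 0" using * theta_divide_eq_0_commute[OF p(1) x(1) c(1)] by simp
qed

text \<open>The square of such a quotient is p to the power -1, 0 or 1. If the quotient is p to the
  power k, then 2 k is one of these numbers, so k = 0.\<close>

lemma theta_square_root_quotient_nonzero:
  assumes p: "norm p < 1" "p \<noteq> 0" and s: "s ^ 2 = p"
    and x: "x \<in> {1, -1, s, -s}" "y \<in> {1, -1, s, -s}" "x \<noteq> y"
  shows "theta (x / y) p \<noteq> 0"
proof
  have s0: "s \<noteq> 0" using s p by auto
  assume "theta (x / y) p = 0"
  then obtain k :: int where k: "x / y = p powi k" using theta_eq_0_iff[OF p] x s0 by auto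
  have "\<exists>m. (m = 1 \<or> m = -1 \<or> m = 0) \<and> (x / y) ^ 2 = p powi m"
  proof -
    have "x ^ 2 = 1 \<or> x ^ 2 = p" "y ^ 2 = 1 \<or> y ^ 2 = p" using x s by auto
    then consider "(x / y) ^ 2 = 1" | "(x / y) ^ 2 = p" | "(x / y) ^ 2 = 1 / p"
      using p by (fastforce simp: power_divide)
    then show ?thesis
    proof cases
      case 1
      then show ?thesis by (intro exI[of _ 0]) simp
    next
      case 2
      then show ?thesis by (intro exI[of _ 1]) simp
    next
      case 3
      then show ?thesis by (intro exI[of _ "-1"]) (simp add: power_int_minus divide_inverse)
    qed
  qed
  then obtain m :: int where m: "m = 1 \<or> m = -1 \<or> m = 0" "(x / y) ^ 2 = p powi m" by blast
  have "(x / y) ^ 2 = p powi (k + k)"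
    using p unfolding k by (metis power_int_add power2_eq_square)
  then have "k + k = m" using power_int_inj[OF p] m(2) by metis
  then have "k = 0" using m(1) by presburger
  then have "x = y" using k x s0 by (auto simp: field_simps)
  then show False using x by simp
qed

lemma complex_eq_neg_self: "(x :: complex) = - x \<Longrightarrow> x = 0"
  by simp

lemma BC_antisymD:
  assumes "BC_antisym p n f" "\<forall>i. z i \<noteq> 0"
  shows "i < n \<Longrightarrow> j < n \<Longrightarrow> i \<noteq> j \<Longrightarrow> f (z \<circ> Transposition.transpose i j) = - f z"
    "i < n \<Longrightarrow> f (z(i := 1 / z i)) = - f z"
    "i < n \<Longrightarrow> f (z(i := p * z i)) = f z / (p ^ (n + 1) * z i ^ (2 * n + 2))"
    "i < n \<Longrightarrow> (\<lambda>u. f (z(i := u))) holomorphic_on - {0}"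
  using assms unfolding BC_antisym_def by auto

text \<open>Each case is a point fixed by a reflection: c = 1 / c if c ^ 2 = 1, c = p / c if c ^ 2 =
  p, and coincidence with z j or 1 / z j. In the second case the multiplier equals 1 at c, so only
  the sign is left.\<close>

lemma BC_antisym_zero:
  assumes f: "BC_antisym p n f" and p: "p \<noteq> 0" and z: "\<forall>i. z i \<noteq> 0" and i: "i < n" and c: "c \<noteq> 0"
    and cases: "c ^ 2 = 1 \<or> c ^ 2 = p \<or> (\<exists>j<n. j \<noteq> i \<and> (c = z j \<or> c = 1 / z j))"
  shows "f (z(i := c)) = 0"
proof -
  have nz: "\<forall>k. (z(i := x)) k \<noteq> 0" if "x \<noteq> 0" for x using z that by simp
  have eq: "f (z(i := z j)) = 0" if "j < n" "j \<noteq> i" for j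
  proof -
    have "z(i := z j) \<circ> Transposition.transpose i j = z(i := z j)"
      using that by (auto simp: Transposition.transpose_def)
    moreover have "f (z(i := z j) \<circ> Transposition.transpose i j) = - f (z(i := z j))"
      by (rule BC_antisymD(1)[OF f nz]) (use z i that in auto)
    ultimately have "f (z(i := z j)) = - f (z(i := z j))" by simp
    then show ?thesis by simp
  qed
  have flip: "f (z(i := 1 / x)) = - f (z(i := x))" if "x \<noteq> 0" for x
  proof -
    have "f ((z(i := x))(i := 1 / (z(i := x)) i)) = - f (z(i := x))"
      by (rule BC_antisymD(2)[OF f nz[OF that] i])
    then show ?thesis by simp
  qed
  from cases show ?thesis
  proof (elim disjE)
    assume "c ^ 2 = 1"
    then have "1 / c = c" using c by (simp add: power2_eq_square field_simps)
    then have "f (z(i := c)) = - f (z(i := c))" using flip[OF c] by (simp only:)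
    then show ?thesis by (rule complex_eq_neg_self)
  next
    assume cp: "c ^ 2 = p"
    have c1: "1 / c \<noteq> 0" using c by simp
    have "p * (1 / c) = c" using cp c by (simp add: power2_eq_square field_simps)
    moreover have "f ((z(i := 1 / c))(i := p * (z(i := 1 / c)) i)) =
        f (z(i := 1 / c)) / (p ^ (n + 1) * (z(i := 1 / c)) i ^ (2 * n + 2))"
      by (rule BC_antisymD(3)[OF f nz[OF c1] i])
    ultimately have "f (z(i := c)) = f (z(i := 1 / c)) / (p ^ (n + 1) * (1 / c) ^ (2 * n + 2))"
      by (simp del: power_Suc)
    also have "p ^ (n + 1) * (1 / c) ^ (2 * n + 2) = 1"
    proof -
      have "c ^ (2 * n + 2) = (c ^ 2) ^ (n + 1)" by (simp add: power_mult flip: power_mult power_add)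
      then show ?thesis using cp p by (simp add: power_divide)
    qed
    also have "f (z(i := 1 / c)) = - f (z(i := c))"
      by (rule flip[OF c])
    finally have "f (z(i := c)) = - f (z(i := c))" unfolding div_by_1 .
    then show ?thesis by (rule complex_eq_neg_self)
  next
    assume "\<exists>j<n. j \<noteq> i \<and> (c = z j \<or> c = 1 / z j)"
    then obtain j where j: "j < n" "j \<noteq> i" "c = z j \<or> c = 1 / z j" by blast
    have "f (z(i := 1 / z j)) = - f (z(i := z j))"
      by (rule flip) (use z in simp)
    then show ?thesis using j eq by auto
  qed
qed

definition BC_generic :: "complex \<Rightarrow> complex set \<Rightarrow> bool" where
  "BC_generic p Y \<longleftrightarrow> (\<forall>x\<in>Y. x \<noteq> 0 \<and> theta (x ^ 2) p \<noteq> 0 \<and>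
     (\<forall>y\<in>Y. x \<noteq> y \<longrightarrow> theta (x / y) p \<noteq> 0 \<and> theta (x * y) p \<noteq> 0))"

text \<open>The combination F of f and g has degree 2 n + 2 in the i-th variable. It has four forced
  zeros with square 1 or p, another 2 (n - 1) at z j and 1 / z j, and a zero at w by construction:
  one too many.\<close>

lemma BC_antisym_coordinate:
  assumes p: "norm p < 1" "p \<noteq> 0" and f: "BC_antisym p n f" and g: "BC_antisym p n g"
    and z: "\<forall>k. z k \<noteq> 0" and i: "i < n"
    and gen: "BC_generic p (insert w (z ` ({..<n} - {i})))"
    and inj: "inj_on z ({..<n} - {i})" "w \<notin> z ` ({..<n} - {i})"
  shows "f z * g (z(i := w)) = f (z(i := w)) * g z"
proof -
  let ?J = "{..<n} - {i}"
  define s where "s = csqrt p"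
  have s: "s ^ 2 = p" by (simp add: s_def)
  have s0: "s \<noteq> 0" using s p by auto
  have w0: "w \<noteq> 0" using gen by (auto simp: BC_generic_def)
  define Y where "Y = z ` ?J"
  define C where "C = {1, -1, s, -s}"
  define Z where "Z = insert w (C \<union> Y \<union> (\<lambda>y. 1 / y) ` Y)"
  have Ynz: "y \<noteq> 0" if "y \<in> insert w Y" for y using that z w0 by (auto simp: Y_def)
  have gY: "theta (y ^ 2) p \<noteq> 0" if "y \<in> insert w Y" for y
    using gen that by (auto simp: BC_generic_def Y_def)
  have gYY: "theta (x / y) p \<noteq> 0" "theta (x * y) p \<noteq> 0" if "x \<in> insert w Y" "y \<in> insert w Y" "x \<noteq> y" for x y
    using gen that unfolding BC_generic_def Y_def by blast+
  have Csq: "\<exists>m. c ^ 2 = p powi m" if "c \<in> C" for c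
    using that s by (auto simp: C_def intro: exI[of _ 0] exI[of _ 1])
  have Cnz: "c \<noteq> 0" if "c \<in> C" for c using that s0 by (auto simp: C_def)
  have gC: "theta (x / c) p \<noteq> 0" "theta (c / x) p \<noteq> 0" "theta (1 / x / c) p \<noteq> 0" "theta (c / (1 / x)) p \<noteq> 0"
    if c: "c \<in> C" and x: "x \<in> insert w Y" for c x
  proof -
    obtain m where m: "c ^ 2 = p powi m" using Csq[OF c] by blast
    show "theta (x / c) p \<noteq> 0" "theta (c / x) p \<noteq> 0"
      using theta_divide_nonzero_of_square[OF p Cnz[OF c] m Ynz[OF x] gY[OF x]] by auto
    have m': "(1 / c) ^ 2 = p powi (- m)" using m by (simp add: power_divide power_int_minus field_simps)
    have c': "1 / c \<noteq> 0" using Cnz[OF c] by simp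
    show "theta (1 / x / c) p \<noteq> 0" "theta (c / (1 / x)) p \<noteq> 0"
      using theta_divide_nonzero_of_square[OF p c' m' Ynz[OF x] gY[OF x]] by (auto simp: mult.commute)
  qed
  have inv1: "theta (1 / u) p \<noteq> 0" if "theta u p \<noteq> 0" "u \<noteq> 0" for u
    using theta_inverse[OF p(1) that(2)] that by auto
  have gI: "theta (x / (1 / y)) p \<noteq> 0" "theta (1 / y / x) p \<noteq> 0" if "x \<in> insert w Y" "y \<in> insert w Y" for x y
  proof -
    have "theta (x * y) p \<noteq> 0" using gYY gY that by (cases "x = y") (auto simp: power2_eq_square)
    then show "theta (x / (1 / y)) p \<noteq> 0" "theta (1 / y / x) p \<noteq> 0"
      using inv1[of "x * y"] Ynz that by (auto simp: mult.commute)
  qed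
  have gII: "theta (1 / x / (1 / y)) p \<noteq> 0" if "x \<in> insert w Y" "y \<in> insert w Y" "x \<noteq> y" for x y
    using gYY(1)[of y x] that by simp
  have pairwise: "theta (x / y) p \<noteq> 0" if xy: "x \<in> Z" "y \<in> Z" "x \<noteq> y" for x y
  proof -
    consider "x \<in> C" | "x \<in> insert w Y" | x' where "x' \<in> Y" "x = 1 / x'" using xy by (auto simp: Z_def)
    then show ?thesis
    proof cases
      case 1
      consider "y \<in> C" | "y \<in> insert w Y" | y' where "y' \<in> Y" "y = 1 / y'" using xy by (auto simp: Z_def)
      then show ?thesis
      proof cases
        case 11: 1
        then show ?thesis using theta_square_root_quotient_nonzero[OF p s, of x y] 1 xy unfolding C_def by blast
      qed (use gC 1 in auto)
    next
      case 2
      consider "y \<in> C" | "y \<in> insert w Y" | y' where "y' \<in> Y" "y = 1 / y'" using xy by (auto simp: Z_def)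
      then show ?thesis
      proof cases
        case 1
        then show ?thesis using gC 2 by blast
      next
        case 22: 2
        then show ?thesis using gYY 2 xy by blast
      next
        case 3
        then show ?thesis using gI(1)[of x y'] 2 by blast
      qed
    next
      case 3
      consider "y \<in> C" | "y \<in> insert w Y" | y' where "y' \<in> Y" "y = 1 / y'" using xy by (auto simp: Z_def)
      then show ?thesis
      proof cases
        case 1
        then show ?thesis using gC(3)[of y x'] 3 by blast
      next
        case 2
        then show ?thesis using gI(2)[of y x'] 3 by blast
      next
        case 33: 3
        then show ?thesis using gII[of x' y'] 3 xy by blast
      qed
    qed
  qed
  have th1: "theta 1 p = 0" using p by simp
  have neq: "x \<noteq> y" if "theta (x / y) p \<noteq> 0" "y \<noteq> 0" for x y using that th1 by auto
  have cardY: "card Y = n - 1" unfolding Y_def using inj i by (simp add: card_image)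
  have finY: "finite Y" by (simp add: Y_def)
  have "C \<inter> Y = {}" using gC(1) neq[OF _ Cnz] by fastforce
  moreover have "(C \<union> Y) \<inter> (\<lambda>y. 1 / y) ` Y = {}"
  proof -
    have "1 / y \<notin> C" if "y \<in> Y" for y using gC(3)[of "1 / y" y] that th1 Cnz[of "1 / y"] Ynz[of y] by auto
    moreover have "1 / y \<notin> Y" if "y \<in> Y" for y using gI(1)[of "1 / y" y] that th1 Ynz[of y] by auto
    ultimately show ?thesis by blast
  qed
  moreover have "w \<notin> C \<union> Y \<union> (\<lambda>y. 1 / y) ` Y"
  proof -
    have "w \<notin> C" using gC(1)[of w w] th1 w0 by auto
    moreover have "w \<noteq> 1 / y" if "y \<in> Y" for y using gI(1)[of w y] that th1 Ynz[of y] w0 by auto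
    ultimately show ?thesis using inj(2) by (auto simp: Y_def)
  qed
  moreover have "card C = 4"
  proof -
    have "x \<noteq> y" if "x \<in> C" "y \<in> C" "theta (x / y) p \<noteq> 0" for x y using neq[OF that(3) Cnz[OF that(2)]] .
    have "s \<noteq> 1" "s \<noteq> -1" using s p by auto
    moreover have "s \<noteq> -s" "-s \<noteq> 1" "-s \<noteq> -1" using s0 \<open>s \<noteq> 1\<close> \<open>s \<noteq> -1\<close> by (auto simp: minus_equation_iff)
    moreover have "(1 :: complex) \<noteq> - 1" by simp
    ultimately show ?thesis unfolding C_def by (simp add: card_insert_if)
  qed
  moreover have "card ((\<lambda>y. 1 / y) ` Y) = card Y" by (intro card_image inj_onI) (simp add: divide_simps Ynz)
  moreover have "finite C" by (simp add: C_def)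
  ultimately have cardZ: "card Z = Suc (2 * n + 2)"
    using finY cardY i unfolding Z_def by (simp add: card_Un_disjoint)
  have vanish: "h (z(i := c)) = 0" if c: "c \<in> C \<union> Y \<union> (\<lambda>y. 1 / y) ` Y" and h: "BC_antisym p n h" for c h
  proof (rule BC_antisym_zero[OF h p(2) z i])
    show "c \<noteq> 0" using c Cnz Ynz by auto
    show "c ^ 2 = 1 \<or> c ^ 2 = p \<or> (\<exists>j<n. j \<noteq> i \<and> (c = z j \<or> c = 1 / z j))"
      using c s by (auto simp: C_def Y_def)
  qed
  define F where "F = (\<lambda>u. f (z(i := u)) * g (z(i := w)) - f (z(i := w)) * g (z(i := u)))"
  have "F (z i) = 0"
  proof (rule theta_function_eq_0[OF p, of F "1 / p ^ (n + 1)" "2 * n + 2" Z])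
    show "F holomorphic_on - {0}"
      unfolding F_def using BC_antisymD(4)[OF f z i] BC_antisymD(4)[OF g z i] by (intro holomorphic_intros)
    show "F (p * u) = 1 / p ^ (n + 1) * F u / u ^ (2 * n + 2)" if u: "u \<noteq> 0" for u
    proof -
      have nz: "\<forall>k. (z(i := u)) k \<noteq> 0" using z u by simp
      show ?thesis
      proof -
        have "f ((z(i := u))(i := p * (z(i := u)) i)) = f (z(i := u)) / (p ^ (n + 1) * (z(i := u)) i ^ (2 * n + 2))"
          "g ((z(i := u))(i := p * (z(i := u)) i)) = g (z(i := u)) / (p ^ (n + 1) * (z(i := u)) i ^ (2 * n + 2))"
          by (rule BC_antisymD(3)[OF f nz i], rule BC_antisymD(3)[OF g nz i])
        then have "f (z(i := p * u)) = f (z(i := u)) / (p ^ (n + 1) * u ^ (2 * n + 2))"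
          "g (z(i := p * u)) = g (z(i := u)) / (p ^ (n + 1) * u ^ (2 * n + 2))"
          by (simp_all del: power_Suc)
        then show ?thesis
          unfolding F_def by (simp add: diff_divide_distrib right_diff_distrib mult_ac del: power_Suc power_add)
      qed
    qed
    show "0 \<notin> Z" using Cnz Ynz by (auto simp: Z_def)
    show "F x = 0" if "x \<in> Z" for x
      using that vanish[of x f] vanish[of x g] f g by (auto simp: Z_def F_def)
  qed (use cardZ pairwise z in auto)
  then show ?thesis by (simp add: F_def)
qed

lemma BC_vandermonde_nonzero:
  assumes p: "norm p < 1" and gen: "BC_generic p (z ` {..<n})" and inj: "inj_on z {..<n}"
  shows "BC_vandermonde p n z \<noteq> 0"
proof -
  have nz: "z k \<noteq> 0" if "k < n" for k using gen that by (auto simp: BC_generic_def)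
  have "z k * theta (1 / z k ^ 2) p \<noteq> 0" if "k < n" for k
    using gen that theta_inverse[OF p, of "z k ^ 2"] nz[OF that] by (auto simp: BC_generic_def)
  moreover have "theta (z j * z k) p * theta (z k / z j) p / z k \<noteq> 0" if "j < k" "k < n" for j k
  proof -
    have "z j \<noteq> z k" using inj that by (auto simp: inj_on_def)
    then show ?thesis using gen that nz[of k] unfolding BC_generic_def
      by (metis (no_types, lifting) imageI lessThan_iff less_trans mult_eq_0_iff divide_eq_0_iff)
  qed
  ultimately show ?thesis
    unfolding BC_vandermonde_def by (auto intro!: pair_prod_nonzero)
qed

text \<open>The quotient of f by the Vandermonde does not change when one coordinate is replaced, so
  z can be moved to w coordinate by coordinate. Coordinates from n on have to agree because f may
  depend on them. Non-generic points are reached along a curve.\<close>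

theorem BC_antisym_unique:
  assumes p: "norm p < 1" "p \<noteq> 0" and f: "BC_antisym p n f"
    and z: "\<forall>i. z i \<noteq> 0" and w: "\<forall>i. w i \<noteq> 0" and agree: "\<forall>i\<ge>n. w i = z i"
  shows "f z * BC_vandermonde p n w = f w * BC_vandermonde p n z"
proof -
  let ?V = "BC_vandermonde p n"
  have generic: "f z * ?V w = f w * ?V z"
    if z: "\<forall>i. z i \<noteq> 0" and w: "\<forall>i. w i \<noteq> 0" and agree: "\<forall>i\<ge>n. w i = z i"
      and gen: "BC_generic p (z ` {..<n} \<union> w ` {..<n})"
      and inj: "inj_on z {..<n}" "inj_on w {..<n}" "z ` {..<n} \<inter> w ` {..<n} = {}" for z w
  proof -
    define y where "y = (\<lambda>m i. if i < m then w i else z i)"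
    have ynz: "\<forall>i. y m i \<noteq> 0" for m using z w by (auto simp: y_def)
    have sub: "BC_generic p Y" if "Y \<subseteq> z ` {..<n} \<union> w ` {..<n}" for Y
      using gen that unfolding BC_generic_def by (meson subsetD)
    have yinj: "inj_on (y m) {..<n}" for m
    proof (rule inj_onI)
      fix i j assume ij: "i \<in> {..<n}" "j \<in> {..<n}" "y m i = y m j"
      have "z i \<noteq> w j" "z j \<noteq> w i" using inj(3) ij by blast+
      then show "i = j" using ij inj_onD[OF inj(1), of i j] inj_onD[OF inj(2), of i j]
        by (simp add: y_def split: if_splits)
    qed
    have ygen: "BC_generic p (y m ` {..<n})" for m by (rule sub) (auto simp: y_def)
    have Vy: "?V (y m) \<noteq> 0" for m by (rule BC_vandermonde_nonzero[OF p(1) ygen yinj])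
    have "f (y m) / ?V (y m) = f (y 0) / ?V (y 0)" if "m \<le> n" for m
      using that
    proof (induction m)
      case (Suc m)
      have upd: "y (Suc m) = (y m)(m := w m)" by (auto simp: y_def)
      have "f (y m) * ?V (y (Suc m)) = f (y (Suc m)) * ?V (y m)"
        unfolding upd
      proof (rule BC_antisym_coordinate[OF p f BC_antisym_vandermonde[OF p] ynz])
        show "m < n" using Suc by simp
        show "BC_generic p (insert (w m) (y m ` ({..<n} - {m})))"
          by (rule sub) (use Suc in \<open>auto simp: y_def\<close>)
        show "inj_on (y m) ({..<n} - {m})" using yinj by (rule inj_on_subset) auto
        show "w m \<notin> y m ` ({..<n} - {m})"
        proof
          assume "w m \<in> y m ` ({..<n} - {m})"
          then obtain j where j: "j < n" "j \<noteq> m" "w m = y m j" by auto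
          have "z j \<noteq> w m" using inj(3) j Suc.prems by (metis Suc_le_lessD IntI empty_iff imageI lessThan_iff)
          then show False using j inj_onD[OF inj(2), of m j] Suc.prems by (simp add: y_def split: if_splits)
        qed
      qed
      then have "f (y (Suc m)) / ?V (y (Suc m)) = f (y m) / ?V (y m)"
        using Vy[of m] Vy[of "Suc m"] by (simp add: frac_eq_eq)
      then show ?case using Suc by simp
    qed simp
    from this[of n] have "f (y n) * ?V (y 0) = f (y 0) * ?V (y n)"
      using Vy[of n] Vy[of 0] by (simp add: field_simps)
    moreover have "y 0 = z" "y n = w" using agree by (auto simp: y_def)
    ultimately show ?thesis by (simp add: mult.commute)
  qed
  \<comment> \<open>The 2 n moving points get the distinct positive rates 1, ..., 2 n, so their
    squares, products and quotients all move. From index n on zs and ws still agree.\<close>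
  define zs where "zs = (\<lambda>s i. z i * exp (of_nat (i + 1) * s))"
  define ws where "ws = (\<lambda>s i. if i < n then w i * exp (of_nat (n + i + 1) * s) else zs s i)"
  define v where "v = (\<lambda>i. if i < n then z i else w (i - n))"
  have v0: "v i \<noteq> 0" for i using z w by (simp add: v_def)
  define vs where "vs = (\<lambda>s i. v i * exp (of_nat (i + 1) * s))"
  have zsv: "zs s i = vs s i" if "i < n" for s i using that by (simp add: zs_def vs_def v_def)
  have wsv: "ws s i = vs s (n + i)" if "i < n" for s i using that by (simp add: ws_def vs_def v_def)
  have vim: "zs s ` {..<n} \<union> ws s ` {..<n} = vs s ` {..<2*n}" for s
  proof -
    have "{..<2*n} = {..<n} \<union> (\<lambda>i. n + i) ` {..<n}"
    proof (intro set_eqI iffI)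
      fix x assume "x \<in> {..<2 * n}"
      then show "x \<in> {..<n} \<union> (\<lambda>i. n + i) ` {..<n}"
        by (cases "x < n") (auto intro!: image_eqI[of _ _ "x - n"])
    qed auto
    then have "vs s ` {..<2*n} = vs s ` {..<n} \<union> (\<lambda>i. vs s (n + i)) ` {..<n}" by (auto simp: image_Un image_image)
    moreover have "zs s ` {..<n} = vs s ` {..<n}" by (intro image_cong) (auto simp: zsv)
    moreover have "ws s ` {..<n} = (\<lambda>i. vs s (n + i)) ` {..<n}" by (intro image_cong) (auto simp: wsv)
    ultimately show ?thesis by simp
  qed
  have ev1: "\<forall>\<^sub>F s in at 0. \<forall>i\<in>{..<2*n}. theta (vs s i ^ 2) p \<noteq> 0"
  proof (intro eventually_ball_finite ballI)
    fix i
    have "\<forall>\<^sub>F s in at 0. theta (v i ^ 2 * exp ((2 * of_nat (i + 1)) * s)) p \<noteq> 0"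
      using v0 by (intro eventually_theta_exp_nonzero[OF p(1)]) (auto simp del: of_nat_Suc of_nat_add)
    moreover have "vs s i ^ 2 = v i ^ 2 * exp ((2 * of_nat (i + 1)) * s)" for s
      by (simp add: vs_def power_mult_distrib power2_eq_square mult_ac flip: exp_add)
    ultimately show "\<forall>\<^sub>F s in at 0. theta (vs s i ^ 2) p \<noteq> 0" by simp
  qed auto
  have ev2: "\<forall>\<^sub>F s in at 0. \<forall>i\<in>{..<2*n}. \<forall>j\<in>{..<2*n}. i \<noteq> j \<longrightarrow> theta (vs s i / vs s j) p \<noteq> 0"
  proof (intro eventually_ball_finite ballI)
    fix i j
    have "\<forall>\<^sub>F s in at 0. theta (v i / v j * exp ((of_nat (i + 1) - of_nat (j + 1)) * s)) p \<noteq> 0" if "i \<noteq> j"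
      using v0 that by (intro eventually_theta_exp_nonzero[OF p(1)]) auto
    moreover have "vs s i / vs s j = v i / v j * exp ((of_nat (i + 1) - of_nat (j + 1)) * s)" for s
      by (simp add: vs_def left_diff_distrib exp_diff del: of_nat_Suc of_nat_add)
    ultimately show "\<forall>\<^sub>F s in at 0. i \<noteq> j \<longrightarrow> theta (vs s i / vs s j) p \<noteq> 0" by (cases "i = j") auto
  qed auto
  have ev3: "\<forall>\<^sub>F s in at 0. \<forall>i\<in>{..<2*n}. \<forall>j\<in>{..<2*n}. theta (vs s i * vs s j) p \<noteq> 0"
  proof (intro eventually_ball_finite ballI)
    fix i j
    have "\<forall>\<^sub>F s in at 0. theta (v i * v j * exp ((of_nat (i + 1) + of_nat (j + 1)) * s)) p \<noteq> 0"
      using v0 by (intro eventually_theta_exp_nonzero[OF p(1)])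
        (auto simp: simp flip: of_nat_add simp del: of_nat_Suc)
    moreover have "vs s i * vs s j = v i * v j * exp ((of_nat (i + 1) + of_nat (j + 1)) * s)" for s
      by (simp add: vs_def distrib_right exp_add del: of_nat_Suc of_nat_add)
    ultimately show "\<forall>\<^sub>F s in at 0. theta (vs s i * vs s j) p \<noteq> 0" by simp
  qed auto
  define H where "H = (\<lambda>s. f (zs s) * ?V (ws s) - f (ws s) * ?V (zs s))"
  have zs0: "\<forall>i. zs s i \<noteq> 0" and ws0: "\<forall>i. ws s i \<noteq> 0" for s
    using z w by (auto simp: zs_def ws_def)
  have "H 0 = 0"
  proof (rule eq_zero_by_curve)
    show "\<forall>\<^sub>F s in at 0. H s = 0"
      using ev1 ev2 ev3
    proof eventually_elim
      case (elim s)
      have vs0: "vs s i \<noteq> 0" for i using v0 by (simp add: vs_def)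
      have vinj: "inj_on (vs s) {..<2*n}"
      proof (rule inj_onI, rule ccontr)
        fix i j assume ij: "i \<in> {..<2*n}" "j \<in> {..<2*n}" "vs s i = vs s j" "i \<noteq> j"
        then have "theta (vs s i / vs s j) p \<noteq> 0" using elim(2) by blast
        moreover have "vs s i / vs s j = 1" using ij(3) vs0[of j] by simp
        ultimately show False using p by simp
      qed
      have "f (zs s) * ?V (ws s) = f (ws s) * ?V (zs s)"
      proof (rule generic[OF zs0 ws0])
        show "\<forall>i\<ge>n. ws s i = zs s i" by (simp add: ws_def)
        show "BC_generic p (zs s ` {..<n} \<union> ws s ` {..<n})"
          unfolding vim BC_generic_def
        proof (intro ballI conjI impI)
          fix x y assume "x \<in> vs s ` {..<2*n}" "y \<in> vs s ` {..<2*n}" "x \<noteq> y"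
          then obtain i j where ij: "i \<in> {..<2*n}" "j \<in> {..<2*n}" "x = vs s i" "y = vs s j" "i \<noteq> j" by auto
          then show "theta (x / y) p \<noteq> 0" "theta (x * y) p \<noteq> 0" using elim(2,3) by blast+
        qed (use elim(1) vs0 in auto)
        show "inj_on (zs s) {..<n}"
          using vinj zsv[of _ s] by (auto simp: inj_on_def)
        show "inj_on (ws s) {..<n}"
        proof (rule inj_onI)
          fix i j assume "i \<in> {..<n}" "j \<in> {..<n}" "ws s i = ws s j"
          then have "n + i = n + j" using wsv[of _ s] by (intro inj_onD[OF vinj]) auto
          then show "i = j" by simp
        qed
        show "zs s ` {..<n} \<inter> ws s ` {..<n} = {}"
        proof (rule ccontr)
          assume "\<not> ?thesis"
          then obtain i j where "i < n" "j < n" "vs s i = vs s (n + j)" using zsv[of _ s] wsv[of _ s] by fastforce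
          then have "i = n + j" using vinj by (intro inj_onD[OF vinj]) auto
          then show False using \<open>i < n\<close> by simp
        qed
      qed
      then show ?case by (simp add: H_def)
    qed
    have cz: "continuous_on UNIV zs" unfolding zs_def
      by (intro continuous_on_coordinatewise_then_product continuous_intros)
    have cw: "continuous_on UNIV ws"
    proof (rule continuous_on_coordinatewise_then_product)
      fix i show "continuous_on UNIV (\<lambda>s. ws s i)"
        unfolding ws_def zs_def by (cases "i < n") (simp_all add: continuous_intros)
    qed
    have comp: "continuous_on UNIV (\<lambda>s. g (h s))"
      if "continuous_on {z. \<forall>i. z i \<noteq> 0} g" "continuous_on UNIV h" "\<And>s. \<forall>i. h s i \<noteq> 0"
      for g :: "(nat \<Rightarrow> complex) \<Rightarrow> complex" and h :: "complex \<Rightarrow> nat \<Rightarrow> complex"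
      by (rule continuous_on_compose2[OF that(1,2)]) (use that(3) in auto)
    have cf: "continuous_on {z. \<forall>i. z i \<noteq> 0} f" using f by (simp add: BC_antisym_def)
    have "continuous_on UNIV H"
      unfolding H_def
      by (intro continuous_on_diff continuous_on_mult comp[OF cf cz zs0] comp[OF cf cw ws0]
          comp[OF continuous_on_BC_vandermonde[OF p(1)] cz zs0]
          comp[OF continuous_on_BC_vandermonde[OF p(1)] cw ws0])
    then show "isCont H 0" by (simp add: continuous_on_eq_continuous_at)
  qed
  moreover have "zs 0 = z" "ws 0 = w" using agree by (auto simp: zs_def ws_def)
  ultimately show ?thesis by (simp add: H_def)
qed

section \<open>Signed sums over inversions of the variables\<close>

definition flip :: "nat set \<Rightarrow> (nat \<Rightarrow> complex) \<Rightarrow> nat \<Rightarrow> complex" where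
  "flip E z i = (if i \<in> E then 1 / z i else z i)"

definition flip_sum :: "nat \<Rightarrow> ((nat \<Rightarrow> complex) \<Rightarrow> complex) \<Rightarrow> (nat \<Rightarrow> complex) \<Rightarrow> complex" where
  "flip_sum n H z = (\<Sum>E\<in>Pow {..<n}. (-1) ^ card E * H (flip E z))"

text \<open>The analytic half of \<open>BC_antisym\<close>. It is stable under inversions,
  permutations and linear combinations; the signs are produced afterwards by summation.\<close>

definition BC_multiplier :: "complex \<Rightarrow> nat \<Rightarrow> ((nat \<Rightarrow> complex) \<Rightarrow> complex) \<Rightarrow> bool" where
  "BC_multiplier p n f \<longleftrightarrow> continuous_on {z. \<forall>i. z i \<noteq> 0} f \<and> (\<forall>z. (\<forall>i. z i \<noteq> 0) \<longrightarrow>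
     (\<forall>i<n. f (z(i := p * z i)) = f z / (p ^ (n + 1) * z i ^ (2 * n + 2)) \<and>
        (\<lambda>u. f (z(i := u))) holomorphic_on - {0}))"

lemma flip_nonzero: "\<forall>i. z i \<noteq> 0 \<Longrightarrow> \<forall>i. flip E z i \<noteq> 0"
  by (simp add: flip_def)

lemma flip_empty [simp]: "flip {} z = z"
  by (simp add: flip_def fun_eq_iff)

lemma flip_upd: "flip E (z(i := u)) = (flip E z)(i := (if i \<in> E then 1 / u else u))"
  by (auto simp: flip_def)

lemma flip_comp: "bij \<tau> \<Longrightarrow> flip E (z \<circ> \<tau>) = flip (\<tau> ` E) z \<circ> \<tau>"
  by (auto simp: flip_def fun_eq_iff bij_def inj_image_mem_iff)

text \<open>Symmetric difference with {i}: a sign-reversing involution on the subsets that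
  corresponds to one more inversion of coordinate i.\<close>

definition toggle :: "nat \<Rightarrow> nat set \<Rightarrow> nat set" where
  "toggle i E = (if i \<in> E then E - {i} else insert i E)"

lemma sum_toggle:
  assumes "i < n"
  shows "(\<Sum>E\<in>Pow {..<n}. g (toggle i E)) = (\<Sum>E\<in>Pow {..<n}. g E)"
  by (rule sum.reindex_bij_witness[where i = "toggle i" and j = "toggle i"])
    (use assms in \<open>auto simp: toggle_def split: if_splits\<close>)

lemma minus_one_power_toggle:
  assumes "finite E"
  shows "(-1 :: complex) ^ card (toggle i E) = - ((-1) ^ card E)"
proof (cases "i \<in> E")
  case True
  obtain m where "card (E - {i}) = m" by blast
  moreover have "card E = Suc (card (E - {i}))" using True assms by (metis card_Suc_Diff1)
  ultimately show ?thesis using True by (simp only: toggle_def if_True) simp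
qed (use assms in \<open>simp add: toggle_def\<close>)

lemma flip_sum_flip:
  assumes "i < n"
  shows "flip_sum n H (z(i := 1 / z i)) = - flip_sum n H z"
proof -
  have "flip E (z(i := 1 / z i)) = flip (toggle i E) z" for E
    by (auto simp: flip_def toggle_def)
  then have "flip_sum n H (z(i := 1 / z i)) = (\<Sum>E\<in>Pow {..<n}. (-1) ^ card E * H (flip (toggle i E) z))"
    by (simp add: flip_sum_def)
  also have "\<dots> = (\<Sum>E\<in>Pow {..<n}. - ((-1) ^ card (toggle i E)) * H (flip (toggle i E) z))"
    by (intro sum.cong refl) (auto simp: minus_one_power_toggle finite_subset)
  also have "\<dots> = (\<Sum>E\<in>Pow {..<n}. - ((-1) ^ card E) * H (flip E z))"
    by (rule sum_toggle[OF assms])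
  finally show ?thesis by (simp add: flip_sum_def sum_negf)
qed

text \<open>A permutation of the coordinates permutes the subsets E and preserves their
  cardinalities, hence the signs.\<close>

lemma flip_sum_comp:
  assumes \<tau>: "\<tau> permutes {..<n}"
  shows "flip_sum n H (z \<circ> \<tau>) = flip_sum n (\<lambda>z. H (z \<circ> \<tau>)) z"
proof -
  have b: "bij \<tau>" using \<tau> by (rule permutes_bij)
  have "flip_sum n H (z \<circ> \<tau>) = (\<Sum>E\<in>Pow {..<n}. (-1) ^ card (\<tau> ` E) * H (flip (\<tau> ` E) z \<circ> \<tau>))"
    unfolding flip_sum_def flip_comp[OF b] using b
    by (intro sum.cong refl) (simp add: card_image inj_on_subset[OF bij_is_inj])
  also have "\<dots> = (\<Sum>E\<in>(\<lambda>E. \<tau> ` E) ` Pow {..<n}. (-1) ^ card E * H (flip E z \<circ> \<tau>))"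
    using b by (subst sum.reindex) (auto intro!: inj_onI simp: inj_image_eq_iff bij_is_inj)
  also have "(\<lambda>E. \<tau> ` E) ` Pow {..<n} = Pow {..<n}"
    using image_Pow_surj[of \<tau> "{..<n}" "{..<n}"] permutes_image[OF \<tau>] by simp
  finally show ?thesis by (simp only: flip_sum_def)
qed

lemma continuous_on_flip: "continuous_on {z. \<forall>i. z i \<noteq> 0} (flip E)"
proof (rule continuous_on_coordinatewise_then_product)
  fix i show "continuous_on {z. \<forall>i. z i \<noteq> 0} (\<lambda>z. flip E z i)"
    unfolding flip_def by (cases "i \<in> E") (auto intro!: continuous_intros)
qed

text \<open>Inversion reproduces the multiplier: p ^ (n + 1) * u ^ (2 * n + 2) at u = 1 / (p * z i)
  is the reciprocal of the same expression at u = z i.\<close>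

lemma BC_multiplier_flip:
  assumes p: "p \<noteq> 0" and H: "BC_multiplier p n H"
  shows "BC_multiplier p n (\<lambda>z. H (flip E z))"
  unfolding BC_multiplier_def
proof (intro conjI allI impI)
  show "continuous_on {z. \<forall>i. z i \<noteq> 0} (\<lambda>z. H (flip E z))"
  proof -
    have "continuous_on {z. \<forall>i. z i \<noteq> 0} H" using H unfolding BC_multiplier_def by blast
    then show ?thesis
      by (rule continuous_on_compose2[OF _ continuous_on_flip]) (auto simp: flip_def split: if_splits)
  qed
  fix z :: "nat \<Rightarrow> complex" and i assume z: "\<forall>i. z i \<noteq> 0" and i: "i < n"
  have Hs: "H (y(i := p * y i)) = H y / (p ^ (n + 1) * y i ^ (2 * n + 2))" if "\<forall>i. y i \<noteq> 0" for y
    using H i that by (simp add: BC_multiplier_def del: power_Suc)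
  have Hh: "(\<lambda>u. H (y(i := u))) holomorphic_on - {0}" if "\<forall>i. y i \<noteq> 0" for y
    using H i that by (simp add: BC_multiplier_def)
  note fz = flip_nonzero[OF z, of E]
  show "(\<lambda>u. H (flip E (z(i := u)))) holomorphic_on - {0}"
  proof (cases "i \<in> E")
    case True
    have "(\<lambda>u. H ((flip E z)(i := 1 / u))) holomorphic_on - {0}"
    proof -
      have h1: "(\<lambda>u::complex. 1 / u) holomorphic_on - {0}" by (intro holomorphic_intros) auto
      have h2: "(\<lambda>u::complex. 1 / u) ` (- {0}) \<subseteq> - {0}" by auto
      from holomorphic_on_compose_gen[OF h1 Hh[OF fz] h2] show ?thesis by (simp only: o_def)
    qed
    then show ?thesis using True by (simp add: flip_upd)
  next
    case False
    then show ?thesis using Hh[OF fz] by (simp add: flip_upd)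
  qed
  show "H (flip E (z(i := p * z i))) = H (flip E z) / (p ^ (n + 1) * z i ^ (2 * n + 2))"
  proof (cases "i \<in> E")
    case False
    then have "flip E (z(i := p * z i)) = (flip E z)(i := p * flip E z i)" "flip E z i = z i"
      by (simp_all add: flip_upd) (simp_all add: flip_def)
    then show ?thesis using Hs[OF fz] by (simp del: power_Suc)
  next
    case True
    \<comment> \<open>The point whose shift at i is \<open>flip E z\<close>, so that the functional
      equation is applied backwards.\<close>
    define y where "y = (flip E z)(i := 1 / (p * z i))"
    have y: "\<forall>i. y i \<noteq> 0" using z p by (auto simp: y_def flip_def)
    have yi: "y i = 1 / (p * z i)" by (simp add: y_def)
    have eq: "y(i := p * y i) = flip E z" using True p z by (auto simp: y_def flip_def)
    have "H (flip E z) = H y / (p ^ (n + 1) * y i ^ (2 * n + 2))"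
      by (subst eq[symmetric]) (rule Hs[OF y])
    then have "H (flip E z) = H y / (p ^ (n + 1) * (1 / (p * z i)) ^ (2 * n + 2))"
      unfolding yi .
    moreover have "flip E (z(i := p * z i)) = y" using True by (simp add: flip_upd y_def)
    moreover have "p ^ (n + 1) * (1 / (p * z i)) ^ (2 * n + 2) * (p ^ (n + 1) * z i ^ (2 * n + 2)) = 1"
    proof -
      have "p ^ (2 * n + 2) = p ^ (n + 1) * p ^ (n + 1)" by (simp add: mult_2 flip: power_add)
      then show ?thesis using p z by (simp add: power_divide power_mult_distrib field_simps del: power_Suc)
    qed
    ultimately show ?thesis by (metis (no_types, lifting) divide_divide_eq_left div_by_1)
  qed
qed

lemma BC_multiplier_sum:
  assumes "finite I" "\<And>k. k \<in> I \<Longrightarrow> BC_multiplier p n (f k)"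
  shows "BC_multiplier p n (\<lambda>z. \<Sum>k\<in>I. c k * f k z)"
  using assms unfolding BC_multiplier_def
  by (auto intro!: continuous_intros holomorphic_intros sum.cong simp: sum_divide_distrib simp del: power_Suc)

text \<open>Conjugation by a permutation only rearranges the inversions, so the sum inherits the
  antisymmetry of H under transpositions and acquires the one under inversions.\<close>

lemma BC_antisym_flip_sum:
  assumes p: "p \<noteq> 0" and H: "BC_multiplier p n H"
    and anti: "\<And>z i j. \<forall>i. z i \<noteq> 0 \<Longrightarrow> i < n \<Longrightarrow> j < n \<Longrightarrow> i \<noteq> j \<Longrightarrow> H (z \<circ> Transposition.transpose i j) = - H z"
  shows "BC_antisym p n (flip_sum n H)"
proof -
  have m: "BC_multiplier p n (flip_sum n H)"
    unfolding flip_sum_def by (intro BC_multiplier_sum BC_multiplier_flip p H) auto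
  have "flip_sum n H (z \<circ> Transposition.transpose i j) = - flip_sum n H z"
    if z: "\<forall>i. z i \<noteq> 0" and ij: "i < n" "j < n" "i \<noteq> j" for z i j
  proof -
    have "flip_sum n H (z \<circ> Transposition.transpose i j) = flip_sum n (\<lambda>z. H (z \<circ> Transposition.transpose i j)) z"
      using ij by (intro flip_sum_comp permutes_swap_id) auto
    also have "\<dots> = (\<Sum>E\<in>Pow {..<n}. - ((-1) ^ card E * H (flip E z)))"
      unfolding flip_sum_def using anti[OF flip_nonzero[OF z] ij] by (intro sum.cong refl) simp
    finally show ?thesis by (simp add: flip_sum_def sum_negf)
  qed
  then show ?thesis
    using m flip_sum_flip unfolding BC_antisym_def BC_multiplier_def by auto
qed

section \<open>The kernel for sums over inversions\<close>

lemma combine_factors: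
  fixes g :: "'a :: field"
  assumes "P' = \<pi> * P" "g' = \<alpha> * g" "\<alpha> * \<pi> = 1 / c" "G = g * R"
  shows "g' * R * P' = G * P / c"
proof -
  have "g' * R * P' = (\<alpha> * \<pi>) * (G * P)" by (simp add: assms(1,2,4) mult_ac)
  then show ?thesis by (simp add: assms(3))
qed

text \<open>Antisymmetric under permutations but not under inversions. A is tied to the other
  parameters by A = b1 * b2 * b3 * t ^ (n - 1) wherever the kernel is symmetrized; this gives it the
  multiplier of \<open>BC_antisym\<close>.\<close>

definition BC_kernel :: "complex \<Rightarrow> complex \<Rightarrow> complex \<Rightarrow> complex \<Rightarrow> complex \<Rightarrow> complex \<Rightarrow> nat \<Rightarrow> (nat \<Rightarrow> complex) \<Rightarrow> complex" where
  "BC_kernel p t A b1 b2 b3 n z =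
     (\<Prod>k<n. z k * theta (A * z k) p * theta (b1 / z k) p * theta (b2 / z k) p * theta (b3 / z k) p) *
     pair_prod (\<lambda>x y. y * theta (x / y) p * theta (t / (x * y)) p) n z"

lemma BC_kernel_transpose:
  assumes p: "norm p < 1" and z: "\<forall>i. z i \<noteq> 0" and ij: "i < n" "j < n" "i \<noteq> j"
  shows "BC_kernel p t A b1 b2 b3 n (z \<circ> Transposition.transpose i j) = - BC_kernel p t A b1 b2 b3 n z"
proof -
  have "pair_prod (\<lambda>x y. y * theta (x / y) p * theta (t / (x * y)) p) n (z \<circ> Transposition.transpose i j)
     = (-1) * pair_prod (\<lambda>x y. y * theta (x / y) p * theta (t / (x * y)) p) n z"
  proof (rule pair_prod_transpose)
    show "z a * theta (z b / z a) p * theta (t / (z b * z a)) p =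
        - 1 * (z b * theta (z a / z b) p * theta (t / (z a * z b)) p)" for a b
      using theta_divide_swap[OF p, of "z b" "z a"] z by (simp add: mult_ac)
  qed (use ij in auto)
  then show ?thesis
    unfolding BC_kernel_def prod_transpose[OF ij(1,2), of "\<lambda>x. x * theta (A * x) p * theta (b1 / x) p * theta (b2 / x) p * theta (b3 / x) p" z]
    by simp
qed

lemma BC_multiplier_kernel:
  assumes p: "norm p < 1" "p \<noteq> 0" and nz: "t \<noteq> 0" "b1 \<noteq> 0" "b2 \<noteq> 0" "b3 \<noteq> 0" and A: "A = b1 * b2 * b3 * t ^ (n - 1)"
  shows "BC_multiplier p n (BC_kernel p t A b1 b2 b3 n)"
proof -
  have A0: "A \<noteq> 0" using nz A by simp
  let ?g = "\<lambda>x. x * theta (A * x) p * theta (b1 / x) p * theta (b2 / x) p * theta (b3 / x) p"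
  let ?h = "\<lambda>x y. y * theta (x / y) p * theta (t / (x * y)) p"
  have cont: "continuous_on {z. \<forall>i. z i \<noteq> 0} (BC_kernel p t A b1 b2 b3 n)"
    unfolding BC_kernel_def using p nz A0 by (intro continuous_intros continuous_on_pair_prod) auto
  have hol: "(\<lambda>u. BC_kernel p t A b1 b2 b3 n (z(i := u))) holomorphic_on - {0}"
    if z: "\<forall>i. z i \<noteq> 0" and i: "i < n" for z i
    unfolding BC_kernel_def prod_upd[OF i, of ?g z]
    using z p nz A0 by (intro holomorphic_intros holomorphic_on_pair_prod) auto
  have shift: "BC_kernel p t A b1 b2 b3 n (z(i := p * z i)) =
      BC_kernel p t A b1 b2 b3 n z / (p ^ (n + 1) * z i ^ (2 * n + 2))"
    if z: "\<forall>i. z i \<noteq> 0" and i: "i < n" for z i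
  proof -
    have d: "theta (c / (p * z i)) p = - (c / z i / p) * theta (c / z i) p" if "c \<noteq> 0" for c
      using theta_div_nome[OF p, of "c / z i"] z that by (simp add: mult_ac)
    have m: "theta (c * (p * z i)) p = - theta (c * z i) p / (c * z i)" if "c \<noteq> 0" for c
      using theta_mult_nome[OF p, of "c * z i"] z that by (simp add: mult_ac)
    have "pair_prod ?h n (z(i := p * z i)) = (\<Prod>j\<in>{..<n}-{i}. t / (p * z i ^ 2)) * pair_prod ?h n z"
    proof (rule pair_prod_upd[OF i])
      fix j assume "j \<noteq> i"
      have zj: "z j \<noteq> 0" "z i \<noteq> 0" using z by auto
      have 1: "theta (t / (z j * (p * z i))) p = - (t / z j / z i / p) * theta (t / (z j * z i)) p"
        using d[of "t / z j"] nz zj by simp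
      have 2: "theta (z j / (p * z i)) p = - (z j / z i / p) * theta (z j / z i) p"
        by (rule d[OF zj(1)])
      show "p * z i * theta (z j / (p * z i)) p * theta (t / (z j * (p * z i))) p =
          t / (p * z i ^ 2) * (z i * theta (z j / z i) p * theta (t / (z j * z i)) p)"
        unfolding 1 2 using p zj by (simp add: field_simps power2_eq_square)
      have 3: "theta (t / (p * z i * z j)) p = - (t / z j / z i / p) * theta (t / (z i * z j)) p"
        using 1 by (simp add: mult_ac)
      have 4: "theta (p * z i / z j) p = - theta (z i / z j) p / (z i / z j)"
        using theta_mult_nome[OF p, of "z i / z j"] zj by simp
      show "z j * theta (p * z i / z j) p * theta (t / (p * z i * z j)) p =
          t / (p * z i ^ 2) * (z j * theta (z i / z j) p * theta (t / (z i * z j)) p)"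
        unfolding 3 4 using p zj by (simp add: field_simps power2_eq_square)
    qed
    moreover have "?g (p * z i) = b1 * b2 * b3 / A / (p ^ 2 * z i ^ 4) * ?g (z i)"
      unfolding d[OF nz(2)] d[OF nz(3)] d[OF nz(4)] m[OF A0]
      using z p A0 by (simp add: field_simps power2_eq_square power4_eq_xxxx)
    moreover have "b1 * b2 * b3 / A / (p ^ 2 * z i ^ 4) * (\<Prod>j\<in>{..<n}-{i}. t / (p * z i ^ 2)) =
        1 / (p ^ (n + 1) * z i ^ (2 * n + 2))"
    proof -
      obtain m where m: "n = Suc m" using i by (cases n) auto
      have "(z i ^ 2) ^ m = z i ^ (2 * m)" by (simp add: power_mult)
      then show ?thesis using i z p nz
        by (simp add: m A power_divide power_mult_distrib field_simps power_add power2_eq_square power4_eq_xxxx)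
    qed
    moreover have "(\<Prod>k<n. ?g (z k)) = ?g (z i) * (\<Prod>k\<in>{..<n}-{i}. ?g (z k))"
      using i by (intro prod.remove) auto
    ultimately show ?thesis
      unfolding BC_kernel_def prod_upd[OF i, of ?g z] by (rule combine_factors)
  qed
  show ?thesis unfolding BC_multiplier_def using cont hol shift by auto
qed

text \<open>In row n of the left side f n and the f (Suc (j + n)) form the full row of f (j + n) for
  j \<le> n, whose last entry is f (2 * n). Applied to f k = theta (b1 ^ 2 * t ^ k), it turns pair
  factors at t * w j * w k into pair factors at w j * w k.\<close>

lemma prod_theta_triangle:
  fixes f :: "nat \<Rightarrow> complex"
  shows "(\<Prod>k<n. f k) * (\<Prod>k<n. \<Prod>j<k. f (Suc (j + k))) = (\<Prod>k<n. f (2 * k)) * (\<Prod>k<n. \<Prod>j<k. f (j + k))"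
proof (induction n)
  case (Suc n)
  have "f n * (\<Prod>j<n. f (Suc (j + n))) = (\<Prod>j<Suc n. f (j + n))"
    by (subst prod.lessThan_Suc_shift) simp
  also have "\<dots> = f (2 * n) * (\<Prod>j<n. f (j + n))"
    by (simp add: mult_2)
  finally have e: "f n * (\<Prod>j<n. f (Suc (j + n))) = f (2 * n) * (\<Prod>j<n. f (j + n))" .
  have "(\<Prod>k<Suc n. f k) * (\<Prod>k<Suc n. \<Prod>j<k. f (Suc (j + k))) =
     ((\<Prod>k<n. f k) * (\<Prod>k<n. \<Prod>j<k. f (Suc (j + k)))) * (f n * (\<Prod>j<n. f (Suc (j + n))))"
    by (simp add: mult_ac)
  also have "\<dots> = ((\<Prod>k<n. f (2 * k)) * (\<Prod>k<n. \<Prod>j<k. f (j + k))) * (f (2 * n) * (\<Prod>j<n. f (j + n)))"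
    by (simp only: Suc e)
  finally show ?case by (simp add: mult_ac)
qed simp

text \<open>At w k = b1 * t ^ k the factor A / w k becomes t ^ (n - 1 - k) * b2 * b3, and reversing
  k removes the offset. The factors in b1 ^ 2 rearrange into the Vandermonde.\<close>

lemma BC_kernel_at_geometric:
  assumes p: "norm p < 1" and nz: "t \<noteq> 0" "b1 \<noteq> 0" "b2 \<noteq> 0" "b3 \<noteq> 0" and A: "A = b1 * b2 * b3 * t ^ (n - 1)"
  shows "(-1) ^ n * BC_kernel p t A b1 b2 b3 n (\<lambda>k. 1 / (b1 * t ^ k)) =
    (\<Prod>k<n. theta (t ^ k * b1 * b2) p * theta (t ^ k * b1 * b3) p * theta (t ^ k * b2 * b3) p) *
    BC_vandermonde p n (\<lambda>k. b1 * t ^ k)"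
proof -
  define w where "w = (\<lambda>k. b1 * t ^ k)"
  define f where "f = (\<lambda>m. theta (b1 ^ 2 * t ^ m) p)"
  have w0: "w k \<noteq> 0" for k using nz by (simp add: w_def)
  have ww: "w j * w k = b1 ^ 2 * t ^ (j + k)" for j k by (simp add: w_def power_add power2_eq_square)
  have "(\<Prod>k<n. theta (A * (1 / w k)) p) = (\<Prod>k<n. theta (t ^ (n - 1 - k) * b2 * b3) p)"
  proof (rule prod.cong[OF refl])
    fix k assume "k \<in> {..<n}"
    then have "t ^ (n - 1) = t ^ (n - 1 - k) * t ^ k" by (simp flip: power_add)
    then have "A * (1 / w k) = t ^ (n - 1 - k) * b2 * b3" using nz by (simp add: A w_def field_simps)
    then show "theta (A * (1 / w k)) p = theta (t ^ (n - 1 - k) * b2 * b3) p" by simp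
  qed
  also have "\<dots> = (\<Prod>k<n. theta (t ^ k * b2 * b3) p)"
    using prod.nat_diff_reindex[of "\<lambda>k. theta (t ^ k * b2 * b3) p" n] by simp
  finally have e1: "(\<Prod>k<n. theta (A * (1 / w k)) p) = (\<Prod>k<n. theta (t ^ k * b2 * b3) p)" .
  have e2: "theta (b2 / (1 / w k)) p = theta (t ^ k * b1 * b2) p"
    "theta (b3 / (1 / w k)) p = theta (t ^ k * b1 * b3) p" 
    "theta (b1 / (1 / w k)) p = f k" for k
    by (simp_all add: w_def f_def mult_ac power2_eq_square)
  let ?c = "pair_prod (\<lambda>x y. theta (y / x) p / y) n w"
  have e3: "pair_prod (\<lambda>x y. y * theta (x / y) p * theta (t / (x * y)) p) n (\<lambda>k. 1 / w k) =
      ?c * (\<Prod>k<n. \<Prod>j<k. f (Suc (j + k)))"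
  proof -
    have "pair_prod (\<lambda>x y. y * theta (x / y) p * theta (t / (x * y)) p) n (\<lambda>k. 1 / w k) =
        pair_prod (\<lambda>x y. (theta (y / x) p / y) * theta (t * (x * y)) p) n w"
      by (rule pair_prod_cong) simp
    also have "\<dots> = ?c * pair_prod (\<lambda>x y. theta (t * (x * y)) p) n w" by (rule pair_prod_mult)
    also have "pair_prod (\<lambda>x y. theta (t * (x * y)) p) n w = (\<Prod>k<n. \<Prod>j<k. f (Suc (j + k)))"
      unfolding pair_prod_def ww f_def by (intro prod.cong refl) (simp add: mult_ac)
    finally show ?thesis .
  qed
  have e4: "pair_prod (\<lambda>x y. theta (x * y) p * theta (y / x) p / y) n w = ?c * (\<Prod>k<n. \<Prod>j<k. f (j + k))"
  proof -
    have "pair_prod (\<lambda>x y. theta (x * y) p * theta (y / x) p / y) n w =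
        pair_prod (\<lambda>x y. (theta (y / x) p / y) * theta (x * y) p) n w"
      by (rule pair_prod_cong) simp
    also have "\<dots> = ?c * pair_prod (\<lambda>x y. theta (x * y) p) n w" by (rule pair_prod_mult)
    also have "pair_prod (\<lambda>x y. theta (x * y) p) n w = (\<Prod>k<n. \<Prod>j<k. f (j + k))"
      unfolding pair_prod_def ww f_def by simp
    finally show ?thesis .
  qed
  have e5: "w k * theta (1 / w k ^ 2) p = (-1) * ((1 / w k) * f (2 * k))" for k
  proof -
    have "w k ^ 2 = b1 ^ 2 * t ^ (2 * k)" using ww[of k k] by (simp add: power2_eq_square mult_2)
    then have "f (2 * k) = theta (w k ^ 2) p" by (simp add: f_def)
    then have "theta (1 / w k ^ 2) p = - f (2 * k) / w k ^ 2"
      using theta_inverse[OF p, of "w k ^ 2"] w0[of k] by simp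
    then show ?thesis using w0[of k] by (simp add: power2_eq_square)
  qed
  have "BC_kernel p t A b1 b2 b3 n (\<lambda>k. 1 / w k) =
     (\<Prod>k<n. 1 / w k) * (\<Prod>k<n. theta (t ^ k * b2 * b3) p) * (\<Prod>k<n. f k) *
     (\<Prod>k<n. theta (t ^ k * b1 * b2) p) * (\<Prod>k<n. theta (t ^ k * b1 * b3) p) *
     (?c * (\<Prod>k<n. \<Prod>j<k. f (Suc (j + k))))"
    unfolding BC_kernel_def e3 e2 prod.distrib e1 by (simp add: e1)
  also have "\<dots> = (\<Prod>k<n. theta (t ^ k * b1 * b2) p * theta (t ^ k * b1 * b3) p * theta (t ^ k * b2 * b3) p) *
     (\<Prod>k<n. 1 / w k) * ?c * ((\<Prod>k<n. f k) * (\<Prod>k<n. \<Prod>j<k. f (Suc (j + k))))"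
    by (simp add: prod.distrib mult_ac)
  also note prod_theta_triangle
  finally have "BC_kernel p t A b1 b2 b3 n (\<lambda>k. 1 / w k) =
     (\<Prod>k<n. theta (t ^ k * b1 * b2) p * theta (t ^ k * b1 * b3) p * theta (t ^ k * b2 * b3) p) *
     (\<Prod>k<n. 1 / w k) * ?c * ((\<Prod>k<n. f (2 * k)) * (\<Prod>k<n. \<Prod>j<k. f (j + k)))" .
  moreover have "BC_vandermonde p n w = (-1) ^ n * ((\<Prod>k<n. 1 / w k) * (\<Prod>k<n. f (2 * k))) * (?c * (\<Prod>k<n. \<Prod>j<k. f (j + k)))"
    unfolding BC_vandermonde_def e4 e5 by (simp only: prod.distrib prod_constant card_lessThan)
  ultimately have "(-1) ^ n * BC_kernel p t A b1 b2 b3 n (\<lambda>k. 1 / w k) =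
    (\<Prod>k<n. theta (t ^ k * b1 * b2) p * theta (t ^ k * b1 * b3) p * theta (t ^ k * b2 * b3) p) *
    BC_vandermonde p n w" by (simp only: mult_ac)
  then show ?thesis by (simp only: w_def)
qed

text \<open>Let i be the least index left uninverted. Either i = 0 and theta (b1 / w 0) = 0, or w (i
  - 1) is inverted, w i is not, and theta (t * w (i - 1) / w i) = 0. Only the inversion of all
  variables survives.\<close>

lemma flip_sum_kernel_at_geometric:
  assumes p: "norm p < 1" and nz: "t \<noteq> 0" "b1 \<noteq> 0" and w: "\<And>k. k < n \<Longrightarrow> w k = b1 * t ^ k"
  shows "flip_sum n (BC_kernel p t A b1 b2 b3 n) w = (-1) ^ n * BC_kernel p t A b1 b2 b3 n (\<lambda>k. 1 / (b1 * t ^ k))"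
proof -
  let ?K = "BC_kernel p t A b1 b2 b3 n"
  have zero: "?K (flip E w) = 0" if E: "E \<subseteq> {..<n}" "E \<noteq> {..<n}" for E
  proof -
    have ex: "\<exists>i. i < n \<and> i \<notin> E" using E by auto
    define i where "i = (LEAST i. i < n \<and> i \<notin> E)"
    have i: "i < n" "i \<notin> E" using LeastI_ex[OF ex] by (auto simp: i_def)
    show ?thesis
    proof (cases i)
      case 0
      then have "theta (b1 / flip E w 0) p = 0" using i w[of 0] nz p by (simp add: flip_def)
      then have "(\<Prod>k<n. flip E w k * theta (A * flip E w k) p * theta (b1 / flip E w k) p *
          theta (b2 / flip E w k) p * theta (b3 / flip E w k) p) = 0"
        using i 0 by (intro prod_zero) auto
      then show ?thesis by (simp add: BC_kernel_def)
    next
      case (Suc k)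
      have k: "k \<in> E" using Suc i not_less_Least[of k "\<lambda>i. i < n \<and> i \<notin> E"] by (auto simp: i_def)
      have "theta (t / (flip E w k * flip E w i)) p = 0"
        using i k Suc w[of k] w[of i] nz p by (simp add: flip_def)
      then have "pair_prod (\<lambda>x y. y * theta (x / y) p * theta (t / (x * y)) p) n (flip E w) = 0"
        unfolding pair_prod_def using Suc i by (intro prod_zero bexI[of _ i] bexI[of _ k]) auto
      then show ?thesis by (simp add: BC_kernel_def)
    qed
  qed
  have "flip_sum n ?K w = (\<Sum>E\<in>{{..<n}}. (-1) ^ card E * ?K (flip E w))"
    unfolding flip_sum_def using zero by (intro sum.mono_neutral_right) auto
  also have "?K (flip {..<n} w) = ?K (\<lambda>k. 1 / (b1 * t ^ k))"
    unfolding BC_kernel_def by (intro arg_cong2[where f = "(*)"] prod.cong pair_prod_cong) (auto simp: flip_def w)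
  then have "(\<Sum>E\<in>{{..<n}}. (-1) ^ card E * ?K (flip E w)) = (-1) ^ n * ?K (\<lambda>k. 1 / (b1 * t ^ k))"
    by simp
  finally show ?thesis .
qed

lemma BC_vandermonde_cong:
  "(\<And>k. k < n \<Longrightarrow> z k = z' k) \<Longrightarrow> BC_vandermonde p n z = BC_vandermonde p n z'"
  unfolding BC_vandermonde_def by (intro arg_cong2[where f = "(*)"] prod.cong pair_prod_cong) auto

text \<open>The sum over inversions is antisymmetric with the multiplier of the Vandermonde, hence a
  multiple of it. The geometric point, where a single term survives, gives the multiple.\<close>

theorem flip_sum_BC_kernel:
  assumes p: "norm p < 1" and nz: "t \<noteq> 0" "b1 \<noteq> 0" "b2 \<noteq> 0" "b3 \<noteq> 0" and A: "A = b1 * b2 * b3 * t ^ (n - 1)"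
    and V: "BC_vandermonde p n (\<lambda>k. b1 * t ^ k) \<noteq> 0" and z: "\<forall>i. z i \<noteq> 0"
  shows "flip_sum n (BC_kernel p t A b1 b2 b3 n) z =
    (\<Prod>k<n. theta (t ^ k * b1 * b2) p * theta (t ^ k * b1 * b3) p * theta (t ^ k * b2 * b3) p) *
    BC_vandermonde p n z"
proof -
  define \<kappa> where "\<kappa> = (\<lambda>p. \<Prod>k<n. theta (t ^ k * b1 * b2) p * theta (t ^ k * b1 * b3) p * theta (t ^ k * b2 * b3) p)"
  let ?w = "\<lambda>k. b1 * t ^ k"
  \<comment> \<open>Kept free of division by the Vandermonde, so that it vanishes at every nonzero
    nome. The uniqueness theorem needs a nonzero nome; nome 0 follows by continuity in p.\<close>
  define F where "F = (\<lambda>p. flip_sum n (BC_kernel p t A b1 b2 b3 n) z * BC_vandermonde p n ?w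
     - \<kappa> p * BC_vandermonde p n ?w * BC_vandermonde p n z)"
  have F0: "F p = 0" if p: "norm p < 1" "p \<noteq> 0" for p
  proof -
    define w where "w = (\<lambda>k. if k < n then b1 * t ^ k else z k)"
    have w: "w k = b1 * t ^ k" if "k < n" for k using that by (simp add: w_def)
    have "BC_antisym p n (flip_sum n (BC_kernel p t A b1 b2 b3 n))"
      by (intro BC_antisym_flip_sum p BC_multiplier_kernel nz A BC_kernel_transpose)
    from BC_antisym_unique[OF p this z, of w]
    have "flip_sum n (BC_kernel p t A b1 b2 b3 n) z * BC_vandermonde p n w =
       flip_sum n (BC_kernel p t A b1 b2 b3 n) w * BC_vandermonde p n z"
      using z nz by (auto simp: w_def)
    also have "flip_sum n (BC_kernel p t A b1 b2 b3 n) w = \<kappa> p * BC_vandermonde p n ?w"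
      unfolding \<kappa>_def using flip_sum_kernel_at_geometric[OF p(1) nz(1,2), of n w] w
        BC_kernel_at_geometric[OF p(1) nz A] by simp
    also have "BC_vandermonde p n w = BC_vandermonde p n ?w" by (rule BC_vandermonde_cong) (rule w)
    finally show ?thesis by (simp add: F_def)
  qed
  have "F p = 0"
  proof (cases "p = 0")
    case True
    have "A \<noteq> 0" using A nz by simp
    then have "continuous_on (ball 0 1) F"
      unfolding F_def \<kappa>_def flip_sum_def BC_kernel_def BC_vandermonde_def pair_prod_def
      using nz z flip_nonzero[OF z] by (intro continuous_intros) auto
    then have "isCont F 0" by (simp add: continuous_on_eq_continuous_at)
    moreover have "\<forall>\<^sub>F s in at 0. F s = 0"
    proof -
      have "\<forall>\<^sub>F s in at (0::complex). s \<in> ball 0 1 - {0}"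
        by (rule eventually_at_in_open) auto
      then show ?thesis by eventually_elim (simp add: F0)
    qed
    ultimately show ?thesis using eq_zero_by_curve True by blast
  qed (use F0 p in auto)
  then show ?thesis using V by (simp add: F_def \<kappa>_def algebra_simps)
qed

section \<open>Sums over the whole hyperoctahedral group\<close>

lemma perm_antisym:
  fixes \<sigma> :: "nat \<Rightarrow> nat"
  assumes \<sigma>: "\<sigma> permutes {..<n}"
    and anti: "\<And>z i j. \<forall>i. z i \<noteq> 0 \<Longrightarrow> i < n \<Longrightarrow> j < n \<Longrightarrow> i \<noteq> j \<Longrightarrow> f (z \<circ> Transposition.transpose i j) = - f z"
    and z: "\<forall>i. z i \<noteq> (0 :: complex)"
  shows "f (z \<circ> \<sigma>) = of_int (sign \<sigma>) * (f z :: complex)"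
  using \<sigma> finite_lessThan[of n] z
proof (induction arbitrary: z rule: permutes_induct)
  case id
  then show ?case by simp
next
  case (swap a b p)
  have ab: "a < n" "b < n" "a \<noteq> b" using swap by auto
  have z': "\<forall>i. (z \<circ> Transposition.transpose a b) i \<noteq> 0" using swap.prems by simp
  have "f (z \<circ> (Transposition.transpose a b \<circ> p)) = of_int (sign p) * f (z \<circ> Transposition.transpose a b)"
    using swap.IH[OF z'] by (simp only: o_assoc)
  also have "f (z \<circ> Transposition.transpose a b) = - f z" by (rule anti[OF swap.prems ab])
  also have "of_int (sign p) * - f z = of_int (sign (Transposition.transpose a b \<circ> p)) * f z"
    using swap ab
    by (subst sign_compose) (auto simp: sign_swap_id permutation_swap_id intro: permutation_permutes[THEN iffD2])
  finally show ?case .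
qed

definition perm_sum :: "nat \<Rightarrow> ((nat \<Rightarrow> complex) \<Rightarrow> complex) \<Rightarrow> (nat \<Rightarrow> complex) \<Rightarrow> complex" where
  "perm_sum n H z = (\<Sum>\<sigma> | \<sigma> permutes {..<n}. of_int (sign \<sigma>) * H (z \<circ> \<sigma>))"

lemma perm_sum_transpose:
  assumes "i < n" "j < n" "i \<noteq> j"
  shows "perm_sum n H (z \<circ> Transposition.transpose i j) = - perm_sum n H z"
proof -
  let ?\<tau> = "Transposition.transpose i j"
  have \<tau>: "?\<tau> permutes {..<n}" using assms by (intro permutes_swap_id) auto
  have "perm_sum n H z = (\<Sum>\<sigma> | \<sigma> permutes {..<n}. of_int (sign (?\<tau> \<circ> \<sigma>)) * H (z \<circ> (?\<tau> \<circ> \<sigma>)))"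
    unfolding perm_sum_def by (rule setum_permutations_compose_left[OF \<tau>])
  also have "\<dots> = (\<Sum>\<sigma> | \<sigma> permutes {..<n}. - (of_int (sign \<sigma>) * H ((z \<circ> ?\<tau>) \<circ> \<sigma>)))"
  proof (rule sum.cong[OF refl])
    fix \<sigma> assume "\<sigma> \<in> {\<sigma>. \<sigma> permutes {..<n}}"
    then have "sign (?\<tau> \<circ> \<sigma>) = - sign \<sigma>"
      using assms by (subst sign_compose) (auto simp: sign_swap_id permutation_swap_id intro: permutation_permutes[THEN iffD2])
    then show "of_int (sign (?\<tau> \<circ> \<sigma>)) * H (z \<circ> (?\<tau> \<circ> \<sigma>)) = - (of_int (sign \<sigma>) * H ((z \<circ> ?\<tau>) \<circ> \<sigma>))"
      by (simp add: o_assoc)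
  qed
  finally show ?thesis by (simp add: perm_sum_def sum_negf)
qed

lemma fun_upd_comp_perm:
  assumes "\<sigma> permutes S"
  shows "(z(i := u)) \<circ> \<sigma> = (z \<circ> \<sigma>)(inv \<sigma> i := u)"
proof
  fix x
  show "((z(i := u)) \<circ> \<sigma>) x = ((z \<circ> \<sigma>)(inv \<sigma> i := u)) x"
    using permutes_inverses[OF assms] by (cases "x = inv \<sigma> i") auto
qed

lemma BC_multiplier_comp:
  assumes H: "BC_multiplier p n H" and \<sigma>: "\<sigma> permutes {..<n}"
  shows "BC_multiplier p n (\<lambda>z. H (z \<circ> \<sigma>))"
  unfolding BC_multiplier_def
proof (intro conjI allI impI)
  show "continuous_on {z. \<forall>i. z i \<noteq> 0} (\<lambda>z. H (z \<circ> \<sigma>))"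
  proof -
    have "continuous_on {z. \<forall>i. z i \<noteq> 0} H" using H unfolding BC_multiplier_def by blast
    then show ?thesis
      by (rule continuous_on_compose2[OF _ continuous_on_comp_index[OF continuous_on_id]]) auto
  qed
  fix z :: "nat \<Rightarrow> complex" and i assume z: "\<forall>i. z i \<noteq> 0" and i: "i < n"
  have i': "inv \<sigma> i < n" using permutes_in_image[OF permutes_inv[OF \<sigma>], of i] i by simp
  have z': "\<forall>i. (z \<circ> \<sigma>) i \<noteq> 0" using z by simp
  have e: "(z \<circ> \<sigma>) (inv \<sigma> i) = z i" using permutes_inverses(1)[OF \<sigma>] by simp
  have "H ((z \<circ> \<sigma>)(inv \<sigma> i := p * (z \<circ> \<sigma>) (inv \<sigma> i))) =
      H (z \<circ> \<sigma>) / (p ^ (n + 1) * (z \<circ> \<sigma>) (inv \<sigma> i) ^ (2 * n + 2))"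
    using H i' z' unfolding BC_multiplier_def by blast
  then show "H (z(i := p * z i) \<circ> \<sigma>) = H (z \<circ> \<sigma>) / (p ^ (n + 1) * z i ^ (2 * n + 2))"
    unfolding e fun_upd_comp_perm[OF \<sigma>] .
  have "(\<lambda>u. H ((z \<circ> \<sigma>)(inv \<sigma> i := u))) holomorphic_on - {0}"
    using H i' z' unfolding BC_multiplier_def by blast
  then show "(\<lambda>u. H (z(i := u) \<circ> \<sigma>)) holomorphic_on - {0}"
    unfolding fun_upd_comp_perm[OF \<sigma>] .
qed

lemma BC_antisym_flip_perm_sum:
  assumes p: "p \<noteq> 0" and H: "BC_multiplier p n H"
  shows "BC_antisym p n (flip_sum n (perm_sum n H))"
proof (rule BC_antisym_flip_sum[OF p])
  show "BC_multiplier p n (perm_sum n H)"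
    unfolding perm_sum_def by (intro BC_multiplier_sum BC_multiplier_comp H) (auto simp: finite_permutations)
qed (rule perm_sum_transpose)

text \<open>Designed around the last variable: its theta functions cancel the poles of the density
  in z m inside the unit disc, and the Vandermonde of the first m variables is the one that the
  integral in m variables needs.\<close>

definition branching_kernel :: "complex \<Rightarrow> complex \<Rightarrow> complex \<Rightarrow> complex \<Rightarrow> complex \<Rightarrow> complex \<Rightarrow> nat \<Rightarrow> (nat \<Rightarrow> complex) \<Rightarrow> complex" where
  "branching_kernel p t a1 a2 a3 a4 m z =
     z m ^ Suc m * (theta (a1 / z m) p * theta (a2 / z m) p * theta (a3 / z m) p * theta (a4 / z m) p) *
     (\<Prod>k<m. theta (t * z k / z m) p * theta (t / (z m * z k)) p) * BC_vandermonde p m z"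

text \<open>A variable z i with i < m has degree 2 m + 2 from the Vandermonde and 2 from the
  coupling to z m. For z m itself the balancing condition supplies the constant of the
  multiplier.\<close>

lemma BC_multiplier_branching_kernel:
  assumes p: "norm p < 1" "p \<noteq> 0" and nz: "t \<noteq> 0" "a1 \<noteq> 0" "a2 \<noteq> 0" "a3 \<noteq> 0" "a4 \<noteq> 0"
    and bal: "a1 * a2 * a3 * a4 * t ^ (2 * m) = p"
  shows "BC_multiplier p (Suc m) (branching_kernel p t a1 a2 a3 a4 m)"
proof -
  let ?B = "branching_kernel p t a1 a2 a3 a4 m"
  let ?h = "\<lambda>x y. theta (t * x / y) p * theta (t / (y * x)) p"
  have cont: "continuous_on {z. \<forall>i. z i \<noteq> 0} ?B"
    unfolding branching_kernel_def using p nz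
    by (intro continuous_intros continuous_on_BC_vandermonde) auto
  have Vm: "BC_vandermonde p m (z(m := u)) = BC_vandermonde p m z" for z u
    by (rule BC_vandermonde_cong) simp
  have hol: "(\<lambda>u. ?B (z(i := u))) holomorphic_on - {0}" if z: "\<forall>i. z i \<noteq> 0" and i: "i < Suc m" for z i
  proof (cases "i = m")
    case True
    show ?thesis
      unfolding branching_kernel_def True Vm using z p nz by (auto intro!: holomorphic_intros)
  next
    case False
    then have i: "i < m" using i by simp
    have V: "(\<lambda>u. BC_vandermonde p m (z(i := u))) holomorphic_on - {0}"
      using BC_antisymD(4)[OF BC_antisym_vandermonde[OF p] z i] .
    show ?thesis
      unfolding branching_kernel_def prod_upd[OF i, of "\<lambda>x. ?h x ((z(i := u)) m)" z for u]
      using False i z p nz by (auto intro!: holomorphic_intros V)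
  qed
  have shift: "?B (z(i := p * z i)) = ?B z / (p ^ (Suc m + 1) * z i ^ (2 * Suc m + 2))"
    if z: "\<forall>i. z i \<noteq> 0" and i: "i < Suc m" for z i
  proof (cases "i = m")
    case True
    have zm: "z m \<noteq> 0" using z by simp
    have d: "theta (c / (p * z m)) p = - (c / z m / p) * theta (c / z m) p" if "c \<noteq> 0" for c
      using theta_div_nome[OF p, of "c / z m"] zm that by (simp add: mult_ac)
    have "(\<Prod>k<m. ?h ((z(m := p * z m)) k) (p * z m)) = (\<Prod>k<m. (t ^ 2 / (p ^ 2 * z m ^ 2)) * ?h (z k) (z m))"
    proof (rule prod.cong[OF refl])
      fix k assume k: "k \<in> {..<m}"
      have zk: "z k \<noteq> 0" using z by simp
      have 1: "theta (t * z k / (p * z m)) p = - (t * z k / z m / p) * theta (t * z k / z m) p"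
        by (rule d) (use zk nz in simp)
      have 2: "theta (t / (p * z m * z k)) p = - (t / z k / z m / p) * theta (t / (z m * z k)) p"
        using d[of "t / z k"] zk nz by (simp add: mult_ac)
      show "?h ((z(m := p * z m)) k) (p * z m) = (t ^ 2 / (p ^ 2 * z m ^ 2)) * ?h (z k) (z m)"
      proof -
        have z': "(z(m := p * z m)) k = z k" using k by simp
        show ?thesis unfolding z' 2 1 using zk zm p by (simp add: field_simps power2_eq_square)
      qed
    qed
    then have e1: "(\<Prod>k<m. ?h ((z(m := p * z m)) k) (p * z m)) = (t ^ 2 / (p ^ 2 * z m ^ 2)) ^ m * (\<Prod>k<m. ?h (z k) (z m))"
      by (simp only: prod.distrib prod_constant card_lessThan)
    have e2: "(p * z m) ^ Suc m * (theta (a1 / (p * z m)) p * theta (a2 / (p * z m)) p * theta (a3 / (p * z m)) p * theta (a4 / (p * z m)) p)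
      = p ^ Suc m * (a1 * a2 * a3 * a4) / (p * z m) ^ 4 *
       (z m ^ Suc m * (theta (a1 / z m) p * theta (a2 / z m) p * theta (a3 / z m) p * theta (a4 / z m) p))"
      unfolding d[OF nz(2)] d[OF nz(3)] d[OF nz(4)] d[OF nz(5)] power_mult_distrib
      using zm p by (simp add: field_simps power4_eq_xxxx)
    have e3: "p ^ Suc m * (a1 * a2 * a3 * a4) / (p * z m) ^ 4 * (t ^ 2 / (p ^ 2 * z m ^ 2)) ^ m =
        1 / (p ^ (Suc m + 1) * z m ^ (2 * Suc m + 2))"
    proof -
      have "(z m ^ 2) ^ m = z m ^ (2 * m)" "(p ^ 2) ^ m = p ^ m * p ^ m" "(t ^ 2) ^ m = t ^ (2 * m)"
        by (simp_all add: power_mult mult_2 flip: power_mult power_add)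
      then have "p ^ Suc m * (a1 * a2 * a3 * a4) / (p * z m) ^ 4 * (t ^ 2 / (p ^ 2 * z m ^ 2)) ^ m =
        p ^ Suc m * (a1 * a2 * a3 * a4 * t ^ (2 * m)) / ((p * z m) ^ 4 * (p ^ m * p ^ m * z m ^ (2 * m)))"
        by (simp add: power_divide power_mult_distrib)
      also have "\<dots> = 1 / (p ^ (Suc m + 1) * z m ^ (2 * Suc m + 2))"
        unfolding bal using p zm by (simp add: field_simps power_add power2_eq_square power4_eq_xxxx)
      finally show ?thesis .
    qed
    have "?B (z(m := p * z m)) = ((p * z m) ^ Suc m * (theta (a1 / (p * z m)) p * theta (a2 / (p * z m)) p * theta (a3 / (p * z m)) p * theta (a4 / (p * z m)) p)) *
        (\<Prod>k<m. ?h ((z(m := p * z m)) k) (p * z m)) * BC_vandermonde p m z"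
      by (simp only: branching_kernel_def Vm fun_upd_same)
    also have "\<dots> = (p ^ Suc m * (a1 * a2 * a3 * a4) / (p * z m) ^ 4 * (t ^ 2 / (p ^ 2 * z m ^ 2)) ^ m) * ?B z"
      unfolding e1 e2 branching_kernel_def by (simp only: mult_ac)
    finally show ?thesis unfolding e3 True by simp
  next
    case False
    then have i: "i < m" using i by simp
    have V: "BC_vandermonde p m (z(i := p * z i)) = BC_vandermonde p m z / (p ^ (m + 1) * z i ^ (2 * m + 2))"
      by (rule BC_vandermonde_shift[OF p z i])
    have zi: "z i \<noteq> 0" "z m \<noteq> 0" using z by auto
    have 1: "theta (t * (p * z i) / z m) p = - theta (t * z i / z m) p / (t * z i / z m)"
      using theta_mult_nome[OF p, of "t * z i / z m"] zi nz by (simp add: mult_ac)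
    have 2: "theta (t / (z m * (p * z i))) p = - (t / (z m * z i) / p) * theta (t / (z m * z i)) p"
      using theta_div_nome[OF p, of "t / (z m * z i)"] zi nz by (simp add: mult_ac)
    have h: "?h (p * z i) (z m) = 1 / (p * z i ^ 2) * ?h (z i) (z m)"
      unfolding 1 2 using zi nz p by (simp add: field_simps power2_eq_square)
    have e: "(\<Prod>k<m. ?h ((z(i := p * z i)) k) (z m)) = 1 / (p * z i ^ 2) * (\<Prod>k<m. ?h (z k) (z m))"
    proof -
      have "(\<Prod>k<m. ?h (z k) (z m)) = ?h (z i) (z m) * (\<Prod>k\<in>{..<m} - {i}. ?h (z k) (z m))"
        using i by (intro prod.remove) auto
      then show ?thesis unfolding prod_upd[OF i, of "\<lambda>x. ?h x (z m)" z] h by simp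
    qed
    have "(z(i := p * z i)) m = z m" using False by simp
    then have "?B (z(i := p * z i)) = z m ^ Suc m * (theta (a1 / z m) p * theta (a2 / z m) p * theta (a3 / z m) p * theta (a4 / z m) p) *
      (\<Prod>k<m. ?h ((z(i := p * z i)) k) (z m)) * BC_vandermonde p m (z(i := p * z i))"
      by (simp only: branching_kernel_def)
    also have "\<dots> = (1 / (p * z i ^ 2) * (1 / (p ^ (m + 1) * z i ^ (2 * m + 2)))) * ?B z"
      unfolding e V branching_kernel_def by (simp only: mult_ac times_divide_eq_right mult_1_right mult_1)
    also have "1 / (p * z i ^ 2) * (1 / (p ^ (m + 1) * z i ^ (2 * m + 2))) = 1 / (p ^ (Suc m + 1) * z i ^ (2 * Suc m + 2))"
      by (simp add: power2_eq_square mult_ac)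
    finally show ?thesis by (simp only: times_divide_eq_left mult_1_left)
  qed
  show ?thesis unfolding BC_multiplier_def using cont hol shift by auto
qed

lemma BC_vandermonde_flip_set:
  assumes p: "norm p < 1" and z: "\<forall>i. z i \<noteq> 0" and E: "finite E" "E \<subseteq> {..<n}"
  shows "BC_vandermonde p n (flip E z) = (-1) ^ card E * BC_vandermonde p n z"
  using E
proof (induction E)
  case (insert i E)
  have "flip (insert i E) z = (flip E z)(i := 1 / flip E z i)" using insert by (auto simp: flip_def)
  then have "BC_vandermonde p n (flip (insert i E) z) = - BC_vandermonde p n (flip E z)"
    using BC_vandermonde_flip[OF p flip_nonzero[OF z], of i n E] insert by simp
  then show ?case using insert by simp
qed simp

text \<open>With i = \<sigma> m the last variable is w i or 1 / w i. If it is w i, then a1 / w 0 or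
  the neighbour w (i - 1) produces theta 1; if it is 1 / w i with i < m, the neighbour w (i + 1)
  does. The two coupling factors cover both orientations of the neighbour.\<close>

lemma branching_kernel_vanishes:
  assumes p: "norm p < 1" and nz: "t \<noteq> 0" "a1 \<noteq> 0" and w: "\<And>k. k < Suc m \<Longrightarrow> w k = a1 * t ^ k"
    and \<sigma>: "\<sigma> permutes {..<Suc m}" and not: "\<not> (m \<in> E \<and> \<sigma> m = m)"
  shows "branching_kernel p t a1 a2 a3 a4 m (flip E w \<circ> \<sigma>) = 0"
proof -
  define i where "i = \<sigma> m"
  have i: "i < Suc m" using permutes_in_image[OF \<sigma>, of m] by (simp add: i_def)
  have pre: "\<exists>k<m. \<sigma> k = j" if "j < Suc m" "j \<noteq> i" for j
  proof -
    obtain k where k: "\<sigma> k = j" using permutes_surj[OF \<sigma>] by (metis surjD)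
    then have "k < Suc m" using permutes_in_image[OF \<sigma>, of k] that by simp
    moreover have "k \<noteq> m" using k that by (auto simp: i_def)
    ultimately show ?thesis using k by (intro exI[of _ k]) auto
  qed
  let ?y = "flip E w \<circ> \<sigma>"
  have ym: "?y m = flip E w i" by (simp add: i_def)
  have fac: "branching_kernel p t a1 a2 a3 a4 m ?y = 0"
    if "k < m" "theta (t * ?y k / ?y m) p = 0 \<or> theta (t / (?y m * ?y k)) p = 0" for k
  proof -
    have "(\<Prod>k<m. theta (t * ?y k / ?y m) p * theta (t / (?y m * ?y k)) p) = 0"
      using that by (intro prod_zero bexI[of _ k]) auto
    then show ?thesis unfolding branching_kernel_def by (simp only: mult_zero_left mult_zero_right)
  qed
  have w1: "w (Suc k) = t * w k" "w k \<noteq> 0" if "Suc k < Suc m" for k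
    using w[of k] w[of "Suc k"] that nz by (auto simp: mult_ac)
  show ?thesis
  proof (cases "i \<in> E")
    case False
    then have ymi: "?y m = w i" using ym by (simp add: flip_def)
    show ?thesis
    proof (cases i)
      case 0
      then have "theta (a1 / ?y m) p = 0" using ymi w[of 0] p nz by simp
      then show ?thesis unfolding branching_kernel_def by (simp only: mult_zero_left mult_zero_right)
    next
      case (Suc j)
      obtain k where k: "k < m" "\<sigma> k = j" using pre[of j] i Suc by auto
      have j: "w i = t * w j" "w j \<noteq> 0" using w1[of j] Suc i by auto
      have "?y k = w j \<or> ?y k = 1 / w j" using k by (simp add: flip_def)
      then have "theta (t * ?y k / ?y m) p = 0 \<or> theta (t / (?y m * ?y k)) p = 0"
        unfolding ymi j(1) using j nz p by auto
      from fac[OF k(1) this] show ?thesis .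
    qed
  next
    case True
    then have ymi: "?y m = 1 / w i" using ym by (simp add: flip_def)
    have im: "i < m" using True not i by (auto simp: i_def less_Suc_eq)
    obtain k where k: "k < m" "\<sigma> k = Suc i" using pre[of "Suc i"] im by auto
    have j: "w (Suc i) = t * w i" "w i \<noteq> 0" using w1[of i] im by auto
    have "?y k = w (Suc i) \<or> ?y k = 1 / w (Suc i)" using k by (simp add: flip_def)
    then have "theta (t * ?y k / ?y m) p = 0 \<or> theta (t / (?y m * ?y k)) p = 0"
      unfolding ymi j(1) using j nz p by auto
    from fac[OF k(1) this] show ?thesis .
  qed
qed

text \<open>The remaining inversions and permutations act on the first m variables only, where the
  sign of the Vandermonde cancels the sign of the group element. The inversion of w m itself leaves
  the minus sign.\<close>

lemma branching_kernel_survives: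
  assumes p: "norm p < 1" and w: "\<forall>i. w i \<noteq> 0"
    and \<sigma>: "\<sigma> permutes {..<Suc m}" and surv: "m \<in> E" "\<sigma> m = m" and E: "E \<subseteq> {..<Suc m}"
  shows "(-1) ^ card E * (of_int (sign \<sigma>) * branching_kernel p t a1 a2 a3 a4 m (flip E w \<circ> \<sigma>)) =
    - branching_kernel p t a1 a2 a3 a4 m (w(m := 1 / w m))"
proof -
  let ?y = "flip E w \<circ> \<sigma>"
  have finE: "finite E" using E finite_subset by blast
  have \<sigma>m: "\<sigma> permutes {..<m}"
    using permutes_superset[OF \<sigma>, of "{..<m}"] surv by (auto simp: less_Suc_eq)
  have ym: "?y m = 1 / w m" using surv by (simp add: flip_def)
  let ?h = "\<lambda>x. theta (t * x / (1 / w m)) p * theta (t / (1 / w m * x)) p"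
  have "(\<Prod>k<m. ?h (?y k)) = (\<Prod>k<m. ?h (w (\<sigma> k)))"
    by (intro prod.cong refl) (auto simp: flip_def mult_ac)
  also have "\<dots> = (\<Prod>k<m. ?h (w k))"
    using prod.permute[OF \<sigma>m, of "\<lambda>k. ?h (w k)"] by (simp add: o_def)
  also have "\<dots> = (\<Prod>k<m. ?h ((w(m := 1 / w m)) k))" by (intro prod.cong) auto
  finally have e1: "(\<Prod>k<m. ?h (?y k)) = (\<Prod>k<m. ?h ((w(m := 1 / w m)) k))" .
  let ?E = "E - {m}"
  have "BC_vandermonde p m ?y = BC_vandermonde p m (flip ?E w \<circ> \<sigma>)"
  proof (rule BC_vandermonde_cong)
    fix k assume "k < m"
    then have "\<sigma> k < m" using permutes_in_image[OF \<sigma>m, of k] by simp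
    then show "?y k = (flip ?E w \<circ> \<sigma>) k" by (simp add: flip_def)
  qed
  also have "\<dots> = of_int (sign \<sigma>) * BC_vandermonde p m (flip ?E w)"
    by (rule perm_antisym[OF \<sigma>m BC_vandermonde_transpose[OF p] flip_nonzero[OF w]])
  also have "BC_vandermonde p m (flip ?E w) = (-1) ^ card ?E * BC_vandermonde p m w"
    using E finE by (intro BC_vandermonde_flip_set p w) auto
  also have "BC_vandermonde p m w = BC_vandermonde p m (w(m := 1 / w m))"
    by (rule BC_vandermonde_cong) simp
  finally have e2: "BC_vandermonde p m ?y = of_int (sign \<sigma>) * ((-1) ^ card ?E * BC_vandermonde p m (w(m := 1 / w m)))" .
  have B: "branching_kernel p t a1 a2 a3 a4 m ?y =
      of_int (sign \<sigma>) * (-1) ^ card ?E * branching_kernel p t a1 a2 a3 a4 m (w(m := 1 / w m))"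
    unfolding branching_kernel_def ym e1 e2 fun_upd_same by (simp only: mult_ac)
  have "card E = Suc (card ?E)" using finE surv by (metis card_Suc_Diff1)
  then have s: "(-1 :: complex) ^ card E * (-1) ^ card ?E = -1"
    by (simp flip: power_add)
  have s': "of_int (sign \<sigma>) * of_int (sign \<sigma>) = (1 :: complex)" by (simp flip: of_int_mult)
  have "(-1) ^ card E * (of_int (sign \<sigma>) * branching_kernel p t a1 a2 a3 a4 m ?y) =
     ((-1) ^ card E * (-1) ^ card ?E) * (of_int (sign \<sigma>) * of_int (sign \<sigma>)) *
     branching_kernel p t a1 a2 a3 a4 m (w(m := 1 / w m))"
    unfolding B by (simp only: mult_ac)
  then show ?thesis unfolding s s' by simp
qed

text \<open>The survivors are counted by the hyperoctahedral group of the first m variables, of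
  order 2 ^ m * fact m.\<close>

lemma flip_perm_sum_branching_at_geometric:
  assumes p: "norm p < 1" and nz: "t \<noteq> 0" "a1 \<noteq> 0" and w: "\<And>k. k < Suc m \<Longrightarrow> w k = a1 * t ^ k" "\<forall>i. w i \<noteq> 0"
  shows "flip_sum (Suc m) (perm_sum (Suc m) (branching_kernel p t a1 a2 a3 a4 m)) w =
    - (2 ^ m * fact m * branching_kernel p t a1 a2 a3 a4 m (w(m := 1 / w m)))"
proof -
  let ?B = "branching_kernel p t a1 a2 a3 a4 m"
  let ?c = "- ?B (w(m := 1 / w m))"
  have "flip_sum (Suc m) (perm_sum (Suc m) ?B) w =
     (\<Sum>E\<in>Pow {..<Suc m}. \<Sum>\<sigma> | \<sigma> permutes {..<Suc m}. (-1) ^ card E * (of_int (sign \<sigma>) * ?B (flip E w \<circ> \<sigma>)))"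
    by (simp only: flip_sum_def perm_sum_def sum_distrib_left)
  also have "\<dots> = (\<Sum>E\<in>Pow {..<Suc m}. \<Sum>\<sigma> | \<sigma> permutes {..<Suc m}. if m \<in> E then (if \<sigma> m = m then ?c else 0) else 0)"
  proof (intro sum.cong refl)
    fix E \<sigma> assume "E \<in> Pow {..<Suc m}" "\<sigma> \<in> {\<sigma>. \<sigma> permutes {..<Suc m}}"
    then have E: "E \<subseteq> {..<Suc m}" and \<sigma>: "\<sigma> permutes {..<Suc m}" by auto
    show "(-1) ^ card E * (of_int (sign \<sigma>) * ?B (flip E w \<circ> \<sigma>)) = (if m \<in> E then (if \<sigma> m = m then ?c else 0) else 0)"
      using branching_kernel_survives[OF p w(2) \<sigma> _ _ E, of t a1 a2 a3 a4]
        branching_kernel_vanishes[OF p nz w(1) \<sigma>, of E a2 a3 a4]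
      by (cases "m \<in> E"; cases "\<sigma> m = m") simp_all
  qed
  also have "\<dots> = (\<Sum>E\<in>Pow {..<Suc m}. if m \<in> E then (\<Sum>\<sigma> | \<sigma> permutes {..<Suc m}. if \<sigma> m = m then ?c else 0) else 0)"
    by (intro sum.cong refl) auto
  also have "(\<Sum>\<sigma> | \<sigma> permutes {..<Suc m}. if \<sigma> m = m then ?c else 0) = (\<Sum>\<sigma> | \<sigma> permutes {..<m}. ?c)"
  proof -
    have "{\<sigma>. \<sigma> permutes {..<m}} = {\<sigma>. \<sigma> permutes {..<Suc m} \<and> \<sigma> m = m}"
    proof (intro set_eqI iffI; clarsimp)
      fix \<sigma> assume "\<sigma> permutes {..<m}"
      then show "\<sigma> permutes {..<Suc m} \<and> \<sigma> m = m"
        using permutes_subset[of \<sigma> "{..<m}" "{..<Suc m}"] permutes_not_in[of \<sigma> "{..<m}" m] by auto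
    next
      fix \<sigma> assume "\<sigma> permutes {..<Suc m}" "\<sigma> m = m"
      then show "\<sigma> permutes {..<m}"
        using permutes_superset[of \<sigma> "{..<Suc m}" "{..<m}"] by (auto simp: less_Suc_eq)
    qed
    then show ?thesis
      by (subst sum.inter_filter[symmetric]) (auto simp: finite_permutations)
  qed
  also have "\<dots> = fact m * ?c" by (simp add: card_permutations)
  also have "(\<Sum>E\<in>Pow {..<Suc m}. if m \<in> E then fact m * ?c else 0) = (\<Sum>E\<in>insert m ` Pow {..<m}. fact m * ?c)"
  proof (subst sum.inter_filter[symmetric], simp, rule sum.cong)
    show "{E \<in> Pow {..<Suc m}. m \<in> E} = insert m ` Pow {..<m}"
    proof (intro set_eqI iffI)
      fix E assume "E \<in> {E \<in> Pow {..<Suc m}. m \<in> E}"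
      then have "E = insert m (E - {m})" "E - {m} \<subseteq> {..<m}" by (auto simp: less_Suc_eq)
      then show "E \<in> insert m ` Pow {..<m}" by blast
    qed auto
  qed auto
  also have "\<dots> = 2 ^ m * (fact m * ?c)"
  proof -
    have "inj_on (insert m) (Pow {..<m})" by (rule inj_onI) (metis Pow_iff insert_ident lessThan_iff less_irrefl subset_iff)
    then show ?thesis by (simp add: card_image card_Pow)
  qed
  finally show ?thesis by simp
qed

text \<open>Two telescoping rows. The factors theta (a1 ^ 2 * t ^ k) shift by one index and become
  the new row of the Vandermonde; the factors theta (t ^ k) leave theta (t ^ Suc m) over theta t,
  and theta t stays on the left to avoid a division.\<close>

lemma branching_kernel_at_geometric:
  assumes p: "norm p < 1" and nz: "t \<noteq> 0" "a1 \<noteq> 0"  and w: "\<And>k. k < Suc m \<Longrightarrow> w k = a1 * t ^ k"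
  shows "- branching_kernel p t a1 a2 a3 a4 m (w(m := 1 / w m)) * theta t p =
    theta (t ^ Suc m) p * theta (t ^ m * a1 * a2) p * theta (t ^ m * a1 * a3) p * theta (t ^ m * a1 * a4) p *
    BC_vandermonde p (Suc m) w"
proof -
  define f where "f = (\<lambda>k. theta (a1 ^ 2 * t ^ k) p)"
  define g where "g = (\<lambda>k. theta (t ^ k) p)"
  have wm: "w m = a1 * t ^ m" "w m \<noteq> 0" using w nz by auto
  have fm: "f m * (\<Prod>k<m. f (Suc (k + m))) = f (2 * m) * (\<Prod>k<m. f (k + m))"
  proof -
    have "f m * (\<Prod>j<m. f (Suc (j + m))) = (\<Prod>j<Suc m. f (j + m))"
      by (subst prod.lessThan_Suc_shift) simp
    then show ?thesis by (simp add: mult_2)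
  qed
  have gm: "(\<Prod>k<m. g (Suc (m - k))) * g 1 = g (Suc m) * (\<Prod>k<m. g (m - k))"
  proof -
    have "(\<Prod>k<m. g (m - k)) = (\<Prod>k<m. g (Suc k))"
      using prod.nat_diff_reindex[of "\<lambda>k. g (Suc k)" m] by (simp add: Suc_diff_Suc)
    moreover have "(\<Prod>k<m. g (Suc (m - k))) = (\<Prod>k<m. g (Suc (Suc k)))"
      using prod.nat_diff_reindex[of "\<lambda>k. g (Suc (Suc k))" m] by (simp add: Suc_diff_Suc)
    moreover have "(\<Prod>k<Suc m. g (Suc k)) = g 1 * (\<Prod>k<m. g (Suc (Suc k)))"
      by (subst prod.lessThan_Suc_shift) simp
    ultimately show ?thesis by (simp add: mult_ac)
  qed
  have q: "w m / w k = t ^ (m - k)" "w k * w m = a1 ^ 2 * t ^ (k + m)" if "k < m" for k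
    using w[of k] wm that nz by (simp_all add: power_diff power_add power2_eq_square)
  have h1: "(\<Prod>k<m. theta (t * (w(m := 1 / w m)) k / (1 / w m)) p * theta (t / (1 / w m * (w(m := 1 / w m)) k)) p)
     = (\<Prod>k<m. f (Suc (k + m))) * (\<Prod>k<m. g (Suc (m - k)))"
    unfolding prod.distrib[symmetric]
  proof (rule prod.cong[OF refl])
    fix k assume "k \<in> {..<m}"
    then have k: "k < m" by simp
    have "t * w k / (1 / w m) = a1 ^ 2 * t ^ Suc (k + m)" using q(2)[OF k] by (simp add: mult_ac)
    moreover have "t / (1 / w m * w k) = t ^ Suc (m - k)" proof -
      have "t / (1 / w m * w k) = t * (w m / w k)" by simp
      then show ?thesis unfolding q(1)[OF k] by simp
    qed
    ultimately show "theta (t * (w(m := 1 / w m)) k / (1 / w m)) p * theta (t / (1 / w m * (w(m := 1 / w m)) k)) p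
      = f (Suc (k + m)) * g (Suc (m - k))"
      using k by (simp add: f_def g_def del: power_Suc)
  qed
  have h2: "(\<Prod>j<m. theta (w j * w m) p * theta (w m / w j) p / w m) = (\<Prod>k<m. f (k + m)) * (\<Prod>k<m. g (m - k)) * (1 / w m) ^ m"
  proof -
    have "(\<Prod>j<m. theta (w j * w m) p * theta (w m / w j) p / w m) = (\<Prod>j<m. f (j + m) * g (m - j) * (1 / w m))"
      by (intro prod.cong refl) (simp add: q f_def g_def)
    then show ?thesis by (simp only: prod.distrib prod_constant card_lessThan)
  qed
  have fw: "f (2 * m) = theta (w m ^ 2) p"
    by (simp add: f_def wm power_mult_distrib power_mult flip: power_mult) (simp add: mult.commute)
  have wt: "w m * theta (1 / w m ^ 2) p = - (1 / w m) * f (2 * m)"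
    using theta_inverse[OF p, of "w m ^ 2"] wm(2) unfolding fw by (simp add: power2_eq_square)
  have th: "theta (a1 / (1 / w m)) p = f m" "theta (a2 / (1 / w m)) p = theta (t ^ m * a1 * a2) p"
    "theta (a3 / (1 / w m)) p = theta (t ^ m * a1 * a3) p" "theta (a4 / (1 / w m)) p = theta (t ^ m * a1 * a4) p"
    by (simp_all add: wm f_def mult_ac power2_eq_square)
  have V: "BC_vandermonde p m (w(m := 1 / w m)) = BC_vandermonde p m w"
    by (rule BC_vandermonde_cong) simp
  have V1: "BC_vandermonde p (Suc m) w = BC_vandermonde p m w * (w m * theta (1 / w m ^ 2) p) *
      (\<Prod>j<m. theta (w j * w m) p * theta (w m / w j) p / w m)"
    by (simp add: BC_vandermonde_def pair_prod_Suc mult_ac)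
  have g1: "theta t p = g 1" "theta (t ^ Suc m) p = g (Suc m)" by (simp_all add: g_def)
  let ?T = "theta (t ^ m * a1 * a2) p * theta (t ^ m * a1 * a3) p * theta (t ^ m * a1 * a4) p"
  have "- branching_kernel p t a1 a2 a3 a4 m (w(m := 1 / w m)) * theta t p =
    - ((1 / w m) ^ Suc m * ?T * BC_vandermonde p m w) * (f m * (\<Prod>k<m. f (Suc (k + m)))) * ((\<Prod>k<m. g (Suc (m - k))) * g 1)"
    unfolding branching_kernel_def fun_upd_same th h1 V g1 by (simp only: mult_ac mult_minus_left mult_minus_right)
  also have "\<dots> = g (Suc m) * ?T * (BC_vandermonde p m w * (- (1 / w m) * f (2 * m)) *
      ((\<Prod>k<m. f (k + m)) * (\<Prod>k<m. g (m - k)) * (1 / w m) ^ m))"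
    unfolding fm gm power_Suc by (simp only: mult_ac mult_minus_left mult_minus_right)
  also have "\<dots> = g (Suc m) * ?T * BC_vandermonde p (Suc m) w"
    unfolding V1 wt h2 ..
  finally show ?thesis unfolding g1 by (simp only: mult_ac)
qed

theorem flip_perm_sum_branching_kernel:
  assumes p: "norm p < 1" "p \<noteq> 0" and nz: "t \<noteq> 0" "a1 \<noteq> 0" "a2 \<noteq> 0" "a3 \<noteq> 0" "a4 \<noteq> 0"
    and bal: "a1 * a2 * a3 * a4 * t ^ (2 * m) = p"
    and V: "BC_vandermonde p (Suc m) (\<lambda>k. a1 * t ^ k) \<noteq> 0" and z: "\<forall>i. z i \<noteq> 0"
  shows "flip_sum (Suc m) (perm_sum (Suc m) (branching_kernel p t a1 a2 a3 a4 m)) z * theta t p =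
    2 ^ m * fact m * theta (t ^ Suc m) p * theta (t ^ m * a1 * a2) p * theta (t ^ m * a1 * a3) p *
    theta (t ^ m * a1 * a4) p * BC_vandermonde p (Suc m) z"
proof -
  let ?B = "branching_kernel p t a1 a2 a3 a4 m"
  let ?N = "flip_sum (Suc m) (perm_sum (Suc m) ?B)"
  define w where "w = (\<lambda>k. if k < Suc m then a1 * t ^ k else z k)"
  have w: "w k = a1 * t ^ k" if "k < Suc m" for k using that by (simp add: w_def)
  have w0: "\<forall>i. w i \<noteq> 0" using nz z by (simp add: w_def)
  have Vw: "BC_vandermonde p (Suc m) w = BC_vandermonde p (Suc m) (\<lambda>k. a1 * t ^ k)"
    by (rule BC_vandermonde_cong) (rule w)
  have "BC_antisym p (Suc m) ?N"
    by (intro BC_antisym_flip_perm_sum BC_multiplier_branching_kernel p nz bal)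
  from BC_antisym_unique[OF p this z w0]
  have "?N z * BC_vandermonde p (Suc m) w = ?N w * BC_vandermonde p (Suc m) z" by (simp add: w_def)
  also have "?N w = 2 ^ m * fact m * - ?B (w(m := 1 / w m))"
    using flip_perm_sum_branching_at_geometric[OF p(1) nz(1,2) w w0] by simp
  finally have "(?N z * theta t p) * BC_vandermonde p (Suc m) w =
     2 ^ m * fact m * (- ?B (w(m := 1 / w m)) * theta t p) * BC_vandermonde p (Suc m) z"
    by (simp add: mult_ac)
  also note branching_kernel_at_geometric[OF p(1) nz(1,2) w]
  finally have "(?N z * theta t p) * BC_vandermonde p (Suc m) w =
    (2 ^ m * fact m * theta (t ^ Suc m) p * theta (t ^ m * a1 * a2) p * theta (t ^ m * a1 * a3) p *
    theta (t ^ m * a1 * a4) p * BC_vandermonde p (Suc m) z) * BC_vandermonde p (Suc m) w"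
    by (simp only: mult_ac)
  then show ?thesis using V by (simp only: Vw mult_cancel_right) simp
qed

subsection \<open>Antisymmetric functionals with a boundary-term relation\<close>

lemma prod_list_map_upt: "prod_list (map f [0..<n]) = (\<Prod>j<n. f j :: 'a :: comm_monoid_mult)"
  by (induction n) (simp_all add: mult.commute)

text \<open>The perturbation has to stay on the torus, so coordinate i is rotated at rate i + 1 with
  a real parameter. The exceptional values are avoided by reading the real parameter as a complex
  one near 0.\<close>

lemma eq_on_torus_by_generic:
  assumes F: "continuous_on torus F"
    and gen: "\<And>z. z \<in> torus \<Longrightarrow> (\<And>i j. i < n \<Longrightarrow> j < n \<Longrightarrow> i \<noteq> j \<Longrightarrow> theta (z i / z j) p \<noteq> 0) \<Longrightarrow>
       (\<And>i x. i < n \<Longrightarrow> x \<in> set xs \<Longrightarrow> theta (z i / x) p \<noteq> 0) \<Longrightarrow> F z = 0"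
    and p: "norm p < 1" and xs: "0 \<notin> set xs" and z: "z \<in> torus"
  shows "F z = (0 :: complex)"
proof -
  define y where "y = (\<lambda>(r :: real) i. z i * cis (real (i + 1) * r))"
  have yT: "y r \<in> torus" for r using z by (simp add: y_def torus_def norm_mult)
  have z0: "z i \<noteq> 0" for i using z by (rule torusD)
  have cisx: "cis (real (i + 1) * r) = exp ((of_nat (i + 1) * \<i>) * of_real r)" for i r
    by (simp add: cis_conv_exp mult_ac)
  have ev: "\<forall>\<^sub>F r in at (0::real). P (of_real r)" if "\<forall>\<^sub>F s in at (0::complex). P s" for P
  proof -
    have "filterlim (of_real :: real \<Rightarrow> complex) (at 0) (at 0)"
      by (rule filterlim_atI) (auto intro!: tendsto_eq_intros simp: eventually_at_filter)
    then show ?thesis using that by (rule filterlim_iff[THEN iffD1, rule_format])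
  qed
  have ev1: "\<forall>\<^sub>F r in at 0. \<forall>i\<in>{..<n}. \<forall>j\<in>{..<n}. i \<noteq> j \<longrightarrow> theta (y r i / y r j) p \<noteq> 0"
  proof (intro eventually_ball_finite ballI)
    fix i j
    have "\<forall>\<^sub>F r in at (0::real). theta (z i / z j * exp (((of_nat (i + 1) - of_nat (j + 1)) * \<i>) * of_real r)) p \<noteq> 0" if "i \<noteq> j"
      using z0 that by (intro ev eventually_theta_exp_nonzero[OF p]) auto
    moreover have "y r i / y r j = z i / z j * exp (((of_nat (i + 1) - of_nat (j + 1)) * \<i>) * of_real r)" for r
      unfolding y_def cisx by (simp add: left_diff_distrib exp_diff del: of_nat_add of_nat_Suc)
    ultimately show "\<forall>\<^sub>F r in at 0. i \<noteq> j \<longrightarrow> theta (y r i / y r j) p \<noteq> 0" by (cases "i = j") auto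
  qed auto
  have ev2: "\<forall>\<^sub>F r in at 0. \<forall>i\<in>{..<n}. \<forall>x\<in>set xs. theta (y r i / x) p \<noteq> 0"
  proof (intro eventually_ball_finite ballI)
    fix i x assume "x \<in> set xs"
    then have "\<forall>\<^sub>F r in at (0::real). theta (z i / x * exp ((of_nat (i + 1) * \<i>) * of_real r)) p \<noteq> 0"
      using z0 xs by (intro ev eventually_theta_exp_nonzero[OF p]) (auto simp del: of_nat_add of_nat_Suc)
    moreover have "y r i / x = z i / x * exp ((of_nat (i + 1) * \<i>) * of_real r)" for r
      unfolding y_def cisx by simp
    ultimately show "\<forall>\<^sub>F r in at 0. theta (y r i / x) p \<noteq> 0" by (simp only:)
  qed auto
  have "\<forall>\<^sub>F r in at 0. F (y r) = 0"
    using ev1 ev2 by eventually_elim (rule gen[OF yT], auto)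
  then have "((\<lambda>r. F (y r)) \<longlongrightarrow> 0) (at 0)" by (rule tendsto_eventually)
  moreover have "isCont (\<lambda>r. F (y r)) 0"
  proof -
    have "continuous_on UNIV y" unfolding y_def
      by (intro continuous_on_coordinatewise_then_product continuous_intros)
    from continuous_on_compose2[OF F this] show ?thesis
      using yT by (auto simp: continuous_on_eq_continuous_at)
  qed
  ultimately have "F (y 0) = 0" by (metis LIM_unique isCont_def)
  then show ?thesis by (simp add: y_def)
qed

text \<open>Symmetrizing the boundary term, whose mean is zero by \<open>vanish\<close>, and expanding it in partial
  fractions relates \<open>value_at (\<alpha> / t)\<close> to \<open>value_at \<alpha>\<close>. At \<open>\<alpha> = a1\<close> one coefficient is zero, so
  \<open>value_at\<close> vanishes at \<open>a1, t * a1, ..., t ^ m * a1\<close>, which fixes it up to a constant.\<close>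

locale torus_functional =
  fixes p t a1 a2 :: complex and m :: nat and s :: "complex \<Rightarrow> complex" and W :: "(nat \<Rightarrow> complex) \<Rightarrow> complex"
  assumes p: "norm p < 1" and nz: "t \<noteq> 0" "a1 \<noteq> 0" "a2 \<noteq> 0"
    and s: "continuous_on (sphere 0 1) s"
    and W: "continuous_on torus W"
    and W_transpose: "\<And>z i j. z \<in> torus \<Longrightarrow> i \<le> m \<Longrightarrow> j \<le> m \<Longrightarrow> i \<noteq> j \<Longrightarrow> W (z \<circ> Transposition.transpose i j) = - W z"
    and vanish: "\<And>z. z \<in> torus \<Longrightarrow> circle_mean (\<lambda>u. u ^ (m + 2) * s u * theta (a1 / u) p * theta (a2 / u) p *
        (\<Prod>j<m. theta (t * z j / u) p * theta (t / (z j * u)) p) * W (z(m := u))) = 0"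
    and generic1: "\<And>k :: int. theta (t powi k * a2 / a1) p \<noteq> 0"
    and generic2: "\<And>k. 1 \<le> k \<Longrightarrow> k \<le> Suc m \<Longrightarrow> theta (t ^ k) p \<noteq> 0"
begin

text \<open>The part of the integrand that is free of \<alpha>. It is symmetric because two of its
  factors are antisymmetric and the others symmetric.\<close>

definition base :: "(nat \<Rightarrow> complex) \<Rightarrow> complex" where
  "base z = (\<Prod>k<Suc m. s (z k)) * pair_prod (\<lambda>x y. theta (t / (x * y)) p) (Suc m) z *
     pair_prod (\<lambda>x y. y * theta (x / y) p) (Suc m) z * W z"

text \<open>With this value the poles \<alpha>, t * c / \<alpha>, z k and the zeros a1, a2, t * z k
  have equal products, as \<open>theta_partial_fractions\<close> requires.\<close>

definition c :: complex where "c = t ^ m * a1 * a2"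

definition value_at :: "complex \<Rightarrow> complex" where
  "value_at \<alpha> = torus_mean (Suc m) (\<lambda>z. base z * (\<Prod>k<Suc m. z k * theta_pair p c \<alpha> (z k)))"

lemma c_nonzero: "c \<noteq> 0" using nz by (simp add: c_def)

lemma continuous_on_s_component [continuous_intros]: "continuous_on torus (\<lambda>z. s (z k))"
  by (rule continuous_on_compose2[OF s continuous_on_torus_component]) (auto simp: torusD)

lemma continuous_on_base: "continuous_on torus base"
  unfolding base_def using p nz
  by (intro continuous_intros continuous_on_pair_prod W) (auto simp: torusD)

lemma continuous_on_integrand:
  "\<alpha> \<noteq> 0 \<Longrightarrow> continuous_on torus (\<lambda>z. base z * (\<Prod>k<Suc m. z k * theta_pair p c \<alpha> (z k)))"
  using p nz c_nonzero by (intro continuous_intros continuous_on_base) (auto simp: torusD)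

lemma base_transpose:
  assumes z: "z \<in> torus" and ij: "i \<le> m" "j \<le> m" "i \<noteq> j"
  shows "base (z \<circ> Transposition.transpose i j) = base z"
proof -
  have ij': "i < Suc m" "j < Suc m" using ij by auto
  have "pair_prod (\<lambda>x y. theta (t / (x * y)) p) (Suc m) (z \<circ> Transposition.transpose i j) =
     1 * pair_prod (\<lambda>x y. theta (t / (x * y)) p) (Suc m) z"
    by (rule pair_prod_transpose) (use ij' ij in \<open>auto simp: mult.commute\<close>)
  moreover have "pair_prod (\<lambda>x y. y * theta (x / y) p) (Suc m) (z \<circ> Transposition.transpose i j) =
     (-1) * pair_prod (\<lambda>x y. y * theta (x / y) p) (Suc m) z"
  proof (rule pair_prod_transpose)
    show "z a * theta (z b / z a) p = -1 * (z b * theta (z a / z b) p)" for a b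
      using theta_divide_swap[OF p, of "z b" "z a"] torusD(2)[OF z] by simp
  qed (use ij' ij in auto)
  ultimately show ?thesis
    unfolding base_def prod_transpose[OF ij', of s z] W_transpose[OF z ij] by simp
qed

text \<open>The integrand of the vanishing boundary term; symmetrizing it over the variables is what the
  partial fraction expansion computes.\<close>

definition boundary :: "complex \<Rightarrow> (nat \<Rightarrow> complex) \<Rightarrow> complex" where
  "boundary \<alpha> z = (z m ^ (m + 2) * s (z m) * theta (a1 / z m) p * theta (a2 / z m) p *
     (\<Prod>j<m. theta (t * z j / z m) p * theta (t / (z j * z m)) p) * W z) *
     ((\<Prod>j<m. s (z j) * (z j ^ 2 * theta (\<alpha> / z j) p * theta (t * c / \<alpha> / z j) p)) *
      pair_prod (\<lambda>x y. theta (t / (x * y)) p) m z * pair_prod (\<lambda>x y. y * theta (x / y) p) m z)"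

lemma continuous_on_boundary: "\<alpha> \<noteq> 0 \<Longrightarrow> continuous_on torus (boundary \<alpha>)"
  unfolding boundary_def using p nz c_nonzero
  by (intro continuous_intros continuous_on_pair_prod W) (auto simp: torusD)

lemma torus_mean_boundary:
  assumes "\<alpha> \<noteq> 0"
  shows "torus_mean (Suc m) (boundary \<alpha>) = 0"
proof -
  \<comment> \<open>The part of \<open>boundary\<close> without the last variable; what remains is
    the integrand of \<open>vanish\<close>.\<close>
  let ?R = "\<lambda>z. (\<Prod>j<m. s (z j) * (z j ^ 2 * theta (\<alpha> / z j) p * theta (t * c / \<alpha> / z j) p)) *
      pair_prod (\<lambda>x y. theta (t / (x * y)) p) m z * pair_prod (\<lambda>x y. y * theta (x / y) p) m z"
  have R: "?R (z(m := u)) = ?R z" for z u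
    by (intro arg_cong2[where f = "(*)"] prod.cong pair_prod_cong) auto
  have "torus_mean (Suc m) (boundary \<alpha>) = torus_mean m (\<lambda>z. circle_mean (\<lambda>u. boundary \<alpha> (z(m := u))))"
    by (rule torus_mean_Suc[OF continuous_on_boundary[OF assms]])
  also have "\<dots> = torus_mean m (\<lambda>z. 0)"
  proof (rule torus_mean_cong)
    fix z :: "nat \<Rightarrow> complex" assume z: "z \<in> torus"
    have "boundary \<alpha> (z(m := u)) = ?R z * (u ^ (m + 2) * s u * theta (a1 / u) p * theta (a2 / u) p *
        (\<Prod>j<m. theta (t * z j / u) p * theta (t / (z j * u)) p) * W (z(m := u)))" for u
    proof -
      have "(\<Prod>j<m. theta (t * (z(m := u)) j / u) p * theta (t / ((z(m := u)) j * u)) p) =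
         (\<Prod>j<m. theta (t * z j / u) p * theta (t / (z j * u)) p)"
        by (intro prod.cong) auto
      then show ?thesis unfolding boundary_def R fun_upd_same by (simp only: mult_ac)
    qed
    then show "circle_mean (\<lambda>u. boundary \<alpha> (z(m := u))) = 0"
      using vanish[OF z] by (simp only: circle_mean_mult mult_zero_right)
  qed
  finally show ?thesis by simp
qed

text \<open>Moving z i into the last place expresses the boundary integrand through the symmetric
  \<open>base\<close>. The cofactor is, up to theta t, the partial fraction term at the pole z i
  with the denominators of \<alpha> and \<beta> cleared.\<close>

lemma boundary_at_transposed:
  assumes z: "z \<in> torus" and i: "i \<le> m" and \<alpha>: "\<alpha> \<noteq> 0"
    and gen: "\<And>i j. i < Suc m \<Longrightarrow> j < Suc m \<Longrightarrow> i \<noteq> j \<Longrightarrow> theta (z i / z j) p \<noteq> 0"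
  shows "boundary \<alpha> (z \<circ> Transposition.transpose i m) = base z * (z i ^ 2 * theta (a1 / z i) p * theta (a2 / z i) p *
     (\<Prod>j\<in>{..<Suc m} - {i}. theta (t * z j / z i) p / theta (z j / z i) p *
       (z j ^ 2 * theta (\<alpha> / z j) p * theta (t * c / \<alpha> / z j) p)))"
proof -
  have last: "boundary \<alpha> y = base y * (y m ^ 2 * theta (a1 / y m) p * theta (a2 / y m) p *
     (\<Prod>j<m. theta (t * y j / y m) p / theta (y j / y m) p *
       (y j ^ 2 * theta (\<alpha> / y j) p * theta (t * c / \<alpha> / y j) p)))"
    if y: "y \<in> torus" and gen: "\<And>i j. i < Suc m \<Longrightarrow> j < Suc m \<Longrightarrow> i \<noteq> j \<Longrightarrow> theta (y i / y j) p \<noteq> 0" for y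
  proof -
    have ne: "(\<Prod>j<m. theta (y j / y m) p) \<noteq> 0" using gen by (auto simp: prod_zero_iff)
    let ?D = "\<Prod>j<m. theta (y j / y m) p"
    let ?P = "\<Prod>j<m. theta (t * y j / y m) p / theta (y j / y m) p *
       (y j ^ 2 * theta (\<alpha> / y j) p * theta (t * c / \<alpha> / y j) p)"
    let ?Q = "y m ^ 2 * theta (a1 / y m) p * theta (a2 / y m) p"
    let ?C = "(\<Prod>k<m. s (y k)) * s (y m) * (pair_prod (\<lambda>x y. theta (t / (x * y)) p) m y *
        (\<Prod>j<m. theta (t / (y j * y m)) p)) * pair_prod (\<lambda>x y. y * theta (x / y) p) m y *
        y m ^ m * W y"
    have base: "base y = ?C * ?D"
      by (simp add: base_def pair_prod_Suc prod.distrib mult_ac)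
    have "base y * (?Q * ?P) = ?C * ?Q * (?P * ?D)" unfolding base by (simp only: mult_ac)
    also have "?P * ?D = (\<Prod>j<m. theta (t * y j / y m) p) * (\<Prod>j<m. y j ^ 2 * theta (\<alpha> / y j) p * theta (t * c / \<alpha> / y j) p)"
      unfolding prod.distrib[symmetric] using gen by (intro prod.cong refl) auto
    also have "?C * ?Q * \<dots> = boundary \<alpha> y"
      unfolding boundary_def prod.distrib power_add by (simp only: mult_ac)
    finally show ?thesis ..
  qed
  let ?\<tau> = "Transposition.transpose i m"
  let ?y = "z \<circ> ?\<tau>"
  have y: "?y \<in> torus" using z by (rule torus_comp)
  have geny: "theta (?y k / ?y j) p \<noteq> 0" if "k < Suc m" "j < Suc m" "k \<noteq> j" for k j
    using gen[of "?\<tau> k" "?\<tau> j"] that i by (auto simp: Transposition.transpose_def)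
  have ym: "?y m = z i" by simp
  have base_y: "base ?y = base z"
    using base_transpose[OF z i order.refl] by (cases "i = m") auto
  have "(\<Prod>j<m. f (?y j)) = (\<Prod>j\<in>{..<Suc m} - {i}. f (z j))" for f :: "complex \<Rightarrow> complex"
    by (rule prod.reindex_bij_witness[where i = ?\<tau> and j = ?\<tau>]) (use i in \<open>auto simp: Transposition.transpose_def split: if_splits\<close>)
  note reindex = this[of "\<lambda>x. theta (t * x / z i) p / theta (x / z i) p *
       (x ^ 2 * theta (\<alpha> / x) p * theta (t * c / \<alpha> / x) p)"]
  have "boundary \<alpha> ?y = base ?y * (?y m ^ 2 * theta (a1 / ?y m) p * theta (a2 / ?y m) p *
     (\<Prod>j<m. theta (t * ?y j / ?y m) p / theta (?y j / ?y m) p *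
       (?y j ^ 2 * theta (\<alpha> / ?y j) p * theta (t * c / \<alpha> / ?y j) p)))"
    by (rule last[OF y geny])
  then show ?thesis unfolding ym base_y reindex .
qed

text \<open>At the pole \<alpha> the factor theta (t * x / \<alpha>) is theta (\<alpha> / t / x) up
  to a monomial, so the residue carries the pair function at \<alpha> / t. Because
  \<open>theta_pair\<close> is unchanged under a -> c / a, the pole \<beta> = t * c / \<alpha> leads
  back to \<alpha> itself.\<close>

lemma pole_term:
  assumes "x \<noteq> 0" "\<alpha> \<noteq> 0" "\<beta> \<noteq> 0" "\<alpha> * \<beta> = t * c" "theta (x / \<alpha>) p \<noteq> 0"
  shows "theta (t * x / \<alpha>) p / theta (x / \<alpha>) p * (x ^ 2 * theta (\<alpha> / x) p * theta (\<beta> / x) p) =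
    t * (x * theta_pair p c (\<alpha> / t) x)"
proof -
  have 1: "theta (t * x / \<alpha>) p = - (t * x / \<alpha>) * theta (\<alpha> / t / x) p"
    using theta_divide_swap[OF p, of "t * x" \<alpha>] assms nz by simp
  have 2: "theta (\<alpha> / x) p = - (\<alpha> / x) * theta (x / \<alpha>) p"
    using theta_divide_swap[OF p, of \<alpha> x] assms by simp
  have "c / (\<alpha> / t * x) = t * c / (\<alpha> * x)" using assms nz by simp
  then have 3: "c / (\<alpha> / t * x) = \<beta> / x" using assms(2) unfolding assms(4)[symmetric] by simp
  have "- (t * x / \<alpha>) * A / B * (x ^ 2 * (- (\<alpha> / x) * B) * C) = t * (x * (x * A * C))"
    if "B \<noteq> 0" for A B C :: complex
    using assms that by (simp add: field_simps power2_eq_square)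
  then show ?thesis unfolding theta_pair_def 1 2 3 using assms(5) by blast
qed

text \<open>Partial fractions over the poles \<alpha>, \<beta> and z i, multiplied by
  \<open>base\<close> and by a product clearing denominators. The poles z i give the transposed
  boundary terms, whose means are 0; the other two poles give the two values.\<close>

lemma relation:
  assumes \<alpha>: "\<alpha> \<noteq> 0" and \<beta>: "\<beta> = t * c / \<alpha>" and ne: "theta (\<beta> / \<alpha>) p \<noteq> 0"
  shows "theta (a1 / \<alpha>) p * theta (a2 / \<alpha>) p / theta (\<beta> / \<alpha>) p * value_at (\<alpha> / t) +
    theta (a1 / \<beta>) p * theta (a2 / \<beta>) p / theta (\<alpha> / \<beta>) p * value_at \<alpha> = 0"
proof -
  have \<beta>0: "\<beta> \<noteq> 0" using \<beta> \<alpha> c_nonzero nz by simp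
  have ne': "theta (\<alpha> / \<beta>) p \<noteq> 0" using ne theta_divide_eq_0_commute[OF p \<alpha> \<beta>0] by simp
  define C1 where "C1 = theta (a1 / \<alpha>) p * theta (a2 / \<alpha>) p / theta (\<beta> / \<alpha>) p"
  define C2 where "C2 = theta (a1 / \<beta>) p * theta (a2 / \<beta>) p / theta (\<alpha> / \<beta>) p"
  define I where "I = (\<lambda>\<alpha> z. base z * (\<Prod>k<Suc m. z k * theta_pair p c \<alpha> (z k)))"
  define F where "F = (\<lambda>z. (\<Sum>i<Suc m. theta t p * boundary \<alpha> (z \<circ> Transposition.transpose i m)) +
     t ^ Suc m * (C1 * I (\<alpha> / t) z + C2 * I \<alpha> z))"
  have cI: "continuous_on torus (I \<alpha>)" "continuous_on torus (I (\<alpha> / t))"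
    unfolding I_def using \<alpha> nz by (auto intro!: continuous_on_integrand simp del: prod.lessThan_Suc)
  have cB: "continuous_on torus (\<lambda>z. boundary \<alpha> (z \<circ> Transposition.transpose i m))" for i
    by (rule continuous_on_compose2[OF continuous_on_boundary[OF \<alpha>]])
      (auto intro!: continuous_on_comp_index continuous_on_id torus_comp)
  \<comment> \<open>Partial fractions need distinct poles, so the pointwise identity is first
    obtained for generic z.\<close>
  have "F z = 0" if "z \<in> torus" for z
  proof (rule eq_on_torus_by_generic[of F "Suc m" p "[\<alpha>, \<beta>]" z])
    show "continuous_on torus F" unfolding F_def by (intro continuous_intros cI cB)
    fix z :: "nat \<Rightarrow> complex" assume z: "z \<in> torus"
      and g1: "\<And>i j. i < Suc m \<Longrightarrow> j < Suc m \<Longrightarrow> i \<noteq> j \<Longrightarrow> theta (z i / z j) p \<noteq> 0"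
      and g2: "\<And>i x. i < Suc m \<Longrightarrow> x \<in> set [\<alpha>, \<beta>] \<Longrightarrow> theta (z i / x) p \<noteq> 0"
    have z0: "z i \<noteq> 0" for i by (rule torusD(2)[OF z])
    have th1: "theta 1 p = 0" using p by simp
    have inj: "inj_on z {..<Suc m}"
    proof (rule inj_onI, rule ccontr)
      fix i j assume "i \<in> {..<Suc m}" "j \<in> {..<Suc m}" "z i = z j" "i \<noteq> j"
      then show False using g1[of i j] z0[of j] th1 by simp
    qed
    define Z where "Z = z ` {..<Suc m}"
    have ab: "\<alpha> \<noteq> \<beta>" using ne th1 \<beta>0 by auto
    have nin: "x \<notin> Z" if "x \<in> {\<alpha>, \<beta>}" for x
    proof
      assume "x \<in> Z"
      then obtain i where "i < Suc m" "x = z i" by (auto simp: Z_def)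
      then show False using g2[of i x] that th1 z0[of i] by auto
    qed
    then have nin: "\<alpha> \<notin> Z" "\<beta> \<notin> Z" by auto
    have g2': "theta (x / z i) p \<noteq> 0" if "i < Suc m" "x \<in> {\<alpha>, \<beta>}" for i x
      using g2[of i x] that theta_divide_eq_0_commute[OF p, of "z i" x] z0 \<alpha> \<beta>0 by auto
    define X where "X = insert \<alpha> (insert \<beta> Z)"
    define ys where "ys = a1 # a2 # map (\<lambda>j. t * z j) [0..<Suc m]"
    have PF: "(\<Sum>x\<in>X. (\<Prod>y\<leftarrow>ys. theta (y / x) p) / (\<Prod>x'\<in>X-{x}. theta (x' / x) p)) = 0"
    proof (rule theta_partial_fractions[OF p])
      show "finite X" "X \<noteq> {}" by (auto simp: X_def Z_def)
      show "0 \<notin> X" using \<alpha> \<beta>0 z0 by (auto simp: X_def Z_def)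
      show "theta (x / y) p \<noteq> 0" if "x \<in> X" "y \<in> X" "x \<noteq> y" for x y
        using that ne ne' g1 g2 g2' unfolding X_def Z_def by auto
      show "length ys = card X"
        using nin ab inj by (simp add: ys_def X_def Z_def card_image del: upt_Suc)
      have "prod_list ys = a1 * a2 * (t ^ Suc m * (\<Prod>j<Suc m. z j))"
        unfolding ys_def prod_list.Cons prod_list_map_upt by (simp add: prod.distrib mult_ac del: prod.lessThan_Suc)
      also have "\<dots> = \<alpha> * (\<beta> * \<Prod>Z)"
        using inj \<alpha> by (simp add: Z_def prod.reindex \<beta> c_def field_simps del: prod.lessThan_Suc)
      also have "\<dots> = \<Prod>X" using nin ab by (simp add: X_def Z_def)
      finally show "prod_list ys = \<Prod>X" .
    qed
    define N where "N = (\<lambda>x. theta (a1 / x) p * theta (a2 / x) p * (\<Prod>j<Suc m. theta (t * z j / x) p))"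
    have N: "(\<Prod>y\<leftarrow>ys. theta (y / x) p) = N x" for x
      unfolding ys_def by (simp add: N_def prod_list_map_upt o_def mult_ac del: upt_Suc prod.lessThan_Suc)
    have "(\<Sum>x\<in>X. N x / (\<Prod>x'\<in>X-{x}. theta (x' / x) p)) =
      N \<alpha> / (\<Prod>x'\<in>X-{\<alpha>}. theta (x' / \<alpha>) p) + (N \<beta> / (\<Prod>x'\<in>X-{\<beta>}. theta (x' / \<beta>) p) +
      (\<Sum>i<Suc m. N (z i) / (\<Prod>x'\<in>X-{z i}. theta (x' / z i) p)))"
      using nin ab inj unfolding X_def by (simp add: Z_def sum.reindex del: sum.lessThan_Suc)
    also have "(\<Prod>x'\<in>X-{\<alpha>}. theta (x' / \<alpha>) p) = theta (\<beta> / \<alpha>) p * (\<Prod>j<Suc m. theta (z j / \<alpha>) p)"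
    proof -
      have "X - {\<alpha>} = insert \<beta> Z" using nin ab by (auto simp: X_def)
      then show ?thesis using nin inj by (simp add: Z_def prod.reindex del: prod.lessThan_Suc)
    qed
    also have "(\<Prod>x'\<in>X-{\<beta>}. theta (x' / \<beta>) p) = theta (\<alpha> / \<beta>) p * (\<Prod>j<Suc m. theta (z j / \<beta>) p)"
    proof -
      have "X - {\<beta>} = insert \<alpha> Z" using nin ab by (auto simp: X_def)
      then show ?thesis using nin inj by (simp add: Z_def prod.reindex del: prod.lessThan_Suc)
    qed
    also have "(\<Sum>i<Suc m. N (z i) / (\<Prod>x'\<in>X-{z i}. theta (x' / z i) p)) =
      (\<Sum>i<Suc m. N (z i) / (theta (\<alpha> / z i) p * (theta (\<beta> / z i) p * (\<Prod>j\<in>{..<Suc m}-{i}. theta (z j / z i) p))))"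
    proof (rule sum.cong[OF refl])
      fix i assume i: "i \<in> {..<Suc m}"
      have "X - {z i} = insert \<alpha> (insert \<beta> (z ` ({..<Suc m} - {i})))"
        using nin inj i by (auto simp: X_def Z_def inj_on_def)
      moreover have "\<alpha> \<notin> insert \<beta> (z ` ({..<Suc m} - {i}))" "\<beta> \<notin> z ` ({..<Suc m} - {i})"
        using nin ab by (auto simp: Z_def)
      moreover have "inj_on z ({..<Suc m} - {i})" using inj by (rule inj_on_subset) auto
      ultimately have "(\<Prod>x'\<in>X-{z i}. theta (x' / z i) p) =
        theta (\<alpha> / z i) p * (theta (\<beta> / z i) p * (\<Prod>j\<in>{..<Suc m}-{i}. theta (z j / z i) p))"
        by (simp add: prod.reindex)
      then show "N (z i) / (\<Prod>x'\<in>X-{z i}. theta (x' / z i) p) =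
        N (z i) / (theta (\<alpha> / z i) p * (theta (\<beta> / z i) p * (\<Prod>j\<in>{..<Suc m}-{i}. theta (z j / z i) p)))" by simp
    qed
    finally have PF': "N \<alpha> / (theta (\<beta> / \<alpha>) p * (\<Prod>j<Suc m. theta (z j / \<alpha>) p)) +
      (N \<beta> / (theta (\<alpha> / \<beta>) p * (\<Prod>j<Suc m. theta (z j / \<beta>) p)) +
      (\<Sum>i<Suc m. N (z i) / (theta (\<alpha> / z i) p * (theta (\<beta> / z i) p * (\<Prod>j\<in>{..<Suc m}-{i}. theta (z j / z i) p))))) = 0"
      using PF unfolding N by simp
    define k where "k = (\<lambda>x. x ^ 2 * theta (\<alpha> / x) p * theta (\<beta> / x) p)"
    define P where "P = (\<Prod>j<Suc m. k (z j))"
    have A1: "N \<alpha> / (theta (\<beta> / \<alpha>) p * (\<Prod>j<Suc m. theta (z j / \<alpha>) p)) * P =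
       t ^ Suc m * C1 * (\<Prod>j<Suc m. z j * theta_pair p c (\<alpha> / t) (z j))"
    proof -
      have "(\<Prod>j<Suc m. theta (t * z j / \<alpha>) p) / (\<Prod>j<Suc m. theta (z j / \<alpha>) p) * P =
          (\<Prod>j<Suc m. t * (z j * theta_pair p c (\<alpha> / t) (z j)))"
        unfolding P_def k_def prod_dividef[symmetric] prod.distrib[symmetric]
        by (intro prod.cong refl pole_term) (use z0 \<alpha> \<beta>0 \<beta> g2 in auto)
      also have "\<dots> = t ^ Suc m * (\<Prod>j<Suc m. z j * theta_pair p c (\<alpha> / t) (z j))"
        by (simp only: prod.distrib prod_constant card_lessThan)
      finally have e: "(\<Prod>j<Suc m. theta (t * z j / \<alpha>) p) / (\<Prod>j<Suc m. theta (z j / \<alpha>) p) * P =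
        t ^ Suc m * (\<Prod>j<Suc m. z j * theta_pair p c (\<alpha> / t) (z j))" .
      have "N \<alpha> / (theta (\<beta> / \<alpha>) p * (\<Prod>j<Suc m. theta (z j / \<alpha>) p)) * P = C1 *
        ((\<Prod>j<Suc m. theta (t * z j / \<alpha>) p) / (\<Prod>j<Suc m. theta (z j / \<alpha>) p) * P)"
        unfolding N_def C1_def by (simp add: mult_ac del: prod.lessThan_Suc power_Suc)
      then show ?thesis unfolding e by (simp only: mult_ac)
    qed
    have A2: "N \<beta> / (theta (\<alpha> / \<beta>) p * (\<Prod>j<Suc m. theta (z j / \<beta>) p)) * P =
       t ^ Suc m * C2 * (\<Prod>j<Suc m. z j * theta_pair p c \<alpha> (z j))"
    proof -
      have "(\<Prod>j<Suc m. theta (t * z j / \<beta>) p) / (\<Prod>j<Suc m. theta (z j / \<beta>) p) * P =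
          (\<Prod>j<Suc m. t * (z j * theta_pair p c \<alpha> (z j)))"
        unfolding P_def k_def prod_dividef[symmetric] prod.distrib[symmetric]
      proof (intro prod.cong refl)
        fix j assume j: "j \<in> {..<Suc m}"
        have "theta (t * z j / \<beta>) p / theta (z j / \<beta>) p * (z j ^ 2 * theta (\<beta> / z j) p * theta (\<alpha> / z j) p) =
          t * (z j * theta_pair p c (\<beta> / t) (z j))"
        proof (rule pole_term[OF z0 \<beta>0 \<alpha>])
          show "\<beta> * \<alpha> = t * c" using \<alpha> \<beta> by simp
          show "theta (z j / \<beta>) p \<noteq> 0" using g2[of j \<beta>] j by simp
        qed
        also have "theta_pair p c (\<beta> / t) (z j) = theta_pair p c \<alpha> (z j)"
        proof -
          have "t * c = \<alpha> * \<beta>" using \<alpha> \<beta> by simp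
          moreover have "c / (\<beta> / t * z j) = t * c / (\<beta> * z j)" using nz by simp
          ultimately have "c / (\<beta> / t * z j) = \<alpha> / z j" using \<beta>0 by simp
          moreover have "\<beta> / t / z j = c / (\<alpha> * z j)" using nz by (simp add: \<beta>)
          ultimately show ?thesis by (simp add: theta_pair_def)
        qed
        finally show "theta (t * z j / \<beta>) p / theta (z j / \<beta>) p * (z j ^ 2 * theta (\<alpha> / z j) p * theta (\<beta> / z j) p) =
          t * (z j * theta_pair p c \<alpha> (z j))" by (simp only: mult_ac)
      qed
      also have "\<dots> = t ^ Suc m * (\<Prod>j<Suc m. z j * theta_pair p c \<alpha> (z j))"
        by (simp only: prod.distrib prod_constant card_lessThan)
      finally have e: "(\<Prod>j<Suc m. theta (t * z j / \<beta>) p) / (\<Prod>j<Suc m. theta (z j / \<beta>) p) * P =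
        t ^ Suc m * (\<Prod>j<Suc m. z j * theta_pair p c \<alpha> (z j))" .
      have "N \<beta> / (theta (\<alpha> / \<beta>) p * (\<Prod>j<Suc m. theta (z j / \<beta>) p)) * P = C2 *
        ((\<Prod>j<Suc m. theta (t * z j / \<beta>) p) / (\<Prod>j<Suc m. theta (z j / \<beta>) p) * P)"
        unfolding N_def C2_def by (simp add: mult_ac del: prod.lessThan_Suc power_Suc)
      then show ?thesis unfolding e by (simp only: mult_ac)
    qed
    \<comment> \<open>The factor k (z i) of P cancels the two theta functions in the denominator,
      and the numerator factor with j = i is theta t.\<close>
    have A3: "base z * (N (z i) / (theta (\<alpha> / z i) p * (theta (\<beta> / z i) p * (\<Prod>j\<in>{..<Suc m}-{i}. theta (z j / z i) p))) * P) =
       theta t p * boundary \<alpha> (z \<circ> Transposition.transpose i m)" if i: "i < Suc m" for i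
    proof -
      have Pi: "P = k (z i) * (\<Prod>j\<in>{..<Suc m}-{i}. k (z j))"
        unfolding P_def using i by (intro prod.remove) auto
      have Ni: "(\<Prod>j<Suc m. theta (t * z j / z i) p) = theta t p * (\<Prod>j\<in>{..<Suc m}-{i}. theta (t * z j / z i) p)"
        using i z0[of i] by (subst prod.remove[of _ i]) auto
      have d: "theta (\<alpha> / z i) p \<noteq> 0" "theta (\<beta> / z i) p \<noteq> 0" using g2' i by auto
      have "N (z i) / (theta (\<alpha> / z i) p * (theta (\<beta> / z i) p * (\<Prod>j\<in>{..<Suc m}-{i}. theta (z j / z i) p))) * P =
        theta t p * (z i ^ 2 * theta (a1 / z i) p * theta (a2 / z i) p *
          ((\<Prod>j\<in>{..<Suc m}-{i}. theta (t * z j / z i) p) / (\<Prod>j\<in>{..<Suc m}-{i}. theta (z j / z i) p) *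
           (\<Prod>j\<in>{..<Suc m}-{i}. k (z j))))"
        unfolding N_def Ni Pi using d by (simp add: k_def field_simps)
      also have "(\<Prod>j\<in>{..<Suc m}-{i}. theta (t * z j / z i) p) / (\<Prod>j\<in>{..<Suc m}-{i}. theta (z j / z i) p) *
           (\<Prod>j\<in>{..<Suc m}-{i}. k (z j)) =
          (\<Prod>j\<in>{..<Suc m} - {i}. theta (t * z j / z i) p / theta (z j / z i) p * k (z j))"
        by (simp only: prod.distrib prod_dividef)
      finally show ?thesis
        using boundary_at_transposed[OF z _ \<alpha> g1, of i] i unfolding k_def \<beta> by (simp add: mult_ac)
    qed
    have "0 = base z * ((N \<alpha> / (theta (\<beta> / \<alpha>) p * (\<Prod>j<Suc m. theta (z j / \<alpha>) p)) +
      (N \<beta> / (theta (\<alpha> / \<beta>) p * (\<Prod>j<Suc m. theta (z j / \<beta>) p)) +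
      (\<Sum>i<Suc m. N (z i) / (theta (\<alpha> / z i) p * (theta (\<beta> / z i) p * (\<Prod>j\<in>{..<Suc m}-{i}. theta (z j / z i) p)))))) * P)"
      unfolding PF' by simp
    also have "\<dots> = base z * (N \<alpha> / (theta (\<beta> / \<alpha>) p * (\<Prod>j<Suc m. theta (z j / \<alpha>) p)) * P) +
      base z * (N \<beta> / (theta (\<alpha> / \<beta>) p * (\<Prod>j<Suc m. theta (z j / \<beta>) p)) * P) +
      (\<Sum>i<Suc m. base z * (N (z i) / (theta (\<alpha> / z i) p * (theta (\<beta> / z i) p * (\<Prod>j\<in>{..<Suc m}-{i}. theta (z j / z i) p))) * P))"
      by (simp only: distrib_left distrib_right sum_distrib_left sum_distrib_right add.assoc)
    also have "\<dots> = F z"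
      unfolding A1 A2 using A3
      by (simp add: F_def I_def algebra_simps del: sum.lessThan_Suc prod.lessThan_Suc power_Suc)
    finally show "F z = 0" by simp
  qed (use p \<alpha> \<beta>0 that in auto)
  then have "torus_mean (Suc m) F = torus_mean (Suc m) (\<lambda>z. 0)" by (rule torus_mean_cong)
  moreover have "torus_mean (Suc m) F =
     torus_mean (Suc m) (\<lambda>z. \<Sum>i<Suc m. theta t p * boundary \<alpha> (z \<circ> Transposition.transpose i m)) +
     t ^ Suc m * (C1 * value_at (\<alpha> / t) + C2 * value_at \<alpha>)"
  proof -
    have v: "value_at x = torus_mean (Suc m) (I x)" for x by (simp only: value_at_def I_def)
    have "torus_mean (Suc m) F =
      torus_mean (Suc m) (\<lambda>z. \<Sum>i<Suc m. theta t p * boundary \<alpha> (z \<circ> Transposition.transpose i m)) +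
      torus_mean (Suc m) (\<lambda>z. t ^ Suc m * (C1 * I (\<alpha> / t) z + C2 * I \<alpha> z))"
      unfolding F_def by (intro torus_mean_add continuous_intros cI cB)
    also have "torus_mean (Suc m) (\<lambda>z. t ^ Suc m * (C1 * I (\<alpha> / t) z + C2 * I \<alpha> z)) =
      t ^ Suc m * torus_mean (Suc m) (\<lambda>z. C1 * I (\<alpha> / t) z + C2 * I \<alpha> z)"
      by (rule torus_mean_mult)
    also have "torus_mean (Suc m) (\<lambda>z. C1 * I (\<alpha> / t) z + C2 * I \<alpha> z) =
      torus_mean (Suc m) (\<lambda>z. C1 * I (\<alpha> / t) z) + torus_mean (Suc m) (\<lambda>z. C2 * I \<alpha> z)"
      by (intro torus_mean_add continuous_intros cI)
    finally show ?thesis by (simp only: v torus_mean_mult)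
  qed
  moreover have "torus_mean (Suc m) (\<lambda>z. \<Sum>i<Suc m. theta t p * boundary \<alpha> (z \<circ> Transposition.transpose i m)) = 0"
  proof (subst torus_mean_sum)
    show "continuous_on torus (\<lambda>z. theta t p * boundary \<alpha> (z \<circ> Transposition.transpose i m))" for i
      by (intro continuous_intros cB)
    have "torus_mean (Suc m) (\<lambda>z. boundary \<alpha> (z \<circ> Transposition.transpose i m)) = 0" if "i < Suc m" for i
      using torus_mean_transpose[OF continuous_on_boundary[OF \<alpha>], of i "Suc m" m] torus_mean_boundary[OF \<alpha>] that by simp
    then show "(\<Sum>i<Suc m. torus_mean (Suc m) (\<lambda>z. theta t p * boundary \<alpha> (z \<circ> Transposition.transpose i m))) = 0"
      by (intro sum.neutral ballI) simp
  qed
  ultimately have "t ^ Suc m * (C1 * value_at (\<alpha> / t) + C2 * value_at \<alpha>) = 0" by simp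
  then show ?thesis using nz by (simp add: C1_def C2_def)
qed

text \<open>At \<alpha> = t ^ r * a1 one has \<beta> = t ^ (m + 1 - r) * a2, and the step from
  \<alpha> / t to \<alpha> divides by theta (a2 / \<beta>). This is possible up to r = m; at r = m +
  1 the chain breaks because \<beta> = a2.\<close>

lemma value_at_root:
  assumes "r \<le> m"
  shows "value_at (t ^ r * a1) = 0"
  using assms
proof (induction r)
  case 0
  define \<beta> where "\<beta> = t * c / a1"
  have \<beta>: "\<beta> = t ^ Suc m * a2" using nz by (simp add: \<beta>_def c_def)
  have e: "\<beta> / a1 = t powi (int (Suc m)) * a2 / a1" "a1 / \<beta> = 1 / (t powi (int (Suc m)) * a2 / a1)" "a2 / \<beta> = 1 / t ^ Suc m"
    using nz by (simp_all add: \<beta> del: power_Suc of_nat_Suc)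
  have inv: "theta (1 / u) p \<noteq> 0" if "theta u p \<noteq> 0" "u \<noteq> 0" for u
    using theta_inverse[OF p that(2)] that by simp
  have "theta (\<beta> / a1) p \<noteq> 0" unfolding e by (rule generic1)
  from relation[OF nz(2) \<beta>_def this]
  have "theta (a1 / \<beta>) p * theta (a2 / \<beta>) p / theta (a1 / \<beta>) p * value_at a1 = 0"
    using p nz by simp
  moreover have "theta (a1 / \<beta>) p \<noteq> 0" unfolding e by (rule inv[OF generic1]) (use nz in simp)
  moreover have "theta (a2 / \<beta>) p \<noteq> 0" unfolding e by (rule inv[OF generic2]) (use nz in auto)
  ultimately show ?case by simp
next
  case (Suc r)
  define \<alpha> where "\<alpha> = t ^ Suc r * a1"
  define \<beta> where "\<beta> = t * c / \<alpha>"
  have \<alpha>0: "\<alpha> \<noteq> 0" using nz by (simp add: \<alpha>_def)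
  have \<alpha>t: "\<alpha> / t = t ^ r * a1" using nz by (simp add: \<alpha>_def)
  obtain d where d: "m = r + d" "d \<ge> 1" using Suc.prems by (metis Suc_le_eq less_imp_add_positive Suc_leI One_nat_def)
  have "t ^ m = t ^ r * t ^ d" by (simp add: d power_add)
  then have \<beta>: "\<beta> = t ^ d * a2" using nz unfolding \<beta>_def \<alpha>_def c_def by simp
  have \<beta>0: "\<beta> \<noteq> 0" using nz by (simp add: \<beta>)
  have e: "\<beta> / \<alpha> = t powi (int d - int (Suc r)) * a2 / a1" "a1 / \<beta> = 1 / (t powi (int d) * a2 / a1)" "a2 / \<beta> = 1 / t ^ d"
    using nz by (simp_all add: \<beta> \<alpha>_def power_int_diff del: power_Suc of_nat_Suc)
  have inv: "theta (1 / u) p \<noteq> 0" if "theta u p \<noteq> 0" "u \<noteq> 0" for u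
    using theta_inverse[OF p that(2)] that by simp
  have ne: "theta (\<beta> / \<alpha>) p \<noteq> 0" unfolding e by (rule generic1)
  from relation[OF \<alpha>0 \<beta>_def ne]
  have "theta (a1 / \<beta>) p * theta (a2 / \<beta>) p / theta (\<alpha> / \<beta>) p * value_at \<alpha> = 0"
    using Suc by (simp add: \<alpha>t)
  moreover have "theta (a1 / \<beta>) p \<noteq> 0" unfolding e by (rule inv[OF generic1]) (use nz in simp)
  moreover have "theta (a2 / \<beta>) p \<noteq> 0" unfolding e by (rule inv[OF generic2]) (use nz d in auto)
  moreover have "theta (\<alpha> / \<beta>) p \<noteq> 0" using ne theta_divide_eq_0_commute[OF p \<alpha>0 \<beta>0] by simp
  ultimately show ?case by (simp add: \<alpha>_def)
qed

text \<open>If y is not in R, the difference of the two sides, as a polynomial in x, has degree at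
  most n but vanishes on R and at y.\<close>

lemma poly_proportional:
  fixes Q :: "complex poly"
  assumes Q: "degree Q \<le> n" and R: "finite R" "card R = n" "\<And>r. r \<in> R \<Longrightarrow> poly Q r = 0"
  shows "poly Q x * (\<Prod>r\<in>R. r - y) = poly Q y * (\<Prod>r\<in>R. r - x)"
proof (cases "y \<in> R")
  case True
  then show ?thesis using R by (simp add: prod_zero_iff)
next
  case False
  define D where "D = smult (\<Prod>r\<in>R. r - y) Q - smult (poly Q y) (\<Prod>r\<in>R. [:r, -1:])"
  have "degree (\<Prod>r\<in>R. [:r, -1 :: complex:]) \<le> (\<Sum>r\<in>R. degree [:r, -1 :: complex:])"
    using degree_prod_sum_le[OF R(1), of "\<lambda>r. [:r, -1:]"] by (simp add: o_def)
  then have "degree D \<le> n"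
    unfolding D_def using Q R(2) by (intro degree_diff_le order.trans[OF degree_smult_le]) auto
  moreover have "insert y R \<subseteq> {x. poly D x = 0}"
    using R by (auto simp: D_def poly_prod prod_zero_iff)
  moreover have "card (insert y R) = Suc n" using False R by simp
  ultimately have "D = 0"
    using card_poly_roots_bound[of D] card_mono[OF poly_roots_finite[of D], of "insert y R"] by (cases "D = 0") auto
  then have "poly D x = 0" by simp
  then show ?thesis by (simp add: D_def poly_prod mult.commute)
qed

text \<open>By the three-term relation each pair function is a combination of two fixed ones with
  coefficients X x and Y x. Hence value_at x is homogeneous of degree m + 1 in these coefficients,
  given by a polynomial Q in Y x / X x, and the m + 1 known zeros determine Q up to a
  factor.\<close>

lemma value_at_proportional:
  assumes \<alpha>: "\<alpha> \<noteq> 0" and \<alpha>': "\<alpha>' \<noteq> 0"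
  shows "value_at \<alpha> * (\<Prod>r<Suc m. theta_pair p c \<alpha>' (t ^ r * a1)) =
    value_at \<alpha>' * (\<Prod>r<Suc m. theta_pair p c \<alpha> (t ^ r * a1))"
proof -
  let ?g = "theta_pair p c"
  let ?r = "\<lambda>r. t ^ r * a1"
  have c0: "c \<noteq> 0" by (rule c_nonzero)
  have r0: "?r r \<noteq> 0" for r using nz by simp
  \<comment> \<open>Second basis point, chosen so that the coordinate X is nonzero wherever a
    quotient Y / X will be formed.\<close>
  obtain \<gamma> where \<gamma>: "\<gamma> \<noteq> 0" "\<And>x. x \<in> insert \<alpha> (insert \<alpha>' (?r ` {..<Suc m})) \<Longrightarrow> ?g x \<gamma> \<noteq> 0"
  proof -
    have ev: "\<forall>\<^sub>F u in at 0. theta (1 / x * exp (1 * u)) p \<noteq> 0 \<and> theta (x / c * exp (1 * u)) p \<noteq> 0" if "x \<noteq> 0" for x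
      using that c0 by (intro eventually_conj eventually_theta_exp_nonzero[OF p]) auto
    have "\<forall>\<^sub>F u in at 0. \<forall>x\<in>insert \<alpha> (insert \<alpha>' (?r ` {..<Suc m})).
        theta (1 / x * exp (1 * u)) p \<noteq> 0 \<and> theta (x / c * exp (1 * u)) p \<noteq> 0"
      using \<alpha> \<alpha>' nz by (intro eventually_ball_finite ballI ev) auto
    then obtain u where u: "\<And>x. x \<in> insert \<alpha> (insert \<alpha>' (?r ` {..<Suc m})) \<Longrightarrow>
        theta (1 / x * exp (1 * u)) p \<noteq> 0 \<and> theta (x / c * exp (1 * u)) p \<noteq> 0"
      using eventually_happens'[of "at (0::complex)"] by fastforce
    have "?g x (exp u) \<noteq> 0" if x: "x \<in> insert \<alpha> (insert \<alpha>' (?r ` {..<Suc m}))" for x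
    proof -
      have x0: "x \<noteq> 0" using x \<alpha> \<alpha>' nz by auto
      have "theta (x / exp u) p \<noteq> 0"
        using u[OF x] theta_divide_eq_0_commute[OF p x0 exp_not_eq_zero, of u] by (simp add: field_simps)
      moreover have "theta (c / (x * exp u)) p \<noteq> 0"
        using u[OF x] theta_divide_eq_0_commute[OF p c0, of "x * exp u"] x0 by (simp add: field_simps)
      ultimately show ?thesis by (simp add: theta_pair_def)
    qed
    then show ?thesis using that[of "exp u"] by simp
  qed
  define G where "G = ?g \<alpha> \<gamma>"
  have G: "G \<noteq> 0" using \<gamma> by (simp add: G_def)
  define X where "X = (\<lambda>x. ?g x \<gamma>)"
  define Y where "Y = (\<lambda>x. - ?g x \<alpha>)"
  have lin: "?g x w = (X x * ?g \<alpha> w + Y x * ?g \<gamma> w) / G" if "x \<noteq> 0" "w \<noteq> 0" for x w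
  proof -
    have "?g x w * ?g \<alpha> \<gamma> + ?g x \<alpha> * ?g \<gamma> w + ?g x \<gamma> * ?g w \<alpha> = 0"
      by (rule theta_pair_three_term[OF p c0 that \<alpha> \<gamma>(1)])
    then have "?g x w * G = X x * ?g \<alpha> w + Y x * ?g \<gamma> w"
      unfolding theta_pair_swap[OF p \<alpha> that(2), of c] X_def Y_def G_def by (simp add: algebra_simps add_eq_0_iff)
    then show ?thesis using G by (simp add: field_simps)
  qed
  have lin': "?g x w = (X x * Y w - Y x * X w) / G" if "x \<noteq> 0" "w \<noteq> 0" for x w
    using lin[OF that] theta_pair_swap[OF p that(2) \<alpha>, of c] theta_pair_swap[OF p that(2) \<gamma>(1), of c]
    by (simp add: X_def Y_def)
  \<comment> \<open>Coefficients from multiplying out the product over the variables; E collects the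
    indices that contribute the second basis function.\<close>
  define M where "M = (\<lambda>E. torus_mean (Suc m) (\<lambda>z. base z *
      ((\<Prod>k\<in>E. z k * ?g \<gamma> (z k) / G) * (\<Prod>k\<in>{..<Suc m} - E. z k * ?g \<alpha> (z k) / G))))"
  define Q where "Q = (\<Sum>E\<in>Pow {..<Suc m}. monom (M E) (card E))"
  have degQ: "degree Q \<le> Suc m"
    unfolding Q_def
  proof (rule degree_sum_le)
    fix E assume "E \<in> Pow {..<Suc m}"
    then have "card E \<le> Suc m" using card_mono[of "{..<Suc m}" E] by simp
    then show "degree (monom (M E) (card E)) \<le> Suc m" using degree_monom_le order.trans by blast
  qed simp
  have UQ: "value_at x = X x ^ Suc m * poly Q (Y x / X x)" if x: "x \<noteq> 0" "X x \<noteq> 0" for x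
  proof -
    let ?y = "Y x / X x"
    have "value_at x = torus_mean (Suc m) (\<lambda>z. X x ^ Suc m * (\<Sum>E\<in>Pow {..<Suc m}. ?y ^ card E * (base z *
      ((\<Prod>k\<in>E. z k * ?g \<gamma> (z k) / G) * (\<Prod>k\<in>{..<Suc m} - E. z k * ?g \<alpha> (z k) / G)))))"
      unfolding value_at_def
    proof (rule torus_mean_cong)
      fix z :: "nat \<Rightarrow> complex" assume z: "z \<in> torus"
      have "(\<Prod>k<Suc m. z k * ?g x (z k)) =
          (\<Prod>k<Suc m. X x * (?y * (z k * ?g \<gamma> (z k) / G) + z k * ?g \<alpha> (z k) / G))"
      proof (intro prod.cong refl)
        fix k
        have "w * ((A * a + B * b) / G) = A * (B / A * (w * b / G) + w * a / G)" if "A \<noteq> 0" for w A B a b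
          using that G by (simp add: field_simps)
        then show "z k * ?g x (z k) = X x * (?y * (z k * ?g \<gamma> (z k) / G) + z k * ?g \<alpha> (z k) / G)"
          unfolding lin[OF x(1) torusD(2)[OF z]] using x(2) by blast
      qed
      also have "\<dots> = X x ^ Suc m * (\<Prod>k<Suc m. ?y * (z k * ?g \<gamma> (z k) / G) + z k * ?g \<alpha> (z k) / G)"
        by (simp only: prod.distrib prod_constant card_lessThan)
      also have "(\<Prod>k<Suc m. ?y * (z k * ?g \<gamma> (z k) / G) + z k * ?g \<alpha> (z k) / G) =
        (\<Sum>E\<in>Pow {..<Suc m}. (\<Prod>k\<in>E. ?y * (z k * ?g \<gamma> (z k) / G)) * (\<Prod>k\<in>{..<Suc m} - E. z k * ?g \<alpha> (z k) / G))"
        by (rule prod_add) simp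
      also have "\<dots> = (\<Sum>E\<in>Pow {..<Suc m}. ?y ^ card E * ((\<Prod>k\<in>E. z k * ?g \<gamma> (z k) / G) * (\<Prod>k\<in>{..<Suc m} - E. z k * ?g \<alpha> (z k) / G)))"
        by (simp only: prod.distrib prod_constant mult.assoc)
      finally show "base z * (\<Prod>k<Suc m. z k * ?g x (z k)) = X x ^ Suc m * (\<Sum>E\<in>Pow {..<Suc m}. ?y ^ card E * (base z *
        ((\<Prod>k\<in>E. z k * ?g \<gamma> (z k) / G) * (\<Prod>k\<in>{..<Suc m} - E. z k * ?g \<alpha> (z k) / G))))"
        by (simp only: sum_distrib_left mult_ac)
    qed
    also have "\<dots> = X x ^ Suc m * (\<Sum>E\<in>Pow {..<Suc m}. ?y ^ card E * M E)"
      unfolding torus_mean_mult M_def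
      by (subst torus_mean_sum)
        (use p c0 \<gamma> \<alpha> G in \<open>auto intro!: continuous_intros continuous_on_base simp: torusD simp del: prod.lessThan_Suc\<close>)
    also have "(\<Sum>E\<in>Pow {..<Suc m}. ?y ^ card E * M E) = poly Q ?y"
      by (simp add: Q_def poly_sum poly_monom mult.commute)
    finally show ?thesis .
  qed
  define yr where "yr = (\<lambda>r. Y (?r r) / X (?r r))"
  have Xr: "X (?r r) \<noteq> 0" if "r < Suc m" for r using \<gamma>(2) that by (auto simp: X_def)
  have gX: "?g x (?r r) = (X x * X (?r r) / G) * (yr r - Y x / X x)" if "x \<noteq> 0" "X x \<noteq> 0" "r < Suc m" for x r
    unfolding lin'[OF that(1) r0] yr_def using that(2) Xr[OF that(3)] G by (simp add: field_simps)
  \<comment> \<open>Two equal roots would make the pair function vanish between t ^ i * a1 and t ^ j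
    * a1, against \<open>generic1\<close> and \<open>generic2\<close>.\<close>
  have inj: "inj_on yr {..<Suc m}"
  proof (rule inj_onI, rule ccontr)
    fix i j assume ij: "i \<in> {..<Suc m}" "j \<in> {..<Suc m}" "yr i = yr j" "i \<noteq> j"
    have gen: "?g (?r i) (?r j) \<noteq> 0" if ij: "i < Suc m" "j < Suc m" "i < j" for i j
    proof -
      have inv: "theta (1 / u) p \<noteq> 0" if "theta u p \<noteq> 0" "u \<noteq> 0" for u
        using theta_inverse[OF p that(2)] that by simp
      have "?r i / ?r j = 1 / t ^ (j - i)" using ij nz by (simp add: power_diff)
      moreover have "theta (1 / t ^ (j - i)) p \<noteq> 0"
        by (rule inv[OF generic2]) (use ij nz in auto)
      moreover have "c / (?r i * ?r j) = t powi (int m - int i - int j) * a2 / a1"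
        using nz by (simp add: c_def power_int_diff power_int_add field_simps)
      ultimately show ?thesis using generic1[of "int m - int i - int j"] r0[of j] by (simp only: theta_pair_def) simp
    qed
    have "?g (?r i) (?r j) = 0"
      using gX[OF r0, of i j] ij Xr[of i] by (simp add: yr_def)
    moreover have "?g (?r j) (?r i) = 0"
      using gX[OF r0, of j i] ij Xr[of j] by (simp add: yr_def)
    ultimately show False using gen[of i j] gen[of j i] ij by (cases "i < j") auto
  qed
  have X\<alpha>: "X \<alpha> \<noteq> 0" "X \<alpha>' \<noteq> 0" using \<gamma>(2) by (auto simp: X_def)
  have root: "poly Q y = 0" if "y \<in> yr ` {..<Suc m}" for y
  proof -
    from that obtain r where "y = yr r" "r \<in> {..<Suc m}" by (rule imageE)
    then have r: "r < Suc m" "y = yr r" by (simp_all only: lessThan_iff)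
    have "value_at (?r r) = 0" using value_at_root[of r] r by simp
    then show ?thesis using UQ[OF r0 Xr[OF r(1)]] Xr[OF r(1)] r by (simp add: yr_def)
  qed
  have P: "(\<Prod>r<Suc m. ?g x (?r r)) = X x ^ Suc m * (\<Prod>r<Suc m. X (?r r) / G) * (\<Prod>y\<in>yr ` {..<Suc m}. y - Y x / X x)"
    if "x \<noteq> 0" "X x \<noteq> 0" for x
  proof -
    have "(\<Prod>r<Suc m. ?g x (?r r)) = (\<Prod>r<Suc m. X x * (X (?r r) / G) * (yr r - Y x / X x))"
      by (intro prod.cong refl) (simp add: gX that)
    also have "\<dots> = X x ^ Suc m * (\<Prod>r<Suc m. X (?r r) / G) * (\<Prod>r<Suc m. yr r - Y x / X x)"
      by (simp only: prod.distrib prod_constant card_lessThan)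
    also have "(\<Prod>r<Suc m. yr r - Y x / X x) = (\<Prod>y\<in>yr ` {..<Suc m}. y - Y x / X x)"
      using inj by (subst prod.reindex) auto
    finally show ?thesis .
  qed
  have "poly Q (Y \<alpha> / X \<alpha>) * (\<Prod>y\<in>yr ` {..<Suc m}. y - Y \<alpha>' / X \<alpha>') =
     poly Q (Y \<alpha>' / X \<alpha>') * (\<Prod>y\<in>yr ` {..<Suc m}. y - Y \<alpha> / X \<alpha>)"
    using inj by (intro poly_proportional[OF degQ]) (auto simp: card_image root)
  then have "A * B * C * (poly Q (Y \<alpha> / X \<alpha>) * (\<Prod>y\<in>yr ` {..<Suc m}. y - Y \<alpha>' / X \<alpha>')) =
     A * B * C * (poly Q (Y \<alpha>' / X \<alpha>') * (\<Prod>y\<in>yr ` {..<Suc m}. y - Y \<alpha> / X \<alpha>))" for A B C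
    by (simp only:)
  from this[of "X \<alpha> ^ Suc m" "X \<alpha>' ^ Suc m" "\<Prod>r<Suc m. X (?r r) / G"] show ?thesis
    unfolding UQ[OF \<alpha> X\<alpha>(1)] UQ[OF \<alpha>' X\<alpha>(2)] P[OF \<alpha> X\<alpha>(1)] P[OF \<alpha>' X\<alpha>(2)]
    by (simp only: mult_ac)
qed

end

subsection \<open>The weights and the symmetric integral\<close>

lemma flip_torus: "z \<in> torus \<Longrightarrow> flip E z \<in> torus"
  by (auto simp: torus_def flip_def norm_divide)

lemma torus_subset_nonzero: "torus \<subseteq> {z. \<forall>i. z i \<noteq> 0}"
  by (auto simp: torusD)

lemma continuous_on_flip_torus: "continuous_on torus (flip E)"
  using continuous_on_flip torus_subset_nonzero by (rule continuous_on_subset)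

lemma torus_mean_flip_set:
  assumes G: "continuous_on torus G" and E: "finite E" "E \<subseteq> {..<n}"
  shows "torus_mean n (\<lambda>z. G (flip E z)) = torus_mean n G"
  using E
proof (induction E)
  case (insert i E)
  have "flip (insert i E) z = flip E (z(i := 1 / z i))" for z using insert by (auto simp: flip_def)
  moreover have "continuous_on torus (\<lambda>z. G (flip E z))"
    by (rule continuous_on_compose2[OF G continuous_on_flip_torus]) (auto simp: flip_torus)
  ultimately show ?case using torus_mean_flip[of "\<lambda>z. G (flip E z)" i n] insert by simp
qed simp

lemma flip_antisym:
  assumes F: "\<And>z i. \<forall>i. z i \<noteq> 0 \<Longrightarrow> i < n \<Longrightarrow> F (z(i := 1 / z i)) = - F z"
    and E: "finite E" "E \<subseteq> {..<n}" and z: "\<forall>i. z i \<noteq> 0"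
  shows "F (flip E z) = (-1) ^ card E * (F z :: complex)"
  using E
proof (induction E)
  case (insert i E)
  have "flip (insert i E) z = (flip E z)(i := 1 / flip E z i)" using insert by (auto simp: flip_def)
  then have "F (flip (insert i E) z) = - F (flip E z)" using F[OF flip_nonzero[OF z], of i E] insert by simp
  then show ?case using insert by simp
qed simp

text \<open>The mean is invariant under inversions, and the sign that F acquires cancels the sign in
  the sum, so all 2 ^ n terms are equal.\<close>

lemma torus_mean_flip_sum:
  assumes H: "continuous_on torus H" and F: "continuous_on torus F"
    and anti: "\<And>z i. \<forall>i. z i \<noteq> 0 \<Longrightarrow> i < n \<Longrightarrow> F (z(i := 1 / z i)) = - F z"
  shows "torus_mean n (\<lambda>z. flip_sum n H z * F z) = 2 ^ n * torus_mean n (\<lambda>z. H z * F z)"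
proof -
  have HE: "continuous_on torus (\<lambda>z. H (flip E z))" for E
    by (rule continuous_on_compose2[OF H continuous_on_flip_torus]) (auto simp: flip_torus)
  have "torus_mean n (\<lambda>z. flip_sum n H z * F z) =
      torus_mean n (\<lambda>z. \<Sum>E\<in>Pow {..<n}. (-1) ^ card E * (H (flip E z) * F z))"
    by (simp add: flip_sum_def sum_distrib_right mult.assoc)
  also have "\<dots> = (\<Sum>E\<in>Pow {..<n}. (-1) ^ card E * torus_mean n (\<lambda>z. H (flip E z) * F z))"
    by (subst torus_mean_sum) (auto intro!: continuous_intros HE F)
  also have "\<dots> = (\<Sum>E\<in>Pow {..<n}. torus_mean n (\<lambda>z. H z * F z))"
  proof (rule sum.cong[OF refl])
    fix E assume "E \<in> Pow {..<n}"
    then have E: "finite E" "E \<subseteq> {..<n}" by (auto intro: finite_subset)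
    have "torus_mean n (\<lambda>z. H z * F z) = torus_mean n (\<lambda>z. (\<lambda>z. H z * F z) (flip E z))"
      by (rule torus_mean_flip_set[symmetric]) (use E in \<open>auto intro!: continuous_intros H F\<close>)
    also have "\<dots> = torus_mean n (\<lambda>z. (-1) ^ card E * (H (flip E z) * F z))"
    proof (rule torus_mean_cong)
      fix z :: "nat \<Rightarrow> complex" assume "z \<in> torus"
      then have "\<forall>i. z i \<noteq> 0" by (simp add: torusD)
      from flip_antisym[where F = F, OF anti E this]
      show "H (flip E z) * F (flip E z) = (-1) ^ card E * (H (flip E z) * F z)" by simp
    qed
    finally show "(-1) ^ card E * torus_mean n (\<lambda>z. H (flip E z) * F z) = torus_mean n (\<lambda>z. H z * F z)" by simp
  qed
  finally show ?thesis by (simp add: card_Pow)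
qed

lemma torus_mean_permute:
  assumes \<sigma>: "\<sigma> permutes {..<n}" and G: "continuous_on torus G"
  shows "torus_mean n (\<lambda>z. G (z \<circ> \<sigma>)) = torus_mean n G"
  using \<sigma> finite_lessThan[of n] G
proof (induction arbitrary: G rule: permutes_induct)
  case id
  then show ?case by simp
next
  case (swap a b p)
  have c: "continuous_on torus (\<lambda>z. G (z \<circ> p))"
    by (rule continuous_on_compose2[OF swap.prems continuous_on_comp_index[OF continuous_on_id]])
      (auto simp: torus_comp)
  have "torus_mean n (\<lambda>z. G (z \<circ> (Transposition.transpose a b \<circ> p))) =
      torus_mean n (\<lambda>z. (\<lambda>z. G (z \<circ> p)) (z \<circ> Transposition.transpose a b))"
    by (simp only: o_assoc)
  also have "\<dots> = torus_mean n (\<lambda>z. G (z \<circ> p))"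
    by (rule torus_mean_transpose[OF c]) (use swap in auto)
  also have "\<dots> = torus_mean n G" by (rule swap.IH[OF swap.prems])
  finally show ?case .
qed

lemma torus_mean_perm_sum:
  assumes H: "continuous_on torus H" and F: "continuous_on torus F"
    and anti: "\<And>z i j. \<forall>i. z i \<noteq> 0 \<Longrightarrow> i < n \<Longrightarrow> j < n \<Longrightarrow> i \<noteq> j \<Longrightarrow> F (z \<circ> Transposition.transpose i j) = - F z"
  shows "torus_mean n (\<lambda>z. perm_sum n H z * F z) = fact n * torus_mean n (\<lambda>z. H z * F z)"
proof -
  have H\<sigma>: "continuous_on torus (\<lambda>z. H (z \<circ> \<sigma>))" for \<sigma>
    by (rule continuous_on_compose2[OF H continuous_on_comp_index[OF continuous_on_id]]) (auto simp: torus_comp)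
  have "torus_mean n (\<lambda>z. perm_sum n H z * F z) =
      torus_mean n (\<lambda>z. \<Sum>\<sigma> | \<sigma> permutes {..<n}. of_int (sign \<sigma>) * (H (z \<circ> \<sigma>) * F z))"
    by (simp only: perm_sum_def sum_distrib_right mult.assoc)
  also have "\<dots> = (\<Sum>\<sigma> | \<sigma> permutes {..<n}. of_int (sign \<sigma>) * torus_mean n (\<lambda>z. H (z \<circ> \<sigma>) * F z))"
    by (subst torus_mean_sum) (auto intro!: continuous_intros H\<sigma> F)
  also have "\<dots> = (\<Sum>\<sigma> | \<sigma> permutes {..<n}. torus_mean n (\<lambda>z. H z * F z))"
  proof (rule sum.cong[OF refl])
    fix \<sigma> assume "\<sigma> \<in> {\<sigma>. \<sigma> permutes {..<n}}"
    then have \<sigma>: "\<sigma> permutes {..<n}" by simp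
    have "torus_mean n (\<lambda>z. H z * F z) = torus_mean n (\<lambda>z. (\<lambda>z. H z * F z) (z \<circ> \<sigma>))"
      by (rule torus_mean_permute[OF \<sigma>, symmetric]) (intro continuous_intros H F)
    also have "\<dots> = torus_mean n (\<lambda>z. of_int (sign \<sigma>) * (H (z \<circ> \<sigma>) * F z))"
    proof (rule torus_mean_cong)
      fix z :: "nat \<Rightarrow> complex" assume "z \<in> torus"
      then have "\<forall>i. z i \<noteq> 0" by (simp add: torusD)
      from perm_antisym[where f = F, OF \<sigma> anti this]
      show "H (z \<circ> \<sigma>) * F (z \<circ> \<sigma>) = of_int (sign \<sigma>) * (H (z \<circ> \<sigma>) * F z)" by simp
    qed
    finally have e: "torus_mean n (\<lambda>z. H z * F z) = of_int (sign \<sigma>) * torus_mean n (\<lambda>z. H (z \<circ> \<sigma>) * F z)"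
      unfolding torus_mean_mult .
    show "of_int (sign \<sigma>) * torus_mean n (\<lambda>z. H (z \<circ> \<sigma>) * F z) = torus_mean n (\<lambda>z. H z * F z)"
      by (rule e[symmetric])
  qed
  finally show ?thesis by (simp add: card_permutations)
qed

section \<open>Even weights and the density\<close>

definition qpoch_pm :: "complex \<Rightarrow> complex list \<Rightarrow> complex \<Rightarrow> complex" where
  "qpoch_pm q bs x = (\<Prod>b\<leftarrow>bs. qpoch_inf (b * x) q * qpoch_inf (b / x) q)"

lemma qpoch_pm_simps [simp]:
  "qpoch_pm q [] x = 1"
  "qpoch_pm q (b # bs) x = qpoch_inf (b * x) q * qpoch_inf (b / x) q * qpoch_pm q bs x"
  by (simp_all add: qpoch_pm_def)

lemma qpoch_pm_inverse: "qpoch_pm q bs (1 / x) = qpoch_pm q bs x"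
  by (induction bs) simp_all

lemma qpoch_pm_mset:
  assumes "mset bs = mset cs"
  shows "qpoch_pm q bs x = qpoch_pm q cs x"
proof -
  have "(\<Prod>b\<leftarrow>bs. f b) = prod_mset (image_mset f (mset bs))" for bs and f :: "complex \<Rightarrow> complex"
    by (simp only: mset_map[symmetric] prod_mset_prod_list)
  then show ?thesis unfolding qpoch_pm_def by (simp only: assms)
qed

lemma qpoch_pm_nonzero:
  assumes "norm q < 1" "\<And>b. b \<in> set bs \<Longrightarrow> norm b < 1" "norm x = 1"
  shows "qpoch_pm q bs x \<noteq> 0"
  using assms(2)
  by (induction bs) (simp_all add: norm_mult norm_divide assms qpoch_inf_nonzero)

lemma continuous_on_qpoch_pm [continuous_intros]:
  assumes "norm q < 1" "continuous_on A f" "\<And>x. x \<in> A \<Longrightarrow> f x \<noteq> 0"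
  shows "continuous_on A (\<lambda>x. qpoch_pm q bs (f x))"
  using assms by (induction bs) (auto intro!: continuous_intros)

definition pair_den :: "complex \<Rightarrow> complex \<Rightarrow> complex \<Rightarrow> complex \<Rightarrow> complex" where
  "pair_den q t x y = qpoch_inf (t * (x * y)) q * qpoch_inf (t / (x * y)) q *
     (qpoch_inf (t * x / y) q * qpoch_inf (t * y / x) q)"

lemma pair_den_commute: "pair_den q t x y = pair_den q t y x"
  by (simp add: pair_den_def mult_ac)

lemma pair_den_inverse: "pair_den q t (1 / x) y = pair_den q t x y"
  by (simp add: pair_den_def mult_ac)

lemma pair_den_nonzero:
  assumes "norm q < 1" "norm t < 1" "norm x = 1" "norm y = 1"
  shows "pair_den q t x y \<noteq> 0"
  using assms by (simp add: pair_den_def norm_mult norm_divide qpoch_inf_nonzero)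

text \<open>The density without its numerators. It is invariant under permutations, and under
  inversions when X (1 / x) = X x, so antisymmetry of an integrand is decided by the numerators
  alone.\<close>

definition omega :: "complex \<Rightarrow> complex \<Rightarrow> (complex \<Rightarrow> complex) \<Rightarrow> nat \<Rightarrow> (nat \<Rightarrow> complex) \<Rightarrow> complex" where
  "omega q t X n z = (\<Prod>k<n. X (z k)) / pair_prod (pair_den q t) n z"

lemma omega_0 [simp]: "omega q t X 0 z = 1"
  by (simp add: omega_def)

lemma omega_Suc: "omega q t X (Suc m) z = omega q t X m z * (X (z m) / (\<Prod>j<m. pair_den q t (z j) (z m)))"
  by (simp add: omega_def pair_prod_Suc)

lemma omega_cong:
  "(\<And>k. k < n \<Longrightarrow> X (z k) = X' (z k)) \<Longrightarrow> omega q t X n z = omega q t X' n z"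
  by (simp add: omega_def)

lemma omega_upd: "n \<le> i \<Longrightarrow> omega q t X n (z(i := u)) = omega q t X n z"
  unfolding omega_def by (intro arg_cong2[where f = "(/)"] prod.cong pair_prod_cong) auto

lemma omega_mult: "omega q t (\<lambda>x. e x * X x) n z = (\<Prod>k<n. e (z k)) * omega q t X n z"
  by (simp add: omega_def prod.distrib)

lemma continuous_on_omega:
  assumes q: "norm q < 1" "norm t < 1" and X: "continuous_on (sphere 0 1) X"
  shows "continuous_on torus (omega q t X n)"
proof -
  have "continuous_on torus (\<lambda>z. X (z k))" for k
    by (rule continuous_on_compose2[OF X continuous_on_torus_component]) (auto simp: torusD)
  moreover have "continuous_on torus (\<lambda>z. pair_prod (pair_den q t) n z)"
    unfolding pair_den_def using q by (intro continuous_on_pair_prod continuous_intros) (auto simp: torusD)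
  moreover have "pair_prod (pair_den q t) n z \<noteq> 0" if "z \<in> torus" for z
    using that by (intro pair_prod_nonzero pair_den_nonzero q) (auto simp: torusD)
  ultimately show ?thesis unfolding omega_def by (intro continuous_intros) auto
qed

lemma omega_transpose:
  assumes "i < n" "j < n" "i \<noteq> j"
  shows "omega q t X n (z \<circ> Transposition.transpose i j) = omega q t X n z"
proof -
  have "pair_prod (pair_den q t) n (z \<circ> Transposition.transpose i j) = 1 * pair_prod (pair_den q t) n z"
  proof (rule pair_prod_transpose)
    show "pair_den q t (z b) (z a) = 1 * pair_den q t (z a) (z b)" for a b
      using pair_den_commute[of q t "z b" "z a"] by simp
  qed (use assms in auto)
  then show ?thesis unfolding omega_def prod_transpose[OF assms(1,2), of X z] by simp
qed

lemma omega_flip: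
  assumes "X (1 / z i) = X (z i)" "i < n"
  shows "omega q t X n (z(i := 1 / z i)) = omega q t X n z"
proof -
  have "pair_prod (pair_den q t) n (z(i := 1 / z i)) = (\<Prod>j\<in>{..<n}-{i}. 1) * pair_prod (pair_den q t) n z"
    by (rule pair_prod_upd[OF assms(2)])
      (simp_all add: pair_den_inverse pair_den_commute[of q t _ "1 / z i"] pair_den_commute[of q t _ "z i"])
  moreover have "(\<Prod>k<n. X ((z(i := 1 / z i)) k)) = (\<Prod>k<n. X (z k))"
    unfolding prod_upd[OF assms(2), of X z] assms(1) using assms(2) by (intro prod.remove[symmetric]) auto
  ultimately show ?thesis by (simp add: omega_def)
qed

lemma BC_vandermonde_Suc:
  "BC_vandermonde p (Suc m) z = BC_vandermonde p m z * (z m * theta (1 / z m ^ 2) p *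
     (\<Prod>j<m. theta (z j * z m) p * theta (z m / z j) p / z m))"
  by (simp add: BC_vandermonde_def pair_prod_Suc mult_ac)

lemma BC_vandermonde_upd: "n \<le> i \<Longrightarrow> BC_vandermonde p n (z(i := u)) = BC_vandermonde p n z"
  by (rule BC_vandermonde_cong) auto

lemma continuous_on_BC_vandermonde_torus: "norm p < 1 \<Longrightarrow> continuous_on torus (BC_vandermonde p n)"
  using continuous_on_BC_vandermonde torus_subset_nonzero by (rule continuous_on_subset)

text \<open>A = 0 makes the numerator 1, so weights with and without a numerator parameter are
  covered together.\<close>

definition weight_pm :: "complex \<Rightarrow> complex \<Rightarrow> complex list \<Rightarrow> complex \<Rightarrow> complex" where
  "weight_pm q A as x = qpoch_pm q [A] x / qpoch_pm q as x"

lemma weight_pm_inverse: "weight_pm q A as (1 / x) = weight_pm q A as x"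
  by (simp only: weight_pm_def qpoch_pm_inverse)

lemma continuous_on_weight_pm:
  assumes "norm q < 1" "\<And>a. a \<in> set as \<Longrightarrow> norm a < 1"
  shows "continuous_on (sphere 0 1) (weight_pm q A as)"
proof -
  have "qpoch_pm q as x \<noteq> 0" if "x \<in> sphere 0 1" for x
    using that by (intro qpoch_pm_nonzero assms) auto
  moreover have "x \<noteq> 0" if "x \<in> sphere 0 1" for x :: complex using that by auto
  ultimately have "continuous_on (sphere 0 1) (\<lambda>x. qpoch_pm q [A] x / qpoch_pm q as x)"
    using assms(1) by (intro continuous_on_divide continuous_on_qpoch_pm continuous_on_id ballI)
  then show ?thesis by (simp only: weight_pm_def[abs_def])
qed

text \<open>The product of the Vandermonde factors of nome 0 and \<open>q\<close> is, up to the sign \<open>(-1) ^ n\<close>, the usual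
  numerator: \<open>(x\<^sup>2; q)\<close> and \<open>(x\<^sup>-\<^sup>2; q)\<close> for each variable, \<open>(x y, 1/(x y), x/y, y/x; q)\<close> for each pair.\<close>

definition BC_integral :: "complex \<Rightarrow> complex \<Rightarrow> nat \<Rightarrow> complex \<Rightarrow> complex list \<Rightarrow> complex" where
  "BC_integral q t n A as =
     torus_mean n (\<lambda>z. BC_vandermonde 0 n z * BC_vandermonde q n z * omega q t (weight_pm q A as) n z)"

lemma BC_integral_mset: "mset as = mset bs \<Longrightarrow> BC_integral q t n A as = BC_integral q t n A bs"
  unfolding BC_integral_def weight_pm_def using qpoch_pm_mset[of as bs] by simp

context torus_functional
begin

text \<open>The pair factors of \<open>base\<close> are those of \<open>BC_kernel\<close>. If at
  some \<alpha> the one-variable factors are those of the kernel times an even function e, the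
  integrand is the kernel times an antisymmetric function, and unfolding the sum over inversions
  replaces the kernel by a multiple of the Vandermonde. This is applied at both nomes.\<close>

lemma value_at_kernel:
  assumes W_flip: "\<And>z i. \<forall>i. z i \<noteq> 0 \<Longrightarrow> i < Suc m \<Longrightarrow> W (z(i := 1 / z i)) = - W z"
    and e: "continuous_on (sphere 0 1) e" "\<And>x. x \<noteq> 0 \<Longrightarrow> e (1 / x) = e x"
    and b: "b1 \<noteq> 0" "b2 \<noteq> 0" "b3 \<noteq> 0" and A: "A = b1 * b2 * b3 * t ^ m"
    and V: "BC_vandermonde p (Suc m) (\<lambda>k. b1 * t ^ k) \<noteq> 0"
    and fac: "\<And>x. norm x = 1 \<Longrightarrow> s x * (x * theta_pair p c \<alpha> x) =
      \<gamma> * e x * (x * theta (A * x) p * theta (b1 / x) p * theta (b2 / x) p * theta (b3 / x) p)"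
  shows "2 ^ Suc m * value_at \<alpha> = \<gamma> ^ Suc m *
    (\<Prod>k<Suc m. theta (t ^ k * b1 * b2) p * theta (t ^ k * b1 * b3) p * theta (t ^ k * b2 * b3) p) *
    torus_mean (Suc m) (\<lambda>z. BC_vandermonde p (Suc m) z * ((\<Prod>k<Suc m. e (z k)) * W z))"
proof -
  let ?K = "BC_kernel p t A b1 b2 b3 (Suc m)"
  let ?\<kappa> = "\<Prod>k<Suc m. theta (t ^ k * b1 * b2) p * theta (t ^ k * b1 * b3) p * theta (t ^ k * b2 * b3) p"
  define F where "F = (\<lambda>z. (\<Prod>k<Suc m. e (z k)) * W z)"
  have A0: "A \<noteq> 0" using A b nz by simp
  have A': "A = b1 * b2 * b3 * t ^ (Suc m - 1)" using A by simp
  have ec: "continuous_on torus (\<lambda>z. e (z k))" for k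
    by (rule continuous_on_compose2[OF e(1) continuous_on_torus_component]) (auto simp: torusD)
  have F: "continuous_on torus F" unfolding F_def by (intro continuous_intros ec W)
  have K: "continuous_on torus ?K"
    unfolding BC_kernel_def using p nz b A0
    by (intro continuous_intros continuous_on_pair_prod) (auto simp: torusD)
  have Fflip: "F (z(i := 1 / z i)) = - F z" if z: "\<forall>i. z i \<noteq> 0" and i: "i < Suc m" for z i
  proof -
    have "(\<Prod>k<Suc m. e ((z(i := 1 / z i)) k)) = (\<Prod>k<Suc m. e (z k))"
      unfolding prod_upd[OF i, of e z] using e(2)[of "z i"] z i by (subst (2) prod.remove[of _ i]) auto
    then show ?thesis unfolding F_def W_flip[OF z i] by simp
  qed
  have int: "base z * (\<Prod>k<Suc m. z k * theta_pair p c \<alpha> (z k)) = \<gamma> ^ Suc m * (?K z * F z)" if z: "z \<in> torus" for z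
  proof -
    have "(\<Prod>k<Suc m. s (z k)) * (\<Prod>k<Suc m. z k * theta_pair p c \<alpha> (z k)) =
        (\<Prod>k<Suc m. \<gamma> * e (z k) * (z k * theta (A * z k) p * theta (b1 / z k) p * theta (b2 / z k) p * theta (b3 / z k) p))"
      unfolding prod.distrib[symmetric] by (intro prod.cong refl fac torusD(1)[OF z])
    also have "\<dots> = \<gamma> ^ Suc m * (\<Prod>k<Suc m. e (z k)) *
        (\<Prod>k<Suc m. z k * theta (A * z k) p * theta (b1 / z k) p * theta (b2 / z k) p * theta (b3 / z k) p)"
      by (simp only: prod.distrib prod_constant card_lessThan mult.assoc)
    finally have 1: "(\<Prod>k<Suc m. s (z k)) * (\<Prod>k<Suc m. z k * theta_pair p c \<alpha> (z k)) = \<dots>" .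
    have "base z * (\<Prod>k<Suc m. z k * theta_pair p c \<alpha> (z k)) =
       ((\<Prod>k<Suc m. s (z k)) * (\<Prod>k<Suc m. z k * theta_pair p c \<alpha> (z k))) *
       (pair_prod (\<lambda>x y. theta (t / (x * y)) p) (Suc m) z * pair_prod (\<lambda>x y. y * theta (x / y) p) (Suc m) z) * W z"
      unfolding base_def by (simp only: mult_ac)
    then show ?thesis
      unfolding 1 BC_kernel_def F_def pair_prod_mult by (simp only: mult_ac)
  qed
  have "2 ^ Suc m * value_at \<alpha> = 2 ^ Suc m * torus_mean (Suc m) (\<lambda>z. \<gamma> ^ Suc m * (?K z * F z))"
    unfolding value_at_def using torus_mean_cong[OF int, where n = "Suc m"] by simp
  also have "\<dots> = \<gamma> ^ Suc m * (2 ^ Suc m * torus_mean (Suc m) (\<lambda>z. ?K z * F z))"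
    unfolding torus_mean_mult by (simp only: mult_ac)
  also have "2 ^ Suc m * torus_mean (Suc m) (\<lambda>z. ?K z * F z) = torus_mean (Suc m) (\<lambda>z. flip_sum (Suc m) ?K z * F z)"
    by (rule torus_mean_flip_sum[symmetric, OF K F Fflip])
  also have "\<dots> = torus_mean (Suc m) (\<lambda>z. ?\<kappa> * (BC_vandermonde p (Suc m) z * F z))"
  proof (rule torus_mean_cong)
    fix z :: "nat \<Rightarrow> complex" assume "z \<in> torus"
    then have "\<forall>i. z i \<noteq> 0" by (simp add: torusD)
    from flip_sum_BC_kernel[OF p nz(1) b A' V this]
    show "flip_sum (Suc m) ?K z * F z = ?\<kappa> * (BC_vandermonde p (Suc m) z * F z)" by (simp only: mult.assoc)
  qed
  finally show ?thesis unfolding torus_mean_mult F_def by (simp only: mult.assoc)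
qed

end

lemma BC_vandermonde_0_geometric_nonzero:
  assumes "norm b < 1" "b \<noteq> 0" "norm t < 1" "t \<noteq> 0"
  shows "BC_vandermonde 0 n (\<lambda>k. b * t ^ k) \<noteq> 0"
proof -
  have lt: "norm (b ^ 2 * t ^ k) < 1" for k
  proof -
    have "norm (b ^ 2 * t ^ k) = norm b ^ 2 * norm t ^ k" by (simp add: norm_mult norm_power)
    also have "\<dots> \<le> norm b ^ 2 * 1" using assms by (intro mult_left_mono power_le_one) auto
    also have "\<dots> < 1" using assms by (simp add: power_less_one_iff abs_square_less_1)
    finally show ?thesis .
  qed
  have ne1: "u \<noteq> 1" if "norm u < 1" for u :: complex using that by auto
  have "b * t ^ k * (b * t ^ k) \<noteq> 1" for k
    using ne1[OF lt[of "k + k"]] by (simp add: power_add power2_eq_square mult_ac)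
  then have 1: "b * t ^ k * theta (1 / (b * t ^ k) ^ 2) 0 \<noteq> 0" for k
    using assms by (simp add: power2_eq_square field_simps)
  have 2: "theta (b * t ^ j * (b * t ^ k)) 0 * theta (b * t ^ k / (b * t ^ j)) 0 / (b * t ^ k) \<noteq> 0" if "j < k" for j k
  proof -
    have "b * t ^ j * (b * t ^ k) \<noteq> 1"
      using ne1[OF lt[of "j + k"]] by (simp add: power_add power2_eq_square mult_ac)
    moreover have "b * t ^ k / (b * t ^ j) = t ^ (k - j)" using assms that by (simp add: power_diff)
    moreover have "t ^ (k - j) \<noteq> 1"
      using that assms by (intro ne1) (simp add: norm_power power_less_one_iff)
    ultimately show ?thesis using assms by simp
  qed
  show ?thesis unfolding BC_vandermonde_def using 1 2 by (auto simp: prod_zero_iff intro!: pair_prod_nonzero)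
qed

subsection \<open>Vanishing of the boundary terms\<close>

text \<open>Invariant under \<open>u \<mapsto> q / u\<close>. The boundary integrand is odd under this reflection and analytic
  between the circles of radius 1 and \<open>norm q\<close>, so its mean over the unit circle is zero.\<close>

definition qpoch_refl :: "complex \<Rightarrow> complex list \<Rightarrow> complex \<Rightarrow> complex" where
  "qpoch_refl q bs u = (\<Prod>b\<leftarrow>bs. qpoch_inf (b * u) q * qpoch_inf (q * b / u) q)"

lemma qpoch_refl_simps [simp]:
  "qpoch_refl q [] u = 1"
  "qpoch_refl q (b # bs) u = qpoch_inf (b * u) q * qpoch_inf (q * b / u) q * qpoch_refl q bs u"
  by (simp_all add: qpoch_refl_def)

lemma qpoch_refl_reflect: "u \<noteq> 0 \<Longrightarrow> q \<noteq> 0 \<Longrightarrow> qpoch_refl q bs (q / u) = qpoch_refl q bs u"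
  by (induction bs) (simp_all add: mult_ac)

lemma qpoch_refl_pm:
  assumes "norm q < 1"
  shows "qpoch_pm q bs u = qpoch_refl q bs u * (\<Prod>b\<leftarrow>bs. 1 - b / u)"
proof (induction bs)
  case (Cons b bs)
  then show ?case using qpoch_inf_rec[OF assms, of "b / u"] by (simp add: mult_ac)
qed simp

lemma qpoch_refl_nonzero:
  assumes "norm q < 1" "q \<noteq> 0" "0 < \<rho>" "\<And>b. b \<in> set bs \<Longrightarrow> norm b \<le> \<rho>" "norm q * \<rho> < norm u" "norm u < 1 / \<rho>"
  shows "qpoch_refl q bs u \<noteq> 0"
  using assms(4)
proof (induction bs)
  case (Cons b bs)
  have b: "norm b \<le> \<rho>" using Cons by simp
  have "norm b * norm u \<le> \<rho> * norm u" using b by (intro mult_right_mono) auto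
  also have "\<rho> * norm u < 1" using assms by (simp add: field_simps)
  finally have 1: "norm (b * u) < 1" by (simp add: norm_mult)
  have u0: "norm u > 0" using assms(2,3,5) by (metis mult_pos_pos order.strict_trans zero_less_norm_iff)
  have "norm q * norm b \<le> norm q * \<rho>" using b by (intro mult_left_mono) auto
  also have "\<dots> < norm u" by (rule assms(5))
  finally have 2: "norm (q * b / u) < 1" using u0 by (simp add: norm_mult norm_divide)
  show ?case using Cons qpoch_inf_nonzero[OF assms(1) 1] qpoch_inf_nonzero[OF assms(1) 2] by simp
qed simp

lemma holomorphic_on_qpoch_refl [holomorphic_intros]:
  assumes "norm q < 1" "0 \<notin> S"
  shows "qpoch_refl q bs holomorphic_on S"
proof (induction bs)
  case Nil
  have "qpoch_refl q [] = (\<lambda>u. 1)" by (simp add: fun_eq_iff)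
  then show ?case by simp
next
  case (Cons b bs)
  have "(\<lambda>u. qpoch_inf (b * u) q * qpoch_inf (q * b / u) q * qpoch_refl q bs u) holomorphic_on S"
    using assms Cons by (intro holomorphic_intros) auto
  moreover have "qpoch_refl q (b # bs) = (\<lambda>u. qpoch_inf (b * u) q * qpoch_inf (q * b / u) q * qpoch_refl q bs u)"
    by (simp add: fun_eq_iff)
  ultimately show ?case by simp
qed

text \<open>The exponent 3 combines u ^ (m + 2) from the boundary term with u / u ^ m from the
  Vandermonde. It is the one power for which the function is odd under u -> q / u.\<close>

lemma theta_cube_reflect:
  assumes "norm q < 1" "q \<noteq> 0" "u \<noteq> 0"
  shows "(q / u) ^ 3 * theta (1 / (q / u) ^ 2) q = - (u ^ 3 * theta (1 / u ^ 2) q)"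
proof -
  have "theta (1 / (q / u) ^ 2) q = theta (u ^ 2 / q / q) q"
    using assms by (simp add: power2_eq_square mult_ac)
  also have "\<dots> = - (u ^ 2 / q / q) * theta (u ^ 2 / q) q"
    using theta_div_nome[OF assms(1,2), of "u ^ 2 / q"] assms by simp
  also have "theta (u ^ 2 / q) q = - (u ^ 2 / q) * theta (u ^ 2) q"
    using theta_div_nome[OF assms(1,2), of "u ^ 2"] assms by simp
  also have "theta (u ^ 2) q = - (u ^ 2) * theta (1 / u ^ 2) q"
    using theta_inverse[OF assms(1), of "u ^ 2"] assms by simp
  finally show ?thesis using assms by (simp add: field_simps power2_eq_square power3_eq_cube)
qed

text \<open>Each linear factor, such as 1 - a / u, adjusts a q-product by one term, which turns the
  weights and the pair denominators into the invariant products \<open>qpoch_refl\<close>. The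
  Vandermonde contributes the odd function of \<open>theta_cube_reflect\<close> and the invariant
  factors theta (z j * u) * theta (u / z j).\<close>

lemma vanish_reflection:
  assumes q: "norm q < 1" "q \<noteq> 0" and t: "norm t < 1"
    and as: "\<And>a. a \<in> set as \<Longrightarrow> norm a < 1" and z: "z \<in> torus"
  shows "circle_mean (\<lambda>u. u ^ (m + 2) * ((1 - A * u) * (\<Prod>a\<leftarrow>as. 1 - a / u)) *
    (\<Prod>j<m. theta (t * z j / u) 0 * theta (t / (z j * u)) 0) *
    (BC_vandermonde q (Suc m) (z(m := u)) * omega q t (weight_pm q (q * A) as) (Suc m) (z(m := u)))) = 0"
proof -
  have zn: "norm (z j) = 1" "z j \<noteq> 0" for j using z by (auto simp: torusD)
  define C where "C = BC_vandermonde q m z * omega q t (weight_pm q (q * A) as) m z"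
  define f where "f = (\<lambda>u. u ^ 3 * theta (1 / u ^ 2) q * (\<Prod>j<m. theta (z j * u) q * theta (u / z j) q) *
     qpoch_refl q [A] u / (qpoch_refl q as u * (\<Prod>j<m. qpoch_refl q [t * z j, t / z j] u)))"
  \<comment> \<open>Bounds the moduli of all parameters and stays below 1, so f is analytic for norm
    q * \<rho> < norm u < 1 / \<rho>, an annulus containing both circles. The entry 1 / 2 keeps
    \<rho> positive.\<close>
  define \<rho> where "\<rho> = Max (insert (1 / 2) (insert (norm t) (norm ` set as)))"
  have \<rho>: "0 < \<rho>" "\<rho> < 1" "norm t \<le> \<rho>" "\<And>a. a \<in> set as \<Longrightarrow> norm a \<le> \<rho>"
  proof -
    have fin: "finite (insert (1 / 2) (insert (norm t) (norm ` set as)))" by simp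
    have ge: "y \<le> \<rho>" if "y \<in> insert (1 / 2) (insert (norm t) (norm ` set as))" for y
      unfolding \<rho>_def by (rule Max_ge[OF fin that])
    have "1 / 2 \<le> \<rho>" by (rule ge) simp
    then show "0 < \<rho>" by simp
    show "norm t \<le> \<rho>" by (rule ge) simp
    show "norm a \<le> \<rho>" if "a \<in> set as" for a by (rule ge) (use that in simp)
    show "\<rho> < 1" unfolding \<rho>_def using as t by (subst Max_less_iff) auto
  qed
  have eq: "u ^ (m + 2) * ((1 - A * u) * (\<Prod>a\<leftarrow>as. 1 - a / u)) *
    (\<Prod>j<m. theta (t * z j / u) 0 * theta (t / (z j * u)) 0) *
    (BC_vandermonde q (Suc m) (z(m := u)) * omega q t (weight_pm q (q * A) as) (Suc m) (z(m := u))) = C * f u"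
    if u: "norm u = 1" for u
  proof -
    have u0: "u \<noteq> 0" using u by auto
    have asn: "(\<Prod>a\<leftarrow>as. 1 - a / u) \<noteq> 0"
    proof -
      have "u \<notin> set as" using as[of u] u by auto
      then show ?thesis using u0 by (auto simp: prod_list_zero_iff)
    qed
    have w: "weight_pm q (q * A) as u * ((1 - A * u) * (\<Prod>a\<leftarrow>as. 1 - a / u)) = qpoch_refl q [A] u / qpoch_refl q as u"
    proof -
      have "qpoch_pm q [q * A] u * (1 - A * u) = qpoch_refl q [A] u"
        using qpoch_inf_rec[OF q(1), of "A * u"] by (simp add: mult_ac)
      moreover have "x / (y * P) * (k * P) = x * k / y" if "P \<noteq> 0" for x y k P :: complex
        using that by simp
      ultimately show ?thesis
        using asn unfolding weight_pm_def qpoch_refl_pm[OF q(1), of as] by metis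
    qed
    have d: "pair_den q t (z j) u = qpoch_refl q [t * z j, t / z j] u * ((1 - t * z j / u) * (1 - t / (z j * u)))" for j
      using qpoch_inf_rec[OF q(1), of "t * z j / u"] qpoch_inf_rec[OF q(1), of "t / (z j * u)"]
      by (simp add: pair_den_def mult_ac)
    have tn: "(\<Prod>j<m. (1 - t * z j / u) * (1 - t / (z j * u))) \<noteq> 0"
    proof -
      have "t * z j / u \<noteq> 1" "t / (z j * u) \<noteq> 1" for j
        using t u zn[of j] by (auto dest!: arg_cong[of _ 1 norm] simp: norm_mult norm_divide)
      then show ?thesis by (auto simp: prod_zero_iff)
    qed
    have "(\<Prod>j<m. theta (z j * u) q * theta (u / z j) q / u) = (\<Prod>j<m. theta (z j * u) q * theta (u / z j) q) / u ^ m"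
      by (simp add: prod_dividef)
    moreover have "(\<Prod>j<m. pair_den q t (z j) u) =
       (\<Prod>j<m. qpoch_refl q [t * z j, t / z j] u) * (\<Prod>j<m. (1 - t * z j / u) * (1 - t / (z j * u)))"
      unfolding d by (simp only: prod.distrib)
    moreover have "(\<Prod>j<m. theta ((z(m := u)) j * u) q * theta (u / (z(m := u)) j) q / u) =
      (\<Prod>j<m. theta (z j * u) q * theta (u / z j) q / u)"
      "(\<Prod>j<m. pair_den q t ((z(m := u)) j) u) = (\<Prod>j<m. pair_den q t (z j) u)"
      by (auto intro!: prod.cong)
    ultimately have V: "BC_vandermonde q (Suc m) (z(m := u)) = BC_vandermonde q m z * (u * theta (1 / u ^ 2) q *
        ((\<Prod>j<m. theta (z j * u) q * theta (u / z j) q) / u ^ m))"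
      and O: "omega q t (weight_pm q (q * A) as) (Suc m) (z(m := u)) = omega q t (weight_pm q (q * A) as) m z *
       (weight_pm q (q * A) as u / ((\<Prod>j<m. qpoch_refl q [t * z j, t / z j] u) *
          (\<Prod>j<m. (1 - t * z j / u) * (1 - t / (z j * u)))))"
      unfolding BC_vandermonde_Suc omega_Suc fun_upd_same by (simp_all only: BC_vandermonde_upd omega_upd order.refl)
    have alg: "u ^ (m + 2) * S * T * ((v * (u * th * (P / u ^ m))) * (o' * (w / (R * T)))) =
       (v * o') * (u ^ 3 * th * P * (w * S) / R)" if "T \<noteq> 0" for S T v th P o' w R
    proof -
      have 1: "u ^ (m + 2) * (u * th * (P / u ^ m)) = u ^ 3 * th * P"
        using u0 by (simp add: power_add power2_eq_square power3_eq_cube)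
      have 2: "w / (R * T) * T = w / R" using that by simp
      have "u ^ (m + 2) * S * T * ((v * (u * th * (P / u ^ m))) * (o' * (w / (R * T)))) =
        (u ^ (m + 2) * (u * th * (P / u ^ m))) * (v * o') * S * (w / (R * T) * T)" by (simp only: mult_ac)
      then show ?thesis unfolding 1 2 by simp
    qed
    show ?thesis
      unfolding V O C_def f_def theta_0_right alg[OF tn] w by simp
  qed
  have "circle_mean f = 0"
  proof (rule circle_mean_antisym[of f "norm q * \<rho>" "1 / \<rho>" q])
    let ?S = "{u. norm q * \<rho> < norm u \<and> norm u < 1 / \<rho>}"
    have S0: "0 \<notin> ?S" using q \<rho> by (auto simp: not_less)
    have nz: "qpoch_refl q as u \<noteq> 0" if "u \<in> ?S" for u
      using that by (intro qpoch_refl_nonzero[OF q \<rho>(1)] \<rho>) auto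
    have nz': "qpoch_refl q [t * z j, t / z j] u \<noteq> 0" if "u \<in> ?S" for u j
      by (rule qpoch_refl_nonzero[OF q \<rho>(1)]) (use that \<rho> zn in \<open>auto simp: norm_mult norm_divide\<close>)
    show "f holomorphic_on ?S"
      unfolding f_def using S0 q zn nz nz' by (auto intro!: holomorphic_intros simp del: qpoch_refl_simps)
    show "f (q / u) = - f u" if "norm u = 1" for u
    proof -
      have u0: "u \<noteq> 0" using that by auto
      have "theta (z j * (q / u)) q * theta ((q / u) / z j) q = theta (z j * u) q * theta (u / z j) q" for j
        using theta_nome_div[of "u / z j" q] theta_nome_div[of "z j * u" q] u0 zn q by (simp add: mult_ac)
      then show ?thesis
        unfolding f_def theta_cube_reflect[OF q u0] qpoch_refl_reflect[OF u0 q(2)] by simp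
    qed
  qed (use q \<rho> in \<open>auto simp: field_simps\<close>)
  moreover have "circle_mean (\<lambda>u. u ^ (m + 2) * ((1 - A * u) * (\<Prod>a\<leftarrow>as. 1 - a / u)) *
    (\<Prod>j<m. theta (t * z j / u) 0 * theta (t / (z j * u)) 0) *
    (BC_vandermonde q (Suc m) (z(m := u)) * omega q t (weight_pm q (q * A) as) (Suc m) (z(m := u)))) = circle_mean (\<lambda>u. C * f u)"
    by (rule circle_mean_cong) (rule eq)
  ultimately show ?thesis by simp
qed

text \<open>Multiplying by the theta functions of the parameters cancels all poles of the density inside
  the unit disc; what is left in the last variable is holomorphic there.\<close>

definition disc_function :: "complex \<Rightarrow> complex \<Rightarrow> complex list \<Rightarrow> nat \<Rightarrow> (nat \<Rightarrow> complex) \<Rightarrow> complex \<Rightarrow> complex" where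
  "disc_function q t as m z u = (u ^ 2 - 1) * (\<Prod>j<m. (1 - z j * u) * (1 - u / z j)) *
     (\<Prod>a\<leftarrow>as. qpoch_inf (q * u / a) q / qpoch_inf (a * u) q) *
     (\<Prod>j<m. (qpoch_inf (q * u / (t * z j)) q * qpoch_inf (q * u * z j / t) q) /
        (qpoch_inf (t * z j * u) q * qpoch_inf (t * u / z j) q))"

lemma disc_function_0 [simp]: "disc_function q t as m z 0 = -1"
proof -
  have "(\<Prod>a\<leftarrow>as. qpoch_inf (q * 0 / a) q / qpoch_inf (a * 0) q) = 1" by (induction as) auto
  then show ?thesis by (simp add: disc_function_def)
qed

text \<open>Every remaining denominator is a q-product in b * u with norm b < 1, which has no zeros
  on the closed unit disc.\<close>

lemma holomorphic_on_disc_function: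
  assumes q: "norm q < 1" and t: "norm t < 1" and as: "\<And>a. a \<in> set as \<Longrightarrow> norm a < 1" and z: "z \<in> torus"
  shows "disc_function q t as m z holomorphic_on cball 0 1"
proof -
  have zn: "norm (z j) = 1" "z j \<noteq> 0" for j using z by (auto simp: torusD)
  have lt: "norm (b * u) < 1" if "norm b < 1" "u \<in> cball 0 1" for b u :: complex
  proof -
    have "norm (b * u) \<le> norm b * 1" unfolding norm_mult using that by (intro mult_left_mono) auto
    then show ?thesis using that by simp
  qed
  have h1: "(\<lambda>u. \<Prod>a\<leftarrow>as. qpoch_inf (q * u / a) q / qpoch_inf (a * u) q) holomorphic_on cball 0 1"
    using as
  proof (induction as)
    case (Cons a as)
    then have "norm a < 1" by simp
    then have "qpoch_inf (a * u) q \<noteq> 0" if "u \<in> cball 0 1" for u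
      by (intro qpoch_inf_nonzero[OF q] lt that)
    then show ?case using Cons q by (auto intro!: holomorphic_intros)
  qed simp
  have nz: "qpoch_inf (t * z j * u) q * qpoch_inf (t * u / z j) q \<noteq> 0" if "u \<in> cball 0 1" for u j
    using qpoch_inf_nonzero[OF q lt[of "t * z j", OF _ that]] qpoch_inf_nonzero[OF q lt[of "t / z j", OF _ that]] t zn
    by (auto simp: norm_mult norm_divide)
  have h2: "(\<lambda>u. \<Prod>j<m. (qpoch_inf (q * u / (t * z j)) q * qpoch_inf (q * u * z j / t) q) /
        (qpoch_inf (t * z j * u) q * qpoch_inf (t * u / z j) q)) holomorphic_on cball 0 1"
  proof (intro holomorphic_on_prod holomorphic_on_divide)
    fix j
    have lin: "(\<lambda>u. c * u) holomorphic_on cball 0 1" for c :: complex by (intro holomorphic_intros)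
    have "(\<lambda>u. qpoch_inf ((q / (t * z j)) * u) q * qpoch_inf ((q * z j / t) * u) q) holomorphic_on cball 0 1"
      by (intro holomorphic_on_mult holomorphic_on_qpoch_inf lin q)
    then show "(\<lambda>u. qpoch_inf (q * u / (t * z j)) q * qpoch_inf (q * u * z j / t) q) holomorphic_on cball 0 1"
      by (simp add: mult_ac)
    have "(\<lambda>u. qpoch_inf ((t * z j) * u) q * qpoch_inf ((t / z j) * u) q) holomorphic_on cball 0 1"
      by (intro holomorphic_on_mult holomorphic_on_qpoch_inf lin q)
    then show "(\<lambda>u. qpoch_inf (t * z j * u) q * qpoch_inf (t * u / z j) q) holomorphic_on cball 0 1"
      by (simp add: mult_ac)
  qed (rule nz)
  have h3: "(\<lambda>u. (u ^ 2 - 1) * (\<Prod>j<m. (1 - z j * u) * (1 - u / z j))) holomorphic_on cball 0 1"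
  proof -
    have "(\<lambda>u. (u ^ 2 - 1) * (\<Prod>j<m. (1 - z j * u) * (1 - (1 / z j) * u))) holomorphic_on cball 0 1"
      by (intro holomorphic_intros)
    then show ?thesis by simp
  qed
  show ?thesis
    unfolding disc_function_def[abs_def] by (rule holomorphic_on_mult[OF holomorphic_on_mult[OF h3 h1] h2])
qed

text \<open>The factor (a / u; q) of theta (a / u) cancels the same factor of the weight, and
  likewise for the pairs. The power u ^ Suc m meets u / u ^ m from the Vandermonde and turns 1 - 1 /
  u ^ 2 into u ^ 2 - 1.\<close>

lemma disc_function_eq:
  assumes q: "norm q < 1" and t: "norm t < 1" "t \<noteq> 0" and as: "\<And>a. a \<in> set as \<Longrightarrow> norm a < 1 \<and> a \<noteq> 0"
    and z: "z \<in> torus" and u: "norm u = 1"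
  shows "u ^ Suc m * (\<Prod>a\<leftarrow>as. theta (a / u) q) * (\<Prod>j<m. theta (t * z j / u) q * theta (t / (z j * u)) q) *
    (BC_vandermonde 0 (Suc m) (z(m := u)) * omega q t (weight_pm q 0 as) (Suc m) (z(m := u))) =
    BC_vandermonde 0 m z * omega q t (weight_pm q 0 as) m z * disc_function q t as m z u"
proof -
  have zn: "norm (z j) = 1" "z j \<noteq> 0" for j using z by (auto simp: torusD)
  have u0: "u \<noteq> 0" using u by auto
  have A: "(\<Prod>a\<leftarrow>as. theta (a / u) q) * weight_pm q 0 as u = (\<Prod>a\<leftarrow>as. qpoch_inf (q * u / a) q / qpoch_inf (a * u) q)"
    using as
  proof (induction as)
    case (Cons a as)
    have "qpoch_inf (a / u) q \<noteq> 0" using Cons u by (intro qpoch_inf_nonzero[OF q]) (auto simp: norm_divide)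
    moreover have "qpoch_inf (a * u) q \<noteq> 0" using Cons u by (intro qpoch_inf_nonzero[OF q]) (auto simp: norm_mult)
    moreover have "theta (a / u) q = qpoch_inf (a / u) q * qpoch_inf (q * u / a) q" by (simp add: theta_def')
    ultimately have 1: "theta (a / u) q / (qpoch_inf (a * u) q * qpoch_inf (a / u) q) =
        qpoch_inf (q * u / a) q / qpoch_inf (a * u) q" by simp
    have "(\<Prod>a\<leftarrow>a # as. theta (a / u) q) * weight_pm q 0 (a # as) u =
      theta (a / u) q / (qpoch_inf (a * u) q * qpoch_inf (a / u) q) * ((\<Prod>a\<leftarrow>as. theta (a / u) q) * weight_pm q 0 as u)"
      by (simp add: weight_pm_def)
    also have "(\<Prod>a\<leftarrow>as. theta (a / u) q) * weight_pm q 0 as u =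
        (\<Prod>a\<leftarrow>as. qpoch_inf (q * u / a) q / qpoch_inf (a * u) q)"
      using Cons by auto
    finally show ?case unfolding 1 by simp
  qed (simp add: weight_pm_def)
  have B: "(\<Prod>j<m. theta (t * z j / u) q * theta (t / (z j * u)) q) / (\<Prod>j<m. pair_den q t (z j) u) =
     (\<Prod>j<m. (qpoch_inf (q * u / (t * z j)) q * qpoch_inf (q * u * z j / t) q) /
        (qpoch_inf (t * z j * u) q * qpoch_inf (t * u / z j) q))"
    unfolding prod_dividef[symmetric]
  proof (rule prod.cong[OF refl])
    fix j
    have "qpoch_inf (t * z j / u) q \<noteq> 0" "qpoch_inf (t / (z j * u)) q \<noteq> 0"
      using u zn t by (auto intro!: qpoch_inf_nonzero[OF q] simp: norm_mult norm_divide)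
    moreover have "theta (t * z j / u) q = qpoch_inf (t * z j / u) q * qpoch_inf (q * u / (t * z j)) q"
      "theta (t / (z j * u)) q = qpoch_inf (t / (z j * u)) q * qpoch_inf (q * u * z j / t) q"
      by (simp_all add: theta_def' mult_ac)
    moreover have "pair_den q t (z j) u = qpoch_inf (t * z j * u) q * qpoch_inf (t / (z j * u)) q *
        (qpoch_inf (t * z j / u) q * qpoch_inf (t * u / z j) q)"
      by (simp add: pair_den_def mult_ac)
    ultimately show "theta (t * z j / u) q * theta (t / (z j * u)) q / pair_den q t (z j) u =
      (qpoch_inf (q * u / (t * z j)) q * qpoch_inf (q * u * z j / t) q) /
        (qpoch_inf (t * z j * u) q * qpoch_inf (t * u / z j) q)"
      by simp
  qed
  have eqs: "(\<Prod>j<m. theta ((z(m := u)) j * u) 0 * theta (u / (z(m := u)) j) 0 / u) =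
      (\<Prod>j<m. (1 - z j * u) * (1 - u / z j)) / u ^ m"
    "(\<Prod>j<m. pair_den q t ((z(m := u)) j) u) = (\<Prod>j<m. pair_den q t (z j) u)"
  proof -
    have "(\<Prod>j<m. theta ((z(m := u)) j * u) 0 * theta (u / (z(m := u)) j) 0 / u) = (\<Prod>j<m. (1 - z j * u) * (1 - u / z j) / u)"
      by (intro prod.cong) auto
    then show "(\<Prod>j<m. theta ((z(m := u)) j * u) 0 * theta (u / (z(m := u)) j) 0 / u) =
      (\<Prod>j<m. (1 - z j * u) * (1 - u / z j)) / u ^ m" by (simp add: prod_dividef)
  qed (auto intro!: prod.cong)
  have V: "BC_vandermonde 0 (Suc m) (z(m := u)) = BC_vandermonde 0 m z * (u * theta (1 / u ^ 2) 0 *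
        ((\<Prod>j<m. (1 - z j * u) * (1 - u / z j)) / u ^ m))"
    and O: "omega q t (weight_pm q 0 as) (Suc m) (z(m := u)) = omega q t (weight_pm q 0 as) m z *
       (weight_pm q 0 as u / (\<Prod>j<m. pair_den q t (z j) u))"
    unfolding BC_vandermonde_Suc omega_Suc fun_upd_same eqs by (simp_all only: BC_vandermonde_upd omega_upd order.refl)
  have alg: "u ^ Suc m * S * T * ((v * (u * theta (1 / u ^ 2) 0 * (P / u ^ m))) * (o' * (w / R))) =
       (v * o') * ((u ^ 2 - 1) * P * (S * w) * (T / R))" for S T v P o' w R
  proof -
    have "u ^ Suc m * (u * X * (P / u ^ m)) = u * u * X * P" for X using u0 by simp
    moreover have "u * u * theta (1 / u ^ 2) 0 = u ^ 2 - 1" using u0 by (simp add: power2_eq_square field_simps)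
    ultimately have 1: "u ^ Suc m * (u * theta (1 / u ^ 2) 0 * (P / u ^ m)) = (u ^ 2 - 1) * P" by simp
    have "u ^ Suc m * S * T * ((v * (u * theta (1 / u ^ 2) 0 * (P / u ^ m))) * (o' * (w / R))) =
      (u ^ Suc m * (u * theta (1 / u ^ 2) 0 * (P / u ^ m))) * (v * o') * (S * w) * (T * (1 / R))"
      by (simp only: mult_ac times_divide_eq_left times_divide_eq_right mult_1_right mult_1_left)
    then show ?thesis unfolding 1 by simp
  qed
  show ?thesis unfolding V O alg A B disc_function_def ..
qed

subsection \<open>Evaluation of the symmetric integral\<close>

lemma weight_pm_shift_parameter:
  assumes q: "norm q < 1" and x: "norm x = 1" and a: "norm a < 1"
  shows "(1 - a * x) * (1 - a / x) * weight_pm q A (a # as) x = weight_pm q A (q * a # as) x"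
proof -
  have "a * x \<noteq> 1" "a / x \<noteq> 1"
    using x a by (auto dest!: arg_cong[of _ 1 norm] simp: norm_mult norm_divide)
  then have nz: "(1 - a * x) * (1 - a / x) \<noteq> 0" by auto
  have alg: "U * V * (X / (U * P * (V * Q) * R)) = X / (P * Q * R)" if "U * V \<noteq> 0" for U V X P Q R :: complex
  proof -
    have "U * V * (X / (U * P * (V * Q) * R)) = (U * V) * X / ((U * V) * (P * Q * R))"
      unfolding times_divide_eq_right by (simp only: mult_ac)
    then show ?thesis using nonzero_mult_divide_mult_cancel_left[OF that, of X "P * Q * R"] by (simp only:)
  qed
  have e: "q * a * x = q * (a * x)" "q * a / x = q * (a / x)" by simp_all
  show ?thesis
    unfolding weight_pm_def qpoch_pm_simps e qpoch_inf_rec[OF q, of "a * x"] qpoch_inf_rec[OF q, of "a / x"]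
    by (rule alg[OF nz])
qed

lemma weight_pm_shift_numerator:
  assumes q: "norm q < 1"
  shows "(1 - A * x) * (1 - A / x) * weight_pm q (q * A) as x = weight_pm q A as x"
  using qpoch_inf_rec[OF q, of "A * x"] qpoch_inf_rec[OF q, of "A / x"]
  by (simp add: weight_pm_def mult_ac)

lemma one_minus_nonzero: "norm (u :: complex) < 1 \<Longrightarrow> 1 - u \<noteq> 0"
  by auto

lemma norm_power_mult_less_1:
  assumes "norm (t :: complex) < 1" "norm u < 1"
  shows "norm (t ^ k * u) < 1"
proof -
  have "norm (t ^ k * u) \<le> 1 * norm u"
    unfolding norm_mult norm_power using assms by (intro mult_right_mono power_le_one) auto
  then show ?thesis using assms by simp
qed

lemma norm_mult_less_1: "norm (u :: complex) < 1 \<Longrightarrow> norm v < 1 \<Longrightarrow> norm (u * v) < 1"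
  by (metis norm_ge_zero norm_mult mult_strict_mono' mult_1)

text \<open>The nome 0 instance of \<open>torus_functional\<close>, compared at two points. At 1 /
  a3 the pair function supplies 1 - a3 * x, which with 1 - a3 / x replaces a3 by q * a3; at
  \<alpha>2 it supplies 1 - A / x, which with 1 - A * x lowers the numerator parameter from q * A to
  A. In both cases a \<open>BC_kernel\<close> of nome 0 is left.\<close>

lemma BC_integral_shift:
  assumes q: "norm q < 1" "q \<noteq> 0" and t: "norm t < 1" "t \<noteq> 0"
    and a: "norm a1 < 1" "norm a2 < 1" "norm a3 < 1" "norm a4 < 1" "norm a5 < 1"
    and a0: "a1 \<noteq> 0" "a2 \<noteq> 0" "a3 \<noteq> 0" "a4 \<noteq> 0" "a5 \<noteq> 0"
    and gen: "\<And>k :: int. t powi k * a2 / a1 \<noteq> 1"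
    and A: "A = t ^ (2 * m) * (a1 * a2 * a3 * a4 * a5)"
  shows "BC_integral q t (Suc m) (q * A) [a1, a2, q * a3, a4, a5] *
      (\<Prod>r<Suc m. (1 - t ^ (m + r) * (a2 * a3 * a4 * a5)) * (1 - t ^ (m + r) * (a1 * a3 * a4 * a5)) *
        (1 - t ^ (m + r) * (a1 * a2 * a3 * a5)) * (1 - t ^ (m + r) * (a1 * a2 * a3 * a4))) =
    BC_integral q t (Suc m) A [a1, a2, a3, a4, a5] *
      (\<Prod>r<Suc m. (1 - t ^ r * (a1 * a3)) * (1 - t ^ r * (a2 * a3)) * (1 - t ^ r * (a3 * a4)) * (1 - t ^ r * (a3 * a5)))"
proof -
  define as where "as = [a1, a2, a3, a4, a5]"
  have asn: "norm b < 1" if "b \<in> set as" for b using that a by (auto simp: as_def)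
  define W where "W = (\<lambda>z. BC_vandermonde q (Suc m) z * omega q t (weight_pm q (q * A) as) (Suc m) z)"
  define s where "s = (\<lambda>x. (1 - A * x) * ((1 - a3 / x) * (1 - a4 / x) * (1 - a5 / x)))"
  have Wflip: "W (z(i := 1 / z i)) = - W z" if "\<forall>i. z i \<noteq> 0" "i < Suc m" for z i
    unfolding W_def using BC_vandermonde_flip[OF q(1) that] omega_flip[where X="weight_pm q (q * A) as" and z=z and i=i, OF weight_pm_inverse that(2)] by simp
  interpret torus_functional 0 t a1 a2 m s W
  proof
    show "continuous_on (sphere 0 1) s" unfolding s_def by (intro continuous_intros) auto
    show "continuous_on torus W" unfolding W_def
      by (intro continuous_intros continuous_on_BC_vandermonde_torus continuous_on_omega q t continuous_on_weight_pm asn)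
    show "W (z \<circ> Transposition.transpose i j) = - W z" if "z \<in> torus" "i \<le> m" "j \<le> m" "i \<noteq> j" for z i j
      unfolding W_def
      using BC_vandermonde_transpose[OF q(1), of z i "Suc m" j] omega_transpose[of i "Suc m" j] that
      by (simp add: torusD)
    show "circle_mean (\<lambda>u. u ^ (m + 2) * s u * theta (a1 / u) 0 * theta (a2 / u) 0 *
        (\<Prod>j<m. theta (t * z j / u) 0 * theta (t / (z j * u)) 0) * W (z(m := u))) = 0" if "z \<in> torus" for z
    proof -
      have p: "(\<Prod>a\<leftarrow>as. 1 - a / u) = (1 - a1 / u) * ((1 - a2 / u) * ((1 - a3 / u) * ((1 - a4 / u) * (1 - a5 / u))))" for u
        by (simp add: as_def)
      show ?thesis
        using vanish_reflection[OF q t(1) asn that, of as m A] unfolding W_def s_def p theta_0_right by (simp only: mult_ac)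
    qed
    show "theta (t powi k * a2 / a1) 0 \<noteq> 0" for k using gen[of k] by simp
    show "theta (t ^ k) 0 \<noteq> 0" if "1 \<le> k" for k
      using norm_power_mult_less_1[OF t(1) t(1), of "k - 1"] that by (cases k) (auto simp: mult.commute)
  qed (use t a0 in auto)
  \<comment> \<open>Chosen so that c / \<alpha>2 = A, while 1 / \<alpha>2 = a3 * a4 * a5 * t ^ m is
    the first parameter of the kernel belonging to a3, a4, a5.\<close>
  define \<alpha>2 where "\<alpha>2 = 1 / (t ^ m * (a3 * a4 * a5))"
  have \<alpha>2: "\<alpha>2 \<noteq> 0" using t a0 by (simp add: \<alpha>2_def)
  have c: "c = t ^ m * (a1 * a2)" by (simp add: c_def)
  have A0: "A \<noteq> 0" using A t a0 by simp
  \<comment> \<open>The condition on the first parameter of the kernel with parameters a4, a5 and c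
    * a3, which is the one that appears at 1 / a3.\<close>
  have AA: "A = a4 * a5 * (c * a3) * t ^ m" by (simp add: A c mult_2 power_add)
  have c\<alpha>2: "c / \<alpha>2 = A" by (simp add: \<alpha>2_def A c mult_2_right power_add mult_ac)
  define e1 where "e1 = (\<lambda>x. (1 - a3 * x) * (1 - a3 / x))"
  define e2 where "e2 = (\<lambda>x. (1 - A * x) * (1 - A / x))"
  have V1: "2 ^ Suc m * value_at (1 / a3) = (- 1 / a3) ^ Suc m *
    (\<Prod>k<Suc m. theta (t ^ k * a4 * a5) 0 * theta (t ^ k * a4 * (c * a3)) 0 * theta (t ^ k * a5 * (c * a3)) 0) *
    torus_mean (Suc m) (\<lambda>z. BC_vandermonde 0 (Suc m) z * ((\<Prod>k<Suc m. e1 (z k)) * W z))"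
  proof (rule value_at_kernel[OF Wflip _ _ a0(4,5) _ AA])
    show "continuous_on (sphere 0 1) e1" unfolding e1_def by (intro continuous_intros) auto
    show "e1 (1 / x) = e1 x" for x by (simp add: e1_def mult_ac)
    show "c * a3 \<noteq> 0" using c_nonzero a0 by simp
    show "BC_vandermonde 0 (Suc m) (\<lambda>k. a4 * t ^ k) \<noteq> 0"
      by (intro BC_vandermonde_0_geometric_nonzero a a0 t)
    fix x :: complex assume "norm x = 1"
    then have x: "x \<noteq> 0" by auto
    have tp: "x * theta_pair 0 c (1 / a3) x = - 1 / a3 * (1 - a3 * x) * (x * (1 - c * a3 / x))"
      using x a0 by (simp add: theta_pair_def field_simps)
    show "s x * (x * theta_pair 0 c (1 / a3) x) = - 1 / a3 * e1 x *
       (x * theta (A * x) 0 * theta (a4 / x) 0 * theta (a5 / x) 0 * theta (c * a3 / x) 0)"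
      unfolding tp s_def e1_def theta_0_right by (simp only: mult_ac)
  qed
  have V2: "2 ^ Suc m * value_at \<alpha>2 = (- \<alpha>2) ^ Suc m *
    (\<Prod>k<Suc m. theta (t ^ k * a3 * a4) 0 * theta (t ^ k * a3 * a5) 0 * theta (t ^ k * a4 * a5) 0) *
    torus_mean (Suc m) (\<lambda>z. BC_vandermonde 0 (Suc m) z * ((\<Prod>k<Suc m. e2 (z k)) * W z))"
  proof (rule value_at_kernel[OF Wflip _ _ a0(3,4,5) refl])
    show "continuous_on (sphere 0 1) e2" unfolding e2_def by (intro continuous_intros) auto
    show "e2 (1 / x) = e2 x" for x by (simp add: e2_def mult_ac)
    show "BC_vandermonde 0 (Suc m) (\<lambda>k. a3 * t ^ k) \<noteq> 0"
      by (intro BC_vandermonde_0_geometric_nonzero a a0 t)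
    fix x :: complex assume "norm x = 1"
    then have x: "x \<noteq> 0" by auto
    have e1: "a3 * a4 * a5 * t ^ m = 1 / \<alpha>2" by (simp add: \<alpha>2_def mult_ac)
    have e2': "c / (\<alpha>2 * x) = A / x" unfolding c\<alpha>2[symmetric] by simp
    have tp: "x * theta_pair 0 c \<alpha>2 x = - \<alpha>2 * (1 - A / x) * (x * (1 - a3 * a4 * a5 * t ^ m * x))"
    proof -
      have "x * (x * (1 - \<alpha>2 / x) * (1 - A / x)) = - \<alpha>2 * (1 - A / x) * (x * (1 - 1 / \<alpha>2 * x))"
        using x \<alpha>2 by (simp add: field_simps)
      then show ?thesis
        unfolding theta_pair_def theta_0_right e1 e2' .
    qed
    show "s x * (x * theta_pair 0 c \<alpha>2 x) = - \<alpha>2 * e2 x *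
       (x * theta (a3 * a4 * a5 * t ^ m * x) 0 * theta (a3 / x) 0 * theta (a4 / x) 0 * theta (a5 / x) 0)"
      unfolding tp s_def e2_def theta_0_right by (simp only: mult_ac)
  qed
  have int: "torus_mean (Suc m) (\<lambda>z. BC_vandermonde 0 (Suc m) z * ((\<Prod>k<Suc m. e (z k)) * W z)) =
      BC_integral q t (Suc m) A' bs"
    if w: "\<And>x. norm x = 1 \<Longrightarrow> e x * weight_pm q (q * A) as x = weight_pm q A' bs x" for e A' bs
    unfolding BC_integral_def
  proof (rule torus_mean_cong)
    fix z :: "nat \<Rightarrow> complex" assume z: "z \<in> torus"
    have "(\<Prod>k<Suc m. e (z k)) * W z = BC_vandermonde q (Suc m) z *
       omega q t (\<lambda>x. e x * weight_pm q (q * A) as x) (Suc m) z"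
      unfolding W_def omega_mult by (simp only: mult_ac)
    also have "omega q t (\<lambda>x. e x * weight_pm q (q * A) as x) (Suc m) z = omega q t (weight_pm q A' bs) (Suc m) z"
      by (rule omega_cong) (use w torusD(1)[OF z] in auto)
    finally show "BC_vandermonde 0 (Suc m) z * ((\<Prod>k<Suc m. e (z k)) * W z) =
       BC_vandermonde 0 (Suc m) z * BC_vandermonde q (Suc m) z * omega q t (weight_pm q A' bs) (Suc m) z"
      by (simp only: mult.assoc)
  qed
  have J1: "torus_mean (Suc m) (\<lambda>z. BC_vandermonde 0 (Suc m) z * ((\<Prod>k<Suc m. e1 (z k)) * W z)) =
      BC_integral q t (Suc m) (q * A) [a1, a2, q * a3, a4, a5]"
  proof (rule int)
    fix x :: complex assume x: "norm x = 1"
    have "weight_pm q (q * A) as x = weight_pm q (q * A) [a3, a1, a2, a4, a5] x"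
      "weight_pm q (q * A) [q * a3, a1, a2, a4, a5] x = weight_pm q (q * A) [a1, a2, q * a3, a4, a5] x"
      unfolding weight_pm_def as_def by (simp_all add: mult_ac)
    then show "e1 x * weight_pm q (q * A) as x = weight_pm q (q * A) [a1, a2, q * a3, a4, a5] x"
      using weight_pm_shift_parameter[OF q(1) x a(3), of "q * A" "[a1, a2, a4, a5]"] by (simp add: e1_def)
  qed
  have J2: "torus_mean (Suc m) (\<lambda>z. BC_vandermonde 0 (Suc m) z * ((\<Prod>k<Suc m. e2 (z k)) * W z)) =
      BC_integral q t (Suc m) A [a1, a2, a3, a4, a5]"
    by (rule int) (use weight_pm_shift_numerator[OF q(1), of A _ as] in \<open>simp add: e2_def as_def\<close>)
  have rev: "(\<Prod>r<Suc m. f (m - r)) = (\<Prod>r<Suc m. f r)" for f :: "nat \<Rightarrow> complex"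
    using prod.nat_diff_reindex[of f "Suc m"] by simp
  have G2: "(\<Prod>r<Suc m. theta_pair 0 c \<alpha>2 (t ^ r * a1)) = (- \<alpha>2) ^ Suc m *
     (\<Prod>r<Suc m. (1 - t ^ (m + r) * (a2 * a3 * a4 * a5)) * (1 - t ^ (m + r) * (a1 * a3 * a4 * a5)))"
  proof -
    have "theta_pair 0 c \<alpha>2 (t ^ r * a1) = - \<alpha>2 * ((1 - t ^ (m + r) * (a1 * a3 * a4 * a5)) *
        (1 - t ^ (m + (m - r)) * (a2 * a3 * a4 * a5)))" if "r \<in> {..<Suc m}" for r
    proof -
      have r: "r \<le> m" using that by simp
      have "t ^ (2 * m) = t ^ (m + (m - r)) * t ^ r" using r by (simp add: mult_2 flip: power_add)
      then have 1: "c / (\<alpha>2 * (t ^ r * a1)) = t ^ (m + (m - r)) * (a2 * a3 * a4 * a5)"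
        using t a0 unfolding divide_divide_eq_left[symmetric] c\<alpha>2 A by simp
      have 2: "t ^ r * a1 - \<alpha>2 = - \<alpha>2 * (1 - t ^ (m + r) * (a1 * a3 * a4 * a5))"
        using t a0 by (simp add: \<alpha>2_def power_add field_simps)
      have "theta_pair 0 c \<alpha>2 (t ^ r * a1) = (t ^ r * a1 - \<alpha>2) * (1 - c / (\<alpha>2 * (t ^ r * a1)))"
        using t a0 by (simp add: theta_pair_def field_simps)
      then show ?thesis unfolding 1 2 by (simp only: mult.assoc)
    qed
    then have "(\<Prod>r<Suc m. theta_pair 0 c \<alpha>2 (t ^ r * a1)) = (\<Prod>r<Suc m. - \<alpha>2 * ((1 - t ^ (m + r) * (a1 * a3 * a4 * a5)) *
        (1 - t ^ (m + (m - r)) * (a2 * a3 * a4 * a5))))"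
      by (rule prod.cong[OF refl])
    also have "\<dots> = (- \<alpha>2) ^ Suc m * ((\<Prod>r<Suc m. 1 - t ^ (m + r) * (a1 * a3 * a4 * a5)) *
        (\<Prod>r<Suc m. 1 - t ^ (m + (m - r)) * (a2 * a3 * a4 * a5)))"
      by (simp only: prod.distrib prod_constant card_lessThan)
    also have "(\<Prod>r<Suc m. 1 - t ^ (m + (m - r)) * (a2 * a3 * a4 * a5)) = (\<Prod>r<Suc m. 1 - t ^ (m + r) * (a2 * a3 * a4 * a5))"
      by (rule rev[of "\<lambda>r. 1 - t ^ (m + r) * (a2 * a3 * a4 * a5)"])
    finally show ?thesis by (simp only: prod.distrib mult_ac)
  qed
  have G1: "(\<Prod>r<Suc m. theta_pair 0 c (1 / a3) (t ^ r * a1)) = (- 1 / a3) ^ Suc m *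
     (\<Prod>r<Suc m. (1 - t ^ r * (a1 * a3)) * (1 - t ^ r * (a2 * a3)))"
  proof -
    have "theta_pair 0 c (1 / a3) (t ^ r * a1) = - 1 / a3 * ((1 - t ^ r * (a1 * a3)) * (1 - t ^ (m - r) * (a2 * a3)))"
      if "r \<in> {..<Suc m}" for r
    proof -
      have r: "r \<le> m" using that by simp
      have "t ^ m = t ^ (m - r) * t ^ r" using r by (simp flip: power_add)
      then have 1: "c / (1 / a3 * (t ^ r * a1)) = t ^ (m - r) * (a2 * a3)"
        using t a0 unfolding c by simp
      have 2: "t ^ r * a1 * (1 - 1 / a3 / (t ^ r * a1)) = - 1 / a3 * (1 - t ^ r * (a1 * a3))"
        using t a0 by (simp add: field_simps)
      show ?thesis unfolding theta_pair_def theta_0_right 1 2 by (simp only: mult.assoc)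
    qed
    then have "(\<Prod>r<Suc m. theta_pair 0 c (1 / a3) (t ^ r * a1)) =
       (\<Prod>r<Suc m. - 1 / a3 * ((1 - t ^ r * (a1 * a3)) * (1 - t ^ (m - r) * (a2 * a3))))"
      by (rule prod.cong[OF refl])
    also have "\<dots> = (- 1 / a3) ^ Suc m * ((\<Prod>r<Suc m. 1 - t ^ r * (a1 * a3)) * (\<Prod>r<Suc m. 1 - t ^ (m - r) * (a2 * a3)))"
      by (simp only: prod.distrib prod_constant card_lessThan)
    also have "(\<Prod>r<Suc m. 1 - t ^ (m - r) * (a2 * a3)) = (\<Prod>r<Suc m. 1 - t ^ r * (a2 * a3))"
      by (rule rev[of "\<lambda>r. 1 - t ^ r * (a2 * a3)"])
    finally show ?thesis by (simp only: prod.distrib)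
  qed
  \<comment> \<open>Both kernels contain the pair a4, a5, so this product occurs on both sides and
    cancels.\<close>
  define R where "R = (\<Prod>r<Suc m. 1 - t ^ r * (a4 * a5))"
  have R: "R \<noteq> 0"
    using norm_power_mult_less_1[OF t(1) norm_mult_less_1[OF a(4,5)]] one_minus_nonzero
    by (auto simp: R_def prod_zero_iff)
  have \<kappa>1: "(\<Prod>k<Suc m. theta (t ^ k * a4 * a5) 0 * theta (t ^ k * a4 * (c * a3)) 0 * theta (t ^ k * a5 * (c * a3)) 0) =
     R * (\<Prod>r<Suc m. (1 - t ^ (m + r) * (a1 * a2 * a3 * a5)) * (1 - t ^ (m + r) * (a1 * a2 * a3 * a4)))"
    unfolding R_def prod.distrib[symmetric] theta_0_right
    by (intro prod.cong refl) (simp add: c power_add mult_ac)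
  have \<kappa>2: "(\<Prod>k<Suc m. theta (t ^ k * a3 * a4) 0 * theta (t ^ k * a3 * a5) 0 * theta (t ^ k * a4 * a5) 0) =
     R * (\<Prod>r<Suc m. (1 - t ^ r * (a3 * a4)) * (1 - t ^ r * (a3 * a5)))"
    unfolding R_def prod.distrib[symmetric] theta_0_right
    by (intro prod.cong refl) (simp add: mult_ac)
  have a3': "1 / a3 \<noteq> 0" using a0 by simp
  have "(2 ^ Suc m * value_at (1 / a3)) * (\<Prod>r<Suc m. theta_pair 0 c \<alpha>2 (t ^ r * a1)) =
    (2 ^ Suc m * value_at \<alpha>2) * (\<Prod>r<Suc m. theta_pair 0 c (1 / a3) (t ^ r * a1))"
    using value_at_proportional[OF a3' \<alpha>2] by (simp only: mult.assoc)
  then have "((- 1 / a3) ^ Suc m * (- \<alpha>2) ^ Suc m * R) * (BC_integral q t (Suc m) (q * A) [a1, a2, q * a3, a4, a5] *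
      (\<Prod>r<Suc m. (1 - t ^ (m + r) * (a2 * a3 * a4 * a5)) * (1 - t ^ (m + r) * (a1 * a3 * a4 * a5)) *
        (1 - t ^ (m + r) * (a1 * a2 * a3 * a5)) * (1 - t ^ (m + r) * (a1 * a2 * a3 * a4)))) =
    ((- 1 / a3) ^ Suc m * (- \<alpha>2) ^ Suc m * R) * (BC_integral q t (Suc m) A [a1, a2, a3, a4, a5] *
      (\<Prod>r<Suc m. (1 - t ^ r * (a1 * a3)) * (1 - t ^ r * (a2 * a3)) * (1 - t ^ r * (a3 * a4)) * (1 - t ^ r * (a3 * a5))))"
    unfolding V1 V2 J1 J2 G1 G2 \<kappa>1 \<kappa>2 by (simp only: prod.distrib mult_ac)
  moreover have "(- 1 / a3) ^ Suc m * (- \<alpha>2) ^ Suc m * R \<noteq> 0" using a0 \<alpha>2 R by simp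
  ultimately show ?thesis by (simp only: mult_cancel_left simp_thms)
qed

section \<open>The integral over its product formula: independence of the parameters\<close>

definition pair_factors :: "complex \<Rightarrow> complex \<Rightarrow> nat \<Rightarrow> complex \<Rightarrow> complex \<Rightarrow> complex \<Rightarrow> complex \<Rightarrow> complex \<Rightarrow> complex" where
  "pair_factors q t n a1 a2 a3 a4 a5 = (\<Prod>r<n.
     qpoch_inf (t ^ r * (a1 * a2)) q * qpoch_inf (t ^ r * (a1 * a3)) q * qpoch_inf (t ^ r * (a1 * a4)) q *
     qpoch_inf (t ^ r * (a1 * a5)) q * qpoch_inf (t ^ r * (a2 * a3)) q * qpoch_inf (t ^ r * (a2 * a4)) q *
     qpoch_inf (t ^ r * (a2 * a5)) q * qpoch_inf (t ^ r * (a3 * a4)) q * qpoch_inf (t ^ r * (a3 * a5)) q *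
     qpoch_inf (t ^ r * (a4 * a5)) q)"

definition quad_factors :: "complex \<Rightarrow> complex \<Rightarrow> nat \<Rightarrow> complex \<Rightarrow> complex \<Rightarrow> complex \<Rightarrow> complex \<Rightarrow> complex \<Rightarrow> complex" where
  "quad_factors q t n a1 a2 a3 a4 a5 = (\<Prod>r<n.
     qpoch_inf (t ^ (n - 1 + r) * (a2 * a3 * a4 * a5)) q * qpoch_inf (t ^ (n - 1 + r) * (a1 * a3 * a4 * a5)) q *
     qpoch_inf (t ^ (n - 1 + r) * (a1 * a2 * a4 * a5)) q * qpoch_inf (t ^ (n - 1 + r) * (a1 * a2 * a3 * a5)) q *
     qpoch_inf (t ^ (n - 1 + r) * (a1 * a2 * a3 * a4)) q)"

text \<open>For n = 1 the integral is that of Nassrallah and Rahman, in general it is Gustafson's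
  multivariate form. The parameter-dependent part of its product evaluation is divided out
  here.\<close>

definition BC_ratio :: "complex \<Rightarrow> complex \<Rightarrow> nat \<Rightarrow> complex \<Rightarrow> complex \<Rightarrow> complex \<Rightarrow> complex \<Rightarrow> complex \<Rightarrow> complex" where
  "BC_ratio q t n a1 a2 a3 a4 a5 =
     BC_integral q t n (t ^ (2 * n - 2) * (a1 * a2 * a3 * a4 * a5)) [a1, a2, a3, a4, a5] *
     pair_factors q t n a1 a2 a3 a4 a5 / quad_factors q t n a1 a2 a3 a4 a5"

lemma BC_ratio_swap:
  "BC_ratio q t n a1 a2 a3 a4 a5 = BC_ratio q t n a1 a2 a4 a3 a5"
  "BC_ratio q t n a1 a2 a3 a4 a5 = BC_ratio q t n a1 a2 a4 a5 a3"
  "BC_ratio q t n a1 a2 a3 a4 a5 = BC_ratio q t n a3 a4 a1 a2 a5"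
proof -
  have m: "BC_integral q t n A [a1, a2, a3, a4, a5] = BC_integral q t n A [a1, a2, a4, a3, a5]"
    "BC_integral q t n A [a1, a2, a3, a4, a5] = BC_integral q t n A [a1, a2, a4, a5, a3]"
    "BC_integral q t n A [a1, a2, a3, a4, a5] = BC_integral q t n A [a3, a4, a1, a2, a5]" for A
    by (rule BC_integral_mset; simp add: add_ac)+
  have p: "pair_factors q t n a1 a2 a3 a4 a5 = pair_factors q t n a1 a2 a4 a3 a5"
    "pair_factors q t n a1 a2 a3 a4 a5 = pair_factors q t n a1 a2 a4 a5 a3"
    "pair_factors q t n a1 a2 a3 a4 a5 = pair_factors q t n a3 a4 a1 a2 a5"
    unfolding pair_factors_def by (intro prod.cong refl; simp only: mult_ac)+
  have q: "quad_factors q t n a1 a2 a3 a4 a5 = quad_factors q t n a1 a2 a4 a3 a5"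
    "quad_factors q t n a1 a2 a3 a4 a5 = quad_factors q t n a1 a2 a4 a5 a3"
    "quad_factors q t n a1 a2 a3 a4 a5 = quad_factors q t n a3 a4 a1 a2 a5"
    unfolding quad_factors_def by (intro prod.cong refl; simp only: mult_ac)+
  have A: "a1 * a2 * a3 * a4 * a5 = a1 * a2 * a4 * a3 * a5" "a1 * a2 * a3 * a4 * a5 = a1 * a2 * a4 * a5 * a3"
    "a1 * a2 * a3 * a4 * a5 = a3 * a4 * a1 * a2 * a5" by (simp_all only: mult_ac)
  show "BC_ratio q t n a1 a2 a3 a4 a5 = BC_ratio q t n a1 a2 a4 a3 a5"
    unfolding BC_ratio_def by (subst A(1), subst m(1), subst p(1), subst q(1)) (rule refl)
  show "BC_ratio q t n a1 a2 a3 a4 a5 = BC_ratio q t n a1 a2 a4 a5 a3"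
    unfolding BC_ratio_def by (subst A(2), subst m(2), subst p(2), subst q(2)) (rule refl)
  show "BC_ratio q t n a1 a2 a3 a4 a5 = BC_ratio q t n a3 a4 a1 a2 a5"
    unfolding BC_ratio_def by (subst A(3), subst m(3), subst p(3), subst q(3)) (rule refl)
qed

lemma pair_factors_nonzero:
  assumes "norm q < 1" "norm t < 1" "norm a1 < 1" "norm a2 < 1" "norm a3 < 1" "norm a4 < 1" "norm a5 < 1"
  shows "pair_factors q t n a1 a2 a3 a4 a5 \<noteq> 0"
  unfolding pair_factors_def using assms
  by (simp add: prod_zero_iff qpoch_inf_nonzero norm_power_mult_less_1 norm_mult_less_1)

lemma quad_factors_nonzero:
  assumes "norm q < 1" "norm t < 1" "norm a1 < 1" "norm a2 < 1" "norm a3 < 1" "norm a4 < 1" "norm a5 < 1"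
  shows "quad_factors q t n a1 a2 a3 a4 a5 \<noteq> 0"
  unfolding quad_factors_def using assms
  by (simp add: prod_zero_iff qpoch_inf_nonzero norm_power_mult_less_1 norm_mult_less_1)

text \<open>Four of the pair products and four of the five fourfold products contain a3. Each loses
  its first factor when a3 becomes q * a3, and these lost factors are the ones in
  \<open>BC_integral_shift\<close>.\<close>

lemma BC_ratio_shift:
  assumes q: "norm q < 1" "q \<noteq> 0" and t: "norm t < 1" "t \<noteq> 0"
    and a: "norm a1 < 1" "norm a2 < 1" "norm a3 < 1" "norm a4 < 1" "norm a5 < 1"
    and a0: "a1 \<noteq> 0" "a2 \<noteq> 0" "a3 \<noteq> 0" "a4 \<noteq> 0" "a5 \<noteq> 0"
    and gen: "\<And>k :: int. t powi k * a2 / a1 \<noteq> 1"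
  shows "BC_ratio q t (Suc m) a1 a2 (q * a3) a4 a5 = BC_ratio q t (Suc m) a1 a2 a3 a4 a5"
proof -
  let ?n = "Suc m"
  let ?X = "\<Prod>r<?n. (1 - t ^ r * (a1 * a3)) * (1 - t ^ r * (a2 * a3)) * (1 - t ^ r * (a3 * a4)) * (1 - t ^ r * (a3 * a5))"
  let ?Y = "\<Prod>r<?n. (1 - t ^ (m + r) * (a2 * a3 * a4 * a5)) * (1 - t ^ (m + r) * (a1 * a3 * a4 * a5)) *
        (1 - t ^ (m + r) * (a1 * a2 * a3 * a5)) * (1 - t ^ (m + r) * (a1 * a2 * a3 * a4))"
  let ?A = "t ^ (2 * m) * (a1 * a2 * a3 * a4 * a5)"
  have rec: "qpoch_inf u q = (1 - u) * qpoch_inf (q * u) q" for u by (rule qpoch_inf_rec[OF q(1)])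
  have Q: "pair_factors q t ?n a1 a2 a3 a4 a5 = ?X * pair_factors q t ?n a1 a2 (q * a3) a4 a5"
    unfolding pair_factors_def prod.distrib[symmetric]
  proof (rule prod.cong[OF refl])
    fix r
    have e: "qpoch_inf (t ^ r * (b * a3)) q = (1 - t ^ r * (b * a3)) * qpoch_inf (t ^ r * (b * (q * a3))) q"
      "qpoch_inf (t ^ r * (a3 * b)) q = (1 - t ^ r * (a3 * b)) * qpoch_inf (t ^ r * (q * a3 * b)) q" for b
      by (subst rec, simp add: mult_ac)+
    show "qpoch_inf (t ^ r * (a1 * a2)) q * qpoch_inf (t ^ r * (a1 * a3)) q * qpoch_inf (t ^ r * (a1 * a4)) q *
     qpoch_inf (t ^ r * (a1 * a5)) q * qpoch_inf (t ^ r * (a2 * a3)) q * qpoch_inf (t ^ r * (a2 * a4)) q *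
     qpoch_inf (t ^ r * (a2 * a5)) q * qpoch_inf (t ^ r * (a3 * a4)) q * qpoch_inf (t ^ r * (a3 * a5)) q *
     qpoch_inf (t ^ r * (a4 * a5)) q =
     (1 - t ^ r * (a1 * a3)) * (1 - t ^ r * (a2 * a3)) * (1 - t ^ r * (a3 * a4)) * (1 - t ^ r * (a3 * a5)) *
     (qpoch_inf (t ^ r * (a1 * a2)) q * qpoch_inf (t ^ r * (a1 * (q * a3))) q * qpoch_inf (t ^ r * (a1 * a4)) q *
     qpoch_inf (t ^ r * (a1 * a5)) q * qpoch_inf (t ^ r * (a2 * (q * a3))) q * qpoch_inf (t ^ r * (a2 * a4)) q *
     qpoch_inf (t ^ r * (a2 * a5)) q * qpoch_inf (t ^ r * (q * a3 * a4)) q * qpoch_inf (t ^ r * (q * a3 * a5)) q *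
     qpoch_inf (t ^ r * (a4 * a5)) q)"
      unfolding e(1)[of a1] e(1)[of a2] e(2)[of a4] e(2)[of a5] by (simp only: mult_ac)
  qed
  have P: "quad_factors q t ?n a1 a2 a3 a4 a5 = ?Y * quad_factors q t ?n a1 a2 (q * a3) a4 a5"
    unfolding quad_factors_def prod.distrib[symmetric]
  proof (rule prod.cong[OF refl])
    fix r
    have e: "qpoch_inf (t ^ k * (x * a3 * y * z)) q = (1 - t ^ k * (x * a3 * y * z)) * qpoch_inf (t ^ k * (x * (q * a3) * y * z)) q"
      "qpoch_inf (t ^ k * (x * y * a3 * z)) q = (1 - t ^ k * (x * y * a3 * z)) * qpoch_inf (t ^ k * (x * y * (q * a3) * z)) q"
      for k x y z
      by (subst rec, simp add: mult_ac)+
    show "qpoch_inf (t ^ (?n - 1 + r) * (a2 * a3 * a4 * a5)) q * qpoch_inf (t ^ (?n - 1 + r) * (a1 * a3 * a4 * a5)) q *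
     qpoch_inf (t ^ (?n - 1 + r) * (a1 * a2 * a4 * a5)) q * qpoch_inf (t ^ (?n - 1 + r) * (a1 * a2 * a3 * a5)) q *
     qpoch_inf (t ^ (?n - 1 + r) * (a1 * a2 * a3 * a4)) q =
     (1 - t ^ (m + r) * (a2 * a3 * a4 * a5)) * (1 - t ^ (m + r) * (a1 * a3 * a4 * a5)) *
        (1 - t ^ (m + r) * (a1 * a2 * a3 * a5)) * (1 - t ^ (m + r) * (a1 * a2 * a3 * a4)) *
     (qpoch_inf (t ^ (?n - 1 + r) * (a2 * (q * a3) * a4 * a5)) q * qpoch_inf (t ^ (?n - 1 + r) * (a1 * (q * a3) * a4 * a5)) q *
     qpoch_inf (t ^ (?n - 1 + r) * (a1 * a2 * a4 * a5)) q * qpoch_inf (t ^ (?n - 1 + r) * (a1 * a2 * (q * a3) * a5)) q *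
     qpoch_inf (t ^ (?n - 1 + r) * (a1 * a2 * (q * a3) * a4)) q)"
      unfolding e(1)[of _ a2 a4 a5] e(1)[of _ a1 a4 a5] e(2)[of _ a1 a2 a5] e(2)[of _ a1 a2 a4] diff_Suc_1
      by (simp only: mult_ac)
  qed
  have Y: "?Y \<noteq> 0"
    using t a by (simp add: prod_zero_iff norm_power_mult_less_1 norm_mult_less_1 one_minus_nonzero del: right_minus_eq eq_iff_diff_eq_0)
  have qa: "norm (q * a3) < 1" using norm_mult_less_1[OF q(1) a(3)] .
  have P0: "quad_factors q t ?n a1 a2 (q * a3) a4 a5 \<noteq> 0" by (intro quad_factors_nonzero q t a qa)
  have n2: "2 * ?n - 2 = 2 * m" by simp
  have A': "t ^ (2 * m) * (a1 * a2 * (q * a3) * a4 * a5) = q * ?A" by (simp only: mult_ac)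
  have sh: "BC_integral q t ?n (q * ?A) [a1, a2, q * a3, a4, a5] * ?Y = BC_integral q t ?n ?A [a1, a2, a3, a4, a5] * ?X"
    by (rule BC_integral_shift[OF q t a a0 gen refl])
  have alg: "J' * Q' / P' = J * (X * Q') / (Y * P')" if "J' * Y = J * X" "Y \<noteq> 0" "P' \<noteq> 0" for J J' X Y Q' P' :: complex
    using that by (simp add: field_simps)
  show ?thesis
    unfolding BC_ratio_def n2 A' Q P by (rule alg[OF sh Y P0])
qed

text \<open>Parameters equal to 0 are allowed, as the limits along powers of q require.\<close>

lemma continuous_on_BC_integral:
  fixes A f1 f2 f3 f4 f5 :: "complex \<Rightarrow> complex"
  assumes K: "compact K" and q: "norm q < 1" and t: "norm t < 1"
    and cont: "continuous_on K A" "continuous_on K f1" "continuous_on K f2" "continuous_on K f3"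
       "continuous_on K f4" "continuous_on K f5"
    and lt: "\<And>s. s \<in> K \<Longrightarrow> norm (f1 s) < 1 \<and> norm (f2 s) < 1 \<and> norm (f3 s) < 1 \<and> norm (f4 s) < 1 \<and> norm (f5 s) < 1"
  shows "continuous_on K (\<lambda>s. BC_integral q t n (A s) [f1 s, f2 s, f3 s, f4 s, f5 s])"
  unfolding BC_integral_def
proof (rule continuous_on_torus_mean[OF K])
  let ?S = "K \<times> torus"
  have z: "continuous_on ?S (\<lambda>x. snd x k)" for k
    by (rule continuous_on_compose2[OF continuous_on_torus_component continuous_on_snd[OF continuous_on_id]]) auto
  have f: "continuous_on ?S (\<lambda>x. g (fst x))" if "continuous_on K g" for g :: "complex \<Rightarrow> complex"
    by (rule continuous_on_compose2[OF that continuous_on_fst[OF continuous_on_id]]) auto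
  have z0: "snd x k \<noteq> 0" "norm (snd x k) = 1" if "x \<in> ?S" for x k using that by (auto simp: torusD)
  have V: "continuous_on ?S (\<lambda>x. BC_vandermonde p n (snd x))" if "norm p < 1" for p
    by (rule continuous_on_compose2[OF continuous_on_BC_vandermonde_torus[OF that] continuous_on_snd[OF continuous_on_id]]) auto
  have O: "continuous_on ?S (\<lambda>x. omega q t (weight_pm q (A (fst x)) [f1 (fst x), f2 (fst x), f3 (fst x), f4 (fst x), f5 (fst x)]) n (snd x))"
    unfolding omega_def
  proof (intro continuous_on_divide continuous_on_prod ballI)
    have d: "continuous_on ?S (\<lambda>x. qpoch_inf (g (fst x) * snd x k) q * qpoch_inf (g (fst x) / snd x k) q)"
      if "continuous_on K g" for g :: "complex \<Rightarrow> complex" and k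
      using z0 q by (intro continuous_intros f that z) auto
    fix k
    have "continuous_on ?S (\<lambda>x. qpoch_pm q [A (fst x)] (snd x k))"
      unfolding qpoch_pm_simps by (intro continuous_intros d cont)
    moreover have "continuous_on ?S (\<lambda>x. qpoch_pm q [f1 (fst x), f2 (fst x), f3 (fst x), f4 (fst x), f5 (fst x)] (snd x k))"
      unfolding qpoch_pm_simps by (intro continuous_intros d cont)
    moreover have "qpoch_pm q [f1 (fst x), f2 (fst x), f3 (fst x), f4 (fst x), f5 (fst x)] (snd x k) \<noteq> 0" if "x \<in> ?S" for x
      using lt[of "fst x"] that z0(2)[OF that] by (intro qpoch_pm_nonzero q) auto
    ultimately show "continuous_on ?S (\<lambda>x. weight_pm q (A (fst x)) [f1 (fst x), f2 (fst x), f3 (fst x), f4 (fst x), f5 (fst x)] (snd x k))"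
      unfolding weight_pm_def by (intro continuous_on_divide ballI)
  next
    show "continuous_on ?S (\<lambda>x. pair_prod (pair_den q t) n (snd x))"
      unfolding pair_den_def using q t z0 by (intro continuous_on_pair_prod continuous_intros z) auto
    show "pair_prod (pair_den q t) n (snd x) \<noteq> 0" if "x \<in> ?S" for x
      using z0(2)[OF that] by (intro pair_prod_nonzero pair_den_nonzero q t)
  qed
  have "continuous_on ?S (\<lambda>x. BC_vandermonde 0 n (snd x) * BC_vandermonde q n (snd x) *
     omega q t (weight_pm q (A (fst x)) [f1 (fst x), f2 (fst x), f3 (fst x), f4 (fst x), f5 (fst x)]) n (snd x))"
    by (intro continuous_on_mult V O) (use q in auto)
  then show "continuous_on ?S (\<lambda>(s, z). BC_vandermonde 0 n z * BC_vandermonde q n z *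
     omega q t (weight_pm q (A s) [f1 s, f2 s, f3 s, f4 s, f5 s]) n z)"
    by (simp only: case_prod_unfold)
qed

lemma continuous_on_BC_ratio:
  fixes f1 f2 f3 f4 f5 :: "complex \<Rightarrow> complex"
  assumes K: "compact K" and q: "norm q < 1" and t: "norm t < 1"
    and cont: "continuous_on K f1" "continuous_on K f2" "continuous_on K f3" "continuous_on K f4" "continuous_on K f5"
    and lt: "\<And>s. s \<in> K \<Longrightarrow> norm (f1 s) < 1 \<and> norm (f2 s) < 1 \<and> norm (f3 s) < 1 \<and> norm (f4 s) < 1 \<and> norm (f5 s) < 1"
  shows "continuous_on K (\<lambda>s. BC_ratio q t n (f1 s) (f2 s) (f3 s) (f4 s) (f5 s))"
proof -
  have "continuous_on K (\<lambda>s. BC_integral q t n (t ^ (2 * n - 2) * (f1 s * f2 s * f3 s * f4 s * f5 s)) [f1 s, f2 s, f3 s, f4 s, f5 s])"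
    by (intro continuous_on_BC_integral K q t cont lt continuous_intros)
  moreover have "continuous_on K (\<lambda>s. pair_factors q t n (f1 s) (f2 s) (f3 s) (f4 s) (f5 s))"
    unfolding pair_factors_def using q by (intro continuous_intros cont)
  moreover have "continuous_on K (\<lambda>s. quad_factors q t n (f1 s) (f2 s) (f3 s) (f4 s) (f5 s))"
    unfolding quad_factors_def using q by (intro continuous_intros cont)
  moreover have "quad_factors q t n (f1 s) (f2 s) (f3 s) (f4 s) (f5 s) \<noteq> 0" if "s \<in> K" for s
    using lt[OF that] by (intro quad_factors_nonzero q t) auto
  ultimately show ?thesis unfolding BC_ratio_def by (intro continuous_on_divide continuous_on_mult ballI)
qed

lemma powers_tendsto_0: "norm (q :: complex) < 1 \<Longrightarrow> (\<lambda>i. q ^ i) \<longlonglongrightarrow> 0"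
  by (rule LIMSEQ_power_zero)

lemma constant_along_powers:
  assumes q: "norm (q :: complex) < 1" and f: "continuous_on (cball 0 1) f" and c: "\<And>i. f (q ^ i) = c"
  shows "f 0 = (c :: complex)"
proof -
  have "norm (q ^ i) \<le> 1" for i using q by (simp add: norm_power power_le_one)
  then have "(\<lambda>i. f (q ^ i)) \<longlonglongrightarrow> f 0"
    using f powers_tendsto_0[OF q] unfolding continuous_on_sequentially o_def by auto
  moreover have "(\<lambda>i. f (q ^ i)) \<longlonglongrightarrow> c" by (simp add: c)
  ultimately show ?thesis by (rule LIMSEQ_unique)
qed

definition generic_parameters :: "complex \<Rightarrow> complex \<Rightarrow> complex \<Rightarrow> complex \<Rightarrow> complex \<Rightarrow> complex \<Rightarrow> bool" where
  "generic_parameters t a1 a2 a3 a4 a5 \<longleftrightarrow> (\<forall>a\<in>{a1, a2, a3, a4, a5}. norm a < 1 \<and> a \<noteq> 0) \<and> (\<forall>k :: int. t powi k * a2 / a1 \<noteq> 1)"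

text \<open>The shift moves only the third parameter; cycling the last three between shifts
  multiplies all of them by q. Iteration drives them to 0 without changing the ratio, which is
  continuous there.\<close>

lemma BC_ratio_reduce:
  assumes q: "norm q < 1" "q \<noteq> 0" and t: "norm t < 1" "t \<noteq> 0" and g: "generic_parameters t a1 a2 a3 a4 a5"
  shows "BC_ratio q t (Suc m) a1 a2 a3 a4 a5 = BC_ratio q t (Suc m) a1 a2 0 0 0"
proof -
  let ?K = "BC_ratio q t (Suc m) a1 a2"
  have a: "norm a1 < 1" "norm a2 < 1" "norm a3 < 1" "norm a4 < 1" "norm a5 < 1"
    "a1 \<noteq> 0" "a2 \<noteq> 0" "a3 \<noteq> 0" "a4 \<noteq> 0" "a5 \<noteq> 0" and gen: "\<And>k :: int. t powi k * a2 / a1 \<noteq> 1"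
    using g by (auto simp: generic_parameters_def)
  have le: "norm (s * b) < 1" if "norm s \<le> 1" "norm b < 1" for s b :: complex
  proof -
    have "norm s * norm b \<le> 1 * norm b" using that by (intro mult_right_mono) auto
    then show ?thesis using that by (simp add: norm_mult)
  qed
  have sh: "?K (q * b3) b4 b5 = ?K b3 b4 b5"
    if "norm b3 < 1" "norm b4 < 1" "norm b5 < 1" "b3 \<noteq> 0" "b4 \<noteq> 0" "b5 \<noteq> 0" for b3 b4 b5
    by (rule BC_ratio_shift[OF q t a(1,2) that(1-3) a(6,7) that(4-6) gen])
  have "?K (q ^ i * a3) (q ^ i * a4) (q ^ i * a5) = ?K a3 a4 a5" for i
  proof (induction i)
    case (Suc i)
    have n: "norm (q ^ i * b) < 1" if "norm b < 1" for b using q that norm_power_mult_less_1 by blast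
    have n': "norm (q * (q ^ i * b)) < 1" if "norm b < 1" for b using norm_mult_less_1[OF q(1) n[OF that]] .
    have "?K (q * (q ^ i * a3)) (q * (q ^ i * a4)) (q * (q ^ i * a5)) = ?K (q ^ i * a3) (q * (q ^ i * a4)) (q * (q ^ i * a5))"
      using a q n n' by (intro sh) auto
    also have "\<dots> = ?K (q * (q ^ i * a4)) (q * (q ^ i * a5)) (q ^ i * a3)" by (rule BC_ratio_swap(2))
    also have "\<dots> = ?K (q ^ i * a4) (q * (q ^ i * a5)) (q ^ i * a3)"
      using a q n n' by (intro sh) auto
    also have "\<dots> = ?K (q * (q ^ i * a5)) (q ^ i * a3) (q ^ i * a4)" by (rule BC_ratio_swap(2))
    also have "\<dots> = ?K (q ^ i * a5) (q ^ i * a3) (q ^ i * a4)"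
      using a q n n' by (intro sh) auto
    also have "\<dots> = ?K (q ^ i * a3) (q ^ i * a4) (q ^ i * a5)" by (rule BC_ratio_swap(2))
    also note Suc
    finally show ?case by (simp only: power_Suc mult.assoc)
  qed simp
  moreover have "continuous_on (cball 0 1) (\<lambda>s. ?K (s * a3) (s * a4) (s * a5))"
    by (intro continuous_on_BC_ratio compact_cball q t continuous_intros) (use a le in auto)
  ultimately have "?K (0 * a3) (0 * a4) (0 * a5) = ?K a3 a4 a5"
    by (intro constant_along_powers[OF q(1), of "\<lambda>s. ?K (s * a3) (s * a4) (s * a5)"])
  then show ?thesis by simp
qed

text \<open>By \<open>BC_ratio_reduce\<close> only the first two parameters matter. Inserting b1, b2
  in the third and fourth places and exchanging the pairs shows that these do not matter
  either.\<close>

lemma BC_ratio_constant: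
  assumes q: "norm q < 1" "q \<noteq> 0" and t: "norm t < 1" "t \<noteq> 0"
    and g: "generic_parameters t a1 a2 a3 a4 a5" and h: "generic_parameters t b1 b2 b3 b4 b5"
  shows "BC_ratio q t (Suc m) a1 a2 a3 a4 a5 = BC_ratio q t (Suc m) b1 b2 b3 b4 b5"
proof -
  let ?K = "BC_ratio q t (Suc m)"
  have g': "generic_parameters t a1 a2 b1 b2 a5" "generic_parameters t b1 b2 a1 a2 a5"
    using g h by (auto simp: generic_parameters_def)
  have "?K a1 a2 a3 a4 a5 = ?K a1 a2 0 0 0" by (rule BC_ratio_reduce[OF q t g])
  also have "\<dots> = ?K a1 a2 b1 b2 a5" by (rule BC_ratio_reduce[OF q t g'(1), symmetric])
  also have "\<dots> = ?K b1 b2 a1 a2 a5" by (rule BC_ratio_swap(3))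
  also have "\<dots> = ?K b1 b2 0 0 0" by (rule BC_ratio_reduce[OF q t g'(2)])
  also have "\<dots> = ?K b1 b2 b3 b4 b5" by (rule BC_ratio_reduce[OF q t h, symmetric])
  finally show ?thesis .
qed

text \<open>\<open>generic_parameters\<close> excludes a vanishing parameter, so the value at 0 is
  obtained as a limit along q ^ i * a5.\<close>

lemma BC_ratio_last_zero:
  assumes q: "norm q < 1" "q \<noteq> 0" and t: "norm t < 1" "t \<noteq> 0" and g: "generic_parameters t a1 a2 a3 a4 a5"
  shows "BC_ratio q t (Suc m) a1 a2 a3 a4 0 = BC_ratio q t (Suc m) a1 a2 a3 a4 a5"
proof -
  let ?K = "BC_ratio q t (Suc m) a1 a2 a3 a4"
  have a: "norm a1 < 1" "norm a2 < 1" "norm a3 < 1" "norm a4 < 1" "norm a5 < 1"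
    using g by (auto simp: generic_parameters_def)
  have le: "norm (s * b) < 1" if "norm s \<le> 1" "norm b < 1" for s b :: complex
  proof -
    have "norm s * norm b \<le> 1 * norm b" using that by (intro mult_right_mono) auto
    then show ?thesis using that by (simp add: norm_mult)
  qed
  have "?K (q ^ i * a5) = ?K a5" for i
  proof (rule BC_ratio_constant[OF q t _ g])
    show "generic_parameters t a1 a2 a3 a4 (q ^ i * a5)"
      using g q norm_power_mult_less_1[OF q(1) a(5)] by (auto simp: generic_parameters_def)
  qed
  moreover have "continuous_on (cball 0 1) (\<lambda>s. ?K (s * a5))"
    by (intro continuous_on_BC_ratio compact_cball q t continuous_intros) (use a le in auto)
  ultimately have "?K (0 * a5) = ?K a5"
    by (intro constant_along_powers[OF q(1), of "\<lambda>s. ?K (s * a5)"])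
  then show ?thesis by simp
qed

text \<open>The mean of the density against the fully symmetrized branching kernel is computed
  twice. Unfolding gives 2 ^ (m + 1) * fact (m + 1) times the mean with the kernel itself, and the
  mean value property in the last variable, with \<open>disc_function\<close> equal to -1 at 0,
  leaves the integral in m variables. Evaluating the symmetrization gives 2 ^ m * fact m and theta
  factors times the integral in m + 1 variables.\<close>

lemma BC_integral_recursion:
  assumes q: "norm q < 1" "q \<noteq> 0" and t: "norm t < 1" "t \<noteq> 0"
    and a: "norm a1 < 1" "norm a2 < 1" "norm a3 < 1" "norm a4 < 1"
    and a0: "a1 \<noteq> 0" "a2 \<noteq> 0" "a3 \<noteq> 0" "a4 \<noteq> 0"
    and bal: "a1 * a2 * a3 * a4 * t ^ (2 * m) = q"
    and V: "BC_vandermonde q (Suc m) (\<lambda>k. a1 * t ^ k) \<noteq> 0"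
  shows "theta (t ^ Suc m) q * theta (t ^ m * a1 * a2) q * theta (t ^ m * a1 * a3) q * theta (t ^ m * a1 * a4) q *
      BC_integral q t (Suc m) 0 [a1, a2, a3, a4] = - 2 * of_nat (Suc m) * theta t q * BC_integral q t m 0 [a1, a2, a3, a4]"
proof -
  define as where "as = [a1, a2, a3, a4]"
  have as: "norm b < 1 \<and> b \<noteq> 0" if "b \<in> set as" for b using that a a0 by (auto simp: as_def)
  let ?n = "Suc m"
  let ?B = "branching_kernel q t a1 a2 a3 a4 m"
  let ?T = "theta (t ^ Suc m) q * theta (t ^ m * a1 * a2) q * theta (t ^ m * a1 * a3) q * theta (t ^ m * a1 * a4) q"
  define F where "F = (\<lambda>z. BC_vandermonde 0 ?n z * omega q t (weight_pm q 0 as) ?n z)"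
  have Om: "continuous_on torus (omega q t (weight_pm q 0 as) k)" for k
    using as by (intro continuous_on_omega q t continuous_on_weight_pm) auto
  have F: "continuous_on torus F"
    unfolding F_def by (intro continuous_intros continuous_on_BC_vandermonde_torus Om) simp
  have Fflip: "F (z(i := 1 / z i)) = - F z" if "\<forall>i. z i \<noteq> 0" "i < ?n" for z i
    unfolding F_def using BC_vandermonde_flip[of 0, OF _ that] omega_flip[where X="weight_pm q 0 as" and z=z and i=i, OF weight_pm_inverse that(2)] by simp
  have Ftrans: "F (z \<circ> Transposition.transpose i j) = - F z" if "\<forall>i. z i \<noteq> 0" "i < ?n" "j < ?n" "i \<noteq> j" for z i j
    unfolding F_def using BC_vandermonde_transpose[of 0, OF _ that] omega_transpose[OF that(2-4)] by simp
  have mult: "BC_multiplier q ?n ?B" by (intro BC_multiplier_branching_kernel q t a0 bal)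
  then have B: "continuous_on torus ?B"
    unfolding BC_multiplier_def using torus_subset_nonzero continuous_on_subset by blast
  have "BC_multiplier q ?n (perm_sum ?n ?B)"
    unfolding perm_sum_def by (intro BC_multiplier_sum BC_multiplier_comp mult) (auto simp: finite_permutations)
  then have PB: "continuous_on torus (perm_sum ?n ?B)"
    unfolding BC_multiplier_def using torus_subset_nonzero continuous_on_subset by blast
  have inner: "torus_mean ?n (\<lambda>z. ?B z * F z) = - BC_integral q t m 0 as"
  proof -
    have "torus_mean ?n (\<lambda>z. ?B z * F z) = torus_mean m (\<lambda>z. circle_mean (\<lambda>u. ?B (z(m := u)) * F (z(m := u))))"
      by (intro torus_mean_Suc continuous_intros B F)
    also have "\<dots> = torus_mean m (\<lambda>z. (-1) * (BC_vandermonde 0 m z * BC_vandermonde q m z * omega q t (weight_pm q 0 as) m z))"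
    proof (rule torus_mean_cong)
      fix z :: "nat \<Rightarrow> complex" assume z: "z \<in> torus"
      define C where "C = BC_vandermonde q m z * (BC_vandermonde 0 m z * omega q t (weight_pm q 0 as) m z)"
      have "?B (z(m := u)) * F (z(m := u)) = C * disc_function q t as m z u" if u: "norm u = 1" for u
      proof -
        have 1: "(\<Prod>a\<leftarrow>as. theta (a / u) q) = theta (a1 / u) q * theta (a2 / u) q * theta (a3 / u) q * theta (a4 / u) q"
          by (simp add: as_def mult_ac)
        have 2: "(\<Prod>k<m. theta (t * (z(m := u)) k / u) q * theta (t / (u * (z(m := u)) k)) q) =
           (\<Prod>j<m. theta (t * z j / u) q * theta (t / (z j * u)) q)"
          by (intro prod.cong) (auto simp: mult.commute)
        have "?B (z(m := u)) * F (z(m := u)) = BC_vandermonde q m z * (u ^ Suc m * (\<Prod>a\<leftarrow>as. theta (a / u) q) *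
            (\<Prod>j<m. theta (t * z j / u) q * theta (t / (z j * u)) q) *
            (BC_vandermonde 0 (Suc m) (z(m := u)) * omega q t (weight_pm q 0 as) (Suc m) (z(m := u))))"
          unfolding branching_kernel_def F_def fun_upd_same 1 2 BC_vandermonde_upd[OF order.refl] by (simp only: mult_ac)
        also have "\<dots> = C * disc_function q t as m z u"
          by (subst disc_function_eq[OF q(1) t as z u]) (simp_all only: C_def mult.assoc)
        finally show ?thesis .
      qed
      then have "circle_mean (\<lambda>u. ?B (z(m := u)) * F (z(m := u))) = circle_mean (\<lambda>u. C * disc_function q t as m z u)"
        by (rule circle_mean_cong)
      also have "\<dots> = C * disc_function q t as m z 0"
        unfolding circle_mean_mult
        using circle_mean_holomorphic[OF holomorphic_on_disc_function[OF q(1) t(1) _ z, of as]] as by simp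
      finally show "circle_mean (\<lambda>u. ?B (z(m := u)) * F (z(m := u))) =
         (-1) * (BC_vandermonde 0 m z * BC_vandermonde q m z * omega q t (weight_pm q 0 as) m z)"
        by (simp add: C_def mult_ac)
    qed
    finally show ?thesis unfolding torus_mean_mult BC_integral_def by simp
  qed
  have "theta t q * (2 ^ ?n * (fact ?n * torus_mean ?n (\<lambda>z. ?B z * F z))) =
     theta t q * torus_mean ?n (\<lambda>z. flip_sum ?n (perm_sum ?n ?B) z * F z)"
    using torus_mean_flip_sum[OF PB F Fflip] torus_mean_perm_sum[OF B F Ftrans] by simp
  also have "\<dots> = torus_mean ?n (\<lambda>z. theta t q * (flip_sum ?n (perm_sum ?n ?B) z * F z))" by simp
  also have "\<dots> = torus_mean ?n (\<lambda>z. (2 ^ m * fact m * ?T) * (BC_vandermonde 0 ?n z * BC_vandermonde q ?n z * omega q t (weight_pm q 0 as) ?n z))"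
  proof (rule torus_mean_cong)
    fix z :: "nat \<Rightarrow> complex" assume "z \<in> torus"
    then have "\<forall>i. z i \<noteq> 0" by (simp add: torusD)
    from flip_perm_sum_branching_kernel[OF q t(2) a0 bal V this]
    have e: "flip_sum ?n (perm_sum ?n ?B) z * theta t q = 2 ^ m * fact m * ?T * BC_vandermonde q ?n z" by (simp only: mult.assoc)
    have "theta t q * (flip_sum ?n (perm_sum ?n ?B) z * F z) = (flip_sum ?n (perm_sum ?n ?B) z * theta t q) * F z"
      by (simp only: mult_ac)
    then show "theta t q * (flip_sum ?n (perm_sum ?n ?B) z * F z) =
      (2 ^ m * fact m * ?T) * (BC_vandermonde 0 ?n z * BC_vandermonde q ?n z * omega q t (weight_pm q 0 as) ?n z)"
      unfolding e F_def by (simp only: mult_ac)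
  qed
  also have "\<dots> = (2 ^ m * fact m) * (?T * BC_integral q t ?n 0 as)"
    unfolding torus_mean_mult BC_integral_def by (simp only: mult.assoc)
  finally have "(2 ^ m * fact m) * (?T * BC_integral q t ?n 0 as) =
     (2 ^ m * fact m) * (- 2 * of_nat ?n * theta t q * BC_integral q t m 0 as)"
  proof -
    assume "theta t q * (2 ^ ?n * (fact ?n * torus_mean ?n (\<lambda>z. ?B z * F z))) = (2 ^ m * fact m) * (?T * BC_integral q t ?n 0 as)"
    moreover have "theta t q * (2 ^ ?n * (fact ?n * - BC_integral q t m 0 as)) = (2 ^ m * fact m) * (- 2 * of_nat ?n * theta t q * BC_integral q t m 0 as)"
      by (simp only: power_Suc fact_Suc mult_minus_left mult_minus_right of_nat_mult mult_ac)
    ultimately show ?thesis by (simp only: inner)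
  qed
  then have "?T * BC_integral q t ?n 0 as = - 2 * of_nat ?n * theta t q * BC_integral q t m 0 as"
    by (rule mult_left_cancel[THEN iffD1, rotated]) simp
  then show ?thesis by (simp only: as_def)
qed

lemma BC_vandermonde_geometric_nonzero:
  assumes p: "norm p < 1" and b: "b \<noteq> 0" and t: "t \<noteq> 0"
    and sq: "\<And>k. k \<le> 2 * m \<Longrightarrow> theta (b ^ 2 * t ^ k) p \<noteq> 0"
    and pw: "\<And>k. 1 \<le> k \<Longrightarrow> k \<le> m \<Longrightarrow> theta (t ^ k) p \<noteq> 0"
  shows "BC_vandermonde p (Suc m) (\<lambda>k. b * t ^ k) \<noteq> 0"
proof -
  have 1: "b * t ^ k * theta (1 / (b * t ^ k) ^ 2) p \<noteq> 0" if "k < Suc m" for k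
  proof -
    have "(b * t ^ k) ^ 2 = b ^ 2 * t ^ (2 * k)" by (simp add: power_mult_distrib mult.commute flip: power_mult)
    then show ?thesis using theta_inverse[OF p, of "(b * t ^ k) ^ 2"] sq[of "2 * k"] that b t by simp
  qed
  have 2: "theta (b * t ^ j * (b * t ^ k)) p * theta (b * t ^ k / (b * t ^ j)) p / (b * t ^ k) \<noteq> 0"
    if "j < k" "k < Suc m" for j k
  proof -
    have "b * t ^ j * (b * t ^ k) = b ^ 2 * t ^ (j + k)" by (simp add: power_add power2_eq_square mult_ac)
    moreover have "b * t ^ k / (b * t ^ j) = t ^ (k - j)" using b t that by (simp add: power_diff)
    ultimately show ?thesis using sq[of "j + k"] pw[of "k - j"] that b t by simp
  qed
  show ?thesis unfolding BC_vandermonde_def using 1 2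
    by (auto simp: prod_zero_iff simp del: mult_eq_0_iff divide_eq_0_iff intro!: pair_prod_nonzero no_zero_divisors)
qed

text \<open>All four parameters lie near a fourth root w of q / t ^ (2 * m), which has modulus less
  than 1 by \<open>qt\<close>. Multiplying them by exp s, exp (2 * s) and the inverses keeps the
  product and makes the tuple generic.\<close>

lemma exists_balanced_parameters:
  fixes q t :: complex
  assumes q: "norm q < 1" "q \<noteq> 0" and t: "norm t < 1" "t \<noteq> 0" and qt: "norm q < norm t ^ (2 * m)"
    and pw: "\<And>k. 1 \<le> k \<Longrightarrow> k \<le> m \<Longrightarrow> theta (t ^ k) q \<noteq> 0"
  obtains a1 a2 a3 a4 where "generic_parameters t a1 a2 a3 a4 a1" "a1 * a2 * a3 * a4 * t ^ (2 * m) = q"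
    "BC_vandermonde q (Suc m) (\<lambda>k. a1 * t ^ k) \<noteq> 0"
proof -
  define Q where "Q = q / t ^ (2 * m)"
  define w where "w = exp (ln Q / 4)"
  have Q: "Q \<noteq> 0" "norm Q < 1" using q t qt by (auto simp: Q_def norm_divide norm_power)
  have w4: "w ^ 4 = Q"
    unfolding w_def exp_of_nat_mult[symmetric] using Q by simp
  have w0: "w \<noteq> 0" by (simp add: w_def)
  have "norm w ^ 4 < 1" using w4 Q by (simp flip: norm_power)
  then have w1: "norm w < 1" by (simp add: power_less_one_iff)
  have small: "\<forall>\<^sub>F s in at 0. norm (w * exp (d * s)) < 1" for d
  proof -
    have "((\<lambda>s. norm (w * exp (d * s))) \<longlongrightarrow> norm (w * exp (d * 0))) (at 0)" by (intro tendsto_intros)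
    then show ?thesis using w1 by (intro order_tendstoD(2)) auto
  qed
  have "\<forall>\<^sub>F s in at 0. \<forall>k\<in>{..2 * m}. theta (w ^ 2 * t ^ k * exp (2 * s)) q \<noteq> 0"
    using w0 t by (intro eventually_ball_finite ballI eventually_theta_exp_nonzero q) auto
  \<comment> \<open>A theta function of nome t expresses that exp s is not an integer power of
    t.\<close>
  moreover have "\<forall>\<^sub>F s in at 0. theta (1 * exp (1 * s)) t \<noteq> 0"
    by (intro eventually_theta_exp_nonzero t) auto
  moreover note small[of 1] small[of 2] small[of "-1"] small[of "-2"]
  ultimately have "\<forall>\<^sub>F s in at 0. (\<forall>k\<in>{..2 * m}. theta (w ^ 2 * t ^ k * exp (2 * s)) q \<noteq> 0) \<and>
     theta (1 * exp (1 * s)) t \<noteq> 0 \<and> norm (w * exp (1 * s)) < 1 \<and> norm (w * exp (2 * s)) < 1 \<and>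
     norm (w * exp (- 1 * s)) < 1 \<and> norm (w * exp (- 2 * s)) < 1"
    by eventually_elim auto
  then obtain s where s: "\<And>k. k \<le> 2 * m \<Longrightarrow> theta (w ^ 2 * t ^ k * exp (2 * s)) q \<noteq> 0"
    "theta (exp s) t \<noteq> 0" "norm (w * exp s) < 1" "norm (w * exp (2 * s)) < 1" "norm (w * exp (- s)) < 1"
    "norm (w * exp (- 2 * s)) < 1"
    using eventually_happens'[OF at_neq_bot] by fastforce
  show thesis
  proof (rule that)
    have "t powi k * (w * exp (2 * s)) / (w * exp s) \<noteq> 1" for k :: int
    proof
      assume "t powi k * (w * exp (2 * s)) / (w * exp s) = 1"
      moreover have "exp (2 * s) = exp s * exp s" by (simp flip: exp_add)
      ultimately have "t powi k * exp s = 1" using w0 by simp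
      then have "exp s = t powi (- k)" using t by (simp add: power_int_minus field_simps)
      then show False using s(2) theta_eq_0_iff[OF t, of "exp s"] by (metis exp_not_eq_zero)
    qed
    then show "generic_parameters t (w * exp s) (w * exp (2 * s)) (w * exp (- s)) (w * exp (- 2 * s)) (w * exp s)"
      using s w0 by (auto simp: generic_parameters_def)
    have "w * exp s * (w * exp (2 * s)) * (w * exp (- s)) * (w * exp (- 2 * s)) = w ^ 4"
      by (simp add: exp_minus field_simps power4_eq_xxxx)
    then show "w * exp s * (w * exp (2 * s)) * (w * exp (- s)) * (w * exp (- 2 * s)) * t ^ (2 * m) = q"
      unfolding w4 Q_def using t by simp
    have "(w * exp s) ^ 2 = w ^ 2 * exp (2 * s)" by (simp add: power_mult_distrib exp_double)
    then show "BC_vandermonde q (Suc m) (\<lambda>k. w * exp s * t ^ k) \<noteq> 0"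
      using s(1) w0 t by (intro BC_vandermonde_geometric_nonzero q pw) (auto simp: mult_ac)
  qed
qed

lemma BC_integral_zero_parameter:
  "BC_integral q t n 0 [a1, a2, a3, a4, 0] = BC_integral q t n 0 [a1, a2, a3, a4]"
  unfolding BC_integral_def weight_pm_def by simp

lemma BC_integral_0 [simp]: "BC_integral q t 0 A as = 1"
  by (simp add: BC_integral_def BC_vandermonde_def)

lemma theta_reciprocal_pair:
  assumes "x * y = p" "x \<noteq> 0"
  shows "qpoch_inf x p * qpoch_inf y p = theta x p"
  using assms by (auto simp: theta_def')

text \<open>The factor (-2) ^ n * fact n is the order of the hyperoctahedral group times the sign
  (-1) ^ n of the product of the two Vandermondes.\<close>

definition ratio_value :: "complex \<Rightarrow> complex \<Rightarrow> nat \<Rightarrow> complex" where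
  "ratio_value q t n = (-2) ^ n * fact n * (\<Prod>i=1..n. qpoch_inf t q / (qpoch_inf q q * qpoch_inf (t ^ i) q))"

text \<open>The ratio does not depend on the parameters, so one tuple suffices to find it: with a vanishing
  fifth parameter and the other four balanced, \<open>BC_integral_recursion\<close> lowers the dimension.\<close>

lemma BC_ratio_eq_ratio_value:
  assumes q: "norm q < 1" "q \<noteq> 0" and t: "norm t < 1" "t \<noteq> 0"
    and "\<And>k. 1 \<le> k \<Longrightarrow> k \<le> n \<Longrightarrow> theta (t ^ k) q \<noteq> 0" "n \<noteq> 0 \<Longrightarrow> norm q < norm t ^ (2 * (n - 1))"
    and "generic_parameters t a1 a2 a3 a4 a5"
  shows "BC_ratio q t n a1 a2 a3 a4 a5 = ratio_value q t n"
  using assms(5-)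
proof (induction n arbitrary: a1 a2 a3 a4 a5)
  case 0
  then show ?case by (simp add: BC_ratio_def pair_factors_def quad_factors_def ratio_value_def)
next
  case (Suc m b1 b2 b3 b4 b5)
  let ?n = "Suc m"
  have pw: "theta (t ^ k) q \<noteq> 0" if "1 \<le> k" "k \<le> ?n" for k using Suc.prems(1) that by simp
  have qt: "norm q < norm t ^ (2 * m)" using Suc.prems(2) by simp
  obtain a1 a2 a3 a4 where g: "generic_parameters t a1 a2 a3 a4 a1" and bal: "a1 * a2 * a3 * a4 * t ^ (2 * m) = q"
    and V: "BC_vandermonde q ?n (\<lambda>k. a1 * t ^ k) \<noteq> 0"
    using exists_balanced_parameters[OF q t qt] pw by (metis le_SucI)
  have a: "norm a1 < 1" "norm a2 < 1" "norm a3 < 1" "norm a4 < 1" and a0: "a1 \<noteq> 0" "a2 \<noteq> 0" "a3 \<noteq> 0" "a4 \<noteq> 0"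
    using g by (auto simp: generic_parameters_def)
  have low: "BC_ratio q t m a1 a2 a3 a4 0 = ratio_value q t m"
  proof (cases m)
    case 0
    then show ?thesis by (simp add: BC_ratio_def pair_factors_def quad_factors_def ratio_value_def)
  next
    case (Suc m')
    have "norm t ^ (2 * m) \<le> norm t ^ (2 * (m - 1))" using t by (intro power_decreasing) auto
    then have "BC_ratio q t m a1 a2 a3 a4 a1 = ratio_value q t m" using pw qt g by (intro Suc.IH) auto
    then show ?thesis unfolding Suc BC_ratio_last_zero[OF q t g] .
  qed
  have high: "BC_ratio q t ?n b1 b2 b3 b4 b5 = BC_ratio q t ?n a1 a2 a3 a4 0"
    unfolding BC_ratio_last_zero[OF q t g] by (rule BC_ratio_constant[OF q t Suc.prems(3) g])
  let ?Q = "\<lambda>k. pair_factors q t k a1 a2 a3 a4 0" and ?P = "\<lambda>k. quad_factors q t k a1 a2 a3 a4 0"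
  let ?J = "\<lambda>k. BC_integral q t k 0 [a1, a2, a3, a4]"
  have ratio: "BC_ratio q t k a1 a2 a3 a4 0 = ?J k * ?Q k / ?P k" for k
    by (simp add: BC_ratio_def BC_integral_zero_parameter)
  have P0: "?P k \<noteq> 0" for k by (intro quad_factors_nonzero q t a) simp
  have JQ: "?J k * ?Q k = BC_ratio q t k a1 a2 a3 a4 0 * ?P k" for k unfolding ratio using P0 by simp
  let ?T = "theta (t ^ m * a1 * a2) q * theta (t ^ m * a1 * a3) q * theta (t ^ m * a1 * a4) q"
  \<comment> \<open>By balancing, the six new pair products group into three complementary pairs,
    each with product q, so they combine into three theta functions.\<close>
  have Q: "?Q ?n = ?Q m * ?T"
  proof -
    have "qpoch_inf (t ^ m * (x * y)) q * qpoch_inf (t ^ m * (z * w)) q = theta (t ^ m * x * y) q"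
      if "x * y * z * w * t ^ (2 * m) = q" "x \<noteq> 0" "y \<noteq> 0" for x y z w
      using theta_reciprocal_pair[of "t ^ m * (x * y)" "t ^ m * (z * w)" q] that t by (simp add: mult_2_right power_add mult_ac)
    then have "?T = (qpoch_inf (t ^ m * (a1 * a2)) q * qpoch_inf (t ^ m * (a3 * a4)) q) *
        (qpoch_inf (t ^ m * (a1 * a3)) q * qpoch_inf (t ^ m * (a2 * a4)) q) *
        (qpoch_inf (t ^ m * (a1 * a4)) q * qpoch_inf (t ^ m * (a2 * a3)) q)"
      using bal a0 by (simp add: mult_ac)
    then show ?thesis by (simp add: pair_factors_def mult_ac)
  qed
  have aa: "a1 * a2 * a3 * a4 = q / t ^ (2 * m)" using bal t by (simp add: field_simps)
  \<comment> \<open>With fifth parameter 0 only the product of the other four survives, and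
    balancing makes it q over a power of t.\<close>
  have Pn: "?P ?n = (\<Prod>k<?n. qpoch_inf (q / t ^ k) q)"
  proof -
    have "?P ?n = (\<Prod>r<?n. qpoch_inf (q / t ^ (m - r)) q)"
      unfolding quad_factors_def
    proof (rule prod.cong[OF refl])
      fix r assume "r \<in> {..<?n}"
      then have "t ^ (2 * m) = t ^ (m + r) * t ^ (m - r)" by (simp add: mult_2 flip: power_add)
      then show "qpoch_inf (t ^ (?n - 1 + r) * (a2 * a3 * a4 * 0)) q * qpoch_inf (t ^ (?n - 1 + r) * (a1 * a3 * a4 * 0)) q *
         qpoch_inf (t ^ (?n - 1 + r) * (a1 * a2 * a4 * 0)) q * qpoch_inf (t ^ (?n - 1 + r) * (a1 * a2 * a3 * 0)) q *
         qpoch_inf (t ^ (?n - 1 + r) * (a1 * a2 * a3 * a4)) q = qpoch_inf (q / t ^ (m - r)) q"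
        unfolding aa using t by simp
    qed
    then show ?thesis using prod.nat_diff_reindex[of "\<lambda>k. qpoch_inf (q / t ^ k) q" ?n] by simp
  qed
  \<comment> \<open>The exponent n - 1 + r depends on n, so in dimension m the powers of t run over
    2, ..., m + 1 instead of 0, ..., m. The ranges differ by the factors at 0, 1 and m + 1.\<close>
  have Pm: "?P m * (qpoch_inf q q * qpoch_inf (q / t) q) = ?P ?n * qpoch_inf (q / t ^ ?n) q"
  proof -
    have "?P m = (\<Prod>r<m. qpoch_inf (q / t ^ (m - Suc r + 2)) q)"
      unfolding quad_factors_def
    proof (rule prod.cong[OF refl])
      fix r assume "r \<in> {..<m}"
      then have "m - 1 + r + (m - Suc r + 2) = 2 * m" by auto
      then have "t ^ (2 * m) = t ^ (m - 1 + r) * t ^ (m - Suc r + 2)" by (simp only: flip: power_add)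
      then show "qpoch_inf (t ^ (m - 1 + r) * (a2 * a3 * a4 * 0)) q * qpoch_inf (t ^ (m - 1 + r) * (a1 * a3 * a4 * 0)) q *
         qpoch_inf (t ^ (m - 1 + r) * (a1 * a2 * a4 * 0)) q * qpoch_inf (t ^ (m - 1 + r) * (a1 * a2 * a3 * 0)) q *
         qpoch_inf (t ^ (m - 1 + r) * (a1 * a2 * a3 * a4)) q = qpoch_inf (q / t ^ (m - Suc r + 2)) q"
        unfolding aa using t by simp
    qed
    also have "\<dots> = (\<Prod>k<m. qpoch_inf (q / t ^ (k + 2)) q)"
      by (rule prod.nat_diff_reindex)
    finally have "?P m * (qpoch_inf q q * qpoch_inf (q / t) q) = (\<Prod>k<Suc (Suc m). qpoch_inf (q / t ^ k) q)"
      by (subst prod.lessThan_Suc_shift, subst prod.lessThan_Suc_shift) (simp add: mult_ac)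
    then show ?thesis unfolding Pn by simp
  qed
  have rec: "theta (t ^ ?n) q * ?T * ?J ?n = - 2 * of_nat ?n * theta t q * ?J m"
    using BC_integral_recursion[OF q t a a0 bal V] by (simp only: mult_ac)
  have "theta (t ^ ?n) q * (?J ?n * ?Q ?n) = (theta (t ^ ?n) q * ?T * ?J ?n) * ?Q m"
    unfolding Q by (simp only: mult_ac)
  also have "\<dots> = - 2 * of_nat ?n * theta t q * (ratio_value q t m * ?P m)"
    unfolding rec low[symmetric] JQ[symmetric] by (simp only: mult_ac)
  finally have main: "theta (t ^ ?n) q * (BC_ratio q t ?n a1 a2 a3 a4 0 * ?P ?n) =
      - 2 * of_nat ?n * theta t q * (ratio_value q t m * ?P m)"
    unfolding JQ .
  define R where "R = BC_ratio q t ?n a1 a2 a3 a4 0"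
  \<comment> \<open>Nonzero because theta (t ^ Suc m) and theta t are, by the assumption on powers
    of t.\<close>
  define D where "D = ?P ?n * qpoch_inf (q / t ^ ?n) q * qpoch_inf (q / t) q"
  have D: "D \<noteq> 0" using P0[of ?n] pw[of ?n] pw[of 1] by (simp add: D_def theta_def')
  have "D * (R * (qpoch_inf (t ^ ?n) q * qpoch_inf q q)) =
     (theta (t ^ ?n) q * (R * ?P ?n)) * (qpoch_inf q q * qpoch_inf (q / t) q)"
    unfolding D_def theta_def' by (simp only: mult_ac)
  also have "\<dots> = - 2 * of_nat ?n * theta t q * ratio_value q t m * (?P m * (qpoch_inf q q * qpoch_inf (q / t) q))"
    unfolding main[folded R_def] by (simp only: mult_ac)
  also have "\<dots> = D * (- 2 * of_nat ?n * qpoch_inf t q * ratio_value q t m)"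
    unfolding Pm D_def theta_def' by (simp only: mult_ac)
  finally have R: "R * (qpoch_inf (t ^ ?n) q * qpoch_inf q q) = - 2 * of_nat ?n * qpoch_inf t q * ratio_value q t m"
    using D by (simp only: mult_cancel_left simp_thms)
  have "qpoch_inf (t ^ ?n) q * qpoch_inf q q \<noteq> 0" using pw[of ?n] qpoch_inf_nonzero[OF q(1) q(1)] by (simp add: theta_def')
  then have "R = - 2 * of_nat ?n * qpoch_inf t q * ratio_value q t m / (qpoch_inf (t ^ ?n) q * qpoch_inf q q)"
    unfolding R[symmetric] by simp
  also have "\<dots> = ratio_value q t ?n" by (simp add: ratio_value_def field_simps)
  finally show ?case unfolding high R_def .
qed

subsection \<open>The theta integral for generic parameters\<close>

definition site_weight :: "complex \<Rightarrow> complex \<Rightarrow> complex \<Rightarrow> complex \<Rightarrow> complex \<Rightarrow> complex \<Rightarrow> complex \<Rightarrow> complex \<Rightarrow> complex \<Rightarrow> nat \<Rightarrow> complex \<Rightarrow> complex" where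
  "site_weight q t v a1 a2 a3 a4 a5 a6 n x = (1 - x ^ 2) *
     (theta (t ^ (n - 1) * a1 * a2 * v / x) q * theta (v * x) q /
       (qpoch_inf (a1 * x) q * qpoch_inf (a1 / x) q * (qpoch_inf (a2 * x) q * qpoch_inf (a2 / x) q))) *
     (qpoch_inf (q * x / a3) q / qpoch_inf (a3 * x) q * (qpoch_inf (q * x / a4) q / qpoch_inf (a4 * x) q) *
      (qpoch_inf (q * x / a5) q / qpoch_inf (a5 * x) q) * (qpoch_inf (q * x / a6) q / qpoch_inf (a6 * x) q))"

definition pair_weight :: "complex \<Rightarrow> complex \<Rightarrow> complex \<Rightarrow> complex \<Rightarrow> complex" where
  "pair_weight q t x y = (1 - x * y) *
     (qpoch_inf (x / y) q * qpoch_inf (y / x) q / (qpoch_inf (t * x / y) q * qpoch_inf (t * y / x) q)) *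
     (qpoch_inf (q * (x * y) / t) q / qpoch_inf (t * (x * y)) q)"

definition theta_integrand :: "complex \<Rightarrow> complex \<Rightarrow> complex \<Rightarrow> complex \<Rightarrow> complex \<Rightarrow> complex \<Rightarrow> complex \<Rightarrow> complex \<Rightarrow> complex \<Rightarrow> nat \<Rightarrow> (nat \<Rightarrow> complex) \<Rightarrow> complex" where
  "theta_integrand q t v a1 a2 a3 a4 a5 a6 n z =
     (\<Prod>k<n. site_weight q t v a1 a2 a3 a4 a5 a6 n (z k)) * pair_prod (pair_weight q t) n z"

definition theta_evaluation :: "complex \<Rightarrow> complex \<Rightarrow> complex \<Rightarrow> complex \<Rightarrow> complex \<Rightarrow> complex \<Rightarrow> complex \<Rightarrow> complex \<Rightarrow> complex \<Rightarrow> nat \<Rightarrow> complex" where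
  "theta_evaluation q t v a1 a2 a3 a4 a5 a6 n = (\<Prod>r<n.
     qpoch_inf t q * (theta (t ^ r * (a1 * v)) q * theta (t ^ r * (a2 * v)) q) *
     (theta (t ^ r * (a3 * a4)) q * theta (t ^ r * (a3 * a5)) q * theta (t ^ r * (a3 * a6)) q *
      theta (t ^ r * (a4 * a5)) q * theta (t ^ r * (a4 * a6)) q * theta (t ^ r * (a5 * a6)) q) /
     (qpoch_inf q q * qpoch_inf (t ^ Suc r) q *
      (qpoch_inf (t ^ r * (a1 * a2)) q * qpoch_inf (t ^ r * (a1 * a3)) q * qpoch_inf (t ^ r * (a1 * a4)) q *
       qpoch_inf (t ^ r * (a1 * a5)) q * qpoch_inf (t ^ r * (a1 * a6)) q * qpoch_inf (t ^ r * (a2 * a3)) q *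
       qpoch_inf (t ^ r * (a2 * a4)) q * qpoch_inf (t ^ r * (a2 * a5)) q * qpoch_inf (t ^ r * (a2 * a6)) q *
       qpoch_inf (t ^ r * (a3 * a4)) q * qpoch_inf (t ^ r * (a3 * a5)) q * qpoch_inf (t ^ r * (a3 * a6)) q *
       qpoch_inf (t ^ r * (a4 * a5)) q * qpoch_inf (t ^ r * (a4 * a6)) q * qpoch_inf (t ^ r * (a5 * a6)) q)))"

lemma theta_divide_weight:
  assumes "norm q < 1" "norm x = 1" "norm b < 1" "b \<noteq> 0"
  shows "theta (b / x) q / (qpoch_inf (b * x) q * qpoch_inf (b / x) q) = qpoch_inf (q * x / b) q / qpoch_inf (b * x) q"
proof -
  have "qpoch_inf (b / x) q \<noteq> 0" using assms by (intro qpoch_inf_nonzero) (auto simp: norm_divide)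
  moreover have "q / (b / x) = q * x / b" using assms by auto
  ultimately show ?thesis by (simp add: theta_def')
qed

text \<open>theta (t / (x * y)) from \<open>base\<close> cancels one of the four denominators, and 1
  - y / x from the nome 0 Vandermonde completes theta (x / y) to the numerator (x / y, y / x;
  q).\<close>

lemma pair_weight_eq:
  assumes q: "norm q < 1" and t: "norm t < 1" "t \<noteq> 0" and x: "norm x = 1" "norm y = 1"
  shows "theta (t / (x * y)) q * (y * theta (x / y) q) * (theta (x * y) 0 * theta (y / x) 0 / y) / pair_den q t x y =
    pair_weight q t x y"
proof -
  have nz: "x \<noteq> 0" "y \<noteq> 0" using x by auto
  have 1: "theta (t / (x * y)) q / (qpoch_inf (t * (x * y)) q * qpoch_inf (t / (x * y)) q) =
     qpoch_inf (q * (x * y) / t) q / qpoch_inf (t * (x * y)) q"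
    using x by (intro theta_divide_weight q t) (simp add: norm_mult)
  have 2: "theta (x / y) q * (1 - y / x) = qpoch_inf (x / y) q * qpoch_inf (y / x) q"
    using qpoch_inf_rec[OF q, of "y / x"] nz by (simp add: theta_def' mult_ac)
  have "theta (t / (x * y)) q * (y * theta (x / y) q) * (theta (x * y) 0 * theta (y / x) 0 / y) / pair_den q t x y =
    (theta (t / (x * y)) q / (qpoch_inf (t * (x * y)) q * qpoch_inf (t / (x * y)) q)) * (1 - x * y) *
    ((theta (x / y) q * (1 - y / x)) / (qpoch_inf (t * x / y) q * qpoch_inf (t * y / x) q))"
    using nz by (simp add: pair_den_def mult_ac)
  then show ?thesis unfolding 1 2 pair_weight_def by (simp only: mult_ac)
qed

lemma prod_reverse: "(\<Prod>r<Suc m. f (m - r)) = (\<Prod>r<Suc m. f r :: complex)"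
  using prod.nat_diff_reindex[of f "Suc m"] by simp

text \<open>The nome q instance of \<open>torus_functional\<close>, compared at 1 / v and 1 / a3.
  The first value is the wanted integral up to a power of v; at the second the kernel structure is
  available and yields the symmetric integral with numerator parameter q / a3.\<close>

lemma theta_integral_generic:
  assumes q: "norm q < 1" "q \<noteq> 0" and t: "norm t < 1" "t \<noteq> 0" and v: "v \<noteq> 0"
    and a: "norm a1 < 1" "norm a2 < 1" "norm a3 < 1" "norm a4 < 1" "norm a5 < 1" "norm a6 < 1"
    and bal: "q = a1 * a2 * a3 * a4 * a5 * a6 * t ^ (2 * m)"
    and g1: "\<And>k :: int. theta (t powi k * a2 / a1) q \<noteq> 0"
    and g2: "\<And>k. 1 \<le> k \<Longrightarrow> k \<le> Suc m \<Longrightarrow> theta (t ^ k) q \<noteq> 0"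
    and g3: "BC_vandermonde q (Suc m) (\<lambda>k. a4 * t ^ k) \<noteq> 0"
    and g4: "\<And>k. k \<le> m \<Longrightarrow> theta (t ^ k * (a1 * a3)) q \<noteq> 0" "\<And>k. k \<le> m \<Longrightarrow> theta (t ^ k * (a2 * a3)) q \<noteq> 0"
  shows "torus_mean (Suc m) (theta_integrand q t v a1 a2 a3 a4 a5 a6 (Suc m)) =
    fact (Suc m) * theta_evaluation q t v a1 a2 a3 a4 a5 a6 (Suc m)"
proof -
  let ?n = "Suc m"
  have a0: "a1 \<noteq> 0" "a2 \<noteq> 0" "a3 \<noteq> 0" "a4 \<noteq> 0" "a5 \<noteq> 0" "a6 \<noteq> 0" using bal q by auto
  define as where "as = [a1, a2, a3, a4, a5, a6]"
  have as: "norm b < 1 \<and> b \<noteq> 0" if "b \<in> set as" for b using that a a0 by (auto simp: as_def)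
  define W where "W = (\<lambda>z. BC_vandermonde 0 ?n z * omega q t (weight_pm q 0 as) ?n z)"
  define s where "s = (\<lambda>x. theta (a3 / x) q * theta (a4 / x) q * theta (a5 / x) q * theta (a6 / x) q)"
  have Wflip: "W (z(i := 1 / z i)) = - W z" if "\<forall>i. z i \<noteq> 0" "i < ?n" for z i
    unfolding W_def using BC_vandermonde_flip[of 0, OF _ that]
      omega_flip[where X="weight_pm q 0 as" and z=z and i=i, OF weight_pm_inverse that(2)] by simp
  interpret torus_functional q t a1 a2 m s W
  proof
    show "continuous_on (sphere 0 1) s" unfolding s_def using q a0 by (intro continuous_intros) auto
    show "continuous_on torus W" unfolding W_def
      by (intro continuous_intros continuous_on_BC_vandermonde_torus continuous_on_omega q t continuous_on_weight_pm) (use as in auto)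
    show "W (z \<circ> Transposition.transpose i j) = - W z" if "z \<in> torus" "i \<le> m" "j \<le> m" "i \<noteq> j" for z i j
      unfolding W_def
      using BC_vandermonde_transpose[of 0 z i "Suc m" j] omega_transpose[of i "Suc m" j] that
      by (simp add: torusD)
    show "circle_mean (\<lambda>u. u ^ (m + 2) * s u * theta (a1 / u) q * theta (a2 / u) q *
        (\<Prod>j<m. theta (t * z j / u) q * theta (t / (z j * u)) q) * W (z(m := u))) = 0" if z: "z \<in> torus" for z
    proof -
      define C where "C = BC_vandermonde 0 m z * omega q t (weight_pm q 0 as) m z"
      let ?d = "disc_function q t as m z"
      have p: "(\<Prod>a\<leftarrow>as. theta (a / u) q) = theta (a1 / u) q * (theta (a2 / u) q * (theta (a3 / u) q *
          (theta (a4 / u) q * (theta (a5 / u) q * theta (a6 / u) q))))" for u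
        by (simp add: as_def)
      \<comment> \<open>There is one power of u more than in \<open>disc_function_eq\<close>, so the
        mean is the value at 0 of a function with the factor u.\<close>
      have "circle_mean (\<lambda>u. u ^ (m + 2) * s u * theta (a1 / u) q * theta (a2 / u) q *
        (\<Prod>j<m. theta (t * z j / u) q * theta (t / (z j * u)) q) * W (z(m := u))) = circle_mean (\<lambda>u. C * (u * ?d u))"
      proof (rule circle_mean_cong)
        fix u :: complex assume u: "norm u = 1"
        have "u ^ (m + 2) * s u * theta (a1 / u) q * theta (a2 / u) q *
          (\<Prod>j<m. theta (t * z j / u) q * theta (t / (z j * u)) q) * W (z(m := u)) =
          u * (u ^ Suc m * (\<Prod>a\<leftarrow>as. theta (a / u) q) * (\<Prod>j<m. theta (t * z j / u) q * theta (t / (z j * u)) q) *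
           (BC_vandermonde 0 (Suc m) (z(m := u)) * omega q t (weight_pm q 0 as) (Suc m) (z(m := u))))"
          unfolding p W_def s_def by (simp add: mult_ac)
        then show "u ^ (m + 2) * s u * theta (a1 / u) q * theta (a2 / u) q *
          (\<Prod>j<m. theta (t * z j / u) q * theta (t / (z j * u)) q) * W (z(m := u)) = C * (u * ?d u)"
          by (subst (asm) disc_function_eq[OF q(1) t as z u]) (simp_all only: C_def mult_ac)
      qed
      also have "\<dots> = C * (0 * ?d 0)"
        unfolding circle_mean_mult using as
        by (subst circle_mean_holomorphic[of "\<lambda>u. u * ?d u"]) (auto intro!: holomorphic_intros holomorphic_on_disc_function q t z)
      finally show ?thesis by simp
    qed
  qed (use q t a0 g1 g2 in auto)
  have c: "c = t ^ m * a1 * a2" by (rule c_def)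
  have c0: "c \<noteq> 0" by (rule c_nonzero)

  have pairform: "theta_pair q c (1 / w) x = - (1 / w) * (theta (w * x) q * theta (c * w / x) q)" if "w \<noteq> 0" "x \<noteq> 0" for w x
  proof -
    have "theta (1 / w / x) q = - theta (w * x) q / (w * x)" using theta_inverse[OF q(1), of "w * x"] that by simp
    moreover have "c / (1 / w * x) = c * w / x" using that by simp
    ultimately show ?thesis unfolding theta_pair_def using that by simp
  qed
  \<comment> \<open>The second theta function is at t ^ (m - r) * (a2 * w); reversing r gives a
    product symmetric in a1 and a2.\<close>
  have pairprod: "(\<Prod>r<?n. theta_pair q c (1 / w) (t ^ r * a1)) =
      (- (1 / w)) ^ ?n * (\<Prod>r<?n. theta (t ^ r * (a1 * w)) q * theta (t ^ r * (a2 * w)) q)" if w: "w \<noteq> 0" for w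
  proof -
    have "theta_pair q c (1 / w) (t ^ r * a1) = - (1 / w) * (theta (t ^ r * (a1 * w)) q * theta (t ^ (m - r) * (a2 * w)) q)"
      if "r \<in> {..<?n}" for r
    proof -
      have "t ^ m = t ^ (m - r) * t ^ r" using that by (simp flip: power_add)
      then have e1: "c * w / (t ^ r * a1) = t ^ (m - r) * (a2 * w)" using t a0 unfolding c by simp
      have e2: "w * (t ^ r * a1) = t ^ r * (a1 * w)" and ne: "t ^ r * a1 \<noteq> 0" using t a0 by simp_all
      show ?thesis unfolding pairform[OF w ne] e1 e2 ..
    qed
    then have "(\<Prod>r<?n. theta_pair q c (1 / w) (t ^ r * a1)) =
      (\<Prod>r<?n. - (1 / w) * (theta (t ^ r * (a1 * w)) q * theta (t ^ (m - r) * (a2 * w)) q))" by (rule prod.cong[OF refl])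
    then show ?thesis
      using prod_reverse[of "\<lambda>r. theta (t ^ r * (a2 * w)) q" m]
      by (simp only: prod.distrib prod_constant card_lessThan)
  qed

  have I: "value_at (1 / v) = (1 / v) ^ ?n * torus_mean ?n (theta_integrand q t v a1 a2 a3 a4 a5 a6 ?n)"
    unfolding value_at_def torus_mean_mult[symmetric]
  proof (rule torus_mean_cong)
    fix z :: "nat \<Rightarrow> complex" assume z: "z \<in> torus"
    have site: "s x * weight_pm q 0 as x * (x * theta_pair q c (1 / v) x) * (x * theta (1 / x ^ 2) 0) =
       1 / v * site_weight q t v a1 a2 a3 a4 a5 a6 ?n x" if x: "norm x = 1" for x
    proof -
      have x0: "x \<noteq> 0" using x by auto
      have e: "qpoch_pm q [0] x = 1" by simp
      have "s x * weight_pm q 0 as x = 1 / (qpoch_inf (a1 * x) q * qpoch_inf (a1 / x) q * (qpoch_inf (a2 * x) q * qpoch_inf (a2 / x) q)) *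
        (theta (a3 / x) q / (qpoch_inf (a3 * x) q * qpoch_inf (a3 / x) q) *
         (theta (a4 / x) q / (qpoch_inf (a4 * x) q * qpoch_inf (a4 / x) q)) *
         (theta (a5 / x) q / (qpoch_inf (a5 * x) q * qpoch_inf (a5 / x) q)) *
         (theta (a6 / x) q / (qpoch_inf (a6 * x) q * qpoch_inf (a6 / x) q)))"
        by (simp add: s_def weight_pm_def as_def mult_ac)
      also have "\<dots> = 1 / (qpoch_inf (a1 * x) q * qpoch_inf (a1 / x) q * (qpoch_inf (a2 * x) q * qpoch_inf (a2 / x) q)) *
        (qpoch_inf (q * x / a3) q / qpoch_inf (a3 * x) q * (qpoch_inf (q * x / a4) q / qpoch_inf (a4 * x) q) *
         (qpoch_inf (q * x / a5) q / qpoch_inf (a5 * x) q) * (qpoch_inf (q * x / a6) q / qpoch_inf (a6 * x) q))"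
        unfolding theta_divide_weight[OF q(1) x a(3) a0(3)] theta_divide_weight[OF q(1) x a(4) a0(4)]
          theta_divide_weight[OF q(1) x a(5) a0(5)] theta_divide_weight[OF q(1) x a(6) a0(6)] ..
      finally have 1: "s x * weight_pm q 0 as x = \<dots>" .
      have cv: "c * v / x = t ^ (?n - 1) * a1 * a2 * v / x" by (simp add: c)
      have 2: "(x * (- (1 / v) * (X * Y))) * (x * theta (1 / x ^ 2) 0) = 1 / v * ((1 - x ^ 2) * (Y * X))" for X Y
      proof -
        have k: "x * (x * theta (1 / x ^ 2) 0) = - (1 - x ^ 2)" using x0 by (simp add: field_simps power2_eq_square)
        have "(x * (- (1 / v) * (X * Y))) * (x * theta (1 / x ^ 2) 0) = - (1 / v) * (X * Y) * (x * (x * theta (1 / x ^ 2) 0))"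
          by (simp only: mult_ac)
        then show ?thesis unfolding k by (simp only: mult_minus_left mult_minus_right minus_minus mult_ac)
      qed
      have "s x * weight_pm q 0 as x * (x * theta_pair q c (1 / v) x) * (x * theta (1 / x ^ 2) 0) =
        s x * weight_pm q 0 as x * ((x * theta_pair q c (1 / v) x) * (x * theta (1 / x ^ 2) 0))" by (simp only: mult.assoc)
      then show ?thesis
        unfolding pairform[OF v x0] 1 2 site_weight_def cv by (simp add: mult_ac)
    qed
    have "base z * (\<Prod>k<?n. z k * theta_pair q c (1 / v) (z k)) =
      (\<Prod>k<?n. s (z k) * weight_pm q 0 as (z k) * (z k * theta_pair q c (1 / v) (z k)) * (z k * theta (1 / z k ^ 2) 0)) *
      pair_prod (\<lambda>x y. theta (t / (x * y)) q * (y * theta (x / y) q) * (theta (x * y) 0 * theta (y / x) 0 / y) / pair_den q t x y) ?n z"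
      unfolding base_def unfolding W_def omega_def BC_vandermonde_def prod.distrib pair_prod_mult pair_prod_divide
      by (simp only: times_divide_eq_right times_divide_eq_left divide_divide_eq_left mult_ac)
    also have "(\<Prod>k<?n. s (z k) * weight_pm q 0 as (z k) * (z k * theta_pair q c (1 / v) (z k)) * (z k * theta (1 / z k ^ 2) 0)) =
      (\<Prod>k<?n. 1 / v * site_weight q t v a1 a2 a3 a4 a5 a6 ?n (z k))"
      by (intro prod.cong refl site torusD(1)[OF z])
    also have "pair_prod (\<lambda>x y. theta (t / (x * y)) q * (y * theta (x / y) q) * (theta (x * y) 0 * theta (y / x) 0 / y) / pair_den q t x y) ?n z =
       pair_prod (pair_weight q t) ?n z"
      by (intro pair_prod_cong pair_weight_eq q t torusD(1)[OF z])
    finally show "base z * (\<Prod>k<?n. z k * theta_pair q c (1 / v) (z k)) =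
       (1 / v) ^ ?n * theta_integrand q t v a1 a2 a3 a4 a5 a6 ?n z"
      unfolding theta_integrand_def by (simp only: prod.distrib prod_constant card_lessThan mult.assoc)
  qed

  \<comment> \<open>Since theta (q / u) = theta u, the kernel factor theta (A * x) is theta (a6 /
    x). The balancing condition is then the condition on A for the kernel with a4, a5 and c *
    a3.\<close>
  define A where "A = q / a6"
  have AA: "A = a4 * a5 * (c * a3) * t ^ m"
    using a0 t by (simp add: A_def bal c mult_2_right power_add mult_ac)
  \<comment> \<open>The even factor left over beside the kernel; it removes a3 from the denominators
    and puts q / a3 into the numerator.\<close>
  define e where "e = (\<lambda>x. theta (a3 * x) q * theta (a3 / x) q)"
  define \<kappa> where "\<kappa> = (\<Prod>r<?n. theta (t ^ r * (a4 * a5)) q * theta (t ^ r * (a4 * a6)) q * theta (t ^ r * (a5 * a6)) q)"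
  have kap: "(\<Prod>k<?n. theta (t ^ k * a4 * a5) q * theta (t ^ k * a4 * (c * a3)) q * theta (t ^ k * a5 * (c * a3)) q) = \<kappa>"
  proof -
    have "theta (t ^ k * a4 * a5) q * theta (t ^ k * a4 * (c * a3)) q * theta (t ^ k * a5 * (c * a3)) q =
      theta (t ^ k * (a4 * a5)) q * theta (t ^ (m - k) * (a5 * a6)) q * theta (t ^ (m - k) * (a4 * a6)) q"
      if "k \<in> {..<?n}" for k
    proof -
      have tt: "t ^ (2 * m) = t ^ (k + m) * t ^ (m - k)" using that by (simp add: mult_2 flip: power_add)
      have "t ^ k * a4 * (c * a3) = q / (t ^ (m - k) * (a5 * a6))" "t ^ k * a5 * (c * a3) = q / (t ^ (m - k) * (a4 * a6))"
        using t a0 unfolding bal tt c by (simp_all add: power_add mult_ac)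
      then show ?thesis using t a0 q by (simp add: theta_nome_div mult_ac)
    qed
    then have "(\<Prod>k<?n. theta (t ^ k * a4 * a5) q * theta (t ^ k * a4 * (c * a3)) q * theta (t ^ k * a5 * (c * a3)) q) =
       (\<Prod>k<?n. theta (t ^ k * (a4 * a5)) q * theta (t ^ (m - k) * (a5 * a6)) q * theta (t ^ (m - k) * (a4 * a6)) q)"
      by (rule prod.cong[OF refl])
    also have "\<dots> = \<kappa>"
      unfolding \<kappa>_def prod.distrib prod_reverse[of "\<lambda>k. theta (t ^ k * (a5 * a6)) q" m]
        prod_reverse[of "\<lambda>k. theta (t ^ k * (a4 * a6)) q" m] by (simp only: mult_ac)
    finally show ?thesis .
  qed
  have V: "2 ^ ?n * value_at (1 / a3) = (- (1 / a3)) ^ ?n * \<kappa> *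
    torus_mean ?n (\<lambda>z. BC_vandermonde q ?n z * ((\<Prod>k<?n. e (z k)) * W z))"
    unfolding kap[symmetric]
  proof (rule value_at_kernel[OF Wflip _ _ a0(4,5) _ AA g3])
    show "continuous_on (sphere 0 1) e" unfolding e_def using q a0 by (intro continuous_intros) auto
    show "e (1 / x) = e x" for x by (simp add: e_def mult_ac)
    show "c * a3 \<noteq> 0" using c0 a0 by simp
    fix x :: complex assume "norm x = 1"
    then have x: "x \<noteq> 0" by auto
    have Ax: "theta (A * x) q = theta (a6 / x) q"
      using theta_nome_div[of "a6 / x" q] a0 x q by (simp add: A_def)
    show "s x * (x * theta_pair q c (1 / a3) x) = - (1 / a3) * e x *
       (x * theta (A * x) q * theta (a4 / x) q * theta (a5 / x) q * theta (c * a3 / x) q)"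
      unfolding pairform[OF a0(3) x] Ax s_def e_def by (simp only: mult_ac)
  qed
  have J: "torus_mean ?n (\<lambda>z. BC_vandermonde q ?n z * ((\<Prod>k<?n. e (z k)) * W z)) =
     BC_integral q t ?n (q / a3) [a1, a2, a4, a5, a6]"
    unfolding BC_integral_def
  proof (rule torus_mean_cong)
    fix z :: "nat \<Rightarrow> complex" assume z: "z \<in> torus"
    have w: "e x * weight_pm q 0 as x = weight_pm q (q / a3) [a1, a2, a4, a5, a6] x" if x: "norm x = 1" for x
    proof -
      have x0: "x \<noteq> 0" using x by auto
      have nz: "qpoch_inf (a3 * x) q \<noteq> 0" "qpoch_inf (a3 / x) q \<noteq> 0"
        using a x q by (simp_all add: qpoch_inf_nonzero norm_mult norm_divide)
      have e: "e x = (qpoch_inf (a3 * x) q * qpoch_inf (a3 / x) q) * (qpoch_inf (q / a3 * x) q * qpoch_inf (q / a3 / x) q)"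
        unfolding e_def theta_def' using x0 a0 by (simp add: mult_ac)
      have alg: "(p * p') * (b * b') * (1 / (P1 * (P2 * (p * p' * R)))) = b * b' / (P1 * (P2 * R))"
        if "p \<noteq> 0" "p' \<noteq> 0" for p p' b b' P1 P2 R :: complex
        using that by simp
      have "weight_pm q 0 as x = 1 / ((qpoch_inf (a1 * x) q * qpoch_inf (a1 / x) q) * ((qpoch_inf (a2 * x) q * qpoch_inf (a2 / x) q) *
         (qpoch_inf (a3 * x) q * qpoch_inf (a3 / x) q * qpoch_pm q [a4, a5, a6] x)))"
        by (simp add: weight_pm_def as_def)
      moreover have "weight_pm q (q / a3) [a1, a2, a4, a5, a6] x = qpoch_inf (q / a3 * x) q * qpoch_inf (q / a3 / x) q /
         ((qpoch_inf (a1 * x) q * qpoch_inf (a1 / x) q) * ((qpoch_inf (a2 * x) q * qpoch_inf (a2 / x) q) * qpoch_pm q [a4, a5, a6] x))"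
        by (simp add: weight_pm_def)
      ultimately show ?thesis unfolding e using alg[OF nz] by (simp only:)
    qed
    have "(\<Prod>k<?n. e (z k)) * W z = BC_vandermonde 0 ?n z * omega q t (\<lambda>x. e x * weight_pm q 0 as x) ?n z"
      unfolding W_def omega_mult by (simp only: mult_ac)
    also have "omega q t (\<lambda>x. e x * weight_pm q 0 as x) ?n z = omega q t (weight_pm q (q / a3) [a1, a2, a4, a5, a6]) ?n z"
      by (rule omega_cong) (rule w[OF torusD(1)[OF z]])
    finally show "BC_vandermonde q ?n z * ((\<Prod>k<?n. e (z k)) * W z) =
       BC_vandermonde 0 ?n z * BC_vandermonde q ?n z * omega q t (weight_pm q (q / a3) [a1, a2, a4, a5, a6]) ?n z"
      by (simp only: mult_ac)
  qed

  have gp: "generic_parameters t a1 a2 a4 a5 a6"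
  proof -
    have "t powi k * a2 / a1 \<noteq> 1" for k using g1[of k] q by (metis theta_1)
    then show ?thesis using a a0 by (auto simp: generic_parameters_def)
  qed
  \<comment> \<open>All six parameters have modulus less than 1, so balancing forces this strict
    inequality.\<close>
  have qt: "norm q < norm t ^ (2 * (?n - 1))"
  proof -
    have "norm (a1 * a2 * a3 * a4 * a5 * a6) < 1" by (intro norm_mult_less_1 a)
    moreover have "0 < norm t ^ (2 * m)" using t by simp
    ultimately have "norm (a1 * a2 * a3 * a4 * a5 * a6) * norm t ^ (2 * m) < 1 * norm t ^ (2 * m)"
      by (rule mult_strict_right_mono)
    then show ?thesis by (subst bal) (simp add: norm_mult norm_power)
  qed
  let ?P = "pair_factors q t ?n a1 a2 a4 a5 a6" and ?Qf = "quad_factors q t ?n a1 a2 a4 a5 a6"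
  have "BC_ratio q t ?n a1 a2 a4 a5 a6 = ratio_value q t ?n"
    by (rule BC_ratio_eq_ratio_value[OF q t g2 qt gp])
  moreover have "t ^ (2 * ?n - 2) * (a1 * a2 * a4 * a5 * a6) = q / a3"
    using a0 by (subst bal) (simp add: field_simps)
  moreover have "?P \<noteq> 0" "?Qf \<noteq> 0" by (intro pair_factors_nonzero quad_factors_nonzero q t a)+
  ultimately have Jv: "BC_integral q t ?n (q / a3) [a1, a2, a4, a5, a6] = ratio_value q t ?n * ?Qf / ?P"
    by (simp only: BC_ratio_def) (simp add: field_simps)
  \<comment> \<open>By balancing, a product of four of the five parameters is q over a product of a3
    with the fifth, up to a power of t. These factors later complete the products at a1 * a3, ...,
    a3 * a6 to theta functions.\<close>
  have Qf: "?Qf = (\<Prod>r<?n. qpoch_inf (q / (t ^ r * (a1 * a3))) q * qpoch_inf (q / (t ^ r * (a2 * a3))) q *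
     qpoch_inf (q / (t ^ r * (a3 * a4))) q * qpoch_inf (q / (t ^ r * (a3 * a5))) q * qpoch_inf (q / (t ^ r * (a3 * a6))) q)"
    (is "_ = (\<Prod>r<?n. ?f r)")
  proof -
    have "?Qf = (\<Prod>r<?n. ?f (m - r))"
      unfolding quad_factors_def
    proof (rule prod.cong[OF refl])
      fix r assume "r \<in> {..<?n}"
      then have tt: "t ^ (2 * m) = t ^ (?n - 1 + r) * t ^ (m - r)" by (simp add: mult_2 flip: power_add)
      have "t ^ (?n - 1 + r) * (a2 * a4 * a5 * a6) = q / (t ^ (m - r) * (a1 * a3))"
        "t ^ (?n - 1 + r) * (a1 * a4 * a5 * a6) = q / (t ^ (m - r) * (a2 * a3))"
        "t ^ (?n - 1 + r) * (a1 * a2 * a5 * a6) = q / (t ^ (m - r) * (a3 * a4))"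
        "t ^ (?n - 1 + r) * (a1 * a2 * a4 * a6) = q / (t ^ (m - r) * (a3 * a5))"
        "t ^ (?n - 1 + r) * (a1 * a2 * a4 * a5) = q / (t ^ (m - r) * (a3 * a6))"
        using t a0 unfolding bal tt by (simp_all add: mult_ac)
      then show "qpoch_inf (t ^ (?n - 1 + r) * (a2 * a4 * a5 * a6)) q * qpoch_inf (t ^ (?n - 1 + r) * (a1 * a4 * a5 * a6)) q *
        qpoch_inf (t ^ (?n - 1 + r) * (a1 * a2 * a5 * a6)) q * qpoch_inf (t ^ (?n - 1 + r) * (a1 * a2 * a4 * a6)) q *
        qpoch_inf (t ^ (?n - 1 + r) * (a1 * a2 * a4 * a5)) q = ?f (m - r)" by (simp only:)
    qed
    also have "\<dots> = (\<Prod>r<?n. ?f r)" by (rule prod_reverse[of ?f m])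
    finally show ?thesis .
  qed

  define X where "X = (\<Prod>r<?n. theta (t ^ r * (a1 * v)) q * theta (t ^ r * (a2 * v)) q)"
  define Y where "Y = (\<Prod>r<?n. theta (t ^ r * (a1 * a3)) q * theta (t ^ r * (a2 * a3)) q)"
  define C where "C = (\<Prod>r<?n. qpoch_inf t q / (qpoch_inf q q * qpoch_inf (t ^ Suc r) q))"
  let ?I = "torus_mean ?n (theta_integrand q t v a1 a2 a3 a4 a5 a6 ?n)"
  \<comment> \<open>The proportionality determines the integral only if the product formula does not
    vanish at the comparison point 1 / a3.\<close>
  have Y0: "Y \<noteq> 0" using g4 by (simp add: Y_def prod_zero_iff less_Suc_eq_le)
  have inv: "1 / v \<noteq> 0" "1 / a3 \<noteq> 0" using v a0 by auto
  have rv: "ratio_value q t ?n = (-2) ^ ?n * fact ?n * C"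
  proof -
    have "(\<Prod>i=1..?n. qpoch_inf t q / (qpoch_inf q q * qpoch_inf (t ^ i) q)) = C"
      unfolding C_def by (rule prod.reindex_bij_witness[of _ Suc "\<lambda>i. i - 1"]) auto
    then show ?thesis by (simp only: ratio_value_def)
  qed
  have proportional: "(1 / v) ^ ?n * ?I * ((- (1 / a3)) ^ ?n * Y) = value_at (1 / a3) * ((- (1 / v)) ^ ?n * X)"
    using value_at_proportional[OF inv] unfolding pairprod[OF v] pairprod[OF a0(3)] I X_def Y_def .
  have sgn: "(-2 :: complex) ^ ?n = (-1) ^ ?n * 2 ^ ?n" "(- (1 / v)) ^ ?n = (-1) ^ ?n * (1 / v) ^ ?n"
    by (simp_all only: power_mult_distrib[symmetric]) simp_all
  have "(2 ^ ?n * ((1 / v) ^ ?n * (- (1 / a3)) ^ ?n)) * (?I * Y) = (2 ^ ?n * value_at (1 / a3)) * ((- (1 / v)) ^ ?n * X)"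
    using arg_cong[OF proportional, of "\<lambda>x. 2 ^ ?n * x"] by (simp only: mult_ac)
  also have "\<dots> = ((-1) ^ ?n * (-1) ^ ?n) * ((2 ^ ?n * ((1 / v) ^ ?n * (- (1 / a3)) ^ ?n)) * (fact ?n * C * \<kappa> * (?Qf / ?P) * X))"
    unfolding V J Jv rv sgn times_divide_eq_right times_divide_eq_left by (simp only: mult_ac)
  also have "(-1) ^ ?n * (-1) ^ ?n = (1 :: complex)" by (simp flip: power_mult_distrib)
  finally have main: "?I * Y = fact ?n * C * \<kappa> * (?Qf / ?P) * X"
  proof -
    assume h: "(2 ^ ?n * ((1 / v) ^ ?n * (- (1 / a3)) ^ ?n)) * (?I * Y) =
      1 * ((2 ^ ?n * ((1 / v) ^ ?n * (- (1 / a3)) ^ ?n)) * (fact ?n * C * \<kappa> * (?Qf / ?P) * X))"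
    have "2 ^ ?n * ((1 / v) ^ ?n * (- (1 / a3)) ^ ?n) \<noteq> (0 :: complex)" using inv by simp
    from mult_left_cancel[OF this] h show ?thesis by (simp only: mult_1_left)
  qed
  have "theta_evaluation q t v a1 a2 a3 a4 a5 a6 ?n * Y = C * \<kappa> * (?Qf / ?P) * X"
    unfolding theta_evaluation_def Y_def C_def \<kappa>_def Qf pair_factors_def X_def prod.distrib[symmetric] prod_dividef[symmetric]
  proof (rule prod.cong[OF refl])
    fix r assume "r \<in> {..<?n}"
    define p where "p x y = qpoch_inf (t ^ r * (x * y)) q" for x y
    define Q where "Q x y = qpoch_inf (q / (t ^ r * (x * y))) q" for x y
    have th: "theta (t ^ r * (x * y)) q = p x y * Q x y" for x y by (simp add: theta_def' p_def Q_def)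
    have p0: "p x y \<noteq> 0" if "norm x < 1" "norm y < 1" for x y
      unfolding p_def by (intro qpoch_inf_nonzero q norm_power_mult_less_1 t norm_mult_less_1 that)
    have alg: "T * U * (p34 * q34 * (p35 * q35) * (p36 * q36) * t45 * t46 * t56) /
        (D * (p12 * p13 * p14 * p15 * p16 * p23 * p24 * p25 * p26 * p34 * p35 * p36 * p45 * p46 * p56)) *
        (p13 * q13 * (p23 * q23)) =
        T / D * (t45 * t46 * t56) * (q13 * q23 * q34 * q35 * q36 / (p12 * p14 * p15 * p16 * p24 * p25 * p26 * p45 * p46 * p56)) * U"
      if "p13 \<noteq> 0" "p23 \<noteq> 0" "p34 \<noteq> 0" "p35 \<noteq> 0" "p36 \<noteq> 0"
      for T U D p12 p13 p14 p15 p16 p23 p24 p25 p26 p34 p35 p36 p45 p46 p56 q13 q23 q34 q35 q36 t45 t46 t56 :: complex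
    proof -
      have 1: "D * (p12 * p13 * p14 * p15 * p16 * p23 * p24 * p25 * p26 * p34 * p35 * p36 * p45 * p46 * p56) =
         (p13 * p23 * p34 * p35 * p36) * (D * (p12 * p14 * p15 * p16 * p24 * p25 * p26 * p45 * p46 * p56))" by (simp only: mult_ac)
      have 2: "T * U * (p34 * q34 * (p35 * q35) * (p36 * q36) * t45 * t46 * t56) * (p13 * q13 * (p23 * q23)) =
        (p13 * p23 * p34 * p35 * p36) * (T * (t45 * t46 * t56) * (q13 * q23 * q34 * q35 * q36) * U)" by (simp only: mult_ac)
      show ?thesis
        unfolding times_divide_eq_left times_divide_eq_right divide_divide_eq_left 1 2
        using that by (subst nonzero_mult_divide_mult_cancel_left) auto
    qed
    show "qpoch_inf t q * (theta (t ^ r * (a1 * v)) q * theta (t ^ r * (a2 * v)) q) *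
     (theta (t ^ r * (a3 * a4)) q * theta (t ^ r * (a3 * a5)) q * theta (t ^ r * (a3 * a6)) q *
      theta (t ^ r * (a4 * a5)) q * theta (t ^ r * (a4 * a6)) q * theta (t ^ r * (a5 * a6)) q) /
     (qpoch_inf q q * qpoch_inf (t ^ Suc r) q *
      (qpoch_inf (t ^ r * (a1 * a2)) q * qpoch_inf (t ^ r * (a1 * a3)) q * qpoch_inf (t ^ r * (a1 * a4)) q *
       qpoch_inf (t ^ r * (a1 * a5)) q * qpoch_inf (t ^ r * (a1 * a6)) q * qpoch_inf (t ^ r * (a2 * a3)) q *
       qpoch_inf (t ^ r * (a2 * a4)) q * qpoch_inf (t ^ r * (a2 * a5)) q * qpoch_inf (t ^ r * (a2 * a6)) q *
       qpoch_inf (t ^ r * (a3 * a4)) q * qpoch_inf (t ^ r * (a3 * a5)) q * qpoch_inf (t ^ r * (a3 * a6)) q *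
       qpoch_inf (t ^ r * (a4 * a5)) q * qpoch_inf (t ^ r * (a4 * a6)) q * qpoch_inf (t ^ r * (a5 * a6)) q)) *
     (theta (t ^ r * (a1 * a3)) q * theta (t ^ r * (a2 * a3)) q) =
     qpoch_inf t q / (qpoch_inf q q * qpoch_inf (t ^ Suc r) q) *
     (theta (t ^ r * (a4 * a5)) q * theta (t ^ r * (a4 * a6)) q * theta (t ^ r * (a5 * a6)) q) *
     (qpoch_inf (q / (t ^ r * (a1 * a3))) q * qpoch_inf (q / (t ^ r * (a2 * a3))) q *
      qpoch_inf (q / (t ^ r * (a3 * a4))) q * qpoch_inf (q / (t ^ r * (a3 * a5))) q * qpoch_inf (q / (t ^ r * (a3 * a6))) q /
      (qpoch_inf (t ^ r * (a1 * a2)) q * qpoch_inf (t ^ r * (a1 * a4)) q * qpoch_inf (t ^ r * (a1 * a5)) q *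
       qpoch_inf (t ^ r * (a1 * a6)) q * qpoch_inf (t ^ r * (a2 * a4)) q * qpoch_inf (t ^ r * (a2 * a5)) q *
       qpoch_inf (t ^ r * (a2 * a6)) q * qpoch_inf (t ^ r * (a4 * a5)) q * qpoch_inf (t ^ r * (a4 * a6)) q *
       qpoch_inf (t ^ r * (a5 * a6)) q)) *
     (theta (t ^ r * (a1 * v)) q * theta (t ^ r * (a2 * v)) q)"
      unfolding th[of a1 a3] th[of a2 a3] th[of a3 a4] th[of a3 a5] th[of a3 a6] p_def[symmetric] Q_def[symmetric]
      by (rule alg) (intro p0 a)+
  qed
  then have "?I * Y = fact ?n * theta_evaluation q t v a1 a2 a3 a4 a5 a6 ?n * Y"
    unfolding main by (simp only: mult.assoc)
  then show ?thesis using Y0 by (simp only: mult_cancel_right simp_thms)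
qed

subsection \<open>Removing genericity\<close>

text \<open>The generic conditions are infinite in number, as k ranges over all integers, so no
  punctured neighbourhood need avoid all exceptional values. Countability of each zero set is
  enough.\<close>

lemma countable_theta_exp_zeros:
  assumes "norm p < 1" "c \<noteq> 0" "d \<noteq> 0"
  shows "countable {s. theta (c * exp (d * s)) p = 0}"
proof (cases "(\<lambda>s. theta (c * exp (d * s)) p) constant_on UNIV")
  case True
  then obtain k where k: "\<And>s. theta (c * exp (d * s)) p = k" by (auto simp: constant_on_def)
  moreover have "k \<noteq> 0"
    using eventually_happens'[OF at_neq_bot eventually_theta_exp_nonzero[OF assms]] unfolding k by simp
  ultimately show ?thesis by simp
next
  case False
  have "(\<lambda>s. theta (c * exp (d * s)) p) holomorphic_on UNIV" using assms by (intro holomorphic_intros) auto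
  from holomorphic_countable_zeros[OF this open_UNIV connected_UNIV _ False] show ?thesis using fsigma.intros[of "\<lambda>_. UNIV :: complex set"] by simp
qed

text \<open>If F 0 were nonzero, continuity would put a whole ball inside B, but balls are
  uncountable.\<close>

lemma eq_zero_off_countable:
  fixes F :: "complex \<Rightarrow> complex"
  assumes r: "r > 0" and F: "continuous_on (cball 0 r) F" and B: "countable B"
    and zero: "\<And>s. s \<in> cball 0 r \<Longrightarrow> s \<notin> B \<Longrightarrow> F s = 0"
  shows "F 0 = 0"
proof (rule ccontr)
  assume ne: "F 0 \<noteq> 0"
  obtain d where d: "d > 0" "\<And>s. s \<in> cball 0 r \<Longrightarrow> dist s 0 < d \<Longrightarrow> dist (F s) (F 0) < norm (F 0)"
    using F r ne unfolding continuous_on_iff by (metis centre_in_cball less_imp_le zero_less_norm_iff)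
  have "ball 0 (min d r) \<subseteq> B"
  proof
    fix s :: complex assume s: "s \<in> ball 0 (min d r)"
    then have "dist (F s) (F 0) < norm (F 0)" by (intro d) auto
    then have "F s \<noteq> 0" by auto
    then show "s \<in> B" using zero[of s] s by auto
  qed
  then have "countable (ball (0 :: complex) (min d r))" using B countable_subset by blast
  then show False using uncountable_ball[of "min d r" "0 :: complex"] d r by simp
qed

definition admissible :: "complex \<Rightarrow> complex \<Rightarrow> complex \<Rightarrow> complex \<Rightarrow> complex \<Rightarrow> complex \<Rightarrow> complex \<Rightarrow> bool" where
  "admissible t a1 a2 a3 a4 a5 a6 \<longleftrightarrow> (\<forall>b\<in>{t, a1, a2, a3, a4, a5, a6}. norm b < 1 \<and> b \<noteq> 0)"

lemma continuous_on_theta_integrand: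
  fixes f g1 g2 g3 g4 g5 g6 :: "complex \<Rightarrow> complex"
  assumes q: "norm q < 1" and v: "v \<noteq> 0"
    and cont: "continuous_on K f" "continuous_on K g1" "continuous_on K g2" "continuous_on K g3"
      "continuous_on K g4" "continuous_on K g5" "continuous_on K g6"
    and adm: "\<And>s. s \<in> K \<Longrightarrow> admissible (f s) (g1 s) (g2 s) (g3 s) (g4 s) (g5 s) (g6 s)"
  shows "continuous_on (K \<times> torus) (\<lambda>(s, z). theta_integrand q (f s) v (g1 s) (g2 s) (g3 s) (g4 s) (g5 s) (g6 s) n z)"
proof -
  let ?S = "K \<times> torus"
  have z: "continuous_on ?S (\<lambda>x. snd x k)" for k
    by (rule continuous_on_compose2[OF continuous_on_torus_component continuous_on_snd[OF continuous_on_id]]) auto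
  have g: "continuous_on ?S (\<lambda>x. h (fst x))" if "continuous_on K h" for h :: "complex \<Rightarrow> complex"
    by (rule continuous_on_compose2[OF that continuous_on_fst[OF continuous_on_id]]) auto
  have zn: "norm (snd x k) = 1" "snd x k \<noteq> 0" if "x \<in> ?S" for x k using that by (auto simp: torusD)
  have n: "norm (f (fst x)) < 1 \<and> norm (g1 (fst x)) < 1 \<and> norm (g2 (fst x)) < 1 \<and> norm (g3 (fst x)) < 1 \<and>
      norm (g4 (fst x)) < 1 \<and> norm (g5 (fst x)) < 1 \<and> norm (g6 (fst x)) < 1"
    and n0: "f (fst x) \<noteq> 0 \<and> g1 (fst x) \<noteq> 0 \<and> g2 (fst x) \<noteq> 0 \<and> g3 (fst x) \<noteq> 0 \<and>
      g4 (fst x) \<noteq> 0 \<and> g5 (fst x) \<noteq> 0 \<and> g6 (fst x) \<noteq> 0"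
    if "x \<in> ?S" for x
    using adm[of "fst x"] that by (auto simp: admissible_def)
  have qp: "qpoch_inf (b * snd x k) q \<noteq> 0" "qpoch_inf (b / snd x k) q \<noteq> 0"
    if "x \<in> ?S" "norm b < 1" for b x k
    using zn[OF that(1)] that(2) by (simp_all add: qpoch_inf_nonzero q norm_mult norm_divide)
  have qp2: "qpoch_inf (b * snd x j / snd x k) q \<noteq> 0" "qpoch_inf (b * (snd x j * snd x k)) q \<noteq> 0"
    if "x \<in> ?S" "norm b < 1" for b x j k
    using zn[OF that(1)] that(2) by (simp_all add: qpoch_inf_nonzero q norm_mult norm_divide)
  have "continuous_on ?S (\<lambda>x. site_weight q (f (fst x)) v (g1 (fst x)) (g2 (fst x)) (g3 (fst x)) (g4 (fst x)) (g5 (fst x)) (g6 (fst x)) n (snd x k))" for k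
    unfolding site_weight_def using n n0 zn qp v q
    by (intro continuous_intros z g cont) simp_all
  moreover have "continuous_on ?S (\<lambda>x. pair_prod (pair_weight q (f (fst x))) n (snd x))"
    unfolding pair_weight_def using n n0 zn qp2 q
    by (intro continuous_on_pair_prod continuous_intros z g cont) simp_all
  ultimately have "continuous_on ?S (\<lambda>x. theta_integrand q (f (fst x)) v (g1 (fst x)) (g2 (fst x)) (g3 (fst x)) (g4 (fst x)) (g5 (fst x)) (g6 (fst x)) n (snd x))"
    unfolding theta_integrand_def by (intro continuous_intros)
  then show ?thesis by (simp only: case_prod_unfold)
qed

lemma continuous_on_theta_evaluation:
  fixes f g1 g2 g3 g4 g5 g6 :: "complex \<Rightarrow> complex"
  assumes q: "norm q < 1" and v: "v \<noteq> 0"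
    and cont: "continuous_on K f" "continuous_on K g1" "continuous_on K g2" "continuous_on K g3"
      "continuous_on K g4" "continuous_on K g5" "continuous_on K g6"
    and adm: "\<And>s. s \<in> K \<Longrightarrow> admissible (f s) (g1 s) (g2 s) (g3 s) (g4 s) (g5 s) (g6 s)"
  shows "continuous_on K (\<lambda>s. theta_evaluation q (f s) v (g1 s) (g2 s) (g3 s) (g4 s) (g5 s) (g6 s) n)"
proof -
  have n: "norm (f s) < 1 \<and> norm (g1 s) < 1 \<and> norm (g2 s) < 1 \<and> norm (g3 s) < 1 \<and>
      norm (g4 s) < 1 \<and> norm (g5 s) < 1 \<and> norm (g6 s) < 1"
    and n0: "f s \<noteq> 0 \<and> g1 s \<noteq> 0 \<and> g2 s \<noteq> 0 \<and> g3 s \<noteq> 0 \<and> g4 s \<noteq> 0 \<and> g5 s \<noteq> 0 \<and> g6 s \<noteq> 0"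
    if "s \<in> K" for s
    using adm[OF that] by (auto simp: admissible_def)
  have qp: "qpoch_inf (u ^ r * (b * b')) q \<noteq> 0" if "norm u < 1" "norm b < 1" "norm b' < 1" for u b b' r
    by (intro qpoch_inf_nonzero q norm_power_mult_less_1 norm_mult_less_1 that)
  have qt: "qpoch_inf (u ^ Suc r) q \<noteq> 0" if "norm u < 1" for u r
    using norm_power_mult_less_1[OF that that, of r] by (intro qpoch_inf_nonzero q) (simp add: mult.commute)
  show ?thesis
    unfolding theta_evaluation_def using n n0 qp qt qpoch_inf_nonzero[OF q q] v q
    by (intro continuous_intros cont) (simp_all del: power_Suc)
qed

text \<open>With one variable there are no pairs and t ^ (n - 1) = 1. This replaces t = 0, which
  balancing permits only for n = 1, by a nonzero value.\<close>

lemma theta_integrand_one: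
  "theta_integrand q t v a1 a2 a3 a4 a5 a6 (Suc 0) = theta_integrand q t' v a1 a2 a3 a4 a5 a6 (Suc 0)"
  by (rule ext) (simp add: theta_integrand_def site_weight_def pair_prod_Suc)

lemma continuous_on_torus_theta_integrand:
  assumes q: "norm q < 1" "q \<noteq> 0" and t: "norm t < 1" and v: "v \<noteq> 0"
    and a: "norm a1 < 1" "norm a2 < 1" "norm a3 < 1" "norm a4 < 1" "norm a5 < 1" "norm a6 < 1"
    and bal: "q = a1 * a2 * a3 * a4 * a5 * a6 * t ^ (2 * m)"
  shows "continuous_on torus (theta_integrand q t v a1 a2 a3 a4 a5 a6 (Suc m))"
proof -
  have main: "continuous_on torus (theta_integrand q u v a1 a2 a3 a4 a5 a6 (Suc m))" if u: "norm u < 1" "u \<noteq> 0" for u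
  proof -
    have adm: "admissible u a1 a2 a3 a4 a5 a6" using u a q bal by (auto simp: admissible_def)
    have "continuous_on ({0} \<times> torus) (\<lambda>(s :: complex, z). theta_integrand q u v a1 a2 a3 a4 a5 a6 (Suc m) z)"
      using continuous_on_theta_integrand[OF q(1) v, of "{0}" "\<lambda>_. u" "\<lambda>_. a1" "\<lambda>_. a2" "\<lambda>_. a3" "\<lambda>_. a4" "\<lambda>_. a5" "\<lambda>_. a6"]
        adm by simp
    from continuous_on_compose2[OF this continuous_on_Pair[OF continuous_on_const[of _ 0] continuous_on_id[of torus]]]
    show ?thesis by auto
  qed
  show ?thesis
  proof (cases "t = 0")
    case True
    then have m: "m = 0" using bal q by (cases m) auto
    show ?thesis using main[of "1 / 2"] unfolding m theta_integrand_one[of q t v _ _ _ _ _ _ "1 / 2"] by (simp add: norm_divide)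
  qed (intro main t)
qed

lemma theta_integral:
  assumes q: "norm q < 1" "q \<noteq> 0" and t: "norm t < 1" and v: "v \<noteq> 0"
    and a: "norm a1 < 1" "norm a2 < 1" "norm a3 < 1" "norm a4 < 1" "norm a5 < 1" "norm a6 < 1"
    and bal: "q = a1 * a2 * a3 * a4 * a5 * a6 * t ^ (2 * m)"
  shows "torus_mean (Suc m) (theta_integrand q t v a1 a2 a3 a4 a5 a6 (Suc m)) =
    fact (Suc m) * theta_evaluation q t v a1 a2 a3 a4 a5 a6 (Suc m)"
proof -
  let ?n = "Suc m"
  have main: "torus_mean ?n (theta_integrand q t v a1 a2 a3 a4 a5 a6 ?n) =
    fact ?n * theta_evaluation q t v a1 a2 a3 a4 a5 a6 ?n"
    if t: "norm t < 1" "t \<noteq> 0" and bal: "q = a1 * a2 * a3 * a4 * a5 * a6 * t ^ (2 * m)" for t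
  proof -
    have a0: "a1 \<noteq> 0" "a2 \<noteq> 0" "a3 \<noteq> 0" "a4 \<noteq> 0" "a5 \<noteq> 0" "a6 \<noteq> 0" using bal q by auto
    \<comment> \<open>The parameter a6 compensates to keep the balancing condition. With rate 4 for
      t and rate 1 for a2, a3, a4 the generic conditions move at rates 4 k, 4 k + 1 and 4 k + 2,
      none of which is zero for the k that occur.\<close>
    define f where "f s = t * exp (4 * s)" for s
    define g2 where "g2 s = a2 * exp s" for s
    define g3 where "g3 s = a3 * exp s" for s
    define g4 where "g4 s = a4 * exp s" for s
    define g6 where "g6 s = a6 / (exp s ^ 3 * exp (4 * s) ^ (2 * m))" for s
    let ?I = "\<lambda>s. torus_mean ?n (theta_integrand q (f s) v a1 (g2 s) (g3 s) (g4 s) a5 (g6 s) ?n)"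
    let ?R = "\<lambda>s. theta_evaluation q (f s) v a1 (g2 s) (g3 s) (g4 s) a5 (g6 s) ?n"
    have cf: "continuous_on A f" "continuous_on A g2" "continuous_on A g3" "continuous_on A g4" "continuous_on A g6" for A
      unfolding f_def g2_def g3_def g4_def g6_def by (intro continuous_intros; simp)+
    have "\<forall>\<^sub>F s in nhds 0. norm (h s) < 1" if "continuous_on UNIV h" "norm (h 0) < 1" for h :: "complex \<Rightarrow> complex"
    proof -
      have "((\<lambda>s. norm (h s)) \<longlongrightarrow> norm (h 0)) (nhds 0)"
        using that(1) unfolding continuous_on_eq_continuous_at[OF open_UNIV] isCont_def
        by (intro tendsto_norm) (auto simp: tendsto_at_iff_tendsto_nhds)
      then show ?thesis using that(2) by (rule order_tendstoD(2))
    qed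
    then have "\<forall>\<^sub>F s in nhds 0. norm (f s) < 1 \<and> norm (g2 s) < 1 \<and> norm (g3 s) < 1 \<and> norm (g4 s) < 1 \<and> norm (g6 s) < 1"
      using cf t a by (intro eventually_conj) (auto simp: f_def g2_def g3_def g4_def g6_def)
    then obtain r where r: "r > 0" and "\<And>s. dist s 0 \<le> r \<Longrightarrow> norm (f s) < 1 \<and> norm (g2 s) < 1 \<and> norm (g3 s) < 1 \<and> norm (g4 s) < 1 \<and> norm (g6 s) < 1"
      unfolding eventually_nhds_metric_le by blast
    then have n: "norm (f s) < 1" "norm (g2 s) < 1" "norm (g3 s) < 1" "norm (g4 s) < 1" "norm (g6 s) < 1" if "s \<in> cball 0 r" for s
      using that by (auto simp: dist_commute)
    have n0: "f s \<noteq> 0" "g2 s \<noteq> 0" "g3 s \<noteq> 0" "g4 s \<noteq> 0" "g6 s \<noteq> 0" for s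
      using t a0 by (simp_all add: f_def g2_def g3_def g4_def g6_def)
    have adm: "admissible (f s) a1 (g2 s) (g3 s) (g4 s) a5 (g6 s)" if "s \<in> cball 0 r" for s
      using n[OF that] n0 a a0 by (auto simp: admissible_def)
    have "continuous_on (cball 0 r) ?I"
      by (intro continuous_on_torus_mean compact_cball continuous_on_theta_integrand q v cf adm continuous_on_const)
    moreover have "continuous_on (cball 0 r) ?R"
      by (intro continuous_on_theta_evaluation q v cf adm continuous_on_const)
    ultimately have cont: "continuous_on (cball 0 r) (\<lambda>s. ?I s - fact ?n * ?R s)" by (intro continuous_intros)
    define zeros where "zeros c d = {s. theta (c * exp (d * s)) q = 0}" for c d
    define B where "B = (\<Union>k :: int. zeros (t powi k * a2 / a1) (of_int (4 * k + 1))) \<union>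
      (\<Union>k\<in>{1..}. zeros (t ^ k) (of_nat (4 * k))) \<union> (\<Union>k. zeros (a4 ^ 2 * t ^ k) (of_nat (4 * k + 2))) \<union>
      (\<Union>k. zeros (t ^ k * (a1 * a3)) (of_nat (4 * k + 1))) \<union> (\<Union>k. zeros (t ^ k * (a2 * a3)) (of_nat (4 * k + 2)))"
    have int: "(of_int (4 * k + 1) :: complex) \<noteq> 0" for k :: int
    proof -
      have "4 * k + 1 \<noteq> 0" by presburger
      then show ?thesis unfolding of_int_eq_0_iff .
    qed
    have nat: "(of_nat (4 * k + 1) :: complex) \<noteq> 0" "(of_nat (4 * k + 2) :: complex) \<noteq> 0" for k
      unfolding of_nat_eq_0_iff by simp_all
    have zc: "countable (zeros c d)" if "c \<noteq> 0" "d \<noteq> 0" for c d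
      unfolding zeros_def by (rule countable_theta_exp_zeros[OF q(1) that])
    have "countable B"
      unfolding B_def using t a0
      by (intro countable_Un countable_UN zc countableI_type int nat) auto
    moreover have "?I s - fact ?n * ?R s = 0" if s: "s \<in> cball 0 r" "s \<notin> B" for s
    proof -
      have nz: "theta (c * exp (d * s)) q \<noteq> 0" if "s \<notin> zeros c d" for c d using that by (simp add: zeros_def)
      have fk: "f s ^ k = t ^ k * exp (of_nat (4 * k) * s)" for k
        by (simp add: f_def power_mult_distrib mult_ac flip: exp_of_nat_mult)
      have ek: "exp (of_nat (4 * k + 1) * s) = exp (of_nat (4 * k) * s) * exp s"
        "exp (of_nat (4 * k + 2) * s) = exp (of_nat (4 * k) * s) * (exp s * exp s)" for k
        by (simp_all add: algebra_simps flip: exp_add)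
      have tk: "theta (f s ^ k) q \<noteq> 0" if "1 \<le> k" for k
        unfolding fk using s that by (intro nz) (auto simp: B_def)
      have "?I s = fact ?n * ?R s"
      proof (rule theta_integral_generic[OF q n(1) n0(1) v a(1) n(2,3,4) a(5) n(5)])
        show "q = a1 * g2 s * g3 s * g4 s * a5 * g6 s * f s ^ (2 * m)"
          by (subst bal) (simp add: f_def g2_def g3_def g4_def g6_def power_mult_distrib power3_eq_cube)
        show "theta (f s powi k * g2 s / a1) q \<noteq> 0" for k
        proof -
          have "f s powi k * g2 s / a1 = t powi k * a2 / a1 * exp (of_int (4 * k + 1) * s)"
          proof -
            have "exp (of_int (4 * k + 1) * s) = exp (of_int k * (4 * s)) * exp s"
              by (simp add: algebra_simps flip: exp_add)
            then show ?thesis by (simp add: f_def g2_def power_int_mult_distrib exp_power_int)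
          qed
          moreover have "s \<notin> zeros (t powi k * a2 / a1) (of_int (4 * k + 1))" using s(2) unfolding B_def by blast
          ultimately show ?thesis using nz by (simp only:)
        qed
        show "theta (f s ^ k) q \<noteq> 0" if "1 \<le> k" for k by (rule tk[OF that])
        show "BC_vandermonde q (Suc m) (\<lambda>k. g4 s * f s ^ k) \<noteq> 0"
        proof (rule BC_vandermonde_geometric_nonzero[OF q(1) n0(4,1) _ tk])
          fix k
          have "g4 s ^ 2 * f s ^ k = a4 ^ 2 * t ^ k * exp (of_nat (4 * k + 2) * s)"
            unfolding fk ek by (simp add: g4_def power2_eq_square)
          moreover have "s \<notin> zeros (a4 ^ 2 * t ^ k) (of_nat (4 * k + 2))" using s(2) unfolding B_def by blast
          ultimately show "theta (g4 s ^ 2 * f s ^ k) q \<noteq> 0" using nz by (simp only:)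
        qed
        show "theta (f s ^ k * (a1 * g3 s)) q \<noteq> 0" for k
        proof -
          have "f s ^ k * (a1 * g3 s) = t ^ k * (a1 * a3) * exp (of_nat (4 * k + 1) * s)"
            unfolding fk ek by (simp add: g3_def)
          moreover have "s \<notin> zeros (t ^ k * (a1 * a3)) (of_nat (4 * k + 1))" using s(2) unfolding B_def by blast
          ultimately show ?thesis using nz by (simp only:)
        qed
        show "theta (f s ^ k * (g2 s * g3 s)) q \<noteq> 0" for k
        proof -
          have "f s ^ k * (g2 s * g3 s) = t ^ k * (a2 * a3) * exp (of_nat (4 * k + 2) * s)"
            unfolding fk ek by (simp add: g2_def g3_def)
          moreover have "s \<notin> zeros (t ^ k * (a2 * a3)) (of_nat (4 * k + 2))" using s(2) unfolding B_def by blast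
          ultimately show ?thesis using nz by (simp only:)
        qed
      qed (use s in auto)
      then show ?thesis by simp
    qed
    ultimately have "?I 0 - fact ?n * ?R 0 = 0" using eq_zero_off_countable[OF r cont] by blast
    then show ?thesis by (simp add: f_def g2_def g3_def g4_def g6_def)
  qed
  show ?thesis
  proof (cases "t = 0")
    case False
    then show ?thesis by (intro main t bal)
  next
    \<comment> \<open>Since q is nonzero, t = 0 forces m = 0, and then neither side depends on t:
      the quotient of qpoch_inf t q by qpoch_inf (t ^ 1) q cancels.\<close>
    case True
    then have m: "m = 0" using bal q by (cases m) auto
    have "theta_integrand q t v a1 a2 a3 a4 a5 a6 ?n = theta_integrand q (1 / 2) v a1 a2 a3 a4 a5 a6 ?n"
      unfolding m by (rule theta_integrand_one)
    moreover have "theta_evaluation q t v a1 a2 a3 a4 a5 a6 ?n = theta_evaluation q (1 / 2) v a1 a2 a3 a4 a5 a6 ?n"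
    proof -
      have "qpoch_inf t q \<noteq> 0" "qpoch_inf (1 / 2) q \<noteq> 0" by (intro qpoch_inf_nonzero q t; simp add: norm_divide)+
      then show ?thesis unfolding m theta_evaluation_def by simp
    qed
    moreover have "q = a1 * a2 * a3 * a4 * a5 * a6 * (1 / 2) ^ (2 * m)" using bal m by simp
    ultimately show ?thesis using main[of "1 / 2"] by simp
  qed
qed

section \<open>Translation to the integral and product as stated\<close>

lemma prod_pairs_eq_pair_prod:
  "(\<Prod>(j, k)\<in>{(j, k). 1 \<le> j \<and> j < k \<and> k \<le> n}. h (z (j - 1)) (z (k - 1))) = pair_prod h n z"
proof -
  have "pair_prod h n z = (\<Prod>(k, j)\<in>(SIGMA k:{..<n}. {..<k}). h (z j) (z k))"
    unfolding pair_prod_def by (rule prod.Sigma) auto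
  also have "\<dots> = (\<Prod>(j, k)\<in>{(j, k). 1 \<le> j \<and> j < k \<and> k \<le> n}. h (z (j - 1)) (z (k - 1)))"
    by (rule prod.reindex_bij_witness[of _ "\<lambda>(j, k). (k - 1, j - 1)" "\<lambda>(k, j). (Suc j, Suc k)"]) auto
  finally show ?thesis by simp
qed

lemma prod_shift_index: "(\<Prod>i=1..n. f (i - 1)) = (\<Prod>k<n. f k)" for f :: "nat \<Rightarrow> complex"
  by (rule prod.reindex_bij_witness[of _ Suc "\<lambda>i. i - 1"]) auto

lemma qpoch_inf_quotient:
  assumes "norm q < 1" "norm u = 1"
  shows "qpoch_inf u q / qpoch_inf (q * u) q = 1 - u"
proof -
  have "qpoch_inf (q * u) q \<noteq> 0" using assms by (intro qpoch_inf_nonzero) (auto simp: norm_mult)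
  then show ?thesis using qpoch_inf_rec[OF assms(1), of u] by simp
qed

lemma pairs_1_6: "{(j, k). 1 \<le> j \<and> j < k \<and> k \<le> (6 :: nat)} =
  {(1,2),(1,3),(1,4),(1,5),(1,6),(2,3),(2,4),(2,5),(2,6),(3,4),(3,5),(3,6),(4,5),(4,6),(5,6)}"
  by (rule set_eqI, clarsimp, presburger)

lemma pairs_3_6: "{(j, k). 3 \<le> j \<and> j < k \<and> k \<le> (6 :: nat)} = {(3,4),(3,5),(3,6),(4,5),(4,6),(5,6)}"
  by (rule set_eqI, clarsimp, presburger)

theorem theorem1p1:
  fixes n :: nat and q t v :: complex and a :: "nat \<Rightarrow> complex"
  assumes "n \<ge> 1"
    and "q \<noteq> 0" and "norm q < 1"
    and "\<And>i. i \<in> {1..6} \<Longrightarrow> norm (a i) < 1" and "norm t < 1"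
    and "q = a 1 * a 2 * a 3 * a 4 * a 5 * a 6 * t ^ (2 * n - 2)"
    and "v \<noteq> 0"
  shows
    "1 / fact n * varpi_integral n (\<lambda>z.
        (\<Prod>i=1..n.
           qpoch_inf (z i ^ 2) q / qpoch_inf (q * z i ^ 2) q *
           (thetas [t ^ (n - 1) * a 1 * a 2 * v * inverse (z i), v * z i] q /
            (\<Prod>j=1..2. qpochs_inf [a j * z i, a j * inverse (z i)] q)) *
           (\<Prod>k=3..6. qpoch_inf (q * inverse (a k) * z i) q / qpoch_inf (a k * z i) q)) *
        (\<Prod>(j, k)\<in>{(j, k). 1 \<le> j \<and> j < k \<and> k \<le> n}.
           qpoch_inf (z j * z k) q / qpoch_inf (q * z j * z k) q *
           (qpochs_inf [z j / z k, z k / z j] q / qpochs_inf [t * z j / z k, t * z k / z j] q) *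
           (qpoch_inf (q * inverse t * z j * z k) q / qpoch_inf (t * z j * z k) q)))
     = (\<Prod>i=1..n.
          qpoch_inf t q *
          (\<Prod>l=1..2. theta (t ^ (i - 1) * a l * v) q) *
          (\<Prod>(j, k)\<in>{(j, k). 3 \<le> j \<and> j < k \<and> k \<le> 6}. theta (t ^ (i - 1) * a j * a k) q) /
          (qpochs_inf [q, t ^ i] q *
           (\<Prod>(j, k)\<in>{(j, k). 1 \<le> j \<and> j < k \<and> k \<le> 6}. qpoch_inf (t ^ (i - 1) * a j * a k) q)))"
  (is "1 / fact n * varpi_integral n ?F = ?R")
proof -
  obtain m where n: "n = Suc m" using assms(1) by (cases n) auto
  have q: "norm q < 1" "q \<noteq> 0" and t: "norm t < 1" and v: "v \<noteq> 0" using assms by auto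
  have a: "norm (a 1) < 1" "norm (a 2) < 1" "norm (a 3) < 1" "norm (a 4) < 1" "norm (a 5) < 1" "norm (a 6) < 1"
    using assms(4) by auto
  have bal: "q = a 1 * a 2 * a 3 * a 4 * a 5 * a 6 * t ^ (2 * m)" using assms(6) by (simp add: n)
  let ?G = "theta_integrand q t v (a 1) (a 2) (a 3) (a 4) (a 5) (a 6) n"
  have s12: "{1..2} = {1, 2 :: nat}" and s36: "{3..6} = {3, 4, 5, 6 :: nat}" by auto
  \<comment> \<open>Restricted to the torus, where the quotients (x ^ 2; q) / (q * x ^ 2; q) and
    those of the pairs simplify because their denominators are nonzero.\<close>
  have F: "?F (\<lambda>i\<in>{1..n}. z (i - 1)) = ?G z" if z: "z \<in> torus" for z
  proof -
    have site: "qpoch_inf (x ^ 2) q / qpoch_inf (q * x ^ 2) q *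
           (thetas [t ^ (n - 1) * a 1 * a 2 * v * inverse x, v * x] q /
            (\<Prod>j=1..2. qpochs_inf [a j * x, a j * inverse x] q)) *
           (\<Prod>k=3..6. qpoch_inf (q * inverse (a k) * x) q / qpoch_inf (a k * x) q) =
        site_weight q t v (a 1) (a 2) (a 3) (a 4) (a 5) (a 6) n x" if "norm x = 1" for x
    proof -
      have e: "q * inverse b * x = q * x / b" for b by (simp add: divide_inverse mult_ac)
      have "norm (x ^ 2) = 1" using that by (simp add: norm_power)
      then show ?thesis
        unfolding site_weight_def qpoch_inf_quotient[OF q(1) \<open>norm (x ^ 2) = 1\<close>] s12 s36 e
        by (simp add: thetas_def qpochs_inf_def divide_inverse mult_ac del: One_nat_def)
    qed
    have pair: "qpoch_inf (x * y) q / qpoch_inf (q * x * y) q *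
           (qpochs_inf [x / y, y / x] q / qpochs_inf [t * x / y, t * y / x] q) *
           (qpoch_inf (q * inverse t * x * y) q / qpoch_inf (t * x * y) q) = pair_weight q t x y"
      if "norm x = 1" "norm y = 1" for x y
    proof -
      have "norm (x * y) = 1" using that by (simp add: norm_mult)
      moreover have "q * inverse t * x * y = q * (x * y) / t" by (simp add: divide_inverse mult_ac)
      ultimately show ?thesis
        unfolding pair_weight_def using qpoch_inf_quotient[OF q(1), of "x * y"]
        by (simp add: qpochs_inf_def mult.assoc)
    qed
    let ?w = "\<lambda>i\<in>{1..n}. z (i - 1)"
    have "?F ?w = (\<Prod>i=1..n. site_weight q t v (a 1) (a 2) (a 3) (a 4) (a 5) (a 6) n (z (i - 1))) *
       (\<Prod>(j, k)\<in>{(j, k). 1 \<le> j \<and> j < k \<and> k \<le> n}. pair_weight q t (z (j - 1)) (z (k - 1)))"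
    proof (intro arg_cong2[where f = "(*)"] prod.cong refl)
      fix i assume i: "i \<in> {1..n}"
      show "qpoch_inf (?w i ^ 2) q / qpoch_inf (q * ?w i ^ 2) q *
           (thetas [t ^ (n - 1) * a 1 * a 2 * v * inverse (?w i), v * ?w i] q /
            (\<Prod>j=1..2. qpochs_inf [a j * ?w i, a j * inverse (?w i)] q)) *
           (\<Prod>k=3..6. qpoch_inf (q * inverse (a k) * ?w i) q / qpoch_inf (a k * ?w i) q) =
           site_weight q t v (a 1) (a 2) (a 3) (a 4) (a 5) (a 6) n (z (i - 1))"
        using site[OF torusD(1)[OF z, of "i - 1"]] i by (simp only: restrict_apply' if_True)
    next
      fix x assume "x \<in> {(j, k). 1 \<le> j \<and> j < k \<and> k \<le> n}"
      then obtain j k where x: "x = (j, k)" and jk: "j \<in> {1..n}" "k \<in> {1..n}" by auto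
      show "(case x of (j, k) \<Rightarrow> qpoch_inf (?w j * ?w k) q / qpoch_inf (q * ?w j * ?w k) q *
           (qpochs_inf [?w j / ?w k, ?w k / ?w j] q / qpochs_inf [t * ?w j / ?w k, t * ?w k / ?w j] q) *
           (qpoch_inf (q * inverse t * ?w j * ?w k) q / qpoch_inf (t * ?w j * ?w k) q)) =
         (case x of (j, k) \<Rightarrow> pair_weight q t (z (j - 1)) (z (k - 1)))"
        using pair[OF torusD(1)[OF z, of "j - 1"] torusD(1)[OF z, of "k - 1"]] jk
        by (simp only: x prod.case restrict_apply' if_True)
    qed
    then show ?thesis
      unfolding theta_integrand_def prod_pairs_eq_pair_prod
        prod_shift_index[of "\<lambda>k. site_weight q t v (a 1) (a 2) (a 3) (a 4) (a 5) (a 6) n (z k)" n] .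
  qed
  have "continuous_on torus ?G" unfolding n by (rule continuous_on_torus_theta_integrand[OF q t v a bal])
  then have "continuous_on torus (\<lambda>z. ?F (\<lambda>i\<in>{1..n}. z (i - 1)))"
    by (rule continuous_on_eq) (simp only: F)
  from varpi_integral_eq_torus_mean[OF this] have "varpi_integral n ?F = torus_mean n ?G"
    using torus_mean_cong[where n = n, OF F] by (simp only:)
  then have int: "varpi_integral n ?F = fact n * theta_evaluation q t v (a 1) (a 2) (a 3) (a 4) (a 5) (a 6) n"
    using theta_integral[OF q t v a bal] by (simp only: n)
  have "?R = theta_evaluation q t v (a 1) (a 2) (a 3) (a 4) (a 5) (a 6) n"
    unfolding theta_evaluation_def prod_shift_index[symmetric]
  proof (rule prod.cong[OF refl], goal_cases)
    case (1 i)
    then have i: "Suc (i - 1) = i" by simp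
    show ?case
      unfolding i pairs_1_6 pairs_3_6 s12
      by (simp add: qpochs_inf_def mult.assoc del: One_nat_def)
  qed
  then show ?thesis unfolding int by simp
qed

end
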